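(* Let $\Omega\subset\mathbb{R}^d$ be a bounded convex open set. Let $\overline{\nu}\geq\underline{\nu}>0$ and $\varepsilon\in(0,1]$ be constants, and let $\overline{a}\in L^\infty(\Omega;\mathbb{R}^{d\times d}_{\mathrm{sym},+})$ satisfy $\overline{a}(x)\in\mathcal{C}(\underline{\nu},\overline{\nu},\varepsilon)$ for almost every $x\in\Omega$. Let $G\in V^*$ and let $m\in L^2(\Omega)$ denote the unique solution of $$(m,-\overline{a}:D^2v)_\Omega=\langle G,v\rangle_{V^*\times V}\quad\forall v\in V.$$ If $G$ is nonnegative in the sense of distributions, then $m$ is nonnegative a.e. in $\Omega$.
   Context: $d\geq1$. $\mathbb{R}^{d\times d}_{\mathrm{sym},+}$ is the set of real symmetric positive semidefinite $d\times d$ matrices; $A:B=\sum_{i,j}A_{ij}B_{ij}$; $|\cdot|$ is the Frobenius norm on matrices. $(\cdot,\cdot)_\Omega$ is the inner product of $L^2(\Omega)$. $V:=H^2(\Omega)\cap H^1_0(\Omega)$ with the norm of $H^2(\Omega)$; $V^*$ is its dual, with duality pairing $\langle\cdot,\cdot\rangle_{V^*\times V}$. $G\in V^*$ is nonnegative in the sense of distributions if $\langle G,v\rangle_{V^*\times V}\geq 0$ for all $v\in V$ with $v\geq0$ a.e. in $\Omega$. Under the hypotheses of the claim the variational equation for $m$ has exactly one solution in $L^2(\Omega)$ for each $G\in V^*$. Cordes class: for $\overline{\nu}\geq\underline{\nu}>0$ and $\varepsilon\in(0,1]$, $\mathcal{C}(\underline{\nu},\overline{\nu},\varepsilon)$ is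 the set of all $\overline{a}\in\mathbb{R}^{d\times d}_{\mathrm{sym},+}$ such that $\underline{\nu}|\xi|^2\leq\xi^T\overline{a}\xi\leq\overline{\nu}|\xi|^2$ for all $\xi\in\mathbb{R}^d$ and $\frac{|\overline{a}|}{\mathrm{Tr}\,\overline{a}}\leq\frac{1}{\sqrt{d-1+\varepsilon}}$. *)

theory Defs
  imports "HOL-Analysis.Analysis"
begin

text \<open>
  Elements of function spaces on \<open>\<Omega>\<close> are represented by functions on the whole space, of which only
  the values on \<open>\<Omega>\<close>, up to null sets, matter. The dimension is \<open>d = CARD('n)\<close>.
\<close>

section \<open>Square-integrable functions\<close>

definition L2 :: "(real^'n) set \<Rightarrow> (real^'n \<Rightarrow> real) set" where
  "L2 \<Omega> = {u \<in> borel_measurable (lebesgue_on \<Omega>). integrable (lebesgue_on \<Omega>) (\<lambda>x. (u x)\<^sup>2)}"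

definition L2_inner :: "(real^'n) set \<Rightarrow> (real^'n \<Rightarrow> real) \<Rightarrow> (real^'n \<Rightarrow> real) \<Rightarrow> real" where
  "L2_inner \<Omega> f g = (\<integral>x. f x * g x \<partial>lebesgue_on \<Omega>)"

section \<open>Test functions\<close>

definition partial :: "'n \<Rightarrow> (real^'n \<Rightarrow> real) \<Rightarrow> real^'n \<Rightarrow> real" where
  "partial i f x = frechet_derivative f (at x) (axis i 1)"

text \<open>A function is \<open>C\<^sup>\<infinity>\<close> iff all its iterated partial derivatives exist and are differentiable
  everywhere; \<open>is = []\<close> is the function itself.\<close>

definition smooth :: "(real^'n \<Rightarrow> real) \<Rightarrow> bool" where
  "smooth f \<longleftrightarrow> (\<forall>is. foldr partial is f differentiable_on UNIV)"

definition test_functions :: "(real^'n) set \<Rightarrow> (real^'n \<Rightarrow> real) set" where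
  "test_functions \<Omega> =
     {\<phi>. smooth \<phi> \<and> compact (closure {x. \<phi> x \<noteq> 0}) \<and> closure {x. \<phi> x \<noteq> 0} \<subseteq> \<Omega>}"

section \<open>Sobolev spaces\<close>

definition has_weak_partial ::
    "(real^'n) set \<Rightarrow> 'n \<Rightarrow> (real^'n \<Rightarrow> real) \<Rightarrow> (real^'n \<Rightarrow> real) \<Rightarrow> bool" where
  "has_weak_partial \<Omega> i u g \<longleftrightarrow> u \<in> L2 \<Omega> \<and> g \<in> L2 \<Omega> \<and>
     (\<forall>\<phi>\<in>test_functions \<Omega>. L2_inner \<Omega> u (partial i \<phi>) = - L2_inner \<Omega> g \<phi>)"

text \<open>A representative of the weak derivative, which on an open set is unique up to null sets.\<close>

definition weak_partial :: "(real^'n) set \<Rightarrow> 'n \<Rightarrow> (real^'n \<Rightarrow> real) \<Rightarrow> real^'n \<Rightarrow> real" where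
  "weak_partial \<Omega> i u = (SOME g. has_weak_partial \<Omega> i u g)"

definition weak_hessian :: "(real^'n) set \<Rightarrow> (real^'n \<Rightarrow> real) \<Rightarrow> real^'n \<Rightarrow> real^'n^'n" where
  "weak_hessian \<Omega> u x = (\<chi> i j. weak_partial \<Omega> i (weak_partial \<Omega> j u) x)"

definition H1 :: "(real^'n) set \<Rightarrow> (real^'n \<Rightarrow> real) set" where
  "H1 \<Omega> = {u \<in> L2 \<Omega>. \<forall>i. \<exists>g. has_weak_partial \<Omega> i u g}"

definition H1_norm :: "(real^'n) set \<Rightarrow> (real^'n \<Rightarrow> real) \<Rightarrow> real" where
  "H1_norm \<Omega> u =
     sqrt (L2_inner \<Omega> u u + (\<Sum>i\<in>UNIV. L2_inner \<Omega> (weak_partial \<Omega> i u) (weak_partial \<Omega> i u)))"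

text \<open>The closure of the test functions in \<open>H\<^sup>1(\<Omega>)\<close>.\<close>

definition H10 :: "(real^'n) set \<Rightarrow> (real^'n \<Rightarrow> real) set" where
  "H10 \<Omega> = {u \<in> H1 \<Omega>. \<forall>e>0. \<exists>\<phi>\<in>test_functions \<Omega>. H1_norm \<Omega> (\<lambda>x. u x - \<phi> x) < e}"

definition H2 :: "(real^'n) set \<Rightarrow> (real^'n \<Rightarrow> real) set" where
  "H2 \<Omega> = {u \<in> H1 \<Omega>. \<forall>i. weak_partial \<Omega> i u \<in> H1 \<Omega>}"

definition H2_norm :: "(real^'n) set \<Rightarrow> (real^'n \<Rightarrow> real) \<Rightarrow> real" where
  "H2_norm \<Omega> u =
     sqrt ((H1_norm \<Omega> u)\<^sup>2 + (\<Sum>i\<in>UNIV. \<Sum>j\<in>UNIV.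
       L2_inner \<Omega> (weak_partial \<Omega> i (weak_partial \<Omega> j u)) (weak_partial \<Omega> i (weak_partial \<Omega> j u))))"

definition V_space :: "(real^'n) set \<Rightarrow> (real^'n \<Rightarrow> real) set" where
  "V_space \<Omega> = H2 \<Omega> \<inter> H10 \<Omega>"

text \<open>
  Bounded linear functionals on \<open>V\<close>; the value \<open>G v\<close> is the duality pairing. Linearity and
  boundedness force \<open>G\<close> to agree on functions equal almost everywhere in \<open>\<Omega>\<close>. Nothing is
  required of \<open>G\<close> outside \<open>V\<close>.
\<close>

definition V_dual :: "(real^'n) set \<Rightarrow> ((real^'n \<Rightarrow> real) \<Rightarrow> real) set" where
  "V_dual \<Omega> = {G.
     (\<forall>u\<in>V_space \<Omega>. \<forall>v\<in>V_space \<Omega>. G (\<lambda>x. u x + v x) = G u + G v) \<and>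
     (\<forall>c. \<forall>v\<in>V_space \<Omega>. G (\<lambda>x. c * v x) = c * G v) \<and>
     (\<exists>C. \<forall>v\<in>V_space \<Omega>. \<bar>G v\<bar> \<le> C * H2_norm \<Omega> v)}"

definition nonneg_functional :: "(real^'n) set \<Rightarrow> ((real^'n \<Rightarrow> real) \<Rightarrow> real) \<Rightarrow> bool" where
  "nonneg_functional \<Omega> G \<longleftrightarrow>
     (\<forall>v\<in>V_space \<Omega>. (AE x in lebesgue_on \<Omega>. 0 \<le> v x) \<longrightarrow> 0 \<le> G v)"

section \<open>Coefficients\<close>

text \<open>The library norm and inner product on \<open>real^'n^'n\<close> are the Frobenius ones:\<close>

lemma norm_matrix_Frobenius:
  fixes A :: "real^'n^'n"
  shows "norm A = sqrt (\<Sum>i\<in>UNIV. \<Sum>j\<in>UNIV. (A $ i $ j)\<^sup>2)"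
  by (simp add: norm_vec_def L2_set_def sum_nonneg)

lemma inner_matrix_Frobenius:
  fixes A B :: "real^'n^'n"
  shows "A \<bullet> B = (\<Sum>i\<in>UNIV. \<Sum>j\<in>UNIV. A $ i $ j * B $ i $ j)"
  by (simp add: inner_vec_def)

definition sym_psd :: "(real^'n^'n) set" where
  "sym_psd = {A. transpose A = A \<and> (\<forall>\<xi>. 0 \<le> \<xi> \<bullet> (A *v \<xi>))}"

definition Linf_sym_psd :: "(real^'n) set \<Rightarrow> (real^'n \<Rightarrow> real^'n^'n) set" where
  "Linf_sym_psd \<Omega> = {a \<in> borel_measurable (lebesgue_on \<Omega>).
     (AE x in lebesgue_on \<Omega>. a x \<in> sym_psd) \<and> (\<exists>C. AE x in lebesgue_on \<Omega>. norm (a x) \<le> C)}"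

definition cordes :: "real \<Rightarrow> real \<Rightarrow> real \<Rightarrow> (real^'n^'n) set" where
  "cordes \<nu>lo \<nu>hi \<epsilon> = {A \<in> sym_psd.
     (\<forall>\<xi>. \<nu>lo * (norm \<xi>)\<^sup>2 \<le> \<xi> \<bullet> (A *v \<xi>) \<and> \<xi> \<bullet> (A *v \<xi>) \<le> \<nu>hi * (norm \<xi>)\<^sup>2) \<and>
     norm A / trace A \<le> 1 / sqrt (real CARD('n) - 1 + \<epsilon>)}"

end

theory Submission
  imports Defs "HOL-Real_Asymp.Real_Asymp" "HOL-Library.Function_Algebras"
begin

text \<open>
  Rescaling by \<open>\<gamma> = Tr a / |a|\<^sup>2\<close> turns the Cordes condition into \<open>|b - I| \<le> \<rho> < 1\<close> for \<open>b = \<gamma> a\<close>.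
  It suffices to find \<open>v \<in> V\<close> with \<open>v \<ge> 0\<close> and \<open>- b : D\<^sup>2v = 1\<^bsub>{m < 0}\<^esub>\<close>, since the equation for \<open>m\<close> then
  says that the integral of \<open>m / \<gamma>\<close> over \<open>{m < 0}\<close> equals \<open>G v \<ge> 0\<close>.

  Such a \<open>v\<close> is obtained without regularity theory. The domain is exhausted by smooth convex domains
  \<open>{w > 0}\<close> that are radial deformations of a ball, and everything is done with smooth functions of the
  form \<open>u = w h\<close>, which vanish on the boundary. On the unit ball the Laplacian maps the polynomials
  \<open>(1 - |y|\<^sup>2) p\<close> onto all polynomials. Along the deformation, and then from the identity to a smooth
  \<open>b\<close>, density of the range in \<open>L\<^sup>2\<close> persists by a perturbation argument, whose a priori estimate is the
  Miranda--Talenti inequality. Approximate positivity is clear for \<open>- b : D\<^sup>2 + \<mu>\<close> with \<open>\<mu>\<close> large and is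
  carried down to \<open>\<mu> = 0\<close> in small steps. The \<open>H\<^sup>2\<close> bounds are uniform in the domains, so convex
  combinations of the approximate solutions converge strongly in \<open>H\<^sup>2\<close>.
\<close>

section \<open>Smooth functions\<close>

text \<open>The equation for \<open>m\<close> is tested with elements of \<open>V\<close> only, so
  approximate solutions have to converge strongly in H^2. On smooth functions the range of the
  operator is merely dense, and density is all that the perturbation argument carries along. Two
  kinds of constants must be kept apart. The H^2 bound depends only on the radius of an enclosing
  ball, on \<rho> and on the size of the data: Miranda--Talenti has constant exactly 1, so
  \<open>b - I\<close> acts as a perturbation of relative size \<rho> < 1. The constant in the
  positivity estimate involves derivatives of the smoothed coefficients, since testing with the
  negative part needs divergence form, and it is not controlled along the approximation. This is
  harmless because the accuracy of each approximate solution is chosen after that constant. Boundary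
  integrals never appear. Cut-offs are functions of \<open>w\<close>, the factor \<open>w\<close> in
  \<open>u = w h\<close> compensates their derivatives, and concavity of \<open>w\<close> gives the
  sign of the curvature term.\<close>

lemma partial_eq:
  assumes "(f has_derivative f') (at x)"
  shows "partial i f x = f' (axis i 1)"
  using frechet_derivative_at[OF assms] by (simp add: partial_def)

lemma smooth_differentiable:
  assumes "smooth f"
  shows "f differentiable (at x)"
proof -
  have "foldr partial [] f differentiable_on UNIV"
    using assms unfolding smooth_def by blast
  then show ?thesis
    by (simp add: differentiable_on_def)
qed

lemma smooth_partial:
  assumes "smooth f"
  shows "smooth (partial i f)"
  unfolding smooth_def
proof
  fix js
  have "foldr partial (js @ [i]) f differentiable_on UNIV"
    using assms unfolding smooth_def by blast
  then show "foldr partial js (partial i f) differentiable_on UNIV"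
    by simp
qed

text \<open>An invariant set of differentiable functions replaces the induction over lists of
  indices in \<open>smooth\<close>; the closure rules below exhibit such a set.\<close>

lemma smooth_coinduct:
  assumes "f \<in> A"
    and "\<And>f x. f \<in> A \<Longrightarrow> f differentiable (at x)"
    and "\<And>f i. f \<in> A \<Longrightarrow> partial i f \<in> A"
  shows "smooth f"
proof -
  have "foldr partial js f \<in> A" for js
    by (induction js) (auto simp: assms)
  then show ?thesis
    unfolding smooth_def differentiable_on_def
    by (auto intro: assms(2))
qed

lemma partial_const [simp]: "partial i (\<lambda>x. c) = (\<lambda>x. 0)"
  by (rule ext, subst partial_eq[where f'="\<lambda>_. 0"]) auto

lemma partial_add_at:
  assumes "f differentiable (at x)" "g differentiable (at x)"
  shows "partial i (\<lambda>x. f x + g x) x = partial i f x + partial i g x"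
proof -
  have "((\<lambda>x. f x + g x) has_derivative
      (\<lambda>h. frechet_derivative f (at x) h + frechet_derivative g (at x) h)) (at x)"
    using assms by (intro derivative_intros) (auto simp: frechet_derivative_works[symmetric])
  from partial_eq[OF this] show ?thesis
    by (simp add: partial_def)
qed

lemma partial_mult_at:
  assumes "f differentiable (at x)" "g differentiable (at x)"
  shows "partial i (\<lambda>x. f x * g x) x = f x * partial i g x + partial i f x * g x"
proof -
  have "((\<lambda>x. f x * g x) has_derivative
      (\<lambda>h. f x * frechet_derivative g (at x) h + frechet_derivative f (at x) h * g x)) (at x)"
    using assms by (intro derivative_intros) (auto simp: frechet_derivative_works[symmetric])
  from partial_eq[OF this] show ?thesis
    by (simp add: partial_def)
qed

lemma
  assumes f: "f differentiable (at x)" and "(\<phi> has_real_derivative D) (at (f x))"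
  shows partial_chain_at: "partial i (\<lambda>x. \<phi> (f x)) x = D * partial i f x"
    and differentiable_chain_at: "(\<lambda>x. \<phi> (f x)) differentiable (at x)"
proof -
  have "(f has_derivative frechet_derivative f (at x)) (at x)"
    using f by (simp add: frechet_derivative_works[symmetric])
  moreover have "(\<phi> has_derivative (\<lambda>h. D * h)) (at (f x))"
    using assms(2) by (simp add: has_field_derivative_def)
  ultimately have *: "((\<lambda>x. \<phi> (f x)) has_derivative (\<lambda>h. D * frechet_derivative f (at x) h)) (at x)"
    using diff_chain_at[of f _ x \<phi>] by (auto simp: o_def)
  from partial_eq[OF this] show "partial i (\<lambda>x. \<phi> (f x)) x = D * partial i f x"
    by (simp add: partial_def)
  from * show "(\<lambda>x. \<phi> (f x)) differentiable (at x)"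
    unfolding differentiable_def by blast
qed

text \<open>The family \<open>psi m\<close> is closed under differentiation, up to linear combinations.\<close>

definition psi :: "nat \<Rightarrow> real \<Rightarrow> real" where
  "psi m t = (if t > 0 then exp (- (1 / t)) / t ^ m else 0)"

lemma psi_pos: "t > 0 \<Longrightarrow> psi m t > 0"
  by (simp add: psi_def)

lemma psi_nonneg: "psi m t \<ge> 0"
  by (simp add: psi_def)

lemma psi_nonpos_eq_0 [simp]: "t \<le> 0 \<Longrightarrow> psi m t = 0"
  by (simp add: psi_def)

lemma tendsto_psi_0: "(psi m \<longlongrightarrow> 0) (at 0)"
proof -
  have "((\<lambda>x. x ^ m / exp x) \<longlongrightarrow> (0::real)) at_top"
    by (rule tendsto_power_div_exp_0)
  then have "((\<lambda>t. inverse t ^ m / exp (inverse t)) \<longlongrightarrow> (0::real)) (at_right 0)"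
    by (rule filterlim_compose[OF _ filterlim_inverse_at_top_right])
  moreover have "\<forall>\<^sub>F t in at_right 0. inverse t ^ m / exp (inverse t) = psi m t"
    unfolding eventually_at_right_field
    by (intro exI[of _ 1]) (auto simp: psi_def exp_minus field_simps)
  ultimately have "(psi m \<longlongrightarrow> 0) (at_right 0)"
    by (rule Lim_transform_eventually)
  moreover have "(psi m \<longlongrightarrow> 0) (at_left 0)"
    by (rule Lim_transform_eventually[of "\<lambda>_. 0"])
      (auto simp: eventually_at_left_field intro!: exI[of _ "-1"])
  ultimately show ?thesis
    by (simp add: filterlim_split_at)
qed

lemma DERIV_psi:
  "(psi m has_real_derivative psi (m + 2) t - real m * psi (m + 1) t) (at t)"
proof (cases t "0::real" rule: linorder_cases)
  case less
  have "((\<lambda>_. 0) has_real_derivative 0) (at t)"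
    by simp
  then have "(psi m has_real_derivative 0) (at t)"
    by (rule has_field_derivative_transform_within_open[where S="{..<0}"]) (use less in auto)
  with less show ?thesis by simp
next
  case equal
  \<comment> \<open>Since \<open>psi m 0 = 0\<close>, the difference quotient at 0 is exactly
    \<open>psi (m + 1) h\<close>, on both sides of 0.\<close>
  have "((\<lambda>h. (psi m (0 + h) - psi m 0) / h) \<longlongrightarrow> 0) (at 0)"
  proof (rule Lim_transform_eventually[OF tendsto_psi_0[of "m + 1"]])
    show "\<forall>\<^sub>F x in at 0. psi (m + 1) x = (psi m (0 + x) - psi m 0) / x"
      by (auto simp: psi_def eventually_at_filter)
  qed
  then show ?thesis
    using equal unfolding DERIV_def by simp
next
  case greater
  have "((\<lambda>t. exp (- (1 / t)) / t ^ m) has_real_derivative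
      (psi (m + 2) t - real m * psi (m + 1) t)) (at t)"
  proof -
    define r where "r = inverse t"
    \<comment> \<open>For \<open>m = 0\<close> the exponent \<open>m - 1\<close> is truncated to 0;
      the factor \<open>real m\<close> makes both sides vanish.\<close>
    have r: "real m * r ^ (m - 1) * r\<^sup>2 = real m * r ^ (m + 1)"
      by (cases m) (auto simp: power2_eq_square)
    have "((\<lambda>t. exp (- inverse t) * inverse t ^ m) has_real_derivative
        exp (- r) * (real m * r ^ (m - 1) * - r\<^sup>2) + (exp (- r) * r\<^sup>2) * r ^ m) (at t)"
      using greater by (auto intro!: derivative_eq_intros simp: r_def power2_eq_square)
    moreover have "exp (- r) * (real m * r ^ (m - 1) * - r\<^sup>2) + (exp (- r) * r\<^sup>2) * r ^ m
        = psi (m + 2) t - real m * psi (m + 1) t"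
    proof -
      have "exp (- r) * (real m * r ^ (m - 1) * - r\<^sup>2) = - (exp (- r) * (real m * r ^ (m + 1)))"
        by (simp only: r[symmetric] mult_minus_right mult.assoc)
      moreover have "psi k t = exp (- r) * r ^ k" for k
        using greater by (simp add: psi_def r_def divide_inverse power_inverse)
      ultimately show ?thesis
        by (auto simp: power_add power2_eq_square algebra_simps)
    qed
    ultimately show ?thesis
      by (simp add: divide_inverse power_inverse)
  qed
  then show ?thesis
    by (rule has_field_derivative_transform_within_open[where S="{0<..}"])
      (use greater in \<open>auto simp: psi_def\<close>)
qed

text \<open>Derivatives of quotients, square roots and \<open>psi m\<close> mix all the operations,
  so the closure rules for \<open>smooth\<close> are proved together. This class is closed under
  every \<open>partial i\<close>; \<open>base\<close> admits arbitrary smooth functions, so that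
  each constructor becomes a rule for \<open>smooth\<close>.\<close>

inductive_set smooth_closure :: "(real^'n \<Rightarrow> real) set" where
  base: "smooth f \<Longrightarrow> f \<in> smooth_closure"
| const: "(\<lambda>x. c) \<in> smooth_closure"
| linear: "bounded_linear f \<Longrightarrow> f \<in> smooth_closure"
| add: "f \<in> smooth_closure \<Longrightarrow> g \<in> smooth_closure \<Longrightarrow> (\<lambda>x. f x + g x) \<in> smooth_closure"
| mult: "f \<in> smooth_closure \<Longrightarrow> g \<in> smooth_closure \<Longrightarrow> (\<lambda>x. f x * g x) \<in> smooth_closure"
| psi: "f \<in> smooth_closure \<Longrightarrow> (\<lambda>x. psi m (f x)) \<in> smooth_closure"
| inverse: "f \<in> smooth_closure \<Longrightarrow> (\<And>x. f x > 0) \<Longrightarrow> (\<lambda>x. inverse (f x)) \<in> smooth_closure"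
| sqrt: "f \<in> smooth_closure \<Longrightarrow> (\<And>x. f x > 0) \<Longrightarrow> (\<lambda>x. sqrt (f x)) \<in> smooth_closure"

lemma smooth_closure_diff:
  assumes "f \<in> smooth_closure"
  shows "(\<forall>x. f differentiable (at x)) \<and> partial i f \<in> smooth_closure"
  using assms
proof induction
  case (base f)
  then show ?case
    by (auto simp: smooth_differentiable smooth_partial smooth_closure.base)
next
  case (const c)
  then show ?case
    using smooth_closure.const[of 0] by simp
next
  case (linear f)
  have *: "(f has_derivative f) (at x)" for x
    using linear by (rule bounded_linear_imp_has_derivative)
  have "partial i f = (\<lambda>x. f (axis i 1))"
    by (rule ext, rule partial_eq, rule *)
  with * show ?case
    unfolding differentiable_def by (auto simp: smooth_closure.const)
next
  case (add f g)
  then have "partial i (\<lambda>x. f x + g x) = (\<lambda>x. partial i f x + partial i g x)"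
    by (auto simp: partial_add_at)
  with add show ?case
    by (auto intro: smooth_closure.intros)
next
  case (mult f g)
  then have "partial i (\<lambda>x. f x * g x) = (\<lambda>x. f x * partial i g x + partial i f x * g x)"
    by (auto simp: partial_mult_at)
  with mult show ?case
    by (auto intro!: smooth_closure.add smooth_closure.mult differentiable_mult)
next
  case (psi f m)
  then have "partial i (\<lambda>x. psi m (f x)) =
      (\<lambda>x. (psi (m + 2) (f x) + (- real m) * psi (m + 1) (f x)) * partial i f x)"
    by (intro ext, subst partial_chain_at[OF _ DERIV_psi]) auto
  moreover have "(\<lambda>x. psi m (f x)) differentiable (at x)" for x
    using psi by (intro differentiable_chain_at[OF _ DERIV_psi]) auto
  moreover have "(\<lambda>x. (psi (m + 2) (f x) + (- real m) * psi (m + 1) (f x)) * partial i f x)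
      \<in> smooth_closure"
    using psi by (intro smooth_closure.mult smooth_closure.add smooth_closure.psi
        smooth_closure.const) auto
  ultimately show ?case
    by auto
next
  case (inverse f)
  have d: "(inverse has_real_derivative - (inverse (f x) * inverse (f x))) (at (f x))" for x
    using inverse.hyps(2)[of x] by (auto intro!: derivative_eq_intros)
  have "partial i (\<lambda>x. inverse (f x)) =
      (\<lambda>x. ((-1) * (inverse (f x) * inverse (f x))) * partial i f x)"
    using inverse by (intro ext, subst partial_chain_at[OF _ d]) auto
  moreover have "(\<lambda>x. inverse (f x)) differentiable (at x)" for x
    using inverse by (intro differentiable_chain_at[OF _ d]) auto
  moreover have "(\<lambda>x. ((-1) * (inverse (f x) * inverse (f x))) * partial i f x) \<in> smooth_closure"
    using inverse by (intro smooth_closure.mult smooth_closure.inverse smooth_closure.const) auto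
  ultimately show ?case
    by auto
next
  case (sqrt f)
  have d: "(sqrt has_real_derivative (1 / 2) * inverse (sqrt (f x))) (at (f x))" for x
    using sqrt.hyps(2)[of x] by (auto intro!: derivative_eq_intros)
  have "partial i (\<lambda>x. sqrt (f x)) = (\<lambda>x. ((1 / 2) * inverse (sqrt (f x))) * partial i f x)"
    using sqrt by (intro ext, subst partial_chain_at[OF _ d]) auto
  moreover have "(\<lambda>x. sqrt (f x)) differentiable (at x)" for x
    using sqrt by (intro differentiable_chain_at[OF _ d]) auto
  moreover have "(\<lambda>x. ((1 / 2) * inverse (sqrt (f x))) * partial i f x) \<in> smooth_closure"
    using sqrt by (intro smooth_closure.mult smooth_closure.inverse smooth_closure.sqrt
        smooth_closure.const) auto
  ultimately show ?case
    by auto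
qed

lemma smooth_closure_smooth: "f \<in> smooth_closure \<Longrightarrow> smooth f"
  by (erule smooth_coinduct) (auto simp: smooth_closure_diff)

named_theorems smooth_intros

lemma smooth_const [smooth_intros]: "smooth (\<lambda>x. c)"
  and smooth_linear: "bounded_linear f \<Longrightarrow> smooth f"
  and smooth_add [smooth_intros]: "smooth f \<Longrightarrow> smooth g \<Longrightarrow> smooth (\<lambda>x. f x + g x)"
  and smooth_mult [smooth_intros]: "smooth f \<Longrightarrow> smooth g \<Longrightarrow> smooth (\<lambda>x. f x * g x)"
  and smooth_psi [smooth_intros]: "smooth f \<Longrightarrow> smooth (\<lambda>x. psi m (f x))"
  and smooth_inverse [smooth_intros]: "smooth f \<Longrightarrow> (\<And>x. f x > 0) \<Longrightarrow> smooth (\<lambda>x. inverse (f x))"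
  and smooth_sqrt [smooth_intros]: "smooth f \<Longrightarrow> (\<And>x. f x > 0) \<Longrightarrow> smooth (\<lambda>x. sqrt (f x))"
  by (rule smooth_closure_smooth; intro smooth_closure.intros; assumption?;
      auto intro: smooth_closure.base)+

declare smooth_partial [smooth_intros]

lemma smooth_nth [smooth_intros]: "smooth (\<lambda>x. x $ i)"
  by (intro smooth_linear bounded_linear_vec_nth)

lemma smooth_cmult: "smooth f \<Longrightarrow> smooth (\<lambda>x. c * f x)"
  by (intro smooth_intros)

lemma smooth_minus [smooth_intros]: "smooth f \<Longrightarrow> smooth (\<lambda>x. - f x)"
  using smooth_cmult[of f "-1"] by simp

lemma smooth_diff [smooth_intros]: "smooth f \<Longrightarrow> smooth g \<Longrightarrow> smooth (\<lambda>x. f x - g x)"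
  using smooth_add[OF _ smooth_minus, of f g] by simp

lemma smooth_divide [smooth_intros]:
  "smooth f \<Longrightarrow> smooth g \<Longrightarrow> (\<And>x. g x > 0) \<Longrightarrow> smooth (\<lambda>x. f x / g x)"
  using smooth_mult[OF _ smooth_inverse, of f g] by (simp add: divide_inverse)

lemma smooth_cdivide [smooth_intros]:
  "smooth f \<Longrightarrow> smooth (\<lambda>x. f x / c)"
  using smooth_cmult[of f "inverse c"] by (simp add: divide_inverse mult.commute)

lemma smooth_sum [smooth_intros]:
  "(\<And>i. i \<in> A \<Longrightarrow> smooth (f i)) \<Longrightarrow> smooth (\<lambda>x. \<Sum>i\<in>A. f i x)"
  by (induction A rule: infinite_finite_induct) (auto intro: smooth_intros)

lemma smooth_power [smooth_intros]: "smooth f \<Longrightarrow> smooth (\<lambda>x. f x ^ n)"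
  by (induction n) (auto intro: smooth_intros)

lemma smooth_polynomial: "real_polynomial_function p \<Longrightarrow> smooth p"
  by (induction rule: real_polynomial_function.induct)
    (auto intro: smooth_intros smooth_linear)

lemma smooth_continuous: "smooth f \<Longrightarrow> continuous_on A f"
  by (meson differentiable_imp_continuous_within continuous_at_imp_continuous_on
      smooth_differentiable)

lemma partial_add: "smooth f \<Longrightarrow> smooth g \<Longrightarrow>
    partial i (\<lambda>x. f x + g x) = (\<lambda>x. partial i f x + partial i g x)"
  by (auto simp: partial_add_at smooth_differentiable)

lemma partial_mult: "smooth f \<Longrightarrow> smooth g \<Longrightarrow>
    partial i (\<lambda>x. f x * g x) = (\<lambda>x. f x * partial i g x + partial i f x * g x)"
  by (auto simp: partial_mult_at smooth_differentiable)

lemma partial_cmult: "smooth f \<Longrightarrow> partial i (\<lambda>x. c * f x) = (\<lambda>x. c * partial i f x)"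
  by (subst partial_mult) (auto intro: smooth_intros)

lemma partial_minus: "smooth f \<Longrightarrow> partial i (\<lambda>x. - f x) = (\<lambda>x. - partial i f x)"
  using partial_cmult[of f i "-1"] by simp

lemma partial_diff: "smooth f \<Longrightarrow> smooth g \<Longrightarrow>
    partial i (\<lambda>x. f x - g x) = (\<lambda>x. partial i f x - partial i g x)"
  using partial_add[OF _ smooth_minus, of f g i] by (simp add: partial_minus)

lemma partial_sum: "(\<And>k. k \<in> A \<Longrightarrow> smooth (f k)) \<Longrightarrow>
    partial i (\<lambda>x. \<Sum>k\<in>A. f k x) = (\<lambda>x. \<Sum>k\<in>A. partial i (f k) x)"
  by (induction A rule: infinite_finite_induct) (auto simp: partial_add smooth_sum)

lemma partial_linear: "bounded_linear f \<Longrightarrow> partial i f = (\<lambda>x. f (axis i 1))"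
  by (rule ext, rule partial_eq, rule bounded_linear_imp_has_derivative)

lemma partial_nth: "partial i (\<lambda>x. x $ j) = (\<lambda>x. if i = j then 1 else 0)"
  by (subst partial_linear) (auto simp: axis_def bounded_linear_vec_nth)

lemma partial_chain: "smooth f \<Longrightarrow> (\<And>t. (\<phi> has_real_derivative \<phi>' t) (at t)) \<Longrightarrow>
    partial i (\<lambda>x. \<phi> (f x)) = (\<lambda>x. \<phi>' (f x) * partial i f x)"
  by (rule ext, rule partial_chain_at) (auto simp: smooth_differentiable)

lemma smooth_has_derivative:
  assumes "smooth f"
  shows "(f has_derivative (\<lambda>h. \<Sum>i\<in>UNIV. partial i f x * h $ i)) (at x)"
proof -
  let ?D = "frechet_derivative f (at x)"
  have D: "(f has_derivative ?D) (at x)"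
    using smooth_differentiable[OF assms] by (simp add: frechet_derivative_works[symmetric])
  then interpret bounded_linear ?D
    by (rule has_derivative_bounded_linear)
  have "?D h = (\<Sum>i\<in>UNIV. partial i f x * h $ i)" for h
  proof -
    have "?D h = ?D (\<Sum>i\<in>UNIV. h $ i *\<^sub>R axis i 1)"
      by (simp add: basis_expansion vector_scalar_mult_def [symmetric] flip: scalar_mult_eq_scaleR)
    also have "\<dots> = (\<Sum>i\<in>UNIV. partial i f x * h $ i)"
      by (simp add: sum scaleR partial_def mult.commute)
    finally show ?thesis .
  qed
  then have "?D = (\<lambda>h. \<Sum>i\<in>UNIV. partial i f x * h $ i)"
    by auto
  with D show ?thesis by metis
qed

lemma partial_compose:
  assumes v: "smooth v" and P: "\<And>k. smooth (\<lambda>x. \<Psi> x $ k)"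
  shows "partial i (\<lambda>x. v (\<Psi> x)) x = (\<Sum>k\<in>UNIV. partial k v (\<Psi> x) * partial i (\<lambda>x. \<Psi> x $ k) x)"
proof -
  let ?D = "\<lambda>h. \<chi> k. \<Sum>j\<in>UNIV. partial j (\<lambda>x. \<Psi> x $ k) x * h $ j"
  have "(\<Psi> has_derivative ?D) (at x)"
    using smooth_has_derivative[OF P]
    by (subst has_derivative_componentwise_within)
      (auto simp: Basis_vec_def inner_axis inner_axis')
  from diff_chain_at[OF this smooth_has_derivative[OF v]]
  have "((\<lambda>x. v (\<Psi> x)) has_derivative (\<lambda>h. \<Sum>k\<in>UNIV. partial k v (\<Psi> x) * ?D h $ k)) (at x)"
    by (simp add: o_def)
  from partial_eq[OF this] show ?thesis
    by (simp add: axis_def if_distrib cong: if_cong)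
qed

section \<open>Integration by parts\<close>

lemma DERIV_along_line:
  assumes "smooth f"
  shows "((\<lambda>t. f (x + t *\<^sub>R v)) has_real_derivative
    (\<Sum>i\<in>UNIV. partial i f (x + t *\<^sub>R v) * v $ i)) (at t)"
proof -
  have "((\<lambda>t. x + t *\<^sub>R v) has_derivative (\<lambda>h. h *\<^sub>R v)) (at t)"
    by (auto intro!: derivative_eq_intros)
  from diff_chain_at[OF this smooth_has_derivative[OF assms]]
  have "((\<lambda>t. f (x + t *\<^sub>R v)) has_derivative
      (\<lambda>h. \<Sum>i\<in>UNIV. partial i f (x + t *\<^sub>R v) * (h * v $ i))) (at t)"
    by (simp add: o_def)
  moreover have "(\<lambda>h. \<Sum>i\<in>UNIV. partial i f (x + t *\<^sub>R v) * (h * v $ i)) =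
      (*) (\<Sum>i\<in>UNIV. partial i f (x + t *\<^sub>R v) * v $ i)"
    by (rule ext) (simp add: sum_distrib_left mult_ac)
  ultimately show ?thesis
    by (simp add: has_field_derivative_def)
qed

lemma DERIV_along_axis:
  assumes "smooth f"
  shows "((\<lambda>t. f (x + t *\<^sub>R axis i 1)) has_real_derivative
    partial i f (x + t *\<^sub>R axis i 1)) (at t)"
proof -
  have "(\<Sum>j\<in>UNIV. partial j f y * axis i 1 $ j) = partial i f y" for y
    by (simp add: axis_def if_distrib cong: if_cong)
  then show ?thesis
    using DERIV_along_line[OF assms, of x "axis i 1" t] by simp
qed

lemma partial_eq_0_outside:
  assumes "closed K" "\<And>x. x \<notin> K \<Longrightarrow> F x = 0" "x \<notin> K"
  shows "partial i F x = 0"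
proof -
  have "(F has_derivative (\<lambda>_. 0)) (at x)"
    by (rule has_derivative_transform_within_open[of "\<lambda>_. 0" _ _ _ "- K"])
      (use assms in \<open>auto simp: open_Compl\<close>)
  from partial_eq[OF this] show ?thesis .
qed

text \<open>By translation invariance all difference quotients have integral zero.\<close>

lemma integral_partial_compact_support:
  fixes F :: "real^'n \<Rightarrow> real"
  assumes F: "smooth F" and K: "compact K" and supp: "\<And>x. x \<notin> K \<Longrightarrow> F x = 0"
  shows "integrable lborel (partial i F)" and "(\<integral>x. partial i F x \<partial>lborel) = 0"
proof -
  obtain R where R: "R > 0" "K \<subseteq> cball 0 R"
    using compact_imp_bounded[OF K] unfolding bounded_pos subset_iff mem_cball_0 by blast
  have zero: "partial i F x = 0" if "x \<notin> K" for x
    using partial_eq_0_outside[OF compact_imp_closed[OF K] supp that] .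
  have cont: "continuous_on A (partial i F)" "continuous_on A F" for A
    using F by (auto intro!: smooth_continuous smooth_partial)
  have "compact (partial i F ` K)"
    by (intro compact_continuous_image cont K)
  then obtain L where L: "L > 0" "\<And>x. x \<in> K \<Longrightarrow> \<bar>partial i F x\<bar> \<le> L"
    by (metis bounded_pos compact_imp_bounded imageI real_norm_def)
  then have L': "\<bar>partial i F x\<bar> \<le> L" for x
    using zero[of x] by (cases "x \<in> K") auto
  define e :: "real^'n" where "e = axis i 1"
  have [simp]: "norm e = 1" by (simp add: e_def norm_axis_1)
  define h where "h n = inverse (real (Suc n))" for n
  have h: "h n > 0" "h n \<le> 1" for n by (auto simp: h_def field_simps)
  define q where "q n x = (F (x + h n *\<^sub>R e) - F x) / h n" for n x
  have meas: "F \<in> borel_measurable lborel" "partial i F \<in> borel_measurable lborel"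
    using cont[of UNIV] by (auto intro: borel_measurable_continuous_onI)
  have qmeas: "q n \<in> borel_measurable lborel" for n
    unfolding q_def using cont(2)[of UNIV]
    by (auto intro!: borel_measurable_continuous_onI continuous_intros
        continuous_on_compose2[OF cont(2)[of UNIV]] simp: h_def)
  \<comment> \<open>Dominating function for the difference quotients: the mean value theorem gives
    the bound \<open>L\<close>, and outside radius \<open>R + 1\<close> both evaluation points miss
    \<open>K\<close> because \<open>h n \<le> 1\<close>.\<close>
  have bound: "norm (q n x) \<le> L * indicator (cball 0 (R + 1)) x" for n x
  proof (cases "x \<in> cball 0 (R + 1)")
    case True
    have "\<exists>z>0. z < h n \<and> F (x + h n *\<^sub>R e) - F (x + 0 *\<^sub>R e) =
        (h n - 0) * partial i F (x + z *\<^sub>R e)"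
      using MVT2[OF h(1)[of n], of "\<lambda>t. F (x + t *\<^sub>R e)" "\<lambda>t. partial i F (x + t *\<^sub>R e)"]
        DERIV_along_axis[OF F, of x i] unfolding e_def by auto
    then obtain z where "F (x + h n *\<^sub>R e) - F x = h n * partial i F (x + z *\<^sub>R e)"
      by auto
    then have "q n x = partial i F (x + z *\<^sub>R e)"
      using h[of n] by (simp add: q_def)
    with L' True show ?thesis by simp
  next
    case False
    then have "norm x > R + 1" by simp
    moreover have "norm (x + h n *\<^sub>R e) \<ge> norm x - h n"
      using norm_triangle_ineq2[of x "- (h n *\<^sub>R e)"] h[of n] by simp
    ultimately have "x \<notin> K" "x + h n *\<^sub>R e \<notin> K"
      using R(2) h(2)[of n] by auto
    with False show ?thesis by (simp add: q_def supp)
  qed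
  have dom: "integrable lborel (\<lambda>x. L * indicator (cball 0 (R + 1)) x :: real)"
    by (intro integrable_mult_right integrable_real_indicator)
      (use emeasure_bounded_finite[OF bounded_cball, of 0 "R + 1"] in auto)
  have lim: "(\<lambda>n. q n x) \<longlonglongrightarrow> partial i F x" for x
  proof -
    have "((\<lambda>t. (F (x + t *\<^sub>R e) - F x) / t) \<longlongrightarrow> partial i F x) (at 0)"
      using DERIV_along_axis[OF F, of x i 0] unfolding e_def DERIV_def by simp
    moreover have "filterlim h (at 0) sequentially"
      unfolding filterlim_at h_def
      using LIMSEQ_inverse_real_of_nat by auto
    ultimately show ?thesis
      unfolding q_def by (rule filterlim_compose)
  qed
  have intF: "integrable lborel F"
  proof -
    have "compact (F ` K)"
      by (intro compact_continuous_image cont K)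
    then obtain M where M: "M > 0" "\<And>x. x \<in> K \<Longrightarrow> \<bar>F x\<bar> \<le> M"
      by (metis bounded_pos compact_imp_bounded imageI real_norm_def)
    show ?thesis
      by (rule integrableI_bounded_set[where A=K and B=M])
        (use M meas supp emeasure_compact_finite[OF K] in \<open>auto simp: borel_compact K\<close>)
  qed
  have shift: "integrable lborel (\<lambda>x. F (x + c)) \<and>
      (\<integral>x. F (x + c) \<partial>lborel) = (\<integral>x. F x \<partial>lborel)" for c
  proof -
    have "integrable (distr lborel borel ((+) c)) F"
      using intF by (simp add: lborel_distr_plus)
    moreover have "integral\<^sup>L (distr lborel borel ((+) c)) F = integral\<^sup>L lborel F"
      by (simp add: lborel_distr_plus)
    ultimately show ?thesis
      using meas by (simp add: integrable_distr_eq integral_distr add.commute)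
  qed
  have zero_int: "(\<integral>x. q n x \<partial>lborel) = 0" for n
    unfolding q_def using shift[of "h n *\<^sub>R e"] intF by simp
  have "(\<lambda>n. \<integral>x. q n x \<partial>lborel) \<longlonglongrightarrow> (\<integral>x. partial i F x \<partial>lborel)"
    by (rule integral_dominated_convergence[where s=q and w="\<lambda>x. L * indicator (cball 0 (R + 1)) x"])
      (use lim bound meas qmeas dom in auto)
  then show "(\<integral>x. partial i F x \<partial>lborel) = 0"
    by (simp add: zero_int LIMSEQ_const_iff)
  show "integrable lborel (partial i F)"
    by (rule integrable_dominated_convergence[where s=q and w="\<lambda>x. L * indicator (cball 0 (R + 1)) x"])
      (use lim bound meas qmeas dom in auto)
qed

lemma integrable_continuous_bounded:
  fixes f :: "real^'n \<Rightarrow> 'b::{banach, second_countable_topology}"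
  assumes U: "open U" and K: "compact K" "U \<subseteq> K" and f: "continuous_on K f"
  shows "integrable (lebesgue_on U) f"
proof -
  obtain M where M: "\<And>x. x \<in> K \<Longrightarrow> norm (f x) \<le> M"
    using compact_imp_bounded[OF compact_continuous_image[OF f K(1)]]
    by (metis bounded_iff imageI)
  show ?thesis
  proof (rule integrableI_bounded_set[where A=U and B=M])
    show "f \<in> borel_measurable (lebesgue_on U)"
      using continuous_on_subset[OF f K(2)] U
      by (intro continuous_imp_measurable_on_sets_lebesgue) auto
    have "bounded U" using K compact_imp_bounded bounded_subset by blast
    then show "emeasure (lebesgue_on U) U < \<infinity>"
      using U emeasure_bounded_finite[of U]
      by (subst emeasure_restrict_space) (auto simp: emeasure_completion)
  qed (use U M K(2) in \<open>auto intro!: AE_I2 simp: sets_restrict_space_iff\<close>)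
qed

lemma integral_partial_supported:
  fixes F :: "real^'n \<Rightarrow> real"
  assumes F: "smooth F" and K: "compact K" "K \<subseteq> U" and supp: "\<And>x. x \<notin> K \<Longrightarrow> F x = 0"
    and U: "open U"
  shows "(\<integral>x. partial i F x \<partial>lebesgue_on U) = 0"
proof -
  have "(\<integral>x. partial i F x \<partial>lebesgue_on U) = (\<integral>x. indicator U x *\<^sub>R partial i F x \<partial>lebesgue)"
    using U by (intro integral_restrict_space) auto
  also have "\<dots> = (\<integral>x. partial i F x \<partial>lebesgue)"
  proof (rule Bochner_Integration.integral_cong)
    show "indicator U x *\<^sub>R partial i F x = partial i F x" for x
      using partial_eq_0_outside[of K F x i, OF compact_imp_closed[OF K(1)] supp] K(2)
      by (auto simp: indicator_def)
  qed auto
  also have "\<dots> = (\<integral>x. partial i F x \<partial>lborel)"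
    using F by (intro integral_completion)
      (auto intro!: borel_measurable_continuous_onI smooth_continuous smooth_partial)
  also have "\<dots> = 0"
    using integral_partial_compact_support(2)[OF F K(1) supp] .
  finally show ?thesis .
qed

text \<open>\<open>cut \<delta> s\<close> vanishes for \<open>s \<le> \<delta>\<close> and tends to 1 for \<open>s > 0\<close> as \<open>\<delta>\<close> tends to 0, while
  \<open>s\<^sup>k cut\<^bsup>(k)\<^esup> \<delta> s\<close> is bounded uniformly in \<open>\<delta>\<close> for \<open>k \<le> 2\<close>.\<close>

definition cut :: "real \<Rightarrow> real \<Rightarrow> real" where
  "cut \<delta> s = psi 0 (s / \<delta> - 1)"

definition cut' :: "real \<Rightarrow> real \<Rightarrow> real" where
  "cut' \<delta> s = psi 2 (s / \<delta> - 1) / \<delta>"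

definition cut'' :: "real \<Rightarrow> real \<Rightarrow> real" where
  "cut'' \<delta> s = (psi 4 (s / \<delta> - 1) - 2 * psi 3 (s / \<delta> - 1)) / \<delta>\<^sup>2"

lemma DERIV_cut: "(cut \<delta> has_real_derivative cut' \<delta> s) (at s)"
proof -
  have "((\<lambda>s. psi 0 (s / \<delta> - 1)) has_real_derivative psi 2 (s / \<delta> - 1) * (1 / \<delta>)) (at s)"
    using DERIV_psi[of 0 "s / \<delta> - 1"]
    by (intro DERIV_chain2[where f="psi 0" and g="\<lambda>s. s / \<delta> - 1"])
      (auto intro!: derivative_eq_intros simp: numeral_2_eq_2 divide_inverse)
  then show ?thesis
    unfolding cut_def[abs_def] cut'_def by simp
qed

lemma DERIV_cut': "(cut' \<delta> has_real_derivative cut'' \<delta> s) (at s)"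
proof -
  have "((\<lambda>s. psi 2 (s / \<delta> - 1)) has_real_derivative
      (psi 4 (s / \<delta> - 1) - 2 * psi 3 (s / \<delta> - 1)) * (1 / \<delta>)) (at s)"
    using DERIV_psi[of 2 "s / \<delta> - 1"]
    by (intro DERIV_chain2[where f="psi 2" and g="\<lambda>s. s / \<delta> - 1"])
      (auto intro!: derivative_eq_intros simp: numeral_eq_Suc divide_inverse)
  from DERIV_cdivide[OF this, of \<delta>] show ?thesis
    unfolding cut'_def[abs_def] cut''_def by (simp add: power2_eq_square)
qed

text \<open>One term of the exponential series is at most its sum, which makes the constants the
  factorials of 1, 2, 3 and 4.\<close>

lemma exp_bounds:
  fixes t :: real
  assumes "t \<ge> 0"
  shows "t * exp (- t) \<le> 1" "t\<^sup>2 * exp (- t) \<le> 2" "t ^ 3 * exp (- t) \<le> 6" "t ^ 4 * exp (- t) \<le> 24"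
proof -
  have *: "t ^ k / fact k \<le> exp t" for k
  proof -
    have "(\<Sum>n\<in>{k}. inverse (fact n) *\<^sub>R t ^ n) \<le> (\<Sum>n. inverse (fact n) *\<^sub>R t ^ n)"
      using assms summable_exp_generic[of t] by (intro sum_le_suminf) auto
    then show ?thesis
      by (simp add: exp_def divide_inverse mult.commute)
  qed
  show "t * exp (- t) \<le> 1" "t\<^sup>2 * exp (- t) \<le> 2" "t ^ 3 * exp (- t) \<le> 6" "t ^ 4 * exp (- t) \<le> 24"
    using *[of 1] *[of 2] *[of 3] *[of 4]
    by (auto simp: exp_minus fact_numeral field_simps)
qed

text \<open>In the variable \<open>t = 1 / (s / \<delta> - 1)\<close> the parameter \<delta>
  cancels: \<open>s * cut'\<close> becomes \<open>(t^2 + t) exp (-t)\<close> and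
  \<open>s^2 * cut''\<close> becomes \<open>(t^4 - 3 t^2 - 2 t) exp (-t)\<close>. Hence 3 = 2 + 1,
  while 50 generously covers the one-sided bounds 24 and 8.\<close>

lemma cut_bounds:
  assumes "\<delta> > 0"
  shows "0 \<le> cut \<delta> s" "cut \<delta> s \<le> 1" "cut' \<delta> s \<ge> 0"
    "\<bar>cut' \<delta> s * s\<bar> \<le> 3" "\<bar>cut'' \<delta> s * s\<^sup>2\<bar> \<le> 50"
proof -
  show "0 \<le> cut \<delta> s" "cut' \<delta> s \<ge> 0"
    using assms by (auto simp: cut_def cut'_def psi_nonneg)
  show "cut \<delta> s \<le> 1"
    by (auto simp: cut_def psi_def)
  have "\<bar>cut' \<delta> s * s\<bar> \<le> 3 \<and> \<bar>cut'' \<delta> s * s\<^sup>2\<bar> \<le> 50"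
  proof (cases "s / \<delta> - 1 > 0")
    case False
    then show ?thesis by (simp add: cut'_def cut''_def)
  next
    case True
    define t where "t = 1 / (s / \<delta> - 1)"
    have t: "t > 0" using True by (simp add: t_def)
    have s: "s / \<delta> = 1 + 1 / t" using True by (simp add: t_def)
    have p: "psi k (s / \<delta> - 1) = exp (- t) * t ^ k" for k
      using True by (simp add: psi_def t_def power_divide)
    have "cut' \<delta> s * s = exp (- t) * t\<^sup>2 * (s / \<delta>)"
      unfolding cut'_def p by simp
    also have "\<dots> = t\<^sup>2 * exp (- t) + t * exp (- t)"
      unfolding s using t by (simp add: field_simps power2_eq_square)
    finally have 1: "cut' \<delta> s * s = t\<^sup>2 * exp (- t) + t * exp (- t)" .
    have "cut'' \<delta> s * s\<^sup>2 = exp (- t) * (t ^ 4 - 2 * t ^ 3) * (s / \<delta>)\<^sup>2"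
      unfolding cut''_def p by (simp add: power_divide algebra_simps diff_divide_distrib)
    also have "\<dots> = exp (- t) * (t\<^sup>2 - 2 * t) * (t + 1)\<^sup>2"
      unfolding s using t by (simp add: field_simps power2_eq_square eval_nat_numeral)
    also have "\<dots> = t ^ 4 * exp (- t) - 3 * (t\<^sup>2 * exp (- t)) - 2 * (t * exp (- t))"
      by (simp add: algebra_simps power2_eq_square eval_nat_numeral)
    finally have 2: "cut'' \<delta> s * s\<^sup>2 = t ^ 4 * exp (- t) - 3 * (t\<^sup>2 * exp (- t)) - 2 * (t * exp (- t))" .
    have "t * exp (- t) \<ge> 0" "t\<^sup>2 * exp (- t) \<ge> 0" "t ^ 4 * exp (- t) \<ge> 0"
      using t by auto
    then show ?thesis
      using exp_bounds[of t] t unfolding 1 2 abs_le_iff by linarith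
  qed
  then show "\<bar>cut' \<delta> s * s\<bar> \<le> 3" "\<bar>cut'' \<delta> s * s\<^sup>2\<bar> \<le> 50" by auto
qed

lemma cut_eq_0: "\<delta> > 0 \<Longrightarrow> s \<le> \<delta> \<Longrightarrow> cut \<delta> s = 0"
  by (simp add: cut_def)

lemma tendsto_cut:
  assumes "s > 0"
  shows "(\<lambda>n. cut (inverse (real (Suc n))) s) \<longlonglongrightarrow> 1"
    and "(\<lambda>n. cut' (inverse (real (Suc n))) s) \<longlonglongrightarrow> 0"
    and "(\<lambda>n. cut'' (inverse (real (Suc n))) s) \<longlonglongrightarrow> 0"
proof -
  have ev: "\<forall>\<^sub>F n in sequentially. s * (1 + real n) - 1 > 0"
    using assms by real_asymp
  have "(\<lambda>n. exp (- (1 / (s * (1 + real n) - 1)))) \<longlonglongrightarrow> 1"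
    using assms by real_asymp
  then show "(\<lambda>n. cut (inverse (real (Suc n))) s) \<longlonglongrightarrow> 1"
    by (rule Lim_transform_eventually)
      (use ev in eventually_elim, auto simp: cut_def psi_def divide_inverse)
  have "(\<lambda>n. exp (- (1 / (s * (1 + real n) - 1))) / (s * (1 + real n) - 1)\<^sup>2 * (1 + real n)) \<longlonglongrightarrow> 0"
    using assms by real_asymp
  then show "(\<lambda>n. cut' (inverse (real (Suc n))) s) \<longlonglongrightarrow> 0"
    by (rule Lim_transform_eventually)
      (use ev in eventually_elim, auto simp: cut'_def psi_def divide_inverse)
  have "(\<lambda>n. (exp (- (1 / (s * (1 + real n) - 1))) / (s * (1 + real n) - 1) ^ 4
      - 2 * (exp (- (1 / (s * (1 + real n) - 1))) / (s * (1 + real n) - 1) ^ 3)) * (1 + real n)\<^sup>2) \<longlonglongrightarrow> 0"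
    using assms by real_asymp
  then show "(\<lambda>n. cut'' (inverse (real (Suc n))) s) \<longlonglongrightarrow> 0"
    by (rule Lim_transform_eventually)
      (use ev in eventually_elim, auto simp: cut''_def psi_def divide_inverse power_inverse)
qed

lemma smooth_cut [smooth_intros]: "smooth f \<Longrightarrow> smooth (\<lambda>x. cut \<delta> (f x))"
  and smooth_cut' [smooth_intros]: "smooth f \<Longrightarrow> smooth (\<lambda>x. cut' \<delta> (f x))"
  unfolding cut_def cut'_def by (auto intro!: smooth_intros)

text \<open>The mean value theorem, used in direction \<open>i\<close> and then in direction
  \<open>j\<close>. The left side is symmetric in \<open>i\<close> and \<open>j\<close>, which is
  the source of the commutation of partial derivatives.\<close>

lemma second_difference:
  assumes f: "smooth f" and h: "(h::real) > 0"
  obtains a b where "0 < a" "a < h" "0 < b" "b < h"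
    "f (x + h *\<^sub>R axis i 1 + h *\<^sub>R axis j 1) - f (x + h *\<^sub>R axis i 1) - f (x + h *\<^sub>R axis j 1) + f x
      = h\<^sup>2 * partial j (partial i f) (x + a *\<^sub>R axis i 1 + b *\<^sub>R axis j 1)"
proof -
  let ?g = "\<lambda>t. f (x + h *\<^sub>R axis j 1 + t *\<^sub>R axis i 1) - f (x + t *\<^sub>R axis i 1)"
  let ?g' = "\<lambda>t. partial i f (x + h *\<^sub>R axis j 1 + t *\<^sub>R axis i 1) - partial i f (x + t *\<^sub>R axis i 1)"
  have "\<exists>a>0. a < h \<and> ?g h - ?g 0 = (h - 0) * ?g' a"
    by (rule MVT2[OF h, of ?g ?g'], intro DERIV_diff DERIV_along_axis f)
  then obtain a where a: "0 < a" "a < h" "?g h - ?g 0 = h * ?g' a" by auto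
  let ?k = "\<lambda>t. partial i f (x + a *\<^sub>R axis i 1 + t *\<^sub>R axis j 1)"
  let ?k' = "\<lambda>t. partial j (partial i f) (x + a *\<^sub>R axis i 1 + t *\<^sub>R axis j 1)"
  have "\<exists>b>0. b < h \<and> ?k h - ?k 0 = (h - 0) * ?k' b"
    by (rule MVT2[OF h, of ?k ?k'], intro DERIV_along_axis smooth_partial f)
  then obtain b where b: "0 < b" "b < h" "?k h - ?k 0 = h * ?k' b" by auto
  have "?g' a = h * ?k' b"
    using b(3) by (simp add: algebra_simps)
  with a have "?g h - ?g 0 = h\<^sup>2 * ?k' b"
    by (simp add: power2_eq_square)
  with a b show ?thesis
    by (intro that[of a b]) (auto simp: algebra_simps)
qed

lemma partial_commute:
  assumes f: "smooth f"
  shows "partial i (partial j f) x = partial j (partial i f) x"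
proof (rule ccontr)
  let ?A = "partial i (partial j f)" and ?B = "partial j (partial i f)"
  assume ne: "?A x \<noteq> ?B x"
  define e where "e = \<bar>?A x - ?B x\<bar> / 2"
  have e: "e > 0" using ne by (simp add: e_def)
  have "isCont ?A x" "isCont ?B x"
    using f by (auto intro!: smooth_partial smooth_continuous simp: continuous_on_eq_continuous_at[symmetric]
        intro: continuous_on_interior[of UNIV])
  then obtain d1 d2 where d: "d1 > 0" "\<And>y. dist y x < d1 \<Longrightarrow> \<bar>?A y - ?A x\<bar> < e"
    "d2 > 0" "\<And>y. dist y x < d2 \<Longrightarrow> \<bar>?B y - ?B x\<bar> < e"
    using e unfolding continuous_at_eps_delta dist_real_def by metis
  \<comment> \<open>The intermediate points lie within \<open>2 h\<close> of \<open>x\<close>, hence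
    inside both neighbourhoods.\<close>
  define h where "h = min d1 d2 / 3"
  have h: "h > 0" using d by (simp add: h_def)
  have near: "dist (x + a *\<^sub>R axis k 1 + b *\<^sub>R axis l 1) x < min d1 d2"
    if "0 < a" "a < h" "0 < b" "b < h" for a b and k l :: 'a
  proof -
    have "dist (x + a *\<^sub>R axis k 1 + b *\<^sub>R axis l 1) x \<le> norm (a *\<^sub>R axis k (1::real)) + norm (b *\<^sub>R axis l (1::real))"
      unfolding dist_norm using norm_triangle_ineq[of "a *\<^sub>R axis k (1::real)" "b *\<^sub>R axis l 1"]
      by (simp add: algebra_simps)
    also have "\<dots> < min d1 d2" using that h by (simp add: h_def norm_axis_1)
    finally show ?thesis .
  qed
  obtain a b where ab: "0 < a" "a < h" "0 < b" "b < h"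
    "f (x + h *\<^sub>R axis i 1 + h *\<^sub>R axis j 1) - f (x + h *\<^sub>R axis i 1) - f (x + h *\<^sub>R axis j 1) + f x
      = h\<^sup>2 * ?B (x + a *\<^sub>R axis i 1 + b *\<^sub>R axis j 1)"
    using second_difference[OF f h] by metis
  obtain a' b' where ab': "0 < a'" "a' < h" "0 < b'" "b' < h"
    "f (x + h *\<^sub>R axis j 1 + h *\<^sub>R axis i 1) - f (x + h *\<^sub>R axis j 1) - f (x + h *\<^sub>R axis i 1) + f x
      = h\<^sup>2 * ?A (x + a' *\<^sub>R axis j 1 + b' *\<^sub>R axis i 1)"
    using second_difference[OF f h] by metis
  have "h\<^sup>2 * ?A (x + a' *\<^sub>R axis j 1 + b' *\<^sub>R axis i 1) = h\<^sup>2 * ?B (x + a *\<^sub>R axis i 1 + b *\<^sub>R axis j 1)"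
  proof -
    have "x + h *\<^sub>R axis j 1 + h *\<^sub>R axis i 1 = x + h *\<^sub>R axis i 1 + h *\<^sub>R axis j 1"
      by simp
    with ab(5) ab'(5) show ?thesis by (simp only:)
  qed
  then have "?A (x + a' *\<^sub>R axis j 1 + b' *\<^sub>R axis i 1) = ?B (x + a *\<^sub>R axis i 1 + b *\<^sub>R axis j 1)"
    using h by simp
  moreover have "\<bar>?A (x + a' *\<^sub>R axis j 1 + b' *\<^sub>R axis i 1) - ?A x\<bar> < e"
    using near[OF ab'(1-4)] d by auto
  moreover have "\<bar>?B (x + a *\<^sub>R axis i 1 + b *\<^sub>R axis j 1) - ?B x\<bar> < e"
    using near[OF ab(1-4)] d by auto
  ultimately show False
    unfolding e_def by (smt (verit) field_sum_of_halves)
qed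

definition laplacian :: "(real^'n \<Rightarrow> real) \<Rightarrow> real^'n \<Rightarrow> real" where
  "laplacian u x = (\<Sum>i\<in>UNIV. partial i (partial i u) x)"

lemma smooth_laplacian [smooth_intros]: "smooth u \<Longrightarrow> smooth (laplacian u)"
  unfolding laplacian_def[abs_def] by (intro smooth_intros)

section \<open>A priori estimates on smooth convex domains\<close>

text \<open>For identities between double sums whose summands agree only after exchanging
  \<open>i\<close> and \<open>j\<close>: it suffices to add the summands for a pair and its
  swap.\<close>

lemma sum_antisymmetric_eq_0:
  fixes T :: "'n \<Rightarrow> 'n \<Rightarrow> real"
  assumes "\<And>i j. T i j + T j i = 0"
  shows "(\<Sum>i\<in>A. \<Sum>j\<in>A. T i j) = 0"
proof -
  have "(\<Sum>i\<in>A. \<Sum>j\<in>A. T i j) = (\<Sum>i\<in>A. \<Sum>j\<in>A. T j i)"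
    by (rule sum.swap)
  also have "\<dots> = (\<Sum>i\<in>A. \<Sum>j\<in>A. - T i j)"
    using assms by (intro sum.cong refl) (simp add: eq_neg_iff_add_eq_0)
  finally show ?thesis
    by (simp add: sum_negf)
qed

text \<open>The form equals |\<xi>|^2 times the trace of \<open>A\<close> on the orthogonal
  complement of \<xi>. With \<open>A\<close> the Hessian of \<open>w\<close> it takes the place of
  the boundary curvature term in the Miranda--Talenti inequality.\<close>

lemma hessian_trace_ineq:
  fixes A :: "'n::finite \<Rightarrow> 'n \<Rightarrow> real" and \<xi> :: "'n \<Rightarrow> real"
  assumes neg: "\<And>\<eta>. (\<Sum>i\<in>UNIV. \<Sum>j\<in>UNIV. A i j * \<eta> i * \<eta> j) \<le> 0"
  shows "(\<Sum>i\<in>UNIV. \<Sum>j\<in>UNIV. A i i * (\<xi> j)\<^sup>2 - A i j * \<xi> i * \<xi> j) \<le> 0"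
proof -
  \<comment> \<open>Test the form with the vectors \<open>\<xi>\<^sub>k e\<^sub>l - \<xi>\<^sub>l e\<^sub>k\<close>.\<close>
  have form: "(\<Sum>i\<in>UNIV. \<Sum>j\<in>UNIV. A i j * (a * of_bool (i = l) - b * of_bool (i = k)) *
      (a * of_bool (j = l) - b * of_bool (j = k)))
      = a\<^sup>2 * A l l - a * b * (A l k + A k l) + b\<^sup>2 * A k k" for a b k l
  proof -
    have pick: "(\<Sum>j\<in>UNIV. c j * (a * of_bool (j = l) - b * of_bool (j = k))) = a * c l - b * c k"
      for c :: "'n \<Rightarrow> real"
      by (simp add: right_diff_distrib sum_subtractf of_bool_def mult_delta_right)
    have "(\<Sum>i\<in>UNIV. \<Sum>j\<in>UNIV. A i j * (a * of_bool (i = l) - b * of_bool (i = k)) *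
        (a * of_bool (j = l) - b * of_bool (j = k)))
        = (\<Sum>i\<in>UNIV. (a * A i l - b * A i k) * (a * of_bool (i = l) - b * of_bool (i = k)))"
      by (rule sum.cong[OF refl], subst pick) (simp add: algebra_simps)
    then show ?thesis
      unfolding pick by (simp add: algebra_simps power2_eq_square)
  qed
  have "(\<Sum>k\<in>UNIV. \<Sum>l\<in>UNIV. (\<xi> k)\<^sup>2 * A l l - \<xi> k * \<xi> l * (A l k + A k l) + (\<xi> l)\<^sup>2 * A k k) \<le> 0"
    using neg[of "\<lambda>i. \<xi> k * of_bool (i = l) - \<xi> l * of_bool (i = k)" for k l]
    by (intro sum_nonpos) (simp only: form)
  moreover have "(\<Sum>k\<in>UNIV. \<Sum>l\<in>UNIV. (\<xi> k)\<^sup>2 * A l l - \<xi> k * \<xi> l * (A l k + A k l) + (\<xi> l)\<^sup>2 * A k k)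
      - 2 * (\<Sum>i\<in>UNIV. \<Sum>j\<in>UNIV. A i i * (\<xi> j)\<^sup>2 - A i j * \<xi> i * \<xi> j) = 0"
    unfolding sum_distrib_left sum_subtractf[symmetric]
    by (rule sum_antisymmetric_eq_0) (simp add: algebra_simps)
  ultimately show ?thesis by simp
qed

text \<open>The domain is described by a defining function because cut-offs near the boundary are
  then \<open>cut \<delta> (w x)\<close>, and functions vanishing on the boundary are products
  \<open>w x * h x\<close> with smooth \<open>h\<close>. The ball supplies the Poincare
  constant.\<close>

locale smooth_domain =
  fixes w :: "real^'n \<Rightarrow> real" and z :: "real^'n" and R :: real
  assumes smooth_w: "smooth w"
    and subset_cball: "{x. 0 < w x} \<subseteq> cball z R"
    and R_pos: "R > 0"
begin

definition U :: "(real^'n) set" where "U = {x. 0 < w x}"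

lemma open_U: "open U"
  unfolding U_def using smooth_continuous[OF smooth_w] by (intro open_Collect_less) auto

lemma integrable_U:
  fixes f :: "real^'n \<Rightarrow> 'b::{banach, second_countable_topology}"
  assumes "continuous_on UNIV f"
  shows "integrable (lebesgue_on U) f"
  using integrable_continuous_bounded[OF open_U compact_cball, of z R f] subset_cball
    continuous_on_subset[OF assms] by (auto simp: U_def)

lemma integrable_smooth: "smooth f \<Longrightarrow> integrable (lebesgue_on U) f"
  by (intro integrable_U smooth_continuous)

lemma AE_U: "(\<And>x. w x > 0 \<Longrightarrow> P x) \<Longrightarrow> AE x in lebesgue_on U. P x"
  by (rule AE_I2) (auto simp: U_def space_restrict_space)

lemma integral_mono_U:
  fixes f g :: "real^'n \<Rightarrow> real"
  assumes "continuous_on UNIV f" "continuous_on UNIV g" "\<And>x. w x > 0 \<Longrightarrow> f x \<le> g x"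
  shows "(\<integral>x. f x \<partial>lebesgue_on U) \<le> (\<integral>x. g x \<partial>lebesgue_on U)"
  by (intro integral_mono integrable_U assms) (auto simp: U_def space_restrict_space assms)

lemma integral_partial_interior:
  assumes "smooth F" "\<delta> > 0" and zero: "\<And>x. w x < \<delta> \<Longrightarrow> F x = 0"
  shows "(\<integral>x. partial i F x \<partial>lebesgue_on U) = 0"
proof (rule integral_partial_supported[OF assms(1), where K="{x. \<delta> \<le> w x}"])
  have "closed {x. \<delta> \<le> w x}"
    using smooth_continuous[OF smooth_w] by (intro closed_Collect_le) auto
  moreover have "{x. \<delta> \<le> w x} \<subseteq> cball z R"
    using subset_cball assms by auto
  ultimately show "compact {x. \<delta> \<le> w x}"
    using bounded_cball bounded_subset compact_eq_bounded_closed by blast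
  show "{x. \<delta> \<le> w x} \<subseteq> U" using assms by (auto simp: U_def)
qed (use zero open_U in auto)

text \<open>With the cut-off inserted the integral vanishes. The derivative that falls on the
  cut-off produces \<open>cut' \<delta> (w x) * w x\<close>, which is bounded by 3 and tends to 0
  pointwise, so dominated convergence removes the cut-off.\<close>

lemma integral_partial_w_mult:
  assumes h: "smooth h"
  shows "(\<integral>x. partial i (\<lambda>x. w x * h x) x \<partial>lebesgue_on U) = 0"
proof -
  define \<delta> where "\<delta> n = inverse (real (Suc n))" for n
  have \<delta>: "\<delta> n > 0" for n by (simp add: \<delta>_def)
  let ?u = "\<lambda>x. w x * h x"
  have u: "smooth ?u" using h smooth_w by (intro smooth_intros)
  have eq: "partial i (\<lambda>x. cut (\<delta> n) (w x) * ?u x) =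
      (\<lambda>x. cut (\<delta> n) (w x) * partial i ?u x + (cut' (\<delta> n) (w x) * w x) * (partial i w x * h x))" for n
    using partial_mult[OF smooth_cut[OF smooth_w, of "\<delta> n"] u, of i]
    by (simp add: partial_chain[OF smooth_w DERIV_cut] mult_ac)
  have "(\<lambda>n. \<integral>x. cut (\<delta> n) (w x) * partial i ?u x + (cut' (\<delta> n) (w x) * w x) * (partial i w x * h x)
      \<partial>lebesgue_on U) \<longlonglongrightarrow> (\<integral>x. partial i ?u x \<partial>lebesgue_on U)"
  proof (rule integral_dominated_convergence[where w="\<lambda>x. \<bar>partial i ?u x\<bar> + 3 * \<bar>partial i w x * h x\<bar>"])
    show "partial i ?u \<in> borel_measurable (lebesgue_on U)"
      using smooth_w h by (intro borel_measurable_integrable integrable_smooth smooth_intros)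
    show "(\<lambda>x. cut (\<delta> n) (w x) * partial i ?u x + (cut' (\<delta> n) (w x) * w x) * (partial i w x * h x))
        \<in> borel_measurable (lebesgue_on U)" for n
      using u smooth_w h by (intro borel_measurable_integrable integrable_smooth smooth_intros)
    show "integrable (lebesgue_on U) (\<lambda>x. \<bar>partial i ?u x\<bar> + 3 * \<bar>partial i w x * h x\<bar>)"
      using u smooth_w h by (intro integrable_U continuous_intros smooth_continuous smooth_intros)
    show "AE x in lebesgue_on U. (\<lambda>n. cut (\<delta> n) (w x) * partial i ?u x
        + (cut' (\<delta> n) (w x) * w x) * (partial i w x * h x)) \<longlonglongrightarrow> partial i ?u x"
    proof (rule AE_U)
      fix x assume x: "0 < w x"
      have "(\<lambda>n. cut (\<delta> n) (w x) * partial i ?u x + (cut' (\<delta> n) (w x) * w x) * (partial i w x * h x))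
          \<longlonglongrightarrow> 1 * partial i ?u x + (0 * w x) * (partial i w x * h x)"
        unfolding \<delta>_def by (intro tendsto_intros tendsto_cut[OF x])
      then show "(\<lambda>n. cut (\<delta> n) (w x) * partial i ?u x + (cut' (\<delta> n) (w x) * w x) * (partial i w x * h x))
          \<longlonglongrightarrow> partial i ?u x" by simp
    qed
    fix n
    show "AE x in lebesgue_on U. norm (cut (\<delta> n) (w x) * partial i ?u x
        + (cut' (\<delta> n) (w x) * w x) * (partial i w x * h x)) \<le> \<bar>partial i ?u x\<bar> + 3 * \<bar>partial i w x * h x\<bar>"
    proof (rule AE_U)
      fix x
      have "\<bar>cut (\<delta> n) (w x) * partial i ?u x\<bar> \<le> 1 * \<bar>partial i ?u x\<bar>"
        unfolding abs_mult using cut_bounds(1,2)[OF \<delta>[of n], of "w x"] by (intro mult_right_mono) auto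
      moreover have "\<bar>(cut' (\<delta> n) (w x) * w x) * (partial i w x * h x)\<bar> \<le> 3 * \<bar>partial i w x * h x\<bar>"
        unfolding abs_mult[of "cut' (\<delta> n) (w x) * w x"]
        using cut_bounds(4)[OF \<delta>[of n], of "w x"] by (intro mult_right_mono) auto
      ultimately show "norm (cut (\<delta> n) (w x) * partial i ?u x
        + (cut' (\<delta> n) (w x) * w x) * (partial i w x * h x)) \<le> \<bar>partial i ?u x\<bar> + 3 * \<bar>partial i w x * h x\<bar>"
        unfolding real_norm_def by linarith
    qed
  qed
  moreover have "(\<integral>x. cut (\<delta> n) (w x) * partial i ?u x + (cut' (\<delta> n) (w x) * w x) * (partial i w x * h x)
      \<partial>lebesgue_on U) = 0" for n
    unfolding eq[symmetric]
    by (rule integral_partial_interior[OF _ \<delta>[of n]])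
      (auto intro!: smooth_intros smooth_w h simp: cut_eq_0[OF \<delta>])
  ultimately show ?thesis
    by (simp add: LIMSEQ_const_iff)
qed

lemma integral_by_parts:
  assumes "smooth h" "smooth g"
  shows "(\<integral>x. partial i (\<lambda>x. w x * h x) x * g x \<partial>lebesgue_on U)
    = - (\<integral>x. (w x * h x) * partial i g x \<partial>lebesgue_on U)"
proof -
  let ?u = "\<lambda>x. w x * h x"
  have u: "smooth ?u" using assms smooth_w by (intro smooth_intros)
  have "0 = (\<integral>x. partial i (\<lambda>x. w x * (h x * g x)) x \<partial>lebesgue_on U)"
    using assms by (subst integral_partial_w_mult) (auto intro: smooth_intros)
  also have "(\<lambda>x. w x * (h x * g x)) = (\<lambda>x. ?u x * g x)" by (simp add: mult.assoc)
  also have "(\<integral>x. partial i (\<lambda>x. ?u x * g x) x \<partial>lebesgue_on U) =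
      (\<integral>x. ?u x * partial i g x + partial i ?u x * g x \<partial>lebesgue_on U)"
    using partial_mult[OF u assms(2)] by simp
  also have "\<dots> = (\<integral>x. ?u x * partial i g x \<partial>lebesgue_on U) + (\<integral>x. partial i ?u x * g x \<partial>lebesgue_on U)"
    by (intro Bochner_Integration.integral_add integrable_smooth smooth_intros u assms)
  finally show ?thesis by simp
qed

text \<open>Integration by parts against \<open>x $ i - z $ i\<close> turns the integral of
  \<open>u^2\<close> into that of \<open>- 2 u (partial i u) (x $ i - z $ i)\<close>; on the domain
  the last factor is at most \<open>R\<close> in modulus, and Young's inequality absorbs half of
  \<open>u^2\<close>.\<close>

lemma poincare:
  assumes h: "smooth h" and u: "u = (\<lambda>x. w x * h x)"
  shows "(\<integral>x. (u x)\<^sup>2 \<partial>lebesgue_on U) \<le> 4 * R\<^sup>2 * (\<integral>x. (partial i u x)\<^sup>2 \<partial>lebesgue_on U)"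
proof -
  have su: "smooth u" unfolding u using h smooth_w by (intro smooth_intros)
  let ?l = "\<lambda>x. x $ i - z $ i"
  have l: "smooth ?l" by (intro smooth_intros)
  have pl: "partial i ?l = (\<lambda>x. 1)"
    by (subst partial_diff) (auto intro: smooth_intros simp: partial_nth)
  have pp: "partial i (\<lambda>x. u x * ?l x) = (\<lambda>x. u x + partial i u x * ?l x)"
    using partial_mult[OF su l] by (simp add: pl)
  have "(\<integral>x. partial i u x * (u x * ?l x) \<partial>lebesgue_on U)
      = - (\<integral>x. u x * (u x + partial i u x * ?l x) \<partial>lebesgue_on U)"
    using integral_by_parts[OF h, of "\<lambda>x. u x * ?l x" i] smooth_mult[OF su l] by (simp add: pp u[symmetric] fun_cong[OF u, symmetric])
  also have "(\<integral>x. u x * (u x + partial i u x * ?l x) \<partial>lebesgue_on U)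
      = (\<integral>x. (u x)\<^sup>2 + partial i u x * (u x * ?l x) \<partial>lebesgue_on U)"
    by (intro Bochner_Integration.integral_cong refl) (simp add: power2_eq_square algebra_simps)
  also have "\<dots> = (\<integral>x. (u x)\<^sup>2 \<partial>lebesgue_on U) + (\<integral>x. partial i u x * (u x * ?l x) \<partial>lebesgue_on U)"
    by (intro Bochner_Integration.integral_add integrable_smooth smooth_intros su l)
  finally have "(\<integral>x. (u x)\<^sup>2 \<partial>lebesgue_on U) = (\<integral>x. - 2 * (partial i u x * (u x * ?l x)) \<partial>lebesgue_on U)"
    by simp
  also have "\<dots> \<le> (\<integral>x. (1/2) * (u x)\<^sup>2 + 2 * R\<^sup>2 * (partial i u x)\<^sup>2 \<partial>lebesgue_on U)"
  proof (intro integral_mono_U smooth_continuous smooth_intros su l)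
    fix x assume "0 < w x"
    then have "norm (x - z) \<le> R"
      using subset_cball by (auto simp: dist_norm norm_minus_commute)
    then have "\<bar>?l x\<bar> \<le> R"
      using component_le_norm_cart[of "x - z" i] by simp
    then have "(?l x)\<^sup>2 \<le> R\<^sup>2"
      using R_pos abs_le_square_iff[of "?l x" R] by simp
    then have "(partial i u x)\<^sup>2 * (?l x)\<^sup>2 \<le> R\<^sup>2 * (partial i u x)\<^sup>2"
      unfolding mult.commute[of "R\<^sup>2"] by (intro mult_left_mono) auto
    moreover have "0 \<le> (u x + 2 * partial i u x * ?l x)\<^sup>2" by simp
    then have "- 4 * (partial i u x * (u x * ?l x)) \<le> (u x)\<^sup>2 + 4 * ((partial i u x)\<^sup>2 * (?l x)\<^sup>2)"
      by (simp add: power2_eq_square algebra_simps)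
    ultimately show "- 2 * (partial i u x * (u x * ?l x)) \<le> (1/2) * (u x)\<^sup>2 + 2 * R\<^sup>2 * (partial i u x)\<^sup>2"
      unfolding mult.assoc[of 2] by linarith
  qed
  also have "\<dots> = (1/2) * (\<integral>x. (u x)\<^sup>2 \<partial>lebesgue_on U) + 2 * R\<^sup>2 * (\<integral>x. (partial i u x)\<^sup>2 \<partial>lebesgue_on U)"
    by (subst Bochner_Integration.integral_add) (auto intro!: integrable_smooth smooth_intros su)
  finally show ?thesis by simp
qed

lemma energy_identity:
  assumes h: "smooth h" and u: "u = (\<lambda>x. w x * h x)"
  shows "(\<integral>x. u x * laplacian u x \<partial>lebesgue_on U) = - (\<integral>x. (\<Sum>i\<in>UNIV. (partial i u x)\<^sup>2) \<partial>lebesgue_on U)"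
proof -
  have su: "smooth u" unfolding u using h smooth_w by (intro smooth_intros)
  have "(\<integral>x. u x * laplacian u x \<partial>lebesgue_on U)
      = (\<Sum>i\<in>UNIV. \<integral>x. u x * partial i (partial i u) x \<partial>lebesgue_on U)"
    unfolding laplacian_def sum_distrib_left
    by (intro Bochner_Integration.integral_sum integrable_smooth smooth_intros su)
  also have "\<dots> = (\<Sum>i\<in>UNIV. - (\<integral>x. (partial i u x)\<^sup>2 \<partial>lebesgue_on U))"
    using integral_by_parts[OF h smooth_partial[OF su]]
    by (simp add: power2_eq_square fun_cong[OF u, symmetric])
  also have "\<dots> = - (\<integral>x. (\<Sum>i\<in>UNIV. (partial i u x)\<^sup>2) \<partial>lebesgue_on U)"
    by (subst Bochner_Integration.integral_sum) (auto intro!: integrable_smooth smooth_intros su simp: sum_negf)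
  finally show ?thesis .
qed

text \<open>The energy identity bounds the gradient by the product of \<open>u\<close> and its
  Laplacian; Young's inequality and the Poincare inequality absorb half of the result.\<close>

lemma gradient_bound:
  assumes h: "smooth h" and u: "u = (\<lambda>x. w x * h x)"
  shows "(\<integral>x. (\<Sum>i\<in>UNIV. (partial i u x)\<^sup>2) \<partial>lebesgue_on U) \<le> 4 * R\<^sup>2 * (\<integral>x. (laplacian u x)\<^sup>2 \<partial>lebesgue_on U)"
proof -
  have su: "smooth u" unfolding u using h smooth_w by (intro smooth_intros)
  let ?G = "\<integral>x. (\<Sum>i\<in>UNIV. (partial i u x)\<^sup>2) \<partial>lebesgue_on U"
  \<comment> \<open>Index types are nonempty; one direction is enough for the Poincare
    inequality.\<close>
  obtain i :: 'n where True by auto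
  have "(\<integral>x. (partial i u x)\<^sup>2 \<partial>lebesgue_on U) \<le> ?G"
  proof (intro integral_mono_U smooth_continuous smooth_intros su)
    show "(partial i u x)\<^sup>2 \<le> (\<Sum>i\<in>UNIV. (partial i u x)\<^sup>2)" for x
      by (rule member_le_sum[of i UNIV "\<lambda>i. (partial i u x)\<^sup>2"]) auto
  qed
  then have "4 * R\<^sup>2 * (\<integral>x. (partial i u x)\<^sup>2 \<partial>lebesgue_on U) \<le> 4 * R\<^sup>2 * ?G"
    by (intro mult_left_mono) auto
  with poincare[OF h u, of i] have P: "(\<integral>x. (u x)\<^sup>2 \<partial>lebesgue_on U) \<le> 4 * R\<^sup>2 * ?G"
    by linarith
  have "?G = (\<integral>x. - (u x * laplacian u x) \<partial>lebesgue_on U)"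
    using energy_identity[OF h u] by simp
  \<comment> \<open>The weight \<open>1 / (8 R^2)\<close> is chosen so that the Poincare constant
    \<open>4 R^2\<close> turns the first term into half of \<open>?G\<close>.\<close>
  also have "\<dots> \<le> (\<integral>x. (1 / (8 * R\<^sup>2)) * (u x)\<^sup>2 + 2 * R\<^sup>2 * (laplacian u x)\<^sup>2 \<partial>lebesgue_on U)"
  proof (intro integral_mono_U smooth_continuous smooth_intros su)
    fix x
    have "0 \<le> (u x + 4 * R\<^sup>2 * laplacian u x)\<^sup>2 / (8 * R\<^sup>2)" by simp
    also have "\<dots> = (1 / (8 * R\<^sup>2)) * (u x)\<^sup>2 + u x * laplacian u x + 2 * R\<^sup>2 * (laplacian u x)\<^sup>2"
      using R_pos by (simp add: field_simps power2_eq_square)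
    finally show "- (u x * laplacian u x) \<le> (1 / (8 * R\<^sup>2)) * (u x)\<^sup>2 + 2 * R\<^sup>2 * (laplacian u x)\<^sup>2"
      by linarith
  qed
  also have "\<dots> = (1 / (8 * R\<^sup>2)) * (\<integral>x. (u x)\<^sup>2 \<partial>lebesgue_on U)
      + 2 * R\<^sup>2 * (\<integral>x. (laplacian u x)\<^sup>2 \<partial>lebesgue_on U)"
    by (subst Bochner_Integration.integral_add) (auto intro!: integrable_smooth smooth_intros su)
  also have "(1 / (8 * R\<^sup>2)) * (\<integral>x. (u x)\<^sup>2 \<partial>lebesgue_on U) \<le> (1 / (8 * R\<^sup>2)) * (4 * R\<^sup>2 * ?G)"
    using P by (intro mult_left_mono) auto
  also have "\<dots> = ?G / 2" using R_pos by simp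
  finally show ?thesis by simp
qed

text \<open>The product rule for the fields \<open>Y i j\<close> of the cut-off Hessian estimate,
  kept abstract in its factors: \<open>p\<close> and \<open>r\<close> will be first derivatives of
  \<open>u\<close>, \<open>q\<close> and \<open>s\<close> second ones.\<close>

lemma partial_divergence_field:
  assumes "smooth c" "smooth p" "smooth q" "smooth r" "smooth s" "smooth c1" "smooth c2"
  shows "partial i (\<lambda>x. c x * (p x * q x - r x * s x) - (c1 x * (p x * p x) - c2 x * (r x * p x))) =
    (\<lambda>x. partial i c x * (p x * q x - r x * s x)
      + c x * (partial i p x * q x + p x * partial i q x - partial i r x * s x - r x * partial i s x)
      - (partial i c1 x * (p x * p x) + 2 * c1 x * p x * partial i p x
      - partial i c2 x * (r x * p x) - c2 x * (partial i r x * p x + r x * partial i p x)))"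
  by (rule ext, simp only: partial_mult partial_diff smooth_mult smooth_diff assms)
    (simp add: algebra_simps)

text \<open>Two integrations by parts move derivatives from |D^2 u|^2 - (Laplacian u)^2 onto the
  weight \<open>cut \<delta> (w x)\<close>. The Hessian of the weight consists of
  \<open>cut'\<close> times the Hessian of \<open>w\<close>, whose contribution is nonpositive by
  concavity, and of \<open>cut''\<close> times the tensor square of the gradient of
  \<open>w\<close>, which yields the right side.\<close>

lemma integral_cut_hessian:
  assumes h: "smooth h" and u: "u = (\<lambda>x. w x * h x)" and \<delta>: "\<delta> > 0"
    and concave: "\<And>x \<xi>. w x > 0 \<Longrightarrow>
      (\<Sum>i\<in>UNIV. \<Sum>j\<in>UNIV. partial i (partial j w) x * \<xi> i * \<xi> j) \<le> 0"
  shows "(\<integral>x. cut \<delta> (w x) * (\<Sum>i\<in>UNIV. \<Sum>j\<in>UNIV. (partial i (partial j u) x)\<^sup>2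
      - partial i (partial i u) x * partial j (partial j u) x) \<partial>lebesgue_on U)
    \<le> (\<integral>x. (cut'' \<delta> (w x) * (w x)\<^sup>2) * (\<Sum>i\<in>UNIV. \<Sum>j\<in>UNIV. (partial i w x)\<^sup>2 * (partial j h x)\<^sup>2
      - partial i w x * partial j w x * partial i h x * partial j h x) \<partial>lebesgue_on U)"
    (is "(\<integral>x. cut \<delta> (w x) * ?q x \<partial>_) \<le> (\<integral>x. _ * ?Q x \<partial>_)")
proof -
  have su: "smooth u" unfolding u using h smooth_w by (intro smooth_intros)
  define c where "c = (\<lambda>x. cut \<delta> (w x))"
  have sc: "smooth c" unfolding c_def using smooth_w by (intro smooth_intros)
  have ci: "partial i c = (\<lambda>x. cut' \<delta> (w x) * partial i w x)" for i
    unfolding c_def by (rule partial_chain[OF smooth_w DERIV_cut])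
  have cij: "partial i (partial j c) = (\<lambda>x. cut' \<delta> (w x) * partial i (partial j w) x
      + cut'' \<delta> (w x) * partial i w x * partial j w x)" for i j
    unfolding ci using partial_mult[OF smooth_cut'[OF smooth_w, of \<delta>] smooth_partial[OF smooth_w, of j], of i]
    by (simp add: partial_chain[OF smooth_w DERIV_cut'])
  have uj: "partial j u = (\<lambda>x. w x * partial j h x + partial j w x * h x)" for j
    unfolding u by (rule partial_mult[OF smooth_w h])
  \<comment> \<open>The first bracket represents |D^2 u|^2 - (Laplacian u)^2 as a divergence; the
    second moves one more derivative from \<open>u\<close> to the weight.\<close>
  define Y where "Y i j = (\<lambda>x. c x * (partial j u x * partial i (partial j u) x
      - partial i u x * partial j (partial j u) x)
      - (partial i c x * (partial j u x * partial j u x) - partial j c x * (partial i u x * partial j u x)))"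
    for i j
  have sY: "smooth (Y i j)" for i j
    unfolding Y_def by (intro smooth_intros sc su)
  have Y0: "Y i j x = 0" if "w x < \<delta>" for i j x
    using that \<delta> by (simp add: Y_def c_def ci[unfolded c_def] cut_eq_0 cut'_def)
  let ?k = "\<lambda>x. \<Sum>i\<in>UNIV. \<Sum>j\<in>UNIV. partial i (partial i c) x * (partial j u x)\<^sup>2
      - partial i (partial j c) x * partial i u x * partial j u x"
  have div: "(\<Sum>i\<in>UNIV. \<Sum>j\<in>UNIV. partial i (Y i j) x) = c x * ?q x - ?k x" for x
  proof -
    have "(\<Sum>i\<in>UNIV. \<Sum>j\<in>UNIV. partial i (Y i j) x
        - (c x * ((partial i (partial j u) x)\<^sup>2 - partial i (partial i u) x * partial j (partial j u) x)
        - (partial i (partial i c) x * (partial j u x)\<^sup>2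
        - partial i (partial j c) x * partial i u x * partial j u x))) = 0"
    \<comment> \<open>The third derivatives of \<open>u\<close> cancel only between the pairs
      \<open>(i, j)\<close> and \<open>(j, i)\<close>.\<close>
    proof (rule sum_antisymmetric_eq_0)
      fix i j
      have c1: "partial j (partial i u) x = partial i (partial j u) x"
        using partial_commute[OF su] .
      have c2: "partial i (partial i (partial j u)) x = partial j (partial i (partial i u)) x" for i j
      proof -
        have "partial i (partial j u) = partial j (partial i u)"
          using partial_commute[OF su] by blast
        then show ?thesis
          using partial_commute[OF smooth_partial[OF su]] by metis
      qed
      show "partial i (Y i j) x
        - (c x * ((partial i (partial j u) x)\<^sup>2 - partial i (partial i u) x * partial j (partial j u) x)
        - (partial i (partial i c) x * (partial j u x)\<^sup>2
        - partial i (partial j c) x * partial i u x * partial j u x))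
        + (partial j (Y j i) x
        - (c x * ((partial j (partial i u) x)\<^sup>2 - partial j (partial j u) x * partial i (partial i u) x)
        - (partial j (partial j c) x * (partial i u x)\<^sup>2
        - partial j (partial i c) x * partial j u x * partial i u x))) = 0"
        unfolding Y_def
        by (subst (1 2) partial_divergence_field)
          (auto intro!: sc su smooth_partial simp: c1 c2[of i j] c2[of j i] algebra_simps power2_eq_square)
    qed
    then show ?thesis
      by (simp add: sum_subtractf sum_distrib_left right_diff_distrib)
  qed
  have "(\<integral>x. c x * ?q x - ?k x \<partial>lebesgue_on U) = 0"
    unfolding div[symmetric]
    by (subst Bochner_Integration.integral_sum
        Bochner_Integration.integral_sum[OF integrable_smooth]
      | auto intro!: integrable_smooth smooth_intros sY simp: integral_partial_interior[OF sY \<delta> Y0])+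
  then have "(\<integral>x. c x * ?q x \<partial>lebesgue_on U) = (\<integral>x. ?k x \<partial>lebesgue_on U)"
    by (subst (asm) Bochner_Integration.integral_diff)
      (auto intro!: integrable_smooth smooth_intros sc su)
  also have "\<dots> \<le> (\<integral>x. (cut'' \<delta> (w x) * (w x)\<^sup>2) * ?Q x \<partial>lebesgue_on U)"
  proof (rule integral_mono_U)
    show "continuous_on UNIV ?k"
      by (intro smooth_continuous smooth_intros sc su)
    show "continuous_on UNIV (\<lambda>x. (cut'' \<delta> (w x) * (w x)\<^sup>2) * ?Q x)"
      unfolding cut''_def by (intro smooth_continuous smooth_intros smooth_w h)
    fix x assume x: "0 < w x"
    \<comment> \<open>The form |grad w|^2 |\<eta>|^2 - (grad w . \<eta>)^2 ignores multiples of grad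
      w in \<eta>. Since grad u = w grad h + h grad w, only w grad h survives, and the factor
      \<open>w^2\<close> appears that keeps \<open>cut''\<close> bounded.\<close>
    have "(\<Sum>i\<in>UNIV. \<Sum>j\<in>UNIV. (partial i w x)\<^sup>2 * (partial j u x)\<^sup>2
        - partial i w x * partial j w x * partial i u x * partial j u x
        - (w x)\<^sup>2 * ((partial i w x)\<^sup>2 * (partial j h x)\<^sup>2
        - partial i w x * partial j w x * partial i h x * partial j h x)) = 0"
      by (rule sum_antisymmetric_eq_0) (simp add: uj algebra_simps power2_eq_square)
    then have eq: "(\<Sum>i\<in>UNIV. \<Sum>j\<in>UNIV. (partial i w x)\<^sup>2 * (partial j u x)\<^sup>2
        - partial i w x * partial j w x * partial i u x * partial j u x) = (w x)\<^sup>2 * ?Q x"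
      by (simp add: sum_subtractf sum_distrib_left right_diff_distrib)
    have "?k x = cut' \<delta> (w x) * (\<Sum>i\<in>UNIV. \<Sum>j\<in>UNIV. partial i (partial i w) x * (partial j u x)\<^sup>2
        - partial i (partial j w) x * partial i u x * partial j u x)
        + cut'' \<delta> (w x) * (\<Sum>i\<in>UNIV. \<Sum>j\<in>UNIV. (partial i w x)\<^sup>2 * (partial j u x)\<^sup>2
        - partial i w x * partial j w x * partial i u x * partial j u x)"
      unfolding cij sum_distrib_left sum.distrib[symmetric]
      by (intro sum.cong refl) (simp add: algebra_simps power2_eq_square)
    also have "\<dots> \<le> cut'' \<delta> (w x) * (\<Sum>i\<in>UNIV. \<Sum>j\<in>UNIV. (partial i w x)\<^sup>2 * (partial j u x)\<^sup>2
        - partial i w x * partial j w x * partial i u x * partial j u x)"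
      using hessian_trace_ineq[of "\<lambda>i j. partial i (partial j w) x" "\<lambda>j. partial j u x"]
        concave[OF x] cut_bounds(3)[OF \<delta>, of "w x"] by (simp add: mult_nonneg_nonpos)
    also have "\<dots> = (cut'' \<delta> (w x) * (w x)\<^sup>2) * ?Q x"
      unfolding eq by simp
    finally show "?k x \<le> (cut'' \<delta> (w x) * (w x)\<^sup>2) * ?Q x" .
  qed
  finally show ?thesis
    unfolding c_def .
qed

text \<open>Letting \<delta> tend to 0 in the cut-off version: the left weight tends to 1, while the
  right weight is bounded by 50 and tends to 0 pointwise. The constant 1 is what later admits every
  \<rho> below 1.\<close>

lemma miranda_talenti:
  assumes h: "smooth h" and u: "u = (\<lambda>x. w x * h x)"
    and concave: "\<And>x \<xi>. w x > 0 \<Longrightarrow>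
      (\<Sum>i\<in>UNIV. \<Sum>j\<in>UNIV. partial i (partial j w) x * \<xi> i * \<xi> j) \<le> 0"
  shows "(\<integral>x. (\<Sum>i\<in>UNIV. \<Sum>j\<in>UNIV. (partial i (partial j u) x)\<^sup>2) \<partial>lebesgue_on U)
    \<le> (\<integral>x. (laplacian u x)\<^sup>2 \<partial>lebesgue_on U)"
proof -
  have su: "smooth u" unfolding u using h smooth_w by (intro smooth_intros)
  define \<delta> where "\<delta> n = inverse (real (Suc n))" for n
  have \<delta>: "\<delta> n > 0" for n by (simp add: \<delta>_def)
  define q where "q = (\<lambda>x. \<Sum>i\<in>UNIV. \<Sum>j\<in>UNIV. (partial i (partial j u) x)\<^sup>2
      - partial i (partial i u) x * partial j (partial j u) x)"
  define Q where "Q = (\<lambda>x. \<Sum>i\<in>UNIV. \<Sum>j\<in>UNIV. (partial i w x)\<^sup>2 * (partial j h x)\<^sup>2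
      - partial i w x * partial j w x * partial i h x * partial j h x)"
  have sq: "smooth q" "smooth Q"
    unfolding q_def Q_def by (intro smooth_intros su smooth_w h)+
  have abs_cont: "continuous_on UNIV (\<lambda>x. \<bar>q x\<bar>)" "continuous_on UNIV (\<lambda>x. 50 * \<bar>Q x\<bar>)"
    by (intro continuous_on_rabs continuous_on_mult_left smooth_continuous sq)+
  have "(\<lambda>n. \<integral>x. cut (\<delta> n) (w x) * q x \<partial>lebesgue_on U) \<longlonglongrightarrow> (\<integral>x. q x \<partial>lebesgue_on U)"
  proof (rule integral_dominated_convergence[where w="\<lambda>x. \<bar>q x\<bar>"])
    show "AE x in lebesgue_on U. (\<lambda>n. cut (\<delta> n) (w x) * q x) \<longlonglongrightarrow> q x"
    proof (rule AE_U)
      fix x assume "0 < w x"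
      then have "(\<lambda>n. cut (\<delta> n) (w x) * q x) \<longlonglongrightarrow> 1 * q x"
        unfolding \<delta>_def by (intro tendsto_intros tendsto_cut)
      then show "(\<lambda>n. cut (\<delta> n) (w x) * q x) \<longlonglongrightarrow> q x" by simp
    qed
    show "AE x in lebesgue_on U. norm (cut (\<delta> n) (w x) * q x) \<le> \<bar>q x\<bar>" for n
      using cut_bounds(1,2)[OF \<delta>[of n]] by (intro AE_U) (auto simp: abs_mult intro!: mult_left_le_one_le)
  qed (use integrable_U[OF abs_cont(1)] in
      \<open>auto intro!: borel_measurable_integrable integrable_smooth smooth_intros sq smooth_w\<close>)
  moreover have "(\<lambda>n. \<integral>x. (cut'' (\<delta> n) (w x) * (w x)\<^sup>2) * Q x \<partial>lebesgue_on U) \<longlonglongrightarrow> (\<integral>x. 0 \<partial>lebesgue_on U)"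
  proof (rule integral_dominated_convergence[where w="\<lambda>x. 50 * \<bar>Q x\<bar>"])
    show "AE x in lebesgue_on U. (\<lambda>n. (cut'' (\<delta> n) (w x) * (w x)\<^sup>2) * Q x) \<longlonglongrightarrow> 0"
    proof (rule AE_U)
      fix x assume "0 < w x"
      then have "(\<lambda>n. (cut'' (\<delta> n) (w x) * (w x)\<^sup>2) * Q x) \<longlonglongrightarrow> (0 * (w x)\<^sup>2) * Q x"
        unfolding \<delta>_def by (intro tendsto_intros tendsto_cut)
      then show "(\<lambda>n. (cut'' (\<delta> n) (w x) * (w x)\<^sup>2) * Q x) \<longlonglongrightarrow> 0" by simp
    qed
    show "AE x in lebesgue_on U. norm ((cut'' (\<delta> n) (w x) * (w x)\<^sup>2) * Q x) \<le> 50 * \<bar>Q x\<bar>" for n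
      unfolding norm_mult[of "cut'' (\<delta> n) (w x) * (w x)\<^sup>2" for x]
      using cut_bounds(5)[OF \<delta>[of n]] by (intro AE_U) (auto intro!: mult_right_mono simp del: abs_mult)
    show "(\<lambda>x. (cut'' (\<delta> n) (w x) * (w x)\<^sup>2) * Q x) \<in> borel_measurable (lebesgue_on U)" for n
      unfolding cut''_def
      by (intro borel_measurable_integrable integrable_smooth smooth_intros sq smooth_w)
  qed (use integrable_U[OF abs_cont(2)] in auto)
  moreover have "(\<integral>x. cut (\<delta> n) (w x) * q x \<partial>lebesgue_on U)
      \<le> (\<integral>x. (cut'' (\<delta> n) (w x) * (w x)\<^sup>2) * Q x \<partial>lebesgue_on U)" for n
    unfolding q_def Q_def by (rule integral_cut_hessian[OF h u \<delta> concave])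
  ultimately have "(\<integral>x. q x \<partial>lebesgue_on U) \<le> (\<integral>x. 0 \<partial>lebesgue_on U)"
    by (intro LIMSEQ_le) auto
  moreover have "q = (\<lambda>x. (\<Sum>i\<in>UNIV. \<Sum>j\<in>UNIV. (partial i (partial j u) x)\<^sup>2) - (laplacian u x)\<^sup>2)"
    unfolding q_def laplacian_def power2_eq_square sum_product by (simp add: sum_subtractf)
  ultimately have "(\<integral>x. (\<Sum>i\<in>UNIV. \<Sum>j\<in>UNIV. (partial i (partial j u) x)\<^sup>2) - (laplacian u x)\<^sup>2
      \<partial>lebesgue_on U) \<le> 0"
    by simp
  then show ?thesis
    by (subst (asm) Bochner_Integration.integral_diff)
      (auto intro!: integrable_smooth smooth_intros su)
qed

end

section \<open>Square-integrable vector functions\<close>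

text \<open>Values in an arbitrary Euclidean space, so that a function, its gradient and its Hessian
  can be handled as one square-integrable map.\<close>

definition sq_integrable :: "'a measure \<Rightarrow> ('a \<Rightarrow> 'b::euclidean_space) \<Rightarrow> bool" where
  "sq_integrable M f \<longleftrightarrow> f \<in> borel_measurable M \<and> integrable M (\<lambda>x. (norm (f x))\<^sup>2)"

definition l2norm :: "'a measure \<Rightarrow> ('a \<Rightarrow> 'b::euclidean_space) \<Rightarrow> real" where
  "l2norm M f = sqrt (\<integral>x. (norm (f x))\<^sup>2 \<partial>M)"

lemma l2norm_nonneg [simp]: "0 \<le> l2norm M f"
  by (simp add: l2norm_def)

lemma l2norm_square: "(l2norm M f)\<^sup>2 = (\<integral>x. (norm (f x))\<^sup>2 \<partial>M)"
  by (simp add: l2norm_def)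

lemma sq_integrable_inner:
  assumes "sq_integrable M f" "sq_integrable M g"
  shows "integrable M (\<lambda>x. f x \<bullet> g x)" "integrable M (\<lambda>x. norm (f x) * norm (g x))"
proof -
  note [measurable] = assms[unfolded sq_integrable_def, THEN conjunct1]
  have dom: "integrable M (\<lambda>x. (norm (f x))\<^sup>2 + (norm (g x))\<^sup>2)"
    using assms by (auto simp: sq_integrable_def)
  have le: "norm (f x) * norm (g x) \<le> (norm (f x))\<^sup>2 + (norm (g x))\<^sup>2" for x
  proof -
    have "2 * norm (f x) * norm (g x) \<le> (norm (f x))\<^sup>2 + (norm (g x))\<^sup>2"
      by (rule sum_squares_bound)
    moreover have "0 \<le> norm (f x) * norm (g x)" by simp
    ultimately show ?thesis by linarith
  qed
  show "integrable M (\<lambda>x. norm (f x) * norm (g x))"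
    by (rule Bochner_Integration.integrable_bound[OF dom]) (simp_all add: le)
  show "integrable M (\<lambda>x. f x \<bullet> g x)"
  proof (rule Bochner_Integration.integrable_bound[OF dom])
    show "AE x in M. norm (f x \<bullet> g x) \<le> norm ((norm (f x))\<^sup>2 + (norm (g x))\<^sup>2)"
    proof (rule AE_I2)
      fix x
      have "\<bar>f x \<bullet> g x\<bar> \<le> norm (f x) * norm (g x)" by (rule Cauchy_Schwarz_ineq2)
      also have "\<dots> \<le> (norm (f x))\<^sup>2 + (norm (g x))\<^sup>2" by (rule le)
      finally show "norm (f x \<bullet> g x) \<le> norm ((norm (f x))\<^sup>2 + (norm (g x))\<^sup>2)" by simp
    qed
  qed measurable
qed

lemma sq_integrable_add [intro]:
  assumes "sq_integrable M f" "sq_integrable M g"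
  shows "sq_integrable M (\<lambda>x. f x + g x)"
proof -
  have "(norm (f x + g x))\<^sup>2 = (norm (f x))\<^sup>2 + 2 * (f x \<bullet> g x) + (norm (g x))\<^sup>2" for x
    by (simp add: power2_norm_eq_inner inner_add_left inner_add_right inner_commute)
  then show ?thesis
    using assms sq_integrable_inner[OF assms] by (auto simp: sq_integrable_def)
qed

lemma sq_integrable_scaleR [intro]:
  "sq_integrable M f \<Longrightarrow> sq_integrable M (\<lambda>x. c *\<^sub>R f x)"
  by (auto simp: sq_integrable_def power_mult_distrib)

lemma sq_integrable_cmult [intro]:
  fixes f :: "'a \<Rightarrow> real"
  shows "sq_integrable M f \<Longrightarrow> sq_integrable M (\<lambda>x. c * f x)"
  using sq_integrable_scaleR[of M f c] by simp

lemma sq_integrable_minus [intro]: "sq_integrable M f \<Longrightarrow> sq_integrable M (\<lambda>x. - f x)"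
  by (auto simp: sq_integrable_def)

lemma sq_integrable_diff [intro]:
  "sq_integrable M f \<Longrightarrow> sq_integrable M g \<Longrightarrow> sq_integrable M (\<lambda>x. f x - g x)"
  using sq_integrable_add[OF _ sq_integrable_minus, of M f g] by simp

lemma sq_integrable_zero [intro, simp]: "sq_integrable M (\<lambda>x. 0)"
  by (simp add: sq_integrable_def)

lemma sq_integrable_sum [intro]:
  "(\<And>k. k \<in> A \<Longrightarrow> sq_integrable M (f k)) \<Longrightarrow> sq_integrable M (\<lambda>x. \<Sum>k\<in>A. f k x)"
  by (induction A rule: infinite_finite_induct) auto

lemma sq_integrable_bound:
  assumes "sq_integrable M f" "g \<in> borel_measurable M" "AE x in M. norm (g x) \<le> c * norm (f x)"
  shows "sq_integrable M g"
proof -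
  have "integrable M (\<lambda>x. c\<^sup>2 * (norm (f x))\<^sup>2)"
    using assms by (simp add: sq_integrable_def)
  then have "integrable M (\<lambda>x. (norm (g x))\<^sup>2)"
  proof (rule Bochner_Integration.integrable_bound)
    show "(\<lambda>x. (norm (g x))\<^sup>2) \<in> borel_measurable M"
      using assms(2) by measurable
    show "AE x in M. norm ((norm (g x))\<^sup>2) \<le> norm (c\<^sup>2 * (norm (f x))\<^sup>2)"
      using assms(3) power_mono[of "norm (g x)" "c * norm (f x)" 2 for x]
      by (auto simp: power_mult_distrib)
  qed
  with assms show ?thesis by (simp add: sq_integrable_def)
qed

lemma l2norm_mono:
  assumes "sq_integrable M f" "g \<in> borel_measurable M" "AE x in M. norm (g x) \<le> c * norm (f x)" "c \<ge> 0"
  shows "l2norm M g \<le> c * l2norm M f"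
proof -
  have "sq_integrable M g"
    by (rule sq_integrable_bound[OF assms(1-3)])
  have "(\<integral>x. (norm (g x))\<^sup>2 \<partial>M) \<le> (\<integral>x. c\<^sup>2 * (norm (f x))\<^sup>2 \<partial>M)"
  proof (rule integral_mono_AE)
    show "AE x in M. (norm (g x))\<^sup>2 \<le> c\<^sup>2 * (norm (f x))\<^sup>2"
      using assms(3) power_mono[of "norm (g x)" "c * norm (f x)" 2 for x]
      by (auto simp: power_mult_distrib)
  qed (use assms \<open>sq_integrable M g\<close> in \<open>simp_all add: sq_integrable_def\<close>)
  then have "(l2norm M g)\<^sup>2 \<le> (c * l2norm M f)\<^sup>2"
    by (simp add: l2norm_square power_mult_distrib)
  then show ?thesis
    by (rule power2_le_imp_le) (use assms(4) in simp)
qed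

lemma l2norm_scaleR: "l2norm M (\<lambda>x. c *\<^sub>R f x) = \<bar>c\<bar> * l2norm M f"
  by (simp add: l2norm_def power_mult_distrib real_sqrt_mult)

lemma l2norm_cmult: "l2norm M (\<lambda>x. c * f x :: real) = \<bar>c\<bar> * l2norm M f"
  using l2norm_scaleR[of M c f] by simp

lemma l2norm_uminus [simp]: "l2norm M (\<lambda>x. - f x) = l2norm M f"
  by (simp add: l2norm_def)

lemma l2norm_minus_commute: "l2norm M (\<lambda>x. f x - g x) = l2norm M (\<lambda>x. g x - f x)"
  by (simp add: l2norm_def norm_minus_commute)

lemma integral_norm_mult_le:
  fixes f g :: "'a \<Rightarrow> 'b::euclidean_space"
  assumes "sq_integrable M f" "sq_integrable M g"
  shows "(\<integral>x. norm (f x) * norm (g x) \<partial>M) \<le> l2norm M f * l2norm M g"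
proof -
  define A where "A = (l2norm M f)\<^sup>2"
  define B where "B = (l2norm M g)\<^sup>2"
  define I where "I = (\<integral>x. norm (f x) * norm (g x) \<partial>M)"
  have I0: "I \<ge> 0" unfolding I_def by simp
  have quad: "0 \<le> t\<^sup>2 * A - 2 * t * s * I + s\<^sup>2 * B" for t s
  proof -
    have "0 \<le> (\<integral>x. (t * norm (f x) - s * norm (g x))\<^sup>2 \<partial>M)" by simp
    also have "\<dots> = (\<integral>x. t\<^sup>2 * (norm (f x))\<^sup>2 - 2 * t * s * (norm (f x) * norm (g x)) + s\<^sup>2 * (norm (g x))\<^sup>2 \<partial>M)"
      by (intro Bochner_Integration.integral_cong refl) (simp add: power2_eq_square algebra_simps)
    also have "\<dots> = t\<^sup>2 * A - 2 * t * s * I + s\<^sup>2 * B"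
      using assms sq_integrable_inner(2)[OF assms]
      by (simp add: sq_integrable_def A_def B_def I_def l2norm_square)
    finally show ?thesis .
  qed
  have AB: "A \<ge> 0" "B \<ge> 0" by (auto simp: A_def B_def)
  have "I\<^sup>2 \<le> A * B"
  proof (cases "A = 0")
    case True
    have "I = 0"
    proof (rule ccontr)
      assume "I \<noteq> 0"
      with I0 have "I > 0" by simp
      \<comment> \<open>For \<open>A = 0\<close> and \<open>s = 1\<close> the form is affine in
        \<open>t\<close> and takes the value -1 here.\<close>
      with quad[of "(B + 1) / (2 * I)" 1] True show False by simp
    qed
    with True show ?thesis by simp
  next
    case False
    with AB have "A > 0" by simp
    \<comment> \<open>The choice \<open>t = I\<close>, \<open>s = A\<close> is the discriminant
      argument without division.\<close>
    have "0 \<le> A * (A * B - I\<^sup>2)"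
      using quad[of I A] by (simp add: power2_eq_square algebra_simps)
    with \<open>A > 0\<close> show ?thesis by (simp add: zero_le_mult_iff)
  qed
  then have "I\<^sup>2 \<le> (l2norm M f * l2norm M g)\<^sup>2"
    by (simp add: A_def B_def power_mult_distrib)
  then show ?thesis
    unfolding I_def by (rule power2_le_imp_le) simp
qed

lemma abs_integral_inner_le:
  assumes "sq_integrable M f" "sq_integrable M g"
  shows "\<bar>\<integral>x. f x \<bullet> g x \<partial>M\<bar> \<le> l2norm M f * l2norm M g"
proof -
  have "\<bar>\<integral>x. f x \<bullet> g x \<partial>M\<bar> \<le> (\<integral>x. \<bar>f x \<bullet> g x\<bar> \<partial>M)"
    by (rule integral_abs_bound)
  also have "\<dots> \<le> (\<integral>x. norm (f x) * norm (g x) \<partial>M)"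
    using sq_integrable_inner[OF assms] by (intro integral_mono) (auto simp: Cauchy_Schwarz_ineq2)
  finally show ?thesis
    using integral_norm_mult_le[OF assms] by linarith
qed

lemma l2norm_triangle:
  assumes "sq_integrable M f" "sq_integrable M g"
  shows "l2norm M (\<lambda>x. f x + g x) \<le> l2norm M f + l2norm M g"
proof -
  have "(l2norm M (\<lambda>x. f x + g x))\<^sup>2 = (\<integral>x. (norm (f x))\<^sup>2 + 2 * (f x \<bullet> g x) + (norm (g x))\<^sup>2 \<partial>M)"
    unfolding l2norm_square
    by (intro Bochner_Integration.integral_cong refl)
      (simp add: power2_norm_eq_inner inner_add_left inner_add_right inner_commute)
  also have "\<dots> = (l2norm M f)\<^sup>2 + 2 * (\<integral>x. f x \<bullet> g x \<partial>M) + (l2norm M g)\<^sup>2"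
    using assms sq_integrable_inner[OF assms] by (simp add: sq_integrable_def l2norm_square)
  also have "\<dots> \<le> (l2norm M f)\<^sup>2 + 2 * (l2norm M f * l2norm M g) + (l2norm M g)\<^sup>2"
    using abs_integral_inner_le[OF assms] by linarith
  also have "\<dots> = (l2norm M f + l2norm M g)\<^sup>2"
    by (simp add: power2_sum)
  finally show ?thesis
    by (rule power2_le_imp_le) simp
qed

lemma l2norm_triangle_diff:
  assumes "sq_integrable M f" "sq_integrable M g" "sq_integrable M h"
  shows "l2norm M (\<lambda>x. f x - h x) \<le> l2norm M (\<lambda>x. f x - g x) + l2norm M (\<lambda>x. g x - h x)"
  using l2norm_triangle[of M "\<lambda>x. f x - g x" "\<lambda>x. g x - h x"] assms by auto

lemma l2norm_le_add_diff:
  assumes "sq_integrable M f" "sq_integrable M g"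
  shows "l2norm M f \<le> l2norm M g + l2norm M (\<lambda>x. f x - g x)"
  using l2norm_triangle[of M g "\<lambda>x. f x - g x"] assms by auto

text \<open>If \<open>S\<close> has dense range, then so has every \<open>T\<close> that is close to \<open>S\<close> relative to \<open>S\<close>:
  solve with \<open>S\<close> and iterate on the residual.\<close>

lemma dense_range_perturbation:
  fixes S T :: "('v \<Rightarrow> real) \<Rightarrow> 'a \<Rightarrow> real"
  assumes Y: "\<And>f. f \<in> Y \<Longrightarrow> sq_integrable M f"
    and Ydiff: "\<And>f g. f \<in> Y \<Longrightarrow> g \<in> Y \<Longrightarrow> (\<lambda>x. f x - g x) \<in> Y"
    and TY: "\<And>v. v \<in> X \<Longrightarrow> T v \<in> Y"
    and S: "\<And>v. v \<in> X \<Longrightarrow> sq_integrable M (S v)"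
    and Xadd: "\<And>u v. u \<in> X \<Longrightarrow> v \<in> X \<Longrightarrow> (\<lambda>x. u x + v x) \<in> X"
    and Tadd: "\<And>u v x. u \<in> X \<Longrightarrow> v \<in> X \<Longrightarrow> T (\<lambda>x. u x + v x) x = T u x + T v x"
    and dense: "\<And>f e. f \<in> Y \<Longrightarrow> e > 0 \<Longrightarrow> \<exists>v\<in>X. l2norm M (\<lambda>x. S v x - f x) < e"
    and \<theta>: "0 \<le> \<theta>" "\<theta> < 1"
    and close: "\<And>v. v \<in> X \<Longrightarrow> l2norm M (\<lambda>x. T v x - S v x) \<le> \<theta> * l2norm M (S v)"
    and f: "f \<in> Y" and e: "e > 0"
  shows "\<exists>v\<in>X. l2norm M (\<lambda>x. T v x - f x) < e"
proof -
  \<comment> \<open>A rate strictly between \<theta> and 1; the gap to \<theta> pays for solving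
    with \<open>S\<close> only approximately.\<close>
  define q where "q = (1 + \<theta>) / 2"
  have q: "0 \<le> q" "q < 1" using \<theta> by (auto simp: q_def)
  obtain v0 where v0: "v0 \<in> X" using dense[OF f zero_less_one] by auto
  define C where "C = l2norm M (\<lambda>x. f x - T v0 x)"
  have step: "\<exists>v\<in>X. l2norm M (\<lambda>x. f x - T v x) \<le> q ^ n * C" for n
  proof (induction n)
    case 0
    show ?case using v0 by (auto simp: C_def)
  next
    case (Suc n)
    then obtain v where v: "v \<in> X" "l2norm M (\<lambda>x. f x - T v x) \<le> q ^ n * C" by auto
    define r where "r = (\<lambda>x. f x - T v x)"
    have rY: "r \<in> Y" unfolding r_def by (intro Ydiff f TY v)
    show ?case
    \<comment> \<open>A vanishing residual leaves no room for the relative tolerance \<eta>; the old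
      \<open>v\<close> is kept.\<close>
    proof (cases "l2norm M r = 0")
      case True
      have "C \<ge> 0" by (simp add: C_def)
      with True v q show ?thesis by (intro bexI[of _ v]) (auto simp: r_def)
    next
      case False
      \<comment> \<open>Chosen so that \<open>\<theta> * l2norm M r + 2 * \<eta>\<close> is exactly
        \<open>q * l2norm M r\<close>; one \<eta> is the defect of \<open>S v'\<close>, the other
        covers the excess of its norm over that of \<open>r\<close>.\<close>
      define \<eta> where "\<eta> = (1 - \<theta>) / 4 * l2norm M r"
      have "\<eta> > 0" using False \<theta> by (simp add: \<eta>_def order_less_le)
      then obtain v' where v': "v' \<in> X" "l2norm M (\<lambda>x. S v' x - r x) < \<eta>"
        using dense[OF rY] by blast
      note sq = Y[OF rY] S[OF v'(1)] Y[OF TY[OF v'(1)]]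
      have "l2norm M (S v') \<le> l2norm M r + \<eta>"
        using l2norm_le_add_diff[OF sq(2) sq(1)] v'(2) by linarith
      then have "\<theta> * l2norm M (S v') \<le> \<theta> * (l2norm M r + \<eta>)"
        using \<theta> by (intro mult_left_mono) auto
      moreover have "\<theta> * \<eta> \<le> \<eta>"
        using \<theta> \<open>\<eta> > 0\<close> by (simp add: mult_left_le_one_le)
      ultimately have "l2norm M (\<lambda>x. T v' x - S v' x) \<le> \<theta> * l2norm M r + \<eta>"
        using close[OF v'(1)] by (simp add: algebra_simps)
      with l2norm_triangle_diff[OF sq(3) sq(2) sq(1)] v'(2)
      have "l2norm M (\<lambda>x. T v' x - r x) \<le> \<theta> * l2norm M r + 2 * \<eta>" by linarith
      also have "\<dots> = q * l2norm M r" by (simp add: \<eta>_def q_def field_simps)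
      also have "\<dots> \<le> q * (q ^ n * C)" using v(2) q by (intro mult_left_mono) (auto simp: r_def)
      finally have "l2norm M (\<lambda>x. r x - T v' x) \<le> q ^ Suc n * C"
        by (simp add: l2norm_minus_commute[of M r])
      moreover have "r x - T v' x = f x - T (\<lambda>x. v x + v' x) x" for x
        using Tadd[OF v(1) v'(1)] by (simp add: r_def)
      ultimately show ?thesis
        using Xadd[OF v(1) v'(1)] by (intro bexI[of _ "\<lambda>x. v x + v' x"]) auto
    qed
  qed
  have "(\<lambda>n. q ^ n * C) \<longlonglongrightarrow> 0 * C"
    using q by (intro tendsto_intros LIMSEQ_realpow_zero) auto
  then have "\<forall>\<^sub>F n in sequentially. q ^ n * C < e"
    using e by (intro order_tendstoD(2)) auto
  then obtain n where "q ^ n * C < e"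
    by (auto simp: eventually_sequentially)
  moreover obtain v where "v \<in> X" "l2norm M (\<lambda>x. f x - T v x) \<le> q ^ n * C"
    using step by blast
  ultimately show ?thesis
    by (intro bexI[of _ v]) (auto simp: l2norm_minus_commute[of M "T v"])
qed

section \<open>Operators satisfying the Cordes condition\<close>

definition hess :: "(real^'n \<Rightarrow> real) \<Rightarrow> real^'n \<Rightarrow> real^'n^'n" where
  "hess u x = (\<chi> i j. partial i (partial j u) x)"

lemma norm_hess: "(norm (hess u x))\<^sup>2 = (\<Sum>i\<in>UNIV. \<Sum>j\<in>UNIV. (partial i (partial j u) x)\<^sup>2)"
  by (simp add: norm_matrix_Frobenius hess_def sum_nonneg)

lemma mat_inner_hess: "mat 1 \<bullet> hess u x = laplacian u x"
  by (simp add: inner_matrix_Frobenius hess_def laplacian_def mat_def mult_delta_left)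

lemma hess_add:
  assumes "smooth u" "smooth v"
  shows "hess (\<lambda>x. u x + v x) x = hess u x + hess v x"
  using assms by (simp add: hess_def vec_eq_iff partial_add smooth_partial)

lemma hess_cmult:
  assumes "smooth u"
  shows "hess (\<lambda>x. c * u x) x = c *\<^sub>R hess u x"
  using assms by (simp add: hess_def vec_eq_iff partial_cmult smooth_partial)

lemma laplacian_add:
  assumes "smooth u" "smooth v"
  shows "laplacian (\<lambda>x. u x + v x) x = laplacian u x + laplacian v x"
  using hess_add[OF assms, of x] by (simp add: mat_inner_hess[symmetric] inner_add_right)

lemma laplacian_cmult:
  assumes "smooth u"
  shows "laplacian (\<lambda>x. c * u x) x = c * laplacian u x"
  using hess_cmult[OF assms, of c x] by (simp add: mat_inner_hess[symmetric])

lemma continuous_hess: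
  assumes "smooth u"
  shows "continuous_on A (hess u)"
  unfolding hess_def by (intro continuous_on_vec_lambda smooth_continuous smooth_partial assms)

definition neg :: "(real^'n \<Rightarrow> real) \<Rightarrow> real^'n \<Rightarrow> real" where
  "neg u x = max 0 (- u x)"

definition smooth_matrix :: "(real^'n \<Rightarrow> real^'n^'n) \<Rightarrow> bool" where
  "smooth_matrix b \<longleftrightarrow> (\<forall>i j. smooth (\<lambda>x. b x $ i $ j))"

lemma continuous_smooth_matrix:
  assumes "smooth_matrix b"
  shows "continuous_on A b"
proof -
  have "continuous_on A (\<lambda>x. \<chi> i j. b x $ i $ j)"
    using assms unfolding smooth_matrix_def
    by (intro continuous_on_vec_lambda smooth_continuous) auto
  then show ?thesis by simp
qed

definition elliptic_op :: "(real^'n \<Rightarrow> real^'n^'n) \<Rightarrow> real \<Rightarrow> (real^'n \<Rightarrow> real) \<Rightarrow> real^'n \<Rightarrow> real" where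
  "elliptic_op b \<mu> u x = - (b x \<bullet> hess u x) + \<mu> * u x"

lemma elliptic_op_add:
  assumes "smooth u" "smooth v"
  shows "elliptic_op b \<mu> (\<lambda>x. u x + v x) x = elliptic_op b \<mu> u x + elliptic_op b \<mu> v x"
  by (simp add: elliptic_op_def hess_add[OF assms] inner_add_right algebra_simps)

lemma continuous_elliptic_op:
  assumes "smooth u" "continuous_on A b"
  shows "continuous_on A (elliptic_op b \<mu> u)"
  unfolding elliptic_op_def[abs_def]
  by (intro continuous_intros continuous_hess smooth_continuous assms)

text \<open>The tensor square of \<xi> has Frobenius norm |\<xi>|^2, so Cauchy--Schwarz in the
  Frobenius product bounds the form of \<open>b - mat 1\<close> by \<rho> |\<xi>|^2.\<close>

lemma elliptic_coercive:
  fixes b :: "real^'n^'n" and \<xi> :: "'n \<Rightarrow> real"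
  assumes "norm (b - mat 1) \<le> \<rho>"
  shows "(1 - \<rho>) * (\<Sum>i\<in>UNIV. (\<xi> i)\<^sup>2) \<le> (\<Sum>i\<in>UNIV. \<Sum>j\<in>UNIV. b $ i $ j * \<xi> i * \<xi> j)"
proof -
  define O' :: "real^'n^'n" where "O' = (\<chi> i j. \<xi> i * \<xi> j)"
  let ?s = "\<Sum>i\<in>UNIV. (\<xi> i)\<^sup>2"
  have "(norm O')\<^sup>2 = ?s\<^sup>2"
    unfolding power2_eq_square[of ?s] sum_product
    by (simp add: norm_matrix_Frobenius O'_def sum_nonneg power_mult_distrib)
  then have n: "norm O' = ?s"
    by (simp add: power2_eq_iff_nonneg sum_nonneg)
  have "b \<bullet> O' = (\<Sum>i\<in>UNIV. \<Sum>j\<in>UNIV. b $ i $ j * \<xi> i * \<xi> j)"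
    by (simp add: inner_matrix_Frobenius O'_def mult.assoc)
  moreover have "mat 1 \<bullet> O' = ?s"
    by (simp add: inner_matrix_Frobenius O'_def mat_def mult_delta_left power2_eq_square)
  moreover have "\<bar>(b - mat 1) \<bullet> O'\<bar> \<le> \<rho> * ?s"
    using Cauchy_Schwarz_ineq2[of "b - mat 1" O'] assms mult_right_mono[OF assms, of "norm O'"]
    unfolding n by (simp add: sum_nonneg)
  ultimately show ?thesis
    by (simp add: inner_diff_left algebra_simps abs_le_iff)
qed

lemma psi_0_le_1: "psi 0 t \<le> 1"
  by (simp add: psi_def)

section \<open>Negative parts for large \<mu>\<close>

context smooth_domain
begin

lemma sq_integrable_U:
  fixes f :: "real^'n \<Rightarrow> 'b::euclidean_space"
  assumes "continuous_on UNIV f"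
  shows "sq_integrable (lebesgue_on U) f"
  unfolding sq_integrable_def
  by (intro conjI borel_measurable_integrable integrable_U continuous_intros assms)

lemma continuous_neg: "continuous_on A f \<Longrightarrow> continuous_on A (neg f)"
  unfolding neg_def[abs_def] by (intro continuous_intros)

lemma l2norm_mono_U:
  fixes f :: "real^'n \<Rightarrow> 'b::euclidean_space" and g :: "real^'n \<Rightarrow> 'c::euclidean_space"
  assumes "continuous_on UNIV f" "continuous_on UNIV g" "c \<ge> 0"
    and "\<And>x. w x > 0 \<Longrightarrow> norm (g x) \<le> c * norm (f x)"
  shows "l2norm (lebesgue_on U) g \<le> c * l2norm (lebesgue_on U) f"
  using assms by (intro l2norm_mono sq_integrable_U borel_measurable_integrable integrable_U AE_U)

text \<open>Testing with \<open>\<zeta>(u) = u exp(\<delta>/u)\<close> for \<open>u < 0\<close>, a smooth approximation of the negative part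
  that vanishes wherever \<open>w\<close> does.\<close>

lemma negative_part_test:
  assumes h: "smooth h" and u: "u = (\<lambda>x. w x * h x)" and b: "smooth_matrix b" and \<delta>: "\<delta> > 0"
    and ell: "\<And>x. w x > 0 \<Longrightarrow> norm (b x - mat 1) \<le> \<rho>" and \<rho>: "\<rho> < 1"
    and B: "\<And>x. w x > 0 \<Longrightarrow> (\<Sum>j\<in>UNIV. (\<Sum>i\<in>UNIV. partial i (\<lambda>x. b x $ i $ j) x)\<^sup>2) \<le> B"
    and \<mu>: "\<mu> \<ge> B / (4 * (1 - \<rho>)) + 1"
  shows "(\<integral>x. psi 0 (- u x / \<delta>) * (u x)\<^sup>2 \<partial>lebesgue_on U)
    \<le> (\<integral>x. neg u x * neg (elliptic_op b \<mu> u) x \<partial>lebesgue_on U)"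
proof -
  have su: "smooth u" unfolding u using h smooth_w by (intro smooth_intros)
  have sb: "smooth (\<lambda>x. b x $ i $ j)" for i j using b by (simp add: smooth_matrix_def)
  \<comment> \<open>Writing the test function \<open>z\<close> as \<open>w\<close> times the smooth
    function \<open>H\<close> makes it admissible for integration by parts.\<close>
  define H where "H = (\<lambda>x. h x * psi 0 (- u x / \<delta>))"
  have sH: "smooth H" unfolding H_def by (intro smooth_intros h su)
  define z where "z = (\<lambda>x. u x * psi 0 (- u x / \<delta>))"
  have z: "z = (\<lambda>x. w x * H x)" by (simp add: z_def H_def u mult.assoc)
  have sz: "smooth z" unfolding z_def by (intro smooth_intros su)
  \<comment> \<open>The derivative of the test nonlinearity at \<open>u\<close>; for
    \<open>u x < 0\<close> its second summand only enlarges it and is dropped later.\<close>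
  define Z where "Z = (\<lambda>x. psi 0 (- u x / \<delta>) - u x * psi 2 (- u x / \<delta>) / \<delta>)"
  have sZ: "smooth Z" unfolding Z_def by (intro smooth_intros su)
  have pz: "partial i z = (\<lambda>x. Z x * partial i u x)" for i
  proof -
    have "((\<lambda>s. s * psi 0 (- s / \<delta>)) has_real_derivative
        (psi 0 (- s / \<delta>) - s * psi 2 (- s / \<delta>) / \<delta>)) (at s)" for s
    proof -
      have "((\<lambda>s. psi 0 (- s / \<delta>)) has_real_derivative psi 2 (- s / \<delta>) * (- 1 / \<delta>)) (at s)"
        using DERIV_psi[of 0 "- s / \<delta>"]
        by (intro DERIV_chain2[where f="psi 0" and g="\<lambda>s. - s / \<delta>"])
          (auto intro!: derivative_eq_intros simp: numeral_2_eq_2 divide_inverse)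
      from DERIV_mult[OF DERIV_ident this] show ?thesis
        by (simp add: algebra_simps)
    qed
    from partial_chain[OF su this] show ?thesis
      by (simp add: z_def Z_def)
  qed
  \<comment> \<open>The divergence of \<open>b\<close>, column by column: the drift created when the
    operator is put into divergence form.\<close>
  define \<beta> where "\<beta> j = (\<lambda>x. \<Sum>i\<in>UNIV. partial i (\<lambda>x. b x $ i $ j) x)" for j
  have s\<beta>: "smooth (\<beta> j)" for j unfolding \<beta>_def by (intro smooth_intros sb)
  let ?M = "lebesgue_on U"
  let ?bD = "\<lambda>x. \<Sum>i\<in>UNIV. \<Sum>j\<in>UNIV. b x $ i $ j * partial i (partial j u) x"
  have bh: "?bD x = b x \<bullet> hess u x" for x
    by (simp add: inner_matrix_Frobenius hess_def)
  have "(\<integral>x. Z x * (\<Sum>i\<in>UNIV. \<Sum>j\<in>UNIV. b x $ i $ j * partial i u x * partial j u x) \<partial>?M)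
      = (\<integral>x. (\<Sum>i\<in>UNIV. \<Sum>j\<in>UNIV. partial i z x * (b x $ i $ j * partial j u x)) \<partial>?M)"
    by (intro Bochner_Integration.integral_cong refl) (simp add: pz sum_distrib_left mult_ac)
  also have "\<dots> = (\<Sum>i\<in>UNIV. \<Sum>j\<in>UNIV. \<integral>x. partial i z x * (b x $ i $ j * partial j u x) \<partial>?M)"
    by (subst Bochner_Integration.integral_sum, (intro integrable_smooth smooth_intros sz sb su)[1])
      (intro sum.cong refl Bochner_Integration.integral_sum integrable_smooth smooth_intros sz sb su)
  also have "\<dots> = (\<Sum>i\<in>UNIV. \<Sum>j\<in>UNIV. - (\<integral>x. z x * partial i (\<lambda>x. b x $ i $ j * partial j u x) x \<partial>?M))"
    unfolding z by (intro sum.cong refl integral_by_parts sH smooth_intros sb su)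
  also have "\<dots> = - (\<Sum>i\<in>UNIV. \<Sum>j\<in>UNIV. \<integral>x. z x * partial i (\<lambda>x. b x $ i $ j * partial j u x) x \<partial>?M)"
    by (simp add: sum_negf)
  also have "(\<Sum>i\<in>UNIV. \<Sum>j\<in>UNIV. \<integral>x. z x * partial i (\<lambda>x. b x $ i $ j * partial j u x) x \<partial>?M)
      = (\<integral>x. (\<Sum>i\<in>UNIV. \<Sum>j\<in>UNIV. z x * partial i (\<lambda>x. b x $ i $ j * partial j u x) x) \<partial>?M)"
    by (subst Bochner_Integration.integral_sum, (intro integrable_smooth smooth_intros sz sb su)[1])
      (intro sum.cong refl Bochner_Integration.integral_sum[symmetric] integrable_smooth smooth_intros sz sb su)
  also have "\<dots> = (\<integral>x. z x * (?bD x + (\<Sum>j\<in>UNIV. \<beta> j x * partial j u x)) \<partial>?M)"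
  proof (intro Bochner_Integration.integral_cong refl)
    fix x
    have "(\<Sum>i\<in>UNIV. \<Sum>j\<in>UNIV. z x * partial i (\<lambda>x. b x $ i $ j * partial j u x) x)
        = z x * (?bD x + (\<Sum>i\<in>UNIV. \<Sum>j\<in>UNIV. partial i (\<lambda>x. b x $ i $ j) x * partial j u x))"
      by (simp add: partial_mult sb su smooth_partial sum_distrib_left sum.distrib distrib_left)
    also have "(\<Sum>i\<in>UNIV. \<Sum>j\<in>UNIV. partial i (\<lambda>x. b x $ i $ j) x * partial j u x)
        = (\<Sum>j\<in>UNIV. \<beta> j x * partial j u x)"
      unfolding \<beta>_def sum_distrib_right by (rule sum.swap)
    finally show "(\<Sum>i\<in>UNIV. \<Sum>j\<in>UNIV. z x * partial i (\<lambda>x. b x $ i $ j * partial j u x) x)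
        = z x * (?bD x + (\<Sum>j\<in>UNIV. \<beta> j x * partial j u x))" .
  qed
  finally have key: "(\<integral>x. Z x * (\<Sum>i\<in>UNIV. \<Sum>j\<in>UNIV. b x $ i $ j * partial i u x * partial j u x) \<partial>?M)
      = - (\<integral>x. z x * (?bD x + (\<Sum>j\<in>UNIV. \<beta> j x * partial j u x)) \<partial>?M)" .
  have "(\<integral>x. psi 0 (- u x / \<delta>) * (u x)\<^sup>2 \<partial>?M)
      \<le> (\<integral>x. Z x * (\<Sum>i\<in>UNIV. \<Sum>j\<in>UNIV. b x $ i $ j * partial i u x * partial j u x)
        + (z x * (\<Sum>j\<in>UNIV. \<beta> j x * partial j u x) + \<mu> * (z x * u x)) \<partial>?M)"
  proof (intro integral_mono_U smooth_continuous smooth_intros su sZ sb sz s\<beta> \<delta>)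
    fix x assume x: "0 < w x"
    let ?G = "\<Sum>i\<in>UNIV. (partial i u x)\<^sup>2"
    let ?b = "\<Sum>i\<in>UNIV. \<Sum>j\<in>UNIV. b x $ i $ j * partial i u x * partial j u x"
    let ?d = "\<Sum>j\<in>UNIV. \<beta> j x * partial j u x"
    show "psi 0 (- u x / \<delta>) * (u x)\<^sup>2 \<le> Z x * ?b + (z x * ?d + \<mu> * (z x * u x))"
    proof (cases "u x < 0")
      case False
      then have "- u x / \<delta> \<le> 0" using \<delta> by simp
      then show ?thesis by (simp add: Z_def z_def)
    next
      case True
      define E where "E = psi 0 (- u x / \<delta>)"
      have E: "E \<ge> 0" by (simp add: E_def psi_nonneg)
      define \<nu> where "\<nu> = 1 - \<rho>"
      have \<nu>: "\<nu> > 0" using \<rho> by (simp add: \<nu>_def)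
      have coer: "\<nu> * ?G \<le> ?b"
        unfolding \<nu>_def by (rule elliptic_coercive[OF ell[OF x]])
      have "u x * psi 2 (- u x / \<delta>) / \<delta> \<le> 0"
        using True \<delta> psi_nonneg[of 2 "- u x / \<delta>"] by (simp add: divide_nonpos_pos mult_nonpos_nonneg)
      then have ZE: "Z x \<ge> E" by (simp add: Z_def E_def)
      have "0 \<le> \<nu> * ?G" using \<nu> by (intro mult_nonneg_nonneg sum_nonneg) auto
      with coer have "0 \<le> ?b" by linarith
      then have 1: "Z x * ?b \<ge> E * (\<nu> * ?G)"
        using ZE E coer \<open>0 \<le> \<nu> * ?G\<close> by (intro mult_mono) auto
      have zx: "z x = E * u x" by (simp add: z_def E_def)
      \<comment> \<open>Completing the square absorbs the drift into the coercive term at the cost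
        of \<open>B / (4 \<nu>)\<close> times \<open>u^2\<close>; the threshold for \<mu> exceeds
        this by 1.\<close>
      have "0 \<le> (\<Sum>j\<in>UNIV. (2 * \<nu> * partial j u x + u x * \<beta> j x)\<^sup>2)"
        by (intro sum_nonneg) auto
      also have "\<dots> = 4 * \<nu>\<^sup>2 * ?G + 4 * \<nu> * u x * ?d + (u x)\<^sup>2 * (\<Sum>j\<in>UNIV. (\<beta> j x)\<^sup>2)"
        by (simp add: power2_sum power_mult_distrib sum.distrib sum_distrib_left mult_ac)
      also have "(u x)\<^sup>2 * (\<Sum>j\<in>UNIV. (\<beta> j x)\<^sup>2) \<le> (u x)\<^sup>2 * B"
        using B[OF x] unfolding \<beta>_def by (intro mult_left_mono) auto
      also have "4 * \<nu>\<^sup>2 * ?G + 4 * \<nu> * u x * ?d + (u x)\<^sup>2 * B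
          = (4 * \<nu>) * (\<nu> * ?G + u x * ?d + B / (4 * \<nu>) * (u x)\<^sup>2)"
        using \<nu> by (simp add: distrib_left power2_eq_square)
      finally have "0 \<le> (4 * \<nu>) * (\<nu> * ?G + u x * ?d + B / (4 * \<nu>) * (u x)\<^sup>2)"
        by simp
      then have 2: "0 \<le> \<nu> * ?G + u x * ?d + B / (4 * \<nu>) * (u x)\<^sup>2"
        using \<nu> by (simp add: zero_le_mult_iff)
      have "(B / (4 * \<nu>) + 1) * (u x)\<^sup>2 \<le> \<mu> * (u x)\<^sup>2"
        using \<mu> by (intro mult_right_mono) (auto simp: \<nu>_def)
      with 2 have "(u x)\<^sup>2 \<le> \<nu> * ?G + u x * ?d + \<mu> * (u x)\<^sup>2"
        by (simp add: algebra_simps)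
      then have "E * (u x)\<^sup>2 \<le> E * (\<nu> * ?G + u x * ?d + \<mu> * (u x)\<^sup>2)"
        using E by (rule mult_left_mono)
      also have "\<dots> = E * (\<nu> * ?G) + (z x * ?d + \<mu> * (z x * u x))"
        by (simp add: zx algebra_simps power2_eq_square)
      also have "\<dots> \<le> Z x * ?b + (z x * ?d + \<mu> * (z x * u x))"
        using 1 by simp
      finally show ?thesis by (simp add: E_def)
    qed
  qed
  also have "\<dots> = (\<integral>x. Z x * (\<Sum>i\<in>UNIV. \<Sum>j\<in>UNIV. b x $ i $ j * partial i u x * partial j u x) \<partial>?M)
        + (\<integral>x. z x * (\<Sum>j\<in>UNIV. \<beta> j x * partial j u x) + \<mu> * (z x * u x) \<partial>?M)"
    by (intro Bochner_Integration.integral_add integrable_smooth smooth_intros su sZ sb sz s\<beta>)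
  also have "\<dots> = (\<integral>x. z x * (\<Sum>j\<in>UNIV. \<beta> j x * partial j u x) + \<mu> * (z x * u x) \<partial>?M)
      - (\<integral>x. z x * (?bD x + (\<Sum>j\<in>UNIV. \<beta> j x * partial j u x)) \<partial>?M)"
    unfolding key by simp
  also have "\<dots> = (\<integral>x. (z x * (\<Sum>j\<in>UNIV. \<beta> j x * partial j u x) + \<mu> * (z x * u x))
      - z x * (?bD x + (\<Sum>j\<in>UNIV. \<beta> j x * partial j u x)) \<partial>?M)"
    by (intro Bochner_Integration.integral_diff[symmetric] integrable_smooth smooth_intros su sb sz s\<beta>)
  also have "\<dots> = (\<integral>x. z x * elliptic_op b \<mu> u x \<partial>?M)"
    unfolding bh by (intro Bochner_Integration.integral_cong refl) (simp add: elliptic_op_def algebra_simps)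
  also have "\<dots> \<le> (\<integral>x. neg u x * neg (elliptic_op b \<mu> u) x \<partial>?M)"
  proof (intro integral_mono_U continuous_on_mult continuous_neg continuous_elliptic_op
      continuous_smooth_matrix smooth_continuous su sz b)
    fix x
    let ?g = "elliptic_op b \<mu> u x"
    have "z x \<le> 0 \<and> - z x \<le> neg u x"
    proof (cases "u x < 0")
      case True
      have "psi 0 (- u x / \<delta>) \<le> 1" "psi 0 (- u x / \<delta>) \<ge> 0"
        by (rule psi_0_le_1, rule psi_nonneg)
      then have "u x * 1 \<le> u x * psi 0 (- u x / \<delta>)" "u x * psi 0 (- u x / \<delta>) \<le> 0"
        using True by (auto intro: mult_left_mono_neg simp: mult_nonpos_nonneg)
      with True show ?thesis
        by (simp add: z_def neg_def)
    next
      case False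
      then have "- u x / \<delta> \<le> 0" using \<delta> by simp
      with False show ?thesis by (simp add: z_def neg_def)
    qed
    moreover have "z x * ?g \<le> - z x * neg (elliptic_op b \<mu> u) x"
    proof (cases "?g \<ge> 0")
      case True
      then show ?thesis using calculation by (simp add: neg_def mult_nonpos_nonneg)
    qed (simp add: neg_def)
    moreover have "neg (elliptic_op b \<mu> u) x \<ge> 0" by (simp add: neg_def)
    ultimately show "z x * ?g \<le> neg u x * neg (elliptic_op b \<mu> u) x"
      by (meson mult_right_mono order_trans)
  qed
  finally show ?thesis .
qed

text \<open>As \<delta> tends to 0 the test bounds the squared norm of \<open>neg u\<close> by the
  integral of \<open>neg u\<close> times the negative part of the right-hand side; Cauchy--Schwarz
  and cancelling one factor finish. The constant 1 reflects the surplus in the bound for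
  \<mu>.\<close>

lemma negative_part_large:
  assumes h: "smooth h" and u: "u = (\<lambda>x. w x * h x)" and b: "smooth_matrix b"
    and ell: "\<And>x. w x > 0 \<Longrightarrow> norm (b x - mat 1) \<le> \<rho>" and \<rho>: "\<rho> < 1"
    and B: "\<And>x. w x > 0 \<Longrightarrow> (\<Sum>j\<in>UNIV. (\<Sum>i\<in>UNIV. partial i (\<lambda>x. b x $ i $ j) x)\<^sup>2) \<le> B"
    and \<mu>: "\<mu> \<ge> B / (4 * (1 - \<rho>)) + 1"
  shows "l2norm (lebesgue_on U) (neg u) \<le> l2norm (lebesgue_on U) (neg (elliptic_op b \<mu> u))"
proof -
  let ?M = "lebesgue_on U"
  have su: "smooth u" unfolding u using h smooth_w by (intro smooth_intros)
  let ?g = "neg (elliptic_op b \<mu> u)"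
  have cont: "continuous_on UNIV (neg u)" "continuous_on UNIV ?g"
    by (intro continuous_neg continuous_elliptic_op continuous_smooth_matrix smooth_continuous su b)+
  define \<delta> where "\<delta> n = inverse (real (Suc n))" for n
  have \<delta>: "\<delta> n > 0" for n by (simp add: \<delta>_def)
  have "(\<lambda>n. \<integral>x. psi 0 (- u x / \<delta> n) * (u x)\<^sup>2 \<partial>?M) \<longlonglongrightarrow> (\<integral>x. (neg u x)\<^sup>2 \<partial>?M)"
  proof (rule integral_dominated_convergence[where w="\<lambda>x. (u x)\<^sup>2"])
    show "AE x in ?M. (\<lambda>n. psi 0 (- u x / \<delta> n) * (u x)\<^sup>2) \<longlonglongrightarrow> (neg u x)\<^sup>2"
    proof (rule AE_U)
      fix x
      show "(\<lambda>n. psi 0 (- u x / \<delta> n) * (u x)\<^sup>2) \<longlonglongrightarrow> (neg u x)\<^sup>2"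
      proof (cases "u x < 0")
        case True
        have "(\<lambda>n. exp (- (1 / (- u x * (1 + real n))))) \<longlonglongrightarrow> 1"
          using True by real_asymp
        moreover have "exp (- (1 / (- u x * (1 + real n)))) = psi 0 (- u x / \<delta> n)" for n
          using True by (simp add: psi_def \<delta>_def divide_inverse mult_neg_pos)
        ultimately have "(\<lambda>n. psi 0 (- u x / \<delta> n)) \<longlonglongrightarrow> 1" by simp
        then have "(\<lambda>n. psi 0 (- u x / \<delta> n) * (u x)\<^sup>2) \<longlonglongrightarrow> 1 * (u x)\<^sup>2"
          by (intro tendsto_intros)
        with True show ?thesis by (simp add: neg_def)
      next
        case False
        then have "- u x / \<delta> n \<le> 0" for n using \<delta>[of n] by simp
        with False show ?thesis by (simp add: neg_def)
      qed
    qed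
    show "AE x in ?M. norm (psi 0 (- u x / \<delta> n) * (u x)\<^sup>2) \<le> (u x)\<^sup>2" for n
      by (intro AE_U) (auto simp: psi_nonneg psi_0_le_1 abs_mult intro!: mult_left_le_one_le)
  qed (intro borel_measurable_integrable integrable_U continuous_on_power cont integrable_smooth
      smooth_intros su)+
  moreover have "(\<integral>x. psi 0 (- u x / \<delta> n) * (u x)\<^sup>2 \<partial>?M) \<le> (\<integral>x. neg u x * ?g x \<partial>?M)" for n
    by (rule negative_part_test[OF h u b \<delta> ell \<rho> B \<mu>])
  ultimately have "(\<integral>x. (neg u x)\<^sup>2 \<partial>?M) \<le> (\<integral>x. neg u x * ?g x \<partial>?M)"
    by (intro LIMSEQ_le_const2) auto
  also have "\<dots> \<le> l2norm ?M (neg u) * l2norm ?M ?g"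
    using abs_integral_inner_le[OF sq_integrable_U[OF cont(1)] sq_integrable_U[OF cont(2)]] by simp
  also have "(\<integral>x. (neg u x)\<^sup>2 \<partial>?M) = l2norm ?M (neg u) * l2norm ?M (neg u)"
    using l2norm_square[of ?M "neg u"] by (simp add: power2_eq_square)
  finally show ?thesis
    by (cases "l2norm ?M (neg u) = 0") (auto simp: mult_le_cancel_left order_less_le)
qed

end

text \<open>\<open>X\<close> is the class in which equations are solved approximately:
  \<open>X_dense\<close> is the only existence statement, and zero-order terms and variable
  coefficients are reached from it by perturbation. Concavity of \<open>w\<close> gives
  Miranda--Talenti on \<open>X\<close>.\<close>

locale dense_domain = smooth_domain w z R
  for w :: "real^'n \<Rightarrow> real" and z R +
  fixes X :: "(real^'n \<Rightarrow> real) set"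
  assumes concave: "w x > 0 \<Longrightarrow>
      (\<Sum>i\<in>UNIV. \<Sum>j\<in>UNIV. partial i (partial j w) x * \<xi> i * \<xi> j) \<le> 0"
    and X_form: "u \<in> X \<Longrightarrow> \<exists>h. smooth h \<and> u = (\<lambda>x. w x * h x)"
    and X_add: "u \<in> X \<Longrightarrow> v \<in> X \<Longrightarrow> (\<lambda>x. u x + v x) \<in> X"
    and X_dense: "continuous_on UNIV f \<Longrightarrow> e > 0 \<Longrightarrow>
      \<exists>u\<in>X. l2norm (lebesgue_on U) (\<lambda>x. laplacian u x - f x) < e"
begin

abbreviation "M \<equiv> lebesgue_on U"

lemma X_smooth: "u \<in> X \<Longrightarrow> smooth u"
  using X_form smooth_w by (metis smooth_mult)

lemma X_hess_le: "u \<in> X \<Longrightarrow> l2norm M (hess u) \<le> l2norm M (laplacian u)"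
  using X_form[of u] miranda_talenti[OF _ _ concave]
  unfolding l2norm_def norm_hess by auto

lemma X_gradient_le:
  assumes "u \<in> X"
  shows "(\<integral>x. (\<Sum>i\<in>UNIV. (partial i u x)\<^sup>2) \<partial>M) \<le> 4 * R\<^sup>2 * (l2norm M (laplacian u))\<^sup>2"
  using X_form[OF assms] gradient_bound by (auto simp: l2norm_square)

text \<open>The constant \<open>4 R^2\<close> enters twice under the square, once from Poincare and
  once from the gradient bound.\<close>

lemma X_l2_le:
  assumes "u \<in> X"
  shows "l2norm M u \<le> 4 * R\<^sup>2 * l2norm M (laplacian u)"
proof -
  have su: "smooth u" using X_smooth[OF assms] .
  obtain h where h: "smooth h" "u = (\<lambda>x. w x * h x)" using X_form[OF assms] by auto
  obtain i :: 'n where True by auto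
  have 1: "(l2norm M u)\<^sup>2 \<le> 4 * R\<^sup>2 * (\<integral>x. (partial i u x)\<^sup>2 \<partial>M)"
    using poincare[OF h, of i] by (simp add: l2norm_square)
  have "(\<integral>x. (partial i u x)\<^sup>2 \<partial>M) \<le> (\<integral>x. (\<Sum>i\<in>UNIV. (partial i u x)\<^sup>2) \<partial>M)"
  proof (intro integral_mono_U smooth_continuous smooth_intros su)
    show "(partial i u x)\<^sup>2 \<le> (\<Sum>i\<in>UNIV. (partial i u x)\<^sup>2)" for x
      by (rule member_le_sum[of i UNIV "\<lambda>i. (partial i u x)\<^sup>2"]) auto
  qed
  also note X_gradient_le[OF assms]
  finally have "4 * R\<^sup>2 * (\<integral>x. (partial i u x)\<^sup>2 \<partial>M) \<le> 4 * R\<^sup>2 * (4 * R\<^sup>2 * (l2norm M (laplacian u))\<^sup>2)"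
    by (intro mult_left_mono) auto
  with 1 have "(l2norm M u)\<^sup>2 \<le> (4 * R\<^sup>2 * l2norm M (laplacian u))\<^sup>2"
    by (simp add: power2_eq_square mult_ac)
  then show ?thesis
    by (rule power2_le_imp_le) simp
qed

text \<open>Expanding the square, the cross term is 2 \<mu> times the integral of |grad u|^2 by the
  energy identity. The bound is uniform in \<mu>, which keeps continuation steps in \<mu> of fixed
  length.\<close>

lemma laplacian_le_shifted:
  assumes "u \<in> X" "\<mu> \<ge> 0"
  shows "l2norm M (laplacian u) \<le> l2norm M (elliptic_op (\<lambda>x. mat 1) \<mu> u)"
proof -
  have su: "smooth u" using X_smooth[OF assms(1)] .
  obtain h where h: "smooth h" "u = (\<lambda>x. w x * h x)" using X_form[OF assms(1)] by auto
  have "(l2norm M (elliptic_op (\<lambda>x. mat 1) \<mu> u))\<^sup>2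
      = (\<integral>x. ((laplacian u x)\<^sup>2 + \<mu>\<^sup>2 * (u x)\<^sup>2) - 2 * \<mu> * (u x * laplacian u x) \<partial>M)"
    unfolding l2norm_square
    by (intro Bochner_Integration.integral_cong refl)
      (simp add: elliptic_op_def mat_inner_hess power2_eq_square algebra_simps)
  also have "\<dots> = (\<integral>x. (laplacian u x)\<^sup>2 + \<mu>\<^sup>2 * (u x)\<^sup>2 \<partial>M) - (\<integral>x. 2 * \<mu> * (u x * laplacian u x) \<partial>M)"
    by (intro Bochner_Integration.integral_diff integrable_smooth smooth_intros su)
  finally have 1: "(l2norm M (elliptic_op (\<lambda>x. mat 1) \<mu> u))\<^sup>2 = \<dots>" .
  have 2: "(\<integral>x. 2 * \<mu> * (u x * laplacian u x) \<partial>M) = 2 * \<mu> * (\<integral>x. u x * laplacian u x \<partial>M)"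
    by simp
  have 3: "2 * \<mu> * (\<integral>x. u x * laplacian u x \<partial>M) \<le> 0"
    unfolding energy_identity[OF h] using assms(2)
    by (intro mult_nonneg_nonpos) (auto intro!: integral_nonneg_AE AE_I2 sum_nonneg)
  have "(\<integral>x. (laplacian u x)\<^sup>2 \<partial>M) \<le> (\<integral>x. (laplacian u x)\<^sup>2 + \<mu>\<^sup>2 * (u x)\<^sup>2 \<partial>M)"
    by (intro integral_mono_U smooth_continuous smooth_intros su) simp
  with 1 2 3 have "(l2norm M (laplacian u))\<^sup>2 \<le> (l2norm M (elliptic_op (\<lambda>x. mat 1) \<mu> u))\<^sup>2"
    by (simp add: l2norm_square)
  then show ?thesis
    by (rule power2_le_imp_le) simp
qed

lemma continuous_op_X:
  assumes "u \<in> X" "continuous_on UNIV b"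
  shows "continuous_on UNIV (elliptic_op b \<mu> u)"
  using continuous_elliptic_op[OF X_smooth[OF assms(1)] assms(2)] .

lemma elliptic_op_dense_step:
  assumes b: "continuous_on UNIV b" "continuous_on UNIV b'"
    and dense: "\<And>f e. continuous_on UNIV f \<Longrightarrow> e > 0 \<Longrightarrow>
      \<exists>u\<in>X. l2norm M (\<lambda>x. elliptic_op b \<mu> u x - f x) < e"
    and "0 \<le> \<theta>" "\<theta> < 1"
    and "\<And>u. u \<in> X \<Longrightarrow> l2norm M (\<lambda>x. elliptic_op b' \<mu>' u x - elliptic_op b \<mu> u x)
      \<le> \<theta> * l2norm M (elliptic_op b \<mu> u)"
    and "continuous_on UNIV f" "e > 0"
  shows "\<exists>u\<in>X. l2norm M (\<lambda>x. elliptic_op b' \<mu>' u x - f x) < e"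
  by (rule dense_range_perturbation[where Y="{f. continuous_on UNIV f}" and S="elliptic_op b \<mu>"
        and T="elliptic_op b' \<mu>'" and \<theta>=\<theta>])
    (use assms in \<open>auto intro!: sq_integrable_U continuous_op_X X_add continuous_on_diff
       elliptic_op_add X_smooth\<close>)

lemma shifted_laplacian_dense:
  assumes "\<mu> \<ge> 0" "continuous_on UNIV f" "e > 0"
  shows "\<exists>u\<in>X. l2norm M (\<lambda>x. elliptic_op (\<lambda>x. mat 1) \<mu> u x - f x) < e"
proof -
  \<comment> \<open>Half the reciprocal of the constant in \<open>X_l2_le\<close>, so that a shift
    by \<open>s\<close> is a perturbation of relative size 1/2.\<close>
  define s where "s = 1 / (8 * R\<^sup>2)"
  have s: "s > 0" using R_pos by (simp add: s_def)
  have "\<forall>f e. continuous_on UNIV f \<longrightarrow> e > 0 \<longrightarrow>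
      (\<exists>u\<in>X. l2norm M (\<lambda>x. elliptic_op (\<lambda>x. mat 1) \<mu> u x - f x) < e)"
    if "0 \<le> \<mu>" "\<mu> \<le> real n * s" for n \<mu>
    using that
  proof (induction n arbitrary: \<mu>)
    case 0
    then have "\<mu> = 0" by simp
    show ?case
    proof (intro allI impI)
      fix f :: "real^'n \<Rightarrow> real" and e :: real
      assume f: "continuous_on UNIV f" "e > 0"
      then obtain u where u: "u \<in> X" "l2norm M (\<lambda>x. laplacian u x - - f x) < e"
        using X_dense[of "\<lambda>x. - f x" e] continuous_on_minus by blast
      have "elliptic_op (\<lambda>x. mat 1) \<mu> u x - f x = - (laplacian u x - - f x)" for x
        by (simp add: \<open>\<mu> = 0\<close> elliptic_op_def mat_inner_hess)
      then have "l2norm M (\<lambda>x. elliptic_op (\<lambda>x. mat 1) \<mu> u x - f x) < e"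
        using u by (simp only: l2norm_uminus)
      with u show "\<exists>u\<in>X. l2norm M (\<lambda>x. elliptic_op (\<lambda>x. mat 1) \<mu> u x - f x) < e" by blast
    qed
  next
    case (Suc n)
    define \<mu>' where "\<mu>' = max 0 (\<mu> - s)"
    have \<mu>': "0 \<le> \<mu>'" "\<mu>' \<le> real n * s" "\<bar>\<mu> - \<mu>'\<bar> \<le> s"
      using Suc.prems s by (auto simp: \<mu>'_def algebra_simps max_def)
    show ?case
    proof (intro allI impI)
      fix f :: "real^'n \<Rightarrow> real" and e :: real
      assume f: "continuous_on UNIV f" "e > 0"
      show "\<exists>u\<in>X. l2norm M (\<lambda>x. elliptic_op (\<lambda>x. mat 1) \<mu> u x - f x) < e"
      proof (rule elliptic_op_dense_step[where \<theta>="1/2" and \<mu>=\<mu>' and b="\<lambda>x. mat 1"])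
        fix u assume u: "u \<in> X"
        have "l2norm M (\<lambda>x. elliptic_op (\<lambda>x. mat 1) \<mu> u x - elliptic_op (\<lambda>x. mat 1) \<mu>' u x)
            = l2norm M (\<lambda>x. (\<mu> - \<mu>') * u x)"
          by (simp add: elliptic_op_def algebra_simps)
        also have "\<dots> = \<bar>\<mu> - \<mu>'\<bar> * l2norm M u"
          by (rule l2norm_cmult)
        also have "\<dots> \<le> s * (4 * R\<^sup>2 * l2norm M (laplacian u))"
          using X_l2_le[OF u] \<mu>'(3) s by (intro mult_mono) auto
        also have "\<dots> = 1/2 * l2norm M (laplacian u)"
          using R_pos by (simp add: s_def)
        also have "\<dots> \<le> 1/2 * l2norm M (elliptic_op (\<lambda>x. mat 1) \<mu>' u)"
          using laplacian_le_shifted[OF u \<mu>'(1)] by simp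
        finally show "l2norm M (\<lambda>x. elliptic_op (\<lambda>x. mat 1) \<mu> u x - elliptic_op (\<lambda>x. mat 1) \<mu>' u x)
            \<le> 1/2 * l2norm M (elliptic_op (\<lambda>x. mat 1) \<mu>' u)" .
      qed (use Suc.IH[OF \<mu>'(1,2)] f in auto)
    qed
  qed
  moreover obtain n where "\<mu> < real n * s"
    using reals_Archimedean3[OF s] by blast
  ultimately show ?thesis
    using assms less_imp_le by blast
qed

section \<open>Coefficients within Frobenius distance \<rho> < 1 of the identity\<close>

context
  fixes b :: "real^'n \<Rightarrow> real^'n^'n" and \<rho> :: real
  assumes b: "smooth_matrix b" and ell: "\<And>x. w x > 0 \<Longrightarrow> norm (b x - mat 1) \<le> \<rho>"
    and \<rho>: "0 \<le> \<rho>" "\<rho> < 1"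
begin

text \<open>The difference is \<open>b - mat 1\<close> against the Hessian, hence at most \<rho>
  times the Hessian norm; Miranda--Talenti passes to the Laplacian and
  \<open>laplacian_le_shifted\<close> to the shifted operator, neither losing a constant.\<close>

lemma cordes_close:
  assumes u: "u \<in> X" and "\<mu> \<ge> 0"
  shows "l2norm M (\<lambda>x. elliptic_op b \<mu> u x - elliptic_op (\<lambda>x. mat 1) \<mu> u x)
    \<le> \<rho> * l2norm M (elliptic_op (\<lambda>x. mat 1) \<mu> u)"
proof -
  have su: "smooth u" using X_smooth[OF u] .
  have "l2norm M (\<lambda>x. elliptic_op b \<mu> u x - elliptic_op (\<lambda>x. mat 1) \<mu> u x) \<le> \<rho> * l2norm M (hess u)"
  proof (rule l2norm_mono_U)
    show "continuous_on UNIV (\<lambda>x. elliptic_op b \<mu> u x - elliptic_op (\<lambda>x. mat 1) \<mu> u x)"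
      using continuous_smooth_matrix[OF b]
      by (intro continuous_intros continuous_op_X u) auto
    fix x assume x: "0 < w x"
    have "elliptic_op b \<mu> u x - elliptic_op (\<lambda>x. mat 1) \<mu> u x = - ((b x - mat 1) \<bullet> hess u x)"
      by (simp add: elliptic_op_def inner_diff_left)
    then have "norm (elliptic_op b \<mu> u x - elliptic_op (\<lambda>x. mat 1) \<mu> u x)
        \<le> norm (b x - mat 1) * norm (hess u x)"
      using Cauchy_Schwarz_ineq2[of "b x - mat 1" "hess u x"] by simp
    also have "\<dots> \<le> \<rho> * norm (hess u x)"
      using ell[OF x] by (intro mult_right_mono) auto
    finally show "norm (elliptic_op b \<mu> u x - elliptic_op (\<lambda>x. mat 1) \<mu> u x) \<le> \<rho> * norm (hess u x)" .
  qed (use \<rho> continuous_hess[OF su] in auto)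
  also have "\<dots> \<le> \<rho> * l2norm M (elliptic_op (\<lambda>x. mat 1) \<mu> u)"
    using X_hess_le[OF u] laplacian_le_shifted[OF assms] \<rho> by (intro mult_left_mono) auto
  finally show ?thesis .
qed

text \<open>One perturbation step from the shifted Laplacian, of relative size \<rho>.\<close>

lemma cordes_dense:
  assumes "\<mu> \<ge> 0" "continuous_on UNIV f" "e > 0"
  shows "\<exists>u\<in>X. l2norm M (\<lambda>x. elliptic_op b \<mu> u x - f x) < e"
  by (rule elliptic_op_dense_step[where \<theta>=\<rho> and \<mu>=\<mu> and b="\<lambda>x. mat 1"])
    (use assms \<rho> cordes_close[OF _ assms(1)] shifted_laplacian_dense[OF assms(1)]
      continuous_smooth_matrix[OF b] in auto)

text \<open>\<open>cordes_close\<close> read backwards: the perturbation of relative size \<rho> is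
  absorbed on the left. The constant depends neither on \<mu> nor on derivatives of
  \<open>b\<close>.\<close>

lemma cordes_laplacian_le:
  assumes u: "u \<in> X" and "\<mu> \<ge> 0"
  shows "(1 - \<rho>) * l2norm M (laplacian u) \<le> l2norm M (elliptic_op b \<mu> u)"
proof -
  have "l2norm M (elliptic_op (\<lambda>x. mat 1) \<mu> u)
      \<le> l2norm M (elliptic_op b \<mu> u) + l2norm M (\<lambda>x. elliptic_op (\<lambda>x. mat 1) \<mu> u x - elliptic_op b \<mu> u x)"
    using continuous_smooth_matrix[OF b]
    by (intro l2norm_le_add_diff sq_integrable_U continuous_op_X u) auto
  also have "l2norm M (\<lambda>x. elliptic_op (\<lambda>x. mat 1) \<mu> u x - elliptic_op b \<mu> u x)
      \<le> \<rho> * l2norm M (elliptic_op (\<lambda>x. mat 1) \<mu> u)"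
    using cordes_close[OF assms] by (subst l2norm_minus_commute)
  finally have "(1 - \<rho>) * l2norm M (elliptic_op (\<lambda>x. mat 1) \<mu> u) \<le> l2norm M (elliptic_op b \<mu> u)"
    by (simp add: algebra_simps)
  moreover have "(1 - \<rho>) * l2norm M (laplacian u) \<le> (1 - \<rho>) * l2norm M (elliptic_op (\<lambda>x. mat 1) \<mu> u)"
    using laplacian_le_shifted[OF assms] \<rho> by (intro mult_left_mono) auto
  ultimately show ?thesis by linarith
qed

lemma cordes_l2_le:
  assumes u: "u \<in> X" and "\<mu> \<ge> 0"
  shows "l2norm M u \<le> 4 * R\<^sup>2 / (1 - \<rho>) * l2norm M (elliptic_op b \<mu> u)"
proof -
  have "l2norm M (laplacian u) \<le> l2norm M (elliptic_op b \<mu> u) / (1 - \<rho>)"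
    using cordes_laplacian_le[OF assms] \<rho> by (simp add: pos_le_divide_eq mult.commute)
  then have "4 * R\<^sup>2 * l2norm M (laplacian u) \<le> 4 * R\<^sup>2 * (l2norm M (elliptic_op b \<mu> u) / (1 - \<rho>))"
    by (intro mult_left_mono) auto
  with X_l2_le[OF u] show ?thesis by simp
qed

text \<open>If \<open>L + \<mu>\<close> is positivity preserving then so is \<open>L + \<mu>'\<close> for \<open>\<mu>' < \<mu>\<close> close to \<open>\<mu>\<close>: add to \<open>u\<close>
  a solution \<open>v\<close> of \<open>(L + \<mu>) v = (\<mu> - \<mu>') u\<^sup>-\<close>, which is small compared to \<open>u\<^sup>-\<close>.\<close>

lemma negative_part_step:
  assumes pos: "\<And>u. u \<in> X \<Longrightarrow> l2norm M (neg u) \<le> K * l2norm M (neg (elliptic_op b \<mu> u))" and K: "K \<ge> 0"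
    and \<mu>: "0 \<le> \<mu>'" "\<mu>' \<le> \<mu>" "(\<mu> - \<mu>') * (4 * R\<^sup>2 / (1 - \<rho>)) \<le> 1/2"
    and u: "u \<in> X"
  shows "l2norm M (neg u) \<le> 2 * K * l2norm M (neg (elliptic_op b \<mu>' u))"
proof -
  define C where "C = 4 * R\<^sup>2 / (1 - \<rho>)"
  have C: "C \<ge> 0" using \<rho> by (simp add: C_def)
  have cb: "continuous_on UNIV b" using continuous_smooth_matrix[OF b] .
  have cu: "continuous_on UNIV u" using X_smooth[OF u] by (rule smooth_continuous)
  let ?n = "l2norm M (neg u)" and ?g = "elliptic_op b \<mu>' u"
  have cg: "continuous_on UNIV ?g" by (rule continuous_op_X[OF u cb])
  let ?r = "\<lambda>x. (\<mu> - \<mu>') * neg u x"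
  have cr: "continuous_on UNIV ?r" by (intro continuous_intros continuous_neg cu)
  have "l2norm M (neg u) \<le> 2 * K * l2norm M (neg ?g) + 2 * (K + C) * \<epsilon>" if \<epsilon>: "\<epsilon> > 0" for \<epsilon>
  proof -
    obtain v where v: "v \<in> X" "l2norm M (\<lambda>x. elliptic_op b \<mu> v x - ?r x) < \<epsilon>"
      using cordes_dense[OF _ cr \<epsilon>, of \<mu>] \<mu> by auto
    have cv: "continuous_on UNIV v" using X_smooth[OF v(1)] by (rule smooth_continuous)
    let ?e = "\<lambda>x. elliptic_op b \<mu> v x - ?r x"
    have ce: "continuous_on UNIV ?e" by (intro continuous_intros continuous_op_X v cb cr)
    let ?s = "\<lambda>x. u x + v x"
    have s: "?s \<in> X" by (intro X_add u v)
    have "l2norm M (elliptic_op b \<mu> v) \<le> l2norm M ?r + \<epsilon>"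
      using l2norm_le_add_diff[OF sq_integrable_U[OF continuous_op_X[OF v(1) cb]] sq_integrable_U[OF cr], of \<mu>] v(2)
      by linarith
    also have "l2norm M ?r = (\<mu> - \<mu>') * ?n"
      using \<mu> by (simp add: l2norm_cmult)
    finally have "C * l2norm M (elliptic_op b \<mu> v) \<le> C * ((\<mu> - \<mu>') * ?n + \<epsilon>)"
      using C by (intro mult_left_mono)
    also have "\<dots> = ((\<mu> - \<mu>') * C) * ?n + C * \<epsilon>" by (simp add: algebra_simps)
    also have "((\<mu> - \<mu>') * C) * ?n \<le> 1/2 * ?n"
      using \<mu>(3) unfolding C_def by (intro mult_right_mono) auto
    finally have nv: "l2norm M v \<le> 1/2 * ?n + C * \<epsilon>"
      using cordes_l2_le[OF v(1), of \<mu>] \<mu> unfolding C_def by linarith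
    \<comment> \<open>\<open>u + neg u\<close> is the positive part of \<open>u\<close>, so
      \<open>u + v\<close> solves the equation with parameter \<mu> and a right-hand side that is
      \<open>?g\<close> plus something nonnegative plus the small defect \<open>?e\<close>.\<close>
    have op: "elliptic_op b \<mu> ?s x = ?g x + (\<mu> - \<mu>') * (u x + neg u x) + ?e x" for x
      using elliptic_op_add[OF X_smooth[OF u] X_smooth[OF v(1)], of b \<mu> x]
      by (simp add: elliptic_op_def algebra_simps)
    have "l2norm M (neg (elliptic_op b \<mu> ?s)) \<le> 1 * l2norm M (\<lambda>x. neg ?g x + \<bar>?e x\<bar>)"
    proof (rule l2norm_mono_U)
      show "continuous_on UNIV (\<lambda>x. neg ?g x + \<bar>?e x\<bar>)" "continuous_on UNIV (neg (elliptic_op b \<mu> ?s))"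
        by (intro continuous_on_add continuous_on_rabs continuous_neg cg ce continuous_op_X s cb)+
      fix x
      have "(\<mu> - \<mu>') * (u x + neg u x) \<ge> 0"
        using \<mu> by (intro mult_nonneg_nonneg) (auto simp: neg_def)
      then show "norm (neg (elliptic_op b \<mu> ?s) x) \<le> 1 * norm (neg ?g x + \<bar>?e x\<bar>)"
        unfolding neg_def op by (auto simp: max_def)
    qed auto
    also have "1 * l2norm M (\<lambda>x. neg ?g x + \<bar>?e x\<bar>) \<le> l2norm M (neg ?g) + l2norm M (\<lambda>x. \<bar>?e x\<bar>)"
      unfolding mult_1
      by (intro l2norm_triangle sq_integrable_U continuous_on_rabs continuous_neg cg ce)
    also have "l2norm M (\<lambda>x. \<bar>?e x\<bar>) = l2norm M ?e" by (simp add: l2norm_def)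
    finally have "l2norm M (neg (elliptic_op b \<mu> ?s)) \<le> l2norm M (neg ?g) + \<epsilon>" using v(2) by linarith
    then have "K * l2norm M (neg (elliptic_op b \<mu> ?s)) \<le> K * (l2norm M (neg ?g) + \<epsilon>)"
      using K by (rule mult_left_mono)
    with pos[OF s] have ns: "l2norm M (neg ?s) \<le> K * l2norm M (neg ?g) + K * \<epsilon>"
      by (simp add: algebra_simps)
    have "l2norm M (neg u) \<le> 1 * l2norm M (\<lambda>x. neg ?s x + \<bar>v x\<bar>)"
      by (intro l2norm_mono_U continuous_on_add continuous_on_rabs continuous_neg cu cv)
        (auto simp: neg_def)
    also have "1 * l2norm M (\<lambda>x. neg ?s x + \<bar>v x\<bar>) \<le> l2norm M (neg ?s) + l2norm M (\<lambda>x. \<bar>v x\<bar>)"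
      unfolding mult_1
      by (intro l2norm_triangle sq_integrable_U continuous_on_add continuous_on_rabs continuous_neg cu cv)
    also have "l2norm M (\<lambda>x. \<bar>v x\<bar>) = l2norm M v" by (simp add: l2norm_def)
    \<comment> \<open>Half of \<open>?n\<close> is absorbed on the left, which doubles
      \<open>K\<close>.\<close>
    finally have "?n \<le> K * l2norm M (neg ?g) + K * \<epsilon> + (1/2 * ?n + C * \<epsilon>)"
      using ns nv by linarith
    then show ?thesis by (simp add: algebra_simps)
  qed
  note le = this
  show ?thesis
  proof (rule field_le_epsilon)
    fix \<epsilon> :: real assume \<epsilon>: "\<epsilon> > 0"
    \<comment> \<open>The summand 1 keeps the denominator positive even if \<open>K + C\<close> is
      zero.\<close>
    define \<eta> where "\<eta> = \<epsilon> / (2 * (K + C) + 1)"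
    have \<eta>: "\<eta> > 0" using \<epsilon> K C by (simp add: \<eta>_def)
    have "2 * (K + C) * \<eta> \<le> (2 * (K + C) + 1) * \<eta>" using \<eta> by (simp add: algebra_simps)
    also have "\<dots> = \<epsilon>" using K C by (simp add: \<eta>_def)
    finally show "?n \<le> 2 * K * l2norm M (neg ?g) + \<epsilon>" using le[OF \<eta>] by linarith
  qed
qed

text \<open>Descent from a large \<mu>, where the constant is 1, to 0 in steps of fixed length,
  doubling the constant each time. So \<open>K\<close> is a power of two whose exponent depends on
  the derivatives of \<open>b\<close>.\<close>

lemma negative_part_bound:
  obtains K where "K > 0" "\<And>u. u \<in> X \<Longrightarrow> l2norm M (neg u) \<le> K * l2norm M (neg (elliptic_op b 0 u))"
proof -
  let ?\<beta> = "\<lambda>x. \<Sum>j\<in>UNIV. (\<Sum>i\<in>UNIV. partial i (\<lambda>x. b x $ i $ j) x)\<^sup>2"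
  have "continuous_on (cball z R) ?\<beta>"
    using b unfolding smooth_matrix_def by (intro smooth_continuous smooth_intros) auto
  then have "bounded (?\<beta> ` cball z R)"
    by (intro compact_imp_bounded compact_continuous_image) auto
  then obtain B where "\<And>x. x \<in> cball z R \<Longrightarrow> \<bar>?\<beta> x\<bar> \<le> B"
    unfolding bounded_iff real_norm_def by blast
  then have B: "\<And>x. w x > 0 \<Longrightarrow> ?\<beta> x \<le> B"
    using subset_cball by (meson abs_le_D1 mem_Collect_eq subsetD)
  define \<mu>0 where "\<mu>0 = max 0 (B / (4 * (1 - \<rho>)) + 1)"
  \<comment> \<open>Half the reciprocal of the constant \<open>4 R^2 / (1 - \<rho>)\<close> in
    \<open>cordes_l2_le\<close>, as the descent step demands.\<close>
  define s where "s = (1 - \<rho>) / (8 * R\<^sup>2)"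
  have s: "s > 0" using R_pos \<rho> by (simp add: s_def)
  have sC: "t * (4 * R\<^sup>2 / (1 - \<rho>)) \<le> 1/2" if "t \<le> s" for t
  proof -
    have "t * (4 * R\<^sup>2 / (1 - \<rho>)) \<le> s * (4 * R\<^sup>2 / (1 - \<rho>))"
      using that \<rho> by (intro mult_right_mono) auto
    also have "\<dots> = 1/2" using \<rho> R_pos by (simp add: s_def)
    finally show ?thesis .
  qed
  have "\<forall>u\<in>X. l2norm M (neg u) \<le> 2 ^ n * l2norm M (neg (elliptic_op b \<mu> u))"
    if "0 \<le> \<mu>" "\<mu>0 - real n * s \<le> \<mu>" for n \<mu>
    using that
  proof (induction n arbitrary: \<mu>)
    case 0
    show ?case
    proof
      fix u assume "u \<in> X"
      then obtain h where h: "smooth h" "u = (\<lambda>x. w x * h x)" using X_form by blast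
      have "\<mu> \<ge> B / (4 * (1 - \<rho>)) + 1" using 0 by (simp add: \<mu>0_def)
      from negative_part_large[OF h b ell \<rho>(2) B this]
      show "l2norm M (neg u) \<le> 2 ^ 0 * l2norm M (neg (elliptic_op b \<mu> u))" by simp
    qed
  next
    case (Suc n)
    have prems: "0 \<le> \<mu>" "\<mu>0 - real n * s \<le> \<mu> + s"
      using Suc.prems by (auto simp: algebra_simps)
    have "\<forall>u\<in>X. l2norm M (neg u) \<le> 2 ^ n * l2norm M (neg (elliptic_op b (\<mu> + s) u))"
      using Suc.IH[of "\<mu> + s"] prems s by auto
    then show ?case
      using negative_part_step[of "2 ^ n" "\<mu> + s" \<mu>] prems s sC[of s] by auto
  qed
  note ind = this
  obtain n where "\<mu>0 \<le> real n * s"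
    using s by (metis reals_Archimedean3 less_imp_le)
  then have "\<forall>u\<in>X. l2norm M (neg u) \<le> 2 ^ n * l2norm M (neg (elliptic_op b 0 u))"
    using ind[of 0 n] by simp
  then show ?thesis
    by (intro that[of "2 ^ n"]) auto
qed

text \<open>Since \<open>f\<close> is nonnegative, the negative part of the operator applied to
  \<open>u\<close> is at most its defect. The accuracy is chosen after the positivity constant, so
  the last bound, the one that must be uniform, does not involve it.\<close>

theorem approximate_nonneg_solution:
  assumes f: "continuous_on UNIV f" "\<And>x. f x \<ge> 0" and e: "e > 0"
  obtains u where "u \<in> X" "l2norm M (\<lambda>x. b x \<bullet> hess u x + f x) < e" "l2norm M (neg u) < e"
    "(1 - \<rho>) * l2norm M (laplacian u) \<le> l2norm M (\<lambda>x. b x \<bullet> hess u x)"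
proof -
  obtain K where K: "K > 0" "\<And>u. u \<in> X \<Longrightarrow> l2norm M (neg u) \<le> K * l2norm M (neg (elliptic_op b 0 u))"
    using negative_part_bound by blast
  define \<epsilon> where "\<epsilon> = min e (e / K)"
  have "\<epsilon> > 0" using e K by (simp add: \<epsilon>_def)
  then obtain u where u: "u \<in> X" "l2norm M (\<lambda>x. elliptic_op b 0 u x - f x) < \<epsilon>"
    using cordes_dense[OF order_refl f(1)] by blast
  have cb: "continuous_on UNIV b" using continuous_smooth_matrix[OF b] .
  have "l2norm M (neg (elliptic_op b 0 u)) \<le> 1 * l2norm M (\<lambda>x. elliptic_op b 0 u x - f x)"
  proof (intro l2norm_mono_U continuous_neg continuous_on_diff continuous_op_X u cb f)
    show "norm (neg (elliptic_op b 0 u) x) \<le> 1 * norm (elliptic_op b 0 u x - f x)" for x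
      using f(2)[of x] by (auto simp: neg_def)
  qed auto
  with u(2) have "l2norm M (neg (elliptic_op b 0 u)) < e / K" by (simp add: \<epsilon>_def)
  then have "l2norm M (neg u) < e"
    using K(1) K(2)[OF u(1)] by (simp add: field_simps)
  moreover have "l2norm M (\<lambda>x. b x \<bullet> hess u x + f x) = l2norm M (\<lambda>x. - (elliptic_op b 0 u x - f x))"
    by (simp add: elliptic_op_def add.commute)
  then have "l2norm M (\<lambda>x. b x \<bullet> hess u x + f x) < e"
    using u(2) unfolding l2norm_uminus by (simp add: \<epsilon>_def)
  moreover have "l2norm M (elliptic_op b 0 u) = l2norm M (\<lambda>x. b x \<bullet> hess u x)"
    unfolding elliptic_op_def by simp
  ultimately show ?thesis
    using that[of u] u(1) cordes_laplacian_le[OF u(1) order_refl] by simp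
qed

end

end

section \<open>The Laplacian on the unit ball\<close>

interpretation funs: vector_space "\<lambda>c (f :: 'a \<Rightarrow> real) x. c * f x"
  by unfold_locales (auto simp: fun_eq_iff algebra_simps)

interpretation funs_pair: vector_space_pair "\<lambda>c (f :: 'a \<Rightarrow> real) x. c * f x" "\<lambda>c (f :: 'a \<Rightarrow> real) x. c * f x"
  by unfold_locales

text \<open>Dimension count in the span of a finite set. \<open>T\<close> is known to be linear only
  there, so a globally linear \<open>T'\<close> with the same values on a basis \<open>B\<close> is
  used; it maps \<open>B\<close> to an independent set of the same size inside the span.\<close>

lemma injective_on_span_imp_surjective:
  fixes T :: "('a \<Rightarrow> real) \<Rightarrow> 'a \<Rightarrow> real"
  assumes fin: "finite S"
    and add: "\<And>f g. f \<in> funs.span S \<Longrightarrow> g \<in> funs.span S \<Longrightarrow> T (\<lambda>x. f x + g x) = (\<lambda>x. T f x + T g x)"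
    and cmult: "\<And>f c. f \<in> funs.span S \<Longrightarrow> T (\<lambda>x. c * f x) = (\<lambda>x. c * T f x)"
    and into: "\<And>f. f \<in> funs.span S \<Longrightarrow> T f \<in> funs.span S"
    and inj: "\<And>f. f \<in> funs.span S \<Longrightarrow> T f = (\<lambda>x. 0) \<Longrightarrow> f = (\<lambda>x. 0)"
    and y: "y \<in> funs.span S"
  shows "\<exists>f\<in>funs.span S. T f = y"
proof -
  obtain B where B: "B \<subseteq> S" "funs.independent B" "S \<subseteq> funs.span B"
    using funs.maximal_independent_subset[of S] by blast
  have finB: "finite B" using B(1) fin by (rule finite_subset)
  have spanB: "funs.span B = funs.span S"
    using B by (intro funs.span_eq[THEN iffD2] conjI) (auto intro: funs.span_base)
  obtain T' where T': "Vector_Spaces.linear (\<lambda>c (f :: 'a \<Rightarrow> real) x. c * f x) (\<lambda>c (f :: 'a \<Rightarrow> real) x. c * f x) T'"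
    and eqB: "\<And>b. b \<in> B \<Longrightarrow> T' b = T b"
    using funs_pair.linear_independent_extend[OF B(2), of T] by blast
  interpret T': Vector_Spaces.linear "\<lambda>c (f :: 'a \<Rightarrow> real) x. c * f x" "\<lambda>c (f :: 'a \<Rightarrow> real) x. c * f x" T'
    by (rule T')
  have T0: "T (\<lambda>x. 0) = (\<lambda>x. 0)"
    using cmult[of "\<lambda>x. 0" 0] funs.span_zero[of S] by (simp add: zero_fun_def)
  have eq: "T' f = T f \<and> f \<in> funs.span S" if "f \<in> funs.span B" for f
    using that
  proof (induction rule: funs.span_induct_alt)
    case base
    then show ?case using T0 funs.span_zero[of S] T'.zero by (simp add: zero_fun_def)
  next
    case (step c b g)
    have b: "b \<in> funs.span S" using step(1) B(1) by (auto intro: funs.span_base)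
    have cb: "(\<lambda>x. c * b x) \<in> funs.span S" using funs.span_scale[OF b] .
    have "T' ((\<lambda>x. c * b x) + g) = (\<lambda>x. c * T b x) + T g"
      using step eqB by (simp add: T'.add T'.scale)
    moreover have "T ((\<lambda>x. c * b x) + g) = (\<lambda>x. c * T b x) + T g"
      using add[OF cb, of g] cmult[OF b] step(2) by (simp add: plus_fun_def)
    ultimately show ?case
      using step(2) funs.span_add[OF cb, of g] by (simp add: plus_fun_def)
  qed
  have "inj_on T' (funs.span B)"
  proof (subst T'.inj_on_iff_eq_0)
    show "funs.subspace (funs.span B)" by (rule funs.subspace_span)
    show "\<forall>f\<in>funs.span B. T' f = 0 \<longrightarrow> f = 0"
      using eq inj by (auto simp: zero_fun_def)
  qed
  then have ind: "funs.independent (T' ` B)"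
    by (rule T'.independent_injective_image[OF B(2)])
  have card: "card (T' ` B) = card B"
    by (intro card_image inj_on_subset[OF \<open>inj_on T' (funs.span B)\<close> funs.span_superset])
  have sub: "T' ` B \<subseteq> funs.span B"
  proof (rule image_subsetI)
    fix b assume "b \<in> B"
    then have "b \<in> funs.span B" by (rule funs.span_base)
    with eq[OF this] into[of b] show "T' b \<in> funs.span B" by (simp add: spanB)
  qed
  have "y \<in> funs.span (T' ` B)"
  proof (rule ccontr)
    assume ny: "y \<notin> funs.span (T' ` B)"
    \<comment> \<open>Otherwise the span of \<open>B\<close> would contain more independent vectors
      than \<open>B\<close> has elements.\<close>
    then have "funs.independent (insert y (T' ` B))"
      using ind by (rule funs.independent_insertI)
    moreover have "insert y (T' ` B) \<subseteq> funs.span B" using sub y spanB by auto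
    ultimately have "finite (insert y (T' ` B)) \<and> card (insert y (T' ` B)) \<le> card B"
      by (rule funs.independent_span_bound[OF finB])
    moreover have "y \<notin> T' ` B" using ny funs.span_base[of y "T' ` B"] by auto
    ultimately show False using card finB by simp
  qed
  then obtain f where f: "f \<in> funs.span B" "y = T' f"
    unfolding T'.span_image by (rule imageE)
  show ?thesis
    using eq[OF f(1)] f(2) by (intro bexI[of _ f]) auto
qed

section \<open>Polynomials filtered by degree\<close>

fun monomials :: "nat \<Rightarrow> (real^'n \<Rightarrow> real) set" where
  "monomials 0 = {\<lambda>x. 1}"
| "monomials (Suc k) = monomials k \<union> (\<Union>i. (\<lambda>m x. x $ i * m x) ` monomials k)"

text \<open>Finite-dimensional pieces, raised by 2 under multiplication with \<open>ball_fun\<close>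
  and lowered by 2 under the Laplacian.\<close>

definition polys :: "nat \<Rightarrow> (real^'n \<Rightarrow> real) set" where
  "polys k = funs.span (monomials k)"

lemma finite_monomials: "finite (monomials k)"
  by (induction k) auto

lemma polys_add: "p \<in> polys k \<Longrightarrow> q \<in> polys k \<Longrightarrow> (\<lambda>x. p x + q x) \<in> polys k"
  unfolding polys_def using funs.span_add by (auto simp: plus_fun_def)

lemma polys_cmult: "p \<in> polys k \<Longrightarrow> (\<lambda>x. c * p x) \<in> polys k"
  unfolding polys_def by (rule funs.span_scale)

lemma polys_zero: "(\<lambda>x. 0) \<in> polys k"
  unfolding polys_def using funs.span_zero by (simp add: zero_fun_def)

lemma polys_sum: "(\<And>i. i \<in> A \<Longrightarrow> p i \<in> polys k) \<Longrightarrow> (\<lambda>x. \<Sum>i\<in>A. p i x) \<in> polys k"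
  by (induction A rule: infinite_finite_induct) (auto simp: polys_zero polys_add)

lemma polys_induct [consumes 1, case_names zero step]:
  assumes "p \<in> polys k" "P (\<lambda>x. 0)"
    and "\<And>c m q. m \<in> monomials k \<Longrightarrow> q \<in> polys k \<Longrightarrow> P q \<Longrightarrow> P (\<lambda>x. c * m x + q x)"
  shows "P p"
proof -
  have "P p \<and> p \<in> polys k"
    using assms(1) unfolding polys_def
  proof (induction rule: funs.span_induct_alt)
    case base
    then show ?case using assms(2) polys_zero by (simp add: zero_fun_def polys_def)
  next
    case (step c m q)
    have "(\<lambda>x. c * m x) + q = (\<lambda>x. c * m x + q x)" by (simp add: plus_fun_def)
    moreover have "m \<in> polys k" using step(1) by (simp add: polys_def funs.span_base)
    ultimately show ?case
      using step assms(3)[of m q c] polys_add[OF polys_cmult, of m k q c] by (simp add: polys_def)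
  qed
  then show ?thesis ..
qed

lemma monomials_mono: "j \<le> k \<Longrightarrow> monomials j \<subseteq> monomials k"
  by (rule lift_Suc_mono_le[of monomials]) auto

lemma polys_mono: "j \<le> k \<Longrightarrow> p \<in> polys j \<Longrightarrow> p \<in> polys k"
  unfolding polys_def using funs.span_mono[OF monomials_mono] by blast

lemma monomials_polys: "m \<in> monomials k \<Longrightarrow> m \<in> polys k"
  by (simp add: polys_def funs.span_base)

lemma polys_nth_mult:
  assumes "p \<in> polys k"
  shows "(\<lambda>x. x $ i * p x) \<in> polys (Suc k)"
  using assms
proof (induction rule: polys_induct)
  case zero
  then show ?case using polys_zero by simp
next
  case (step c m q)
  have "(\<lambda>x. x $ i * m x) \<in> monomials (Suc k)" using step(1) by auto
  from polys_add[OF polys_cmult[OF monomials_polys[OF this], of c] step(3)]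
  show ?case by (simp add: algebra_simps)
qed

lemma monomial_polynomial: "m \<in> monomials k \<Longrightarrow> real_polynomial_function m"
proof (induction k arbitrary: m)
  case (Suc k)
  have "real_polynomial_function (\<lambda>x :: real^'a. x $ i)" for i
    by (intro real_polynomial_function.intros(1) bounded_linear_vec_nth)
  with Suc show ?case by auto
qed auto

lemma polys_polynomial: "p \<in> polys k \<Longrightarrow> real_polynomial_function p"
proof (induction rule: polys_induct)
  case (step c m q)
  then show ?case
    using real_polynomial_function.intros(3)[OF real_polynomial_function.intros(4)
        [OF real_polynomial_function.intros(2) monomial_polynomial[OF step(1)]] step(3)] by simp
qed (rule real_polynomial_function.intros(2))

lemma polys_smooth: "p \<in> polys k \<Longrightarrow> smooth p"
  using polys_polynomial smooth_polynomial by blast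

text \<open>For \<open>k = 0\<close> the truncated \<open>k - 1\<close> is again 0, which is right
  because the derivative of a constant is zero.\<close>

lemma partial_monomial: "m \<in> monomials k \<Longrightarrow> partial i m \<in> polys (k - 1)"
proof (induction k arbitrary: m)
  case 0
  then show ?case using polys_zero by auto
next
  case (Suc k)
  show ?case
  proof (cases "m \<in> monomials k")
    case True
    show ?thesis using polys_mono[of "k - 1" k, OF _ Suc.IH[OF True]] by simp
  next
    case False
    then obtain j m' where m: "m = (\<lambda>x. x $ j * m' x)" "m' \<in> monomials k"
      using Suc.prems by auto
    have sm: "smooth m'" using m(2) monomials_polys polys_smooth by blast
    have p: "partial i m = (\<lambda>x. x $ j * partial i m' x + (if i = j then 1 else 0) * m' x)"
      unfolding m(1) by (simp add: partial_mult smooth_nth sm partial_nth)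
    have "(\<lambda>x. x $ j * partial i m' x) \<in> polys k"
    proof (cases k)
      case 0
      then show ?thesis using m(2) polys_zero by simp
    next
      case (Suc l)
      then show ?thesis using polys_nth_mult[OF Suc.IH[OF m(2)]] Suc.IH by simp
    qed
    then show ?thesis
      unfolding p using polys_add[OF _ polys_cmult[OF monomials_polys[OF m(2)]]] by simp
  qed
qed

lemma partial_polys:
  assumes "p \<in> polys k"
  shows "partial i p \<in> polys (k - 1)"
  using assms
proof (induction rule: polys_induct)
  case zero
  then show ?case using polys_zero by simp
next
  case (step c m q)
  have "smooth m" "smooth q"
    using step(1,2) polys_smooth monomials_polys by blast+
  then have "partial i (\<lambda>x. c * m x + q x) = (\<lambda>x. c * partial i m x + partial i q x)"
    using partial_add[OF smooth_cmult, of m q i c] by (simp add: partial_cmult)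
  then show ?case
    using polys_add[OF polys_cmult[OF partial_monomial[OF step(1)]] step(3)] by simp
qed

lemma polys_mult:
  assumes "p \<in> polys j" "q \<in> polys k"
  shows "(\<lambda>x. p x * q x) \<in> polys (j + k)"
proof -
  have m: "(\<lambda>x. m x * q x) \<in> polys (j + k)" if "m \<in> monomials j" for m j
    using that
  proof (induction j arbitrary: m)
    case 0
    then show ?case using assms(2) by simp
  next
    case (Suc j)
    show ?case
    proof (cases "m \<in> monomials j")
      case True
      show ?thesis using polys_mono[of "j + k" "Suc j + k", OF _ Suc.IH[OF True]] by simp
    next
      case False
      then obtain i m' where m: "m = (\<lambda>x. x $ i * m' x)" "m' \<in> monomials j"
        using Suc.prems by auto
      then show ?thesis using polys_nth_mult[OF Suc.IH[OF m(2)], of i] by (simp add: mult.assoc)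
    qed
  qed
  show ?thesis
    using assms(1)
  proof (induction rule: polys_induct)
    case zero
    then show ?case using polys_zero by simp
  next
    case (step c m' q')
    from polys_add[OF polys_cmult[OF m[OF step(1)], of c] step(3)]
    show ?case by (simp add: algebra_simps)
  qed
qed

lemma polynomial_in_polys: "real_polynomial_function p \<Longrightarrow> \<exists>k. p \<in> polys k"
proof (induction rule: real_polynomial_function.induct)
  case (linear f)
  then interpret bounded_linear f .
  have one: "(\<lambda>x. 1) \<in> polys 0" by (rule monomials_polys) simp
  have "f x = (\<Sum>i\<in>UNIV. f (axis i 1) * (x $ i * 1))" for x
  proof -
    have "(\<Sum>i\<in>UNIV. x $ i *\<^sub>R axis i 1) = x"
      using basis_expansion[of x] by (simp only: scalar_mult_eq_scaleR)
    then have "f x = f (\<Sum>i\<in>UNIV. x $ i *\<^sub>R axis i 1)" by (simp only:)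
    also have "\<dots> = (\<Sum>i\<in>UNIV. f (axis i 1) * (x $ i * 1))"
      unfolding sum scaleR by (simp add: mult.commute)
    finally show ?thesis .
  qed
  then have "f = (\<lambda>x. \<Sum>i\<in>UNIV. f (axis i 1) * (x $ i * 1))" by blast
  moreover have "(\<lambda>x. \<Sum>i\<in>UNIV. f (axis i 1) * (x $ i * 1)) \<in> polys (Suc 0)"
    by (intro polys_sum polys_cmult polys_nth_mult one)
  ultimately show ?case by metis
next
  case (const c)
  have "(\<lambda>x. c * 1) \<in> polys 0" by (intro polys_cmult monomials_polys) simp
  then show ?case by auto
next
  case (add f g)
  then obtain j k where "f \<in> polys j" "g \<in> polys k" by blast
  then have "f \<in> polys (max j k)" "g \<in> polys (max j k)"
    using polys_mono by (meson max.cobounded1 max.cobounded2)+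
  then show ?case using polys_add by blast
next
  case (mult f g)
  then show ?case using polys_mult by blast
qed

lemma polynomial_along_line:
  "real_polynomial_function p \<Longrightarrow> \<exists>q. \<forall>t. p (t *\<^sub>R y) = poly q t"
proof (induction rule: real_polynomial_function.induct)
  case (linear f)
  then interpret bounded_linear f .
  show ?case by (intro exI[of _ "[:0, f y:]"]) (simp add: scaleR)
next
  case (const c)
  show ?case by (intro exI[of _ "[:c:]"]) simp
next
  case (add f g)
  then obtain q r where "\<forall>t. f (t *\<^sub>R y) = poly q t" "\<forall>t. g (t *\<^sub>R y) = poly r t" by blast
  then show ?case by (intro exI[of _ "q + r"]) simp
next
  case (mult f g)
  then obtain q r where "\<forall>t. f (t *\<^sub>R y) = poly q t" "\<forall>t. g (t *\<^sub>R y) = poly r t" by blast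
  then show ?case by (intro exI[of _ "q * r"]) simp
qed

text \<open>On the line through 0 and \<open>y\<close> the polynomial becomes one in a single
  variable with infinitely many zeros.\<close>

lemma polynomial_eq_0:
  assumes p: "real_polynomial_function p" and zero: "\<And>x. norm x < 1 \<Longrightarrow> p x = 0"
  shows "p y = 0"
proof -
  obtain q where q: "\<And>t. p (t *\<^sub>R y) = poly q t"
    using polynomial_along_line[OF p] by blast
  \<comment> \<open>For \<open>0 < t < a\<close> the point \<open>t *\<^sub>R y\<close> lies in the
    unit ball; the summand 1 covers \<open>y = 0\<close>.\<close>
  define a where "a = 1 / (norm y + 1)"
  have a: "a > 0" by (simp add: a_def add_nonneg_pos)
  have "poly q t = 0" if t: "t \<in> {0<..<a}" for t
  proof -
    have "t * norm y \<le> t * (norm y + 1)" using t by (intro mult_left_mono) auto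
    also have "\<dots> < 1"
      using t pos_less_divide_eq[of "norm y + 1" t 1] by (simp add: a_def add_nonneg_pos)
    finally show ?thesis using q[of t] zero[of "t *\<^sub>R y"] t by simp
  qed
  then have sub: "{0<..<a} \<subseteq> {t. poly q t = 0}" by blast
  have "infinite {t. poly q t = 0}"
    using infinite_super[OF sub infinite_Ioo[OF a]] .
  then have "q = 0"
    using poly_roots_finite[of q] by auto
  then show ?thesis using q[of 1] by simp
qed

definition ball_fun :: "real^'n \<Rightarrow> real" where
  "ball_fun x = 1 - x \<bullet> x"

lemma ball_fun_polys: "ball_fun \<in> polys 2"
proof -
  have one: "(\<lambda>x. 1) \<in> polys 0" by (rule monomials_polys) simp
  have "(\<lambda>x. 1 + (-1) * (\<Sum>i\<in>UNIV. x $ i * (x $ i * 1))) \<in> polys 2"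
    using polys_nth_mult[OF polys_nth_mult[OF one]]
    by (intro polys_add polys_cmult polys_sum polys_mono[OF _ one]) (auto simp: numeral_2_eq_2)
  then show ?thesis by (simp add: ball_fun_def[abs_def] inner_vec_def)
qed

lemma smooth_ball_fun [smooth_intros]: "smooth ball_fun"
  using polys_smooth[OF ball_fun_polys] .

lemma ball_fun_pos_iff: "0 < ball_fun x \<longleftrightarrow> norm x < 1"
proof -
  have "norm x < 1 \<longleftrightarrow> (norm x)\<^sup>2 < 1"
    using abs_square_less_1[of "norm x"] by simp
  then show ?thesis by (simp add: ball_fun_def power2_norm_eq_inner)
qed

interpretation unit_ball: smooth_domain ball_fun 0 1
  by unfold_locales (auto intro: smooth_intros simp: ball_fun_pos_iff)

lemma (in smooth_domain) integral_square_eq_0_imp: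
  assumes f: "continuous_on UNIV f" and zero: "(\<integral>x. (f x)\<^sup>2 \<partial>lebesgue_on U) = (0::real)" and x: "w x > 0"
  shows "f x = 0"
proof (rule ccontr)
  assume ne: "f x \<noteq> 0"
  have "AE x in lebesgue_on U. (f x)\<^sup>2 = 0"
    using zero by (subst (asm) integral_nonneg_eq_0_iff_AE)
      (auto intro!: integrable_U continuous_intros f)
  then have "AE x in lebesgue. x \<in> U \<longrightarrow> f x = 0"
    using open_U by (simp add: AE_restrict_space_iff)
  then obtain N where "N \<in> null_sets lebesgue" "{x. \<not> (x \<in> U \<longrightarrow> f x = 0)} \<subseteq> N"
    by (auto simp: eventually_ae_filter)
  then have "negligible {x. \<not> (x \<in> U \<longrightarrow> f x = 0)}"
    using negligible_iff_null_sets negligible_subset by blast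
  moreover have "{x. \<not> (x \<in> U \<longrightarrow> f x = 0)} = U \<inter> {x. f x \<noteq> 0}" by auto
  moreover have "open (U \<inter> {x. f x \<noteq> 0})"
    using f by (intro open_Int open_U open_Collect_neq) auto
  moreover have "x \<in> U \<inter> {x. f x \<noteq> 0}" using x ne by (simp add: U_def)
  ultimately show False using open_not_negligible by (metis empty_iff)
qed

text \<open>A harmonic function of the form \<open>ball_fun x * p x\<close> has zero gradient energy
  by \<open>gradient_bound\<close>, hence vanishes on the ball by Poincare; division by
  \<open>ball_fun\<close> leaves \<open>p = 0\<close> there, and for a polynomial this extends
  everywhere.\<close>

lemma unit_ball_injective:
  assumes p: "real_polynomial_function p" and zero: "laplacian (\<lambda>x. ball_fun x * p x) = (\<lambda>x. 0)"
  shows "p y = 0"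
proof (rule polynomial_eq_0[OF p])
  fix x :: "real^'a" assume x: "norm x < 1"
  let ?u = "\<lambda>x. ball_fun x * p x"
  have sp: "smooth p" using smooth_polynomial[OF p] .
  have su: "smooth ?u" by (intro smooth_intros sp)
  obtain i :: 'a where True by auto
  have "(\<integral>x. (\<Sum>i\<in>UNIV. (partial i ?u x)\<^sup>2) \<partial>lebesgue_on unit_ball.U) \<le> 0"
    using unit_ball.gradient_bound[OF sp refl] by (simp add: zero)
  moreover have "(\<integral>x. (partial i ?u x)\<^sup>2 \<partial>lebesgue_on unit_ball.U)
      \<le> (\<integral>x. (\<Sum>i\<in>UNIV. (partial i ?u x)\<^sup>2) \<partial>lebesgue_on unit_ball.U)"
  proof (intro unit_ball.integral_mono_U smooth_continuous smooth_intros su sp)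
    show "(partial i ?u x)\<^sup>2 \<le> (\<Sum>i\<in>UNIV. (partial i ?u x)\<^sup>2)" for x
      by (rule member_le_sum[of i UNIV "\<lambda>i. (partial i ?u x)\<^sup>2"]) auto
  qed
  ultimately have "(\<integral>x. (?u x)\<^sup>2 \<partial>lebesgue_on unit_ball.U) \<le> 0"
    using unit_ball.poincare[OF sp refl, of i] by simp
  then have "(\<integral>x. (?u x)\<^sup>2 \<partial>lebesgue_on unit_ball.U) = 0"
    by (rule order_antisym) (rule Bochner_Integration.integral_nonneg, rule zero_le_power2)
  then have "?u x = 0"
    using x unfolding ball_fun_pos_iff[symmetric]
    by (rule unit_ball.integral_square_eq_0_imp[OF smooth_continuous[OF su]])
  then show "p x = 0"
    using x ball_fun_pos_iff[of x] by auto
qed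

text \<open>Fischer's argument: sending \<open>p\<close> to the Laplacian of \<open>ball_fun\<close>
  times \<open>p\<close> preserves polynomials of degree at most \<open>k\<close> and is injective,
  hence onto in finite dimension.\<close>

lemma unit_ball_surjective:
  assumes f: "real_polynomial_function f"
  obtains p where "real_polynomial_function p" "laplacian (\<lambda>x. ball_fun x * p x) = f"
proof -
  obtain k where k: "f \<in> polys k" using polynomial_in_polys[OF f] ..
  have "\<exists>p\<in>funs.span (monomials k). laplacian (\<lambda>x. ball_fun x * p x) = f"
  proof (rule injective_on_span_imp_surjective[OF finite_monomials,
        where T="\<lambda>p. laplacian (\<lambda>x. ball_fun x * p x)"])
    fix p q :: "real^'a \<Rightarrow> real" assume "p \<in> funs.span (monomials k)" "q \<in> funs.span (monomials k)"
    then have "smooth p" "smooth q" unfolding polys_def[symmetric] by (auto intro: polys_smooth)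
    then have "smooth (\<lambda>x. ball_fun x * p x)" "smooth (\<lambda>x. ball_fun x * q x)"
      by (simp_all add: smooth_mult[OF smooth_ball_fun])
    from laplacian_add[OF this] show "laplacian (\<lambda>x. ball_fun x * (p x + q x))
        = (\<lambda>x. laplacian (\<lambda>x. ball_fun x * p x) x + laplacian (\<lambda>x. ball_fun x * q x) x)"
      by (simp add: distrib_left fun_eq_iff)
  next
    fix p :: "real^'a \<Rightarrow> real" and c assume "p \<in> funs.span (monomials k)"
    then have "smooth p" unfolding polys_def[symmetric] by (rule polys_smooth)
    then have "smooth (\<lambda>x. ball_fun x * p x)"
      by (rule smooth_mult[OF smooth_ball_fun])
    from laplacian_cmult[OF this] show "laplacian (\<lambda>x. ball_fun x * (c * p x))
        = (\<lambda>x. c * laplacian (\<lambda>x. ball_fun x * p x) x)"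
      by (simp add: fun_eq_iff mult.left_commute)
  next
    fix p :: "real^'a \<Rightarrow> real" assume "p \<in> funs.span (monomials k)"
    then have "(\<lambda>x. ball_fun x * p x) \<in> polys (2 + k)"
      using polys_mult[OF ball_fun_polys] by (simp add: polys_def)
    from partial_polys[OF partial_polys[OF this]]
    have "laplacian (\<lambda>x. ball_fun x * p x) \<in> polys k"
      unfolding laplacian_def[abs_def] by (intro polys_sum) simp
    then show "laplacian (\<lambda>x. ball_fun x * p x) \<in> funs.span (monomials k)"
      by (simp add: polys_def)
  next
    fix p :: "real^'a \<Rightarrow> real" assume "p \<in> funs.span (monomials k)" "laplacian (\<lambda>x. ball_fun x * p x) = (\<lambda>x. 0)"
    then show "p = (\<lambda>x. 0)"
      using unit_ball_injective[OF polys_polynomial[of p k]] unfolding polys_def by blast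
  qed (use k in \<open>simp add: polys_def\<close>)
  then obtain p where "p \<in> polys k" "laplacian (\<lambda>x. ball_fun x * p x) = f"
    unfolding polys_def ..
  then show ?thesis
    by (intro that[of p] polys_polynomial[of p k])
qed

section \<open>Lipschitz changes of variables\<close>

text \<open>The change of variables theorem of the library requires the index type to be a well-order;
  inequalities with a constant are all that is needed here.\<close>

lemma emeasure_lipschitz_image_le:
  fixes \<phi> :: "'a::euclidean_space \<Rightarrow> 'a"
  assumes U: "open U" and L: "L > 0"
    and lip: "\<And>x y. x \<in> U \<Longrightarrow> y \<in> U \<Longrightarrow> dist (\<phi> x) (\<phi> y) \<le> L * dist x y"
    and meas: "\<phi> ` U \<in> sets borel"
  shows "emeasure lborel (\<phi> ` U) \<le> ennreal (L ^ DIM('a)) * emeasure lborel U"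
proof -
  let ?K = "{i :: 'a \<times> real. snd i > 0 \<and> ball (fst i) (snd i) \<subseteq> U}"
  have "\<exists>i. i \<in> ?K \<and> x \<in> ball (fst i) (snd i) \<and> snd i < d" if x: "x \<in> U" "d > 0" for x d
  proof -
    obtain e where e: "e > 0" "ball x e \<subseteq> U" using U x openE by blast
    have "ball x (min e (d / 2)) \<subseteq> U" using e(2) by auto
    then show ?thesis using e x by (intro exI[of _ "(x, min e (d / 2))"]) auto
  qed
  \<comment> \<open>By Vitali, disjoint balls exhaust the open set up to a null set. A ball of
    radius \<open>r\<close> is mapped into a ball of radius \<open>L r\<close>, larger in volume by
    the factor \<open>L^d\<close>, and the exceptional set has a null image.\<close>
  then obtain C where C: "countable C" "C \<subseteq> ?K"
    and disj: "pairwise (\<lambda>i j. disjnt (ball (fst i) (snd i)) (ball (fst j) (snd j))) C"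
    and neg: "negligible (U - (\<Union>i\<in>C. ball (fst i) (snd i)))"
    by (rule Vitali_covering_theorem_balls[of U ?K fst snd])
  \<comment> \<open>Each \<open>I n\<close> is a singleton or empty: an enumeration of the countable
    family that also works when it is finite.\<close>
  define I where "I n = {i \<in> C. to_nat_on C i = n}" for n
  define B where "B n = (\<Union>i\<in>I n. ball (fst i) (snd i))" for n
  define D where "D n = (\<Union>i\<in>I n. cball (\<phi> (fst i)) (L * snd i))" for n
  define N where "N = U - (\<Union>i\<in>C. ball (fst i) (snd i))"
  have I: "I n = {} \<or> (\<exists>i\<in>C. I n = {i})" for n
  proof (cases "I n = {}")
    case False
    then obtain i where i: "i \<in> C" "to_nat_on C i = n" by (auto simp: I_def)
    have "j = i" if "j \<in> I n" for j
      using that i inj_onD[OF inj_on_to_nat_on[OF C(1)], of j i] by (simp add: I_def)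
    moreover have "i \<in> I n" using i by (simp add: I_def)
    ultimately have "I n = {i}" by blast
    with i show ?thesis by blast
  qed simp
  have UB: "(\<Union>n. B n) = (\<Union>i\<in>C. ball (fst i) (snd i))"
    by (auto simp: B_def I_def)
  have BU: "(\<Union>n. B n) \<subseteq> U"
    unfolding UB using C(2) by auto
  have "disjoint_family B"
    unfolding disjoint_family_on_def
  proof (intro ballI impI)
    fix m n :: nat assume "m \<noteq> n"
    have "disjnt (ball (fst i) (snd i)) (ball (fst j) (snd j))" if "i \<in> I m" "j \<in> I n" for i j
      using that \<open>m \<noteq> n\<close> pairwiseD[OF disj, of i j] by (auto simp: I_def)
    then show "B m \<inter> B n = {}" unfolding B_def disjnt_def by blast
  qed
  have DB: "emeasure lborel (D n) \<le> ennreal (L ^ DIM('a)) * emeasure lborel (B n)" for n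
  proof (cases "I n = {}")
    case False
    then obtain i where i: "i \<in> C" "I n = {i}" using I by blast
    then have r: "snd i > 0" using C(2) by auto
    have "emeasure lborel (D n) = ennreal (unit_ball_vol (real DIM('a)) * (L * snd i) ^ DIM('a))"
      using r L by (simp add: D_def i(2) emeasure_cball)
    also have "\<dots> = ennreal (L ^ DIM('a)) * emeasure lborel (B n)"
      using r L by (simp add: B_def i(2) emeasure_ball power_mult_distrib mult_ac flip: ennreal_mult)
    finally show ?thesis by simp
  qed (simp add: D_def)
  have negN: "negligible (\<phi> ` N)"
  proof (rule negligible_locally_Lipschitz_image)
    show "negligible N" unfolding N_def by (rule neg)
    fix x assume x: "x \<in> N"
    then have "norm (\<phi> y - \<phi> x) \<le> L * norm (y - x)" if "y \<in> N \<inter> UNIV" for y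
      using that lip[of y x] by (auto simp: N_def dist_norm)
    then show "\<exists>T B. open T \<and> x \<in> T \<and> (\<forall>y\<in>N \<inter> T. norm (\<phi> y - \<phi> x) \<le> B * norm (y - x))"
      by (intro exI[of _ UNIV] exI[of _ L]) auto
  qed simp
  have "\<phi> ` U \<subseteq> \<phi> ` N \<union> (\<Union>n. D n)"
  proof (rule image_subsetI)
    fix x assume x: "x \<in> U"
    show "\<phi> x \<in> \<phi> ` N \<union> (\<Union>n. D n)"
    proof (cases "x \<in> N")
      case False
      then obtain i where i: "i \<in> C" "x \<in> ball (fst i) (snd i)" using x by (auto simp: N_def)
      then have "fst i \<in> U" using C(2) by force
      then have "dist (\<phi> (fst i)) (\<phi> x) \<le> L * dist (fst i) x" using lip x by blast
      also have "\<dots> \<le> L * snd i" using i L by (intro mult_left_mono) auto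
      finally have "\<phi> x \<in> cball (\<phi> (fst i)) (L * snd i)" by simp
      moreover have "i \<in> I (to_nat_on C i)" using i by (simp add: I_def)
      ultimately have "\<phi> x \<in> D (to_nat_on C i)" unfolding D_def by blast
      then show ?thesis by blast
    qed auto
  qed
  have Ns: "\<phi> ` N \<in> sets lebesgue" "emeasure lebesgue (\<phi> ` N) = 0"
    using negN by (auto simp: negligible_iff_null_sets)
  have Ds: "D n \<in> sets lborel" for n
    using I[of n] by (auto simp: D_def)
  have Bs: "B n \<in> sets lborel" for n
    using I[of n] by (auto simp: B_def)
  have "emeasure lborel (\<phi> ` U) = emeasure lebesgue (\<phi> ` U)"
    using meas by (simp add: emeasure_completion)
  also have "\<dots> \<le> emeasure lebesgue (\<phi> ` N \<union> (\<Union>n. D n))"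
    using Ds Ns \<open>\<phi> ` U \<subseteq> _\<close> by (intro emeasure_mono) auto
  also have "\<dots> \<le> emeasure lebesgue (\<phi> ` N) + emeasure lebesgue (\<Union>n. D n)"
    using Ds Ns by (intro emeasure_subadditive) auto
  also have "\<dots> = emeasure lborel (\<Union>n. D n)"
    using Ds Ns by (simp add: emeasure_completion sets.countable_UN)
  also have "\<dots> \<le> (\<Sum>n. emeasure lborel (D n))"
    using Ds by (intro emeasure_subadditive_countably) auto
  also have "\<dots> \<le> (\<Sum>n. ennreal (L ^ DIM('a)) * emeasure lborel (B n))"
    by (intro suminf_le DB) auto
  also have "\<dots> = ennreal (L ^ DIM('a)) * (\<Sum>n. emeasure lborel (B n))"
    by (rule ennreal_suminf_cmult)
  also have "(\<Sum>n. emeasure lborel (B n)) = emeasure lborel (\<Union>n. B n)"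
    using Bs \<open>disjoint_family B\<close> by (intro suminf_emeasure) auto
  also have "\<dots> \<le> emeasure lborel U"
    using U BU by (intro emeasure_mono) auto
  finally show ?thesis by (simp add: mult_left_mono)
qed

text \<open>The push-forward \<nu> of Lebesgue measure on \<open>B\<close> under \<psi> gives
  \<open>S\<close> the measure of the \<phi>-image of \<open>S \<inter> A\<close>. It is dominated
  by \<open>L^d\<close> times Lebesgue measure on \<open>A\<close>, for open sets by the image
  estimate and for Borel sets by outer regularity; integrals of nonnegative functions
  follow.\<close>

lemma nn_integral_lipschitz_le:
  fixes \<phi> \<psi> :: "'a::euclidean_space \<Rightarrow> 'a" and H :: "'a \<Rightarrow> ennreal"
  assumes A: "open A" and B: "open B" and L: "L > 0"
    and \<phi>: "\<And>x. x \<in> A \<Longrightarrow> \<phi> x \<in> B \<and> \<psi> (\<phi> x) = x"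
    and \<psi>: "\<And>y. y \<in> B \<Longrightarrow> \<psi> y \<in> A \<and> \<phi> (\<psi> y) = y"
    and lip: "\<And>x y. x \<in> A \<Longrightarrow> y \<in> A \<Longrightarrow> dist (\<phi> x) (\<phi> y) \<le> L * dist x y"
    and cont: "continuous_on B \<psi>"
    and H: "H \<in> borel_measurable borel"
  shows "(\<integral>\<^sup>+y. H (\<psi> y) * indicator B y \<partial>lborel)
    \<le> ennreal (L ^ DIM('a)) * (\<integral>\<^sup>+x. H x * indicator A x \<partial>lborel)"
proof -
  let ?C = "ennreal (L ^ DIM('a))"
  have m\<psi>: "\<psi> \<in> borel_measurable (restrict_space lborel B)"
    using borel_measurable_continuous_on_restrict[OF cont] by (simp add: measurable_def space_restrict_space sets_restrict_space)
  define \<nu> where "\<nu> = distr (restrict_space lborel B) borel \<psi>"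
  have em: "emeasure \<nu> S = emeasure lborel (\<psi> -` S \<inter> B)" if "S \<in> sets borel" for S
    unfolding \<nu>_def using that m\<psi> B
    by (subst emeasure_distr) (auto simp: space_restrict_space emeasure_restrict_space)
  have img: "\<psi> -` S \<inter> B = \<phi> ` (S \<inter> A)" for S
  proof
    show "\<psi> -` S \<inter> B \<subseteq> \<phi> ` (S \<inter> A)"
    proof
      fix y assume y: "y \<in> \<psi> -` S \<inter> B"
      then have "y = \<phi> (\<psi> y)" "\<psi> y \<in> S \<inter> A" using \<psi>[of y] by auto
      then show "y \<in> \<phi> ` (S \<inter> A)" by (rule image_eqI)
    qed
    show "\<phi> ` (S \<inter> A) \<subseteq> \<psi> -` S \<inter> B"
      using \<phi> by auto
  qed
  have open_le: "emeasure \<nu> S \<le> ?C * emeasure lborel (S \<inter> A)" if S: "open S" for S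
  proof -
    have "emeasure \<nu> S = emeasure lborel (\<phi> ` (S \<inter> A))"
      using em[of S] S by (simp add: img)
    also have "\<dots> \<le> ?C * emeasure lborel (S \<inter> A)"
    proof (rule emeasure_lipschitz_image_le[OF _ L])
      have "open (\<psi> -` S \<inter> B)"
        using continuous_open_preimage[OF cont B S] by (simp add: Int_commute)
      then show "\<phi> ` (S \<inter> A) \<in> sets borel" by (simp add: img)
    qed (use A S lip in auto)
    finally show ?thesis .
  qed
  have borel_le: "emeasure \<nu> S \<le> ?C * emeasure lborel (S \<inter> A)" if S: "S \<in> sets borel" for S
  proof (cases "emeasure lborel (S \<inter> A) = \<infinity>")
    case True
    then show ?thesis using L by (simp add: ennreal_mult_top)
  next
    case False
    show ?thesis
    proof (rule ennreal_le_epsilon)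
      fix e :: real assume e: "e > 0"
      define \<epsilon> where "\<epsilon> = e / L ^ DIM('a)"
      have \<epsilon>: "\<epsilon> > 0" using e L by (simp add: \<epsilon>_def)
      have "S \<inter> A \<in> sets lebesgue" using S A by auto
      then obtain T where T: "open T" "S \<inter> A \<subseteq> T" "T - (S \<inter> A) \<in> lmeasurable"
        "emeasure lebesgue (T - (S \<inter> A)) < ennreal \<epsilon>"
        using sets_lebesgue_outer_open[OF _ \<epsilon>] by metis
      have TS: "T - (S \<inter> A) \<in> sets borel" using T(1) S A by auto
      have "emeasure \<nu> S \<le> emeasure \<nu> (T \<inter> A)"
      proof -
        have "emeasure \<nu> S = emeasure lborel (\<phi> ` (S \<inter> A))" using em[OF S] by (simp add: img)
        also have "\<dots> \<le> emeasure lborel (\<phi> ` (T \<inter> A))"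
        proof (rule emeasure_mono)
          have "open (\<psi> -` T \<inter> B)"
            using continuous_open_preimage[OF cont B T(1)] by (simp add: Int_commute)
          then show "\<phi> ` (T \<inter> A) \<in> sets lborel" by (simp add: img)
        qed (use T(2) in auto)
        also have "\<dots> = emeasure \<nu> (T \<inter> A)"
          using em[of "T \<inter> A"] T(1) A unfolding img by (simp add: Int_assoc)
        finally show ?thesis .
      qed
      also have "\<dots> \<le> ?C * emeasure lborel (T \<inter> A \<inter> A)" using T(1) A by (intro open_le) auto
      also have "\<dots> \<le> ?C * (emeasure lborel (S \<inter> A) + emeasure lborel (T - (S \<inter> A)))"
      proof (rule mult_left_mono)
        have "emeasure lborel (T \<inter> A \<inter> A) \<le> emeasure lborel ((S \<inter> A) \<union> (T - (S \<inter> A)))"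
          using T S A by (intro emeasure_mono) auto
        also have "\<dots> \<le> emeasure lborel (S \<inter> A) + emeasure lborel (T - (S \<inter> A))"
          using S A TS by (intro emeasure_subadditive) auto
        finally show "emeasure lborel (T \<inter> A \<inter> A) \<le> emeasure lborel (S \<inter> A) + emeasure lborel (T - (S \<inter> A))" .
      qed simp
      also have "\<dots> \<le> ?C * (emeasure lborel (S \<inter> A) + ennreal \<epsilon>)"
        using T(4) TS by (intro mult_left_mono add_left_mono) (auto simp: emeasure_completion)
      also have "\<dots> = ?C * emeasure lborel (S \<inter> A) + ennreal e"
        using L \<epsilon> by (simp add: distrib_left \<epsilon>_def flip: ennreal_mult)
      finally show "emeasure \<nu> S \<le> ?C * emeasure lborel (S \<inter> A) + ennreal e" .
    qed
  qed
  have [measurable]: "A \<in> sets borel" using A by simp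
  have mD: "(\<lambda>x. ?C * indicator A x) \<in> borel_measurable lborel" by measurable
  let ?D = "density lborel (\<lambda>x. ?C * indicator A x)"
  have "\<nu> \<le> ?D"
  proof (rule le_measure[THEN iffD2], goal_cases)
    case 1 then show ?case by (simp add: \<nu>_def)
  next
    case 2
    show ?case
    proof
      fix S assume "S \<in> sets \<nu>"
      then have S: "S \<in> sets borel" by (simp add: \<nu>_def)
      have "emeasure ?D S = (\<integral>\<^sup>+x. ?C * indicator (S \<inter> A) x \<partial>lborel)"
        unfolding emeasure_density[OF mD, of S, simplified, OF S]
        by (intro nn_integral_cong) (auto simp: indicator_def)
      also have "\<dots> = ?C * emeasure lborel (S \<inter> A)"
        using S A by (subst nn_integral_cmult) auto
      finally show "emeasure \<nu> S \<le> emeasure ?D S" using borel_le[OF S] by simp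
    qed
  qed
  have "(\<integral>\<^sup>+y. H (\<psi> y) * indicator B y \<partial>lborel) = (\<integral>\<^sup>+y. H (\<psi> y) \<partial>restrict_space lborel B)"
    using B by (subst nn_integral_restrict_space) auto
  also have "\<dots> = (\<integral>\<^sup>+x. H x \<partial>\<nu>)"
    unfolding \<nu>_def using m\<psi> H by (subst nn_integral_distr) auto
  also have "\<dots> \<le> (\<integral>\<^sup>+x. H x \<partial>?D)"
    using \<open>\<nu> \<le> ?D\<close> by (intro nn_integral_mono_measure) (auto simp: \<nu>_def)
  also have "\<dots> = (\<integral>\<^sup>+x. ?C * (H x * indicator A x) \<partial>lborel)"
    using H A by (subst nn_integral_density) (auto simp: mult_ac)
  also have "\<dots> = ?C * (\<integral>\<^sup>+x. H x * indicator A x \<partial>lborel)"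
    using H A by (intro nn_integral_cmult) auto
  finally show ?thesis .
qed

lemma l2norm_lipschitz_le:
  fixes \<phi> \<psi> :: "real^'n \<Rightarrow> real^'n" and f :: "real^'n \<Rightarrow> real"
  assumes A: "open A" and B: "open B" and L: "L > 0"
    and \<phi>: "\<And>x. x \<in> A \<Longrightarrow> \<phi> x \<in> B \<and> \<psi> (\<phi> x) = x"
    and \<psi>: "\<And>y. y \<in> B \<Longrightarrow> \<psi> y \<in> A \<and> \<phi> (\<psi> y) = y"
    and lip: "\<And>x y. x \<in> A \<Longrightarrow> y \<in> A \<Longrightarrow> dist (\<phi> x) (\<phi> y) \<le> L * dist x y"
    and cont: "continuous_on B \<psi>" and f: "continuous_on A f"
    and int: "sq_integrable (lebesgue_on A) f"
  shows "l2norm (lebesgue_on B) (\<lambda>y. f (\<psi> y)) \<le> sqrt (L ^ CARD('n)) * l2norm (lebesgue_on A) f"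
proof -
  \<comment> \<open>Cutting off with the indicator gives an integrand that is Borel on the whole
    space, whereas \<open>f\<close> is controlled only on \<open>A\<close>.\<close>
  define H where "H = (\<lambda>x. ennreal ((f x)\<^sup>2) * indicator A x)"
  have "(\<lambda>x. indicator A x *\<^sub>R (f x)\<^sup>2) \<in> borel_measurable borel"
    using f A by (intro borel_measurable_continuous_on_indicator continuous_intros) auto
  then have "(\<lambda>x. ennreal (indicator A x *\<^sub>R (f x)\<^sup>2)) \<in> borel_measurable borel" by measurable
  moreover have "(\<lambda>x. ennreal (indicator A x *\<^sub>R (f x)\<^sup>2)) = H"
    by (auto simp: H_def indicator_def)
  ultimately have mH: "H \<in> borel_measurable borel" by (simp only:)
  have mB: "(\<lambda>y. (f (\<psi> y))\<^sup>2) \<in> borel_measurable (lebesgue_on B)"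
    using \<psi> B by (intro continuous_imp_measurable_on_sets_lebesgue continuous_on_power
        continuous_on_compose2[OF f cont]) auto
  have nnA: "(\<integral>\<^sup>+x. ennreal ((f x)\<^sup>2) \<partial>lebesgue_on A) = (\<integral>\<^sup>+x. H x * indicator A x \<partial>lborel)"
  proof -
    have "(\<integral>\<^sup>+x. ennreal ((f x)\<^sup>2) \<partial>lebesgue_on A) = (\<integral>\<^sup>+x. ennreal ((f x)\<^sup>2) * indicator A x \<partial>lebesgue)"
      using A by (subst nn_integral_restrict_space) auto
    also have "\<dots> = (\<integral>\<^sup>+x. H x * indicator A x \<partial>lebesgue)"
      by (intro nn_integral_cong) (auto simp: H_def indicator_def)
    also have "\<dots> = (\<integral>\<^sup>+x. H x * indicator A x \<partial>lborel)"
      by (rule nn_integral_completion)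
    finally show ?thesis .
  qed
  have nnB: "(\<integral>\<^sup>+y. ennreal ((f (\<psi> y))\<^sup>2) \<partial>lebesgue_on B) = (\<integral>\<^sup>+y. H (\<psi> y) * indicator B y \<partial>lborel)"
  proof -
    have "(\<integral>\<^sup>+y. ennreal ((f (\<psi> y))\<^sup>2) \<partial>lebesgue_on B) = (\<integral>\<^sup>+y. ennreal ((f (\<psi> y))\<^sup>2) * indicator B y \<partial>lebesgue)"
      using B by (subst nn_integral_restrict_space) auto
    also have "\<dots> = (\<integral>\<^sup>+y. H (\<psi> y) * indicator B y \<partial>lebesgue)"
      using \<psi> by (intro nn_integral_cong) (auto simp: H_def indicator_def)
    also have "\<dots> = (\<integral>\<^sup>+y. H (\<psi> y) * indicator B y \<partial>lborel)"
      by (rule nn_integral_completion)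
    finally show ?thesis .
  qed
  have "(l2norm (lebesgue_on B) (\<lambda>y. f (\<psi> y)))\<^sup>2 = enn2real (\<integral>\<^sup>+y. ennreal ((f (\<psi> y))\<^sup>2) \<partial>lebesgue_on B)"
    unfolding l2norm_square using mB by (subst integral_eq_nn_integral) auto
  also have "\<dots> \<le> enn2real (ennreal (L ^ CARD('n)) * (\<integral>\<^sup>+x. ennreal ((f x)\<^sup>2) \<partial>lebesgue_on A))"
  proof (rule enn2real_mono)
    show "(\<integral>\<^sup>+y. ennreal ((f (\<psi> y))\<^sup>2) \<partial>lebesgue_on B)
        \<le> ennreal (L ^ CARD('n)) * (\<integral>\<^sup>+x. ennreal ((f x)\<^sup>2) \<partial>lebesgue_on A)"
      unfolding nnA nnB using nn_integral_lipschitz_le[OF A B L \<phi> \<psi> lip cont mH] by simp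
    have "(\<integral>\<^sup>+x. ennreal ((f x)\<^sup>2) \<partial>lebesgue_on A) = ennreal (\<integral>x. (f x)\<^sup>2 \<partial>lebesgue_on A)"
      using int by (intro nn_integral_eq_integral) (auto simp: sq_integrable_def)
    then show "ennreal (L ^ CARD('n)) * (\<integral>\<^sup>+x. ennreal ((f x)\<^sup>2) \<partial>lebesgue_on A) < top"
      by (simp add: ennreal_mult_less_top)
  qed
  also have "\<dots> = L ^ CARD('n) * (l2norm (lebesgue_on A) f)\<^sup>2"
    unfolding l2norm_square using L int
    by (subst integral_eq_nn_integral) (auto simp: sq_integrable_def enn2real_mult)
  also have "\<dots> = (sqrt (L ^ CARD('n)) * l2norm (lebesgue_on A) f)\<^sup>2"
    using L by (simp add: power_mult_distrib)
  finally show ?thesis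
    by (rule power2_le_imp_le) (use L in simp)
qed

section \<open>Radial deformation of a ball into a convex domain\<close>

text \<open>A polynomial outer function allows induction on its construction; the solution space on
  the ball consists of polynomials.\<close>

lemma smooth_poly_compose:
  assumes "real_polynomial_function p" and \<Psi>: "\<And>l. smooth (\<lambda>x. \<Psi> x $ l)"
  shows "smooth (\<lambda>x. p (\<Psi> x))"
  using assms(1)
proof (induction rule: real_polynomial_function.induct)
  case (linear f)
  have "f (\<Psi> x) = (\<Sum>i\<in>UNIV. f (axis i 1) * \<Psi> x $ i)" for x
  proof -
    have "(\<Sum>i\<in>UNIV. \<Psi> x $ i *\<^sub>R axis i 1) = \<Psi> x"
      using basis_expansion[of "\<Psi> x"] by (simp only: scalar_mult_eq_scaleR)
    then have "f (\<Psi> x) = f (\<Sum>i\<in>UNIV. \<Psi> x $ i *\<^sub>R axis i 1)" by (simp only:)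
    also have "\<dots> = (\<Sum>i\<in>UNIV. f (axis i 1) * \<Psi> x $ i)"
      unfolding linear_sum[OF bounded_linear.linear[OF linear]] linear_cmul[OF bounded_linear.linear[OF linear]]
      by (simp add: mult.commute)
    finally show ?thesis .
  qed
  moreover have "smooth (\<lambda>x. \<Sum>i\<in>UNIV. f (axis i 1) * \<Psi> x $ i)"
    by (intro smooth_intros \<Psi>)
  ultimately show ?case by (simp only:)
qed (auto intro: smooth_intros)

lemma partial_polynomial: "real_polynomial_function p \<Longrightarrow> real_polynomial_function (partial i p)"
  using polynomial_in_polys partial_polys polys_polynomial by blast

text \<open>Along the line through \<open>x\<close> in direction \<xi> the tangent inequalities at 0
  and at \<open>t\<close> show that the derivative increases; its difference quotients from the
  right are therefore nonnegative.\<close>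

lemma smooth_convex_hessian_nonneg:
  fixes F :: "real^'n \<Rightarrow> real" and \<xi> :: "'n \<Rightarrow> real"
  assumes F: "smooth F" and cvx: "convex_on UNIV F"
  shows "0 \<le> (\<Sum>i\<in>UNIV. \<Sum>j\<in>UNIV. partial i (partial j F) x * \<xi> i * \<xi> j)"
proof -
  define v :: "real^'n" where "v = (\<chi> i. \<xi> i)"
  let ?f = "\<lambda>t. F (x + t *\<^sub>R v)"
  let ?f' = "\<lambda>t. \<Sum>j\<in>UNIV. \<xi> j * partial j F (x + t *\<^sub>R v)"
  have d1: "(?f has_real_derivative ?f' t) (at t)" for t
    using DERIV_along_line[OF F, of x v t] by (simp add: v_def mult.commute)
  have sF': "smooth (\<lambda>y. \<Sum>j\<in>UNIV. \<xi> j * partial j F y)"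
    by (intro smooth_intros F)
  have d2: "(?f' has_real_derivative
      (\<Sum>i\<in>UNIV. \<Sum>j\<in>UNIV. partial i (partial j F) x * \<xi> i * \<xi> j)) (at 0)"
    using DERIV_along_line[OF sF', of x v 0]
    by (simp add: v_def partial_sum partial_cmult smooth_partial F smooth_cmult sum_distrib_left
        sum_distrib_right mult_ac)
  have cf: "convex_on UNIV ?f"
  proof (rule convex_onI)
    fix t a b :: real assume t: "0 < t" "t < 1"
    have "x + ((1 - t) *\<^sub>R a + t *\<^sub>R b) *\<^sub>R v = (1 - t) *\<^sub>R (x + a *\<^sub>R v) + t *\<^sub>R (x + b *\<^sub>R v)"
      by (simp add: algebra_simps)
    then show "?f ((1 - t) *\<^sub>R a + t *\<^sub>R b) \<le> (1 - t) * ?f a + t * ?f b"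
      using convex_onD[OF cvx, of t "x + a *\<^sub>R v" "x + b *\<^sub>R v"] t by simp
  qed simp
  have mono: "0 \<le> ?f' t - ?f' 0" if "t > 0" for t
  proof -
    have "?f t - ?f 0 \<ge> ?f' 0 * (t - 0)"
      by (rule convex_on_imp_above_tangent[OF cf]) (use d1[of 0] in auto)
    moreover have "?f 0 - ?f t \<ge> ?f' t * (0 - t)"
      by (rule convex_on_imp_above_tangent[OF cf]) (use d1[of t] in auto)
    ultimately have "0 \<le> (?f' t - ?f' 0) * t" by (simp add: algebra_simps)
    with that show ?thesis by (simp add: zero_le_mult_iff)
  qed
  have "((\<lambda>h. (?f' (0 + h) - ?f' 0) / h) \<longlongrightarrow>
      (\<Sum>i\<in>UNIV. \<Sum>j\<in>UNIV. partial i (partial j F) x * \<xi> i * \<xi> j)) (at_right 0)"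
    using d2 unfolding DERIV_def by (rule filterlim_mono) (auto simp: at_le)
  then show ?thesis
  proof (rule tendsto_lowerbound)
    show "\<forall>\<^sub>F h in at_right 0. 0 \<le> (?f' (0 + h) - ?f' 0) / h"
      unfolding eventually_at_right_field using mono by (intro exI[of _ 1]) auto
  qed simp
qed

lemma convex_on_square:
  assumes f: "convex_on A f" and nonneg: "\<And>x. x \<in> A \<Longrightarrow> 0 \<le> f x"
  shows "convex_on A (\<lambda>x. (f x)\<^sup>2)"
proof (rule convex_onI)
  fix t :: real and x y assume t: "0 < t" "t < 1" and xy: "x \<in> A" "y \<in> A"
  have "(1 - t) *\<^sub>R x + t *\<^sub>R y \<in> A"
    using convex_on_imp_convex[OF f] xy t by (intro convexD) auto
  then have "(f ((1 - t) *\<^sub>R x + t *\<^sub>R y))\<^sup>2 \<le> ((1 - t) * f x + t * f y)\<^sup>2"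
    using convex_onD[OF f, of t x y] t xy nonneg by (intro power_mono) auto
  also have "\<dots> = (1 - t) * (f x)\<^sup>2 + t * (f y)\<^sup>2 - t * (1 - t) * (f x - f y)\<^sup>2"
    by (simp add: power2_eq_square algebra_simps)
  also have "\<dots> \<le> (1 - t) * (f x)\<^sup>2 + t * (f y)\<^sup>2"
    using t by simp
  finally show "(f ((1 - t) *\<^sub>R x + t *\<^sub>R y))\<^sup>2 \<le> (1 - t) * (f x)\<^sup>2 + t * (f y)\<^sup>2" .
qed (rule convex_on_imp_convex[OF f])

definition grad :: "(real^'n \<Rightarrow> real) \<Rightarrow> real^'n \<Rightarrow> real^'n" where
  "grad v x = (\<chi> i. partial i v x)"

lemma continuous_grad: "smooth v \<Longrightarrow> continuous_on A (grad v)"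
  unfolding grad_def by (intro continuous_on_vec_lambda smooth_continuous smooth_partial)

lemma norm_vec_square:
  fixes f :: "'n::finite \<Rightarrow> real"
  shows "(norm (\<chi> i. f i))\<^sup>2 = (\<Sum>i\<in>UNIV. (f i)\<^sup>2)"
  by (simp add: norm_vec_def L2_set_def sum_nonneg)

text \<open>The deformation is \<open>Psi k x = (c + k E x) (x - x0)\<close> for \<open>k\<close> in
  [0,1]. At \<open>k = 0\<close> the set where |Psi k| < 1 is a ball of radius \<open>1 / c\<close>;
  at \<open>k = 1\<close> it is the approximating domain. Convexity of |x - x0| E makes |Psi k|
  convex, so all intermediate domains are convex and one estimate serves them all.\<close>

locale star_map =
  fixes x0 :: "real^'n" and c :: real and E :: "real^'n \<Rightarrow> real"
  assumes c: "c > 0" and smooth_E: "smooth E" and E_nonneg: "E x \<ge> 0"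
    and convex_S: "convex_on UNIV (\<lambda>x. norm (x - x0) * E x)"
begin

definition g :: "real \<Rightarrow> real^'n \<Rightarrow> real" where
  "g k x = c + k * E x"

definition Psi :: "real \<Rightarrow> real^'n \<Rightarrow> real^'n" where
  "Psi k x = g k x *\<^sub>R (x - x0)"

definition wk :: "real \<Rightarrow> real^'n \<Rightarrow> real" where
  "wk k x = ball_fun (Psi k x)"

lemma g_ge: "k \<ge> 0 \<Longrightarrow> g k x \<ge> c"
  using E_nonneg by (simp add: g_def)

lemma g_pos: "k \<ge> 0 \<Longrightarrow> g k x > 0"
  using g_ge c by (meson less_le_trans)

text \<open>The convex function |x - x0| E vanishes at \<open>x0\<close>, hence grows at least
  linearly along rays; dividing by the distance leaves a nondecreasing \<open>E\<close>.\<close>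

lemma E_ray:
  assumes "0 < t" "t \<le> 1"
  shows "E (x0 + t *\<^sub>R X) \<le> E (x0 + X)"
proof (cases "X = 0")
  case False
  have "(1 - t) *\<^sub>R x0 + t *\<^sub>R (x0 + X) = x0 + t *\<^sub>R X" by (simp add: algebra_simps)
  then have "norm (t *\<^sub>R X) * E (x0 + t *\<^sub>R X) \<le> t * (norm X * E (x0 + X))"
    using convex_onD[OF convex_S, of t x0 "x0 + X"] assms by simp
  with False assms show ?thesis by simp
qed simp

lemma norm_Psi:
  assumes "k \<ge> 0"
  shows "norm (Psi k x) = c * norm (x - x0) + k * (norm (x - x0) * E x)"
proof -
  have "norm (Psi k x) = g k x * norm (x - x0)"
    using g_pos[OF assms, of x] by (simp add: Psi_def)
  then show ?thesis by (simp add: g_def algebra_simps)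
qed

lemma norm_Psi_ge: "k \<ge> 0 \<Longrightarrow> c * norm (x - x0) \<le> norm (Psi k x)"
  using E_nonneg by (simp add: norm_Psi)

lemma norm_Psi_le_1:
  assumes "k \<ge> 0" "norm (Psi k x) \<le> 1"
  shows "x \<in> cball x0 (1 / c)"
  using norm_Psi_ge[OF assms(1), of x] assms(2) c
  by (simp add: dist_norm norm_minus_commute field_simps)

lemma convex_norm_Psi:
  assumes "k \<ge> 0"
  shows "convex_on UNIV (\<lambda>x. norm (Psi k x))"
proof -
  have "convex_on UNIV (\<lambda>x. norm (x - x0))"
    using convex_on_dist[of UNIV x0] by (simp add: dist_norm norm_minus_commute)
  then have "convex_on UNIV (\<lambda>x. c * norm (x - x0) + k * (norm (x - x0) * E x))"
    using c assms convex_S by (intro convex_on_add convex_on_cmul) auto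
  then show ?thesis by (simp add: norm_Psi assms)
qed

text \<open>Equal images force \<open>x\<close> and \<open>y\<close> onto one ray. The point with
  the larger \<open>g\<close> is the nearer one to \<open>x0\<close>, but \<open>E\<close> and hence
  \<open>g\<close> does not decrease along rays, so the two values of \<open>g\<close>
  agree.\<close>

lemma Psi_inj:
  assumes k: "k \<ge> 0" and eq: "Psi k x = Psi k y"
  shows "x = y"
proof -
  have main: "x = y" if eq: "Psi k x = Psi k y" and le: "g k y \<le> g k x" for x y
  proof -
    define s where "s = g k y / g k x"
    have s: "0 < s" "s \<le> 1" using g_pos[OF k, of x] g_pos[OF k, of y] le by (auto simp: s_def)
    have "g k x *\<^sub>R (x - x0) = g k x *\<^sub>R (s *\<^sub>R (y - x0))"
      using eq g_pos[OF k, of x] by (simp add: Psi_def s_def)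
    then have X: "x - x0 = s *\<^sub>R (y - x0)"
      using g_pos[OF k, of x] unfolding scaleR_cancel_left by auto
    then have "x = x0 + s *\<^sub>R (y - x0)" by (simp add: algebra_simps)
    then have "E x \<le> E y" using E_ray[OF s, of "y - x0"] by simp
    then have "g k x \<le> g k y" using k by (simp add: g_def mult_left_mono)
    with le have "g k x = g k y" by simp
    then have "s = 1" using g_pos[OF k, of x] by (simp add: s_def)
    with X show ?thesis by simp
  qed
  show ?thesis
    using main[OF eq] main[OF eq[symmetric]] by (cases "g k y \<le> g k x") auto
qed

lemma smooth_g: "smooth (g k)"
  unfolding g_def[abs_def] by (intro smooth_intros smooth_E)

lemma continuous_Psi: "continuous_on A (Psi k)"
  unfolding Psi_def[abs_def] by (intro continuous_intros smooth_continuous smooth_g)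

text \<open>Intermediate value theorem along the ray in direction \<open>y\<close>:
  \<open>t * g\<close> reaches 1 no later than \<open>t = 1 / c\<close>, because \<open>g\<close> is
  at least \<open>c\<close>.\<close>

lemma Psi_surj:
  assumes k: "k \<ge> 0"
  shows "\<exists>x. Psi k x = y"
proof -
  define f where "f t = t * g k (x0 + t *\<^sub>R y)" for t
  have "continuous_on {0..1/c} f"
    unfolding f_def
    by (intro continuous_intros continuous_on_compose2[OF smooth_continuous[OF smooth_g[of k], of UNIV]]) auto
  moreover have "f 0 \<le> 1" by (simp add: f_def)
  moreover have "1 \<le> f (1/c)"
    using g_ge[OF k, of "x0 + (1/c) *\<^sub>R y"] c by (simp add: f_def field_simps)
  ultimately obtain t where t: "f t = 1"
    using IVT'[of f 0 1 "1/c"] c by auto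
  have "Psi k (x0 + t *\<^sub>R y) = y"
    using t by (simp add: Psi_def f_def mult.commute)
  then show ?thesis by blast
qed

definition Phi :: "real \<Rightarrow> real^'n \<Rightarrow> real^'n" where
  "Phi k y = (THE x. Psi k x = y)"

lemma Psi_Phi [simp]:
  assumes k: "k \<ge> 0"
  shows "Psi k (Phi k y) = y"
proof -
  from Psi_surj[OF k, of y] obtain x where x: "Psi k x = y" by auto
  have "(THE x. Psi k x = y) = x"
  proof (rule the_equality)
    fix z assume "Psi k z = y"
    with x show "z = x" by (simp add: Psi_inj[OF k, of z x])
  qed (rule x)
  then have "Phi k y = x" by (simp only: Phi_def)
  then show ?thesis using x by simp
qed

lemma Phi_Psi [simp]: "k \<ge> 0 \<Longrightarrow> Phi k (Psi k x) = x"
  using Psi_inj[of k "Phi k (Psi k x)" x] by simp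

lemma continuous_snd_smooth: "smooth f \<Longrightarrow> continuous_on A (\<lambda>p. f (snd p))"
  by (intro continuous_on_compose2[OF smooth_continuous[of f UNIV]] continuous_intros) auto

text \<open>A continuous injection on a compact set has a continuous inverse; carrying
  \<open>k\<close> as a coordinate gives continuity in both variables, from which uniform continuity
  of the coefficients in \<open>k\<close> will follow.\<close>

lemma continuous_Phi_joint:
  "continuous_on ({0..1} \<times> cball 0 1) (\<lambda>p. Phi (fst p) (snd p))"
proof -
  let ?M = "{0..1::real} \<times> cball x0 (1 / c)"
  let ?T = "\<lambda>p. (fst p, Psi (fst p) (snd p))"
  have "continuous_on ?M ?T"
    unfolding Psi_def g_def
    by (intro continuous_intros continuous_snd_smooth smooth_E)
  moreover have "compact ?M" by (intro compact_Times) auto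
  ultimately have "continuous_on (?T ` ?M) (\<lambda>p. (fst p, Phi (fst p) (snd p)))"
    by (rule continuous_on_inv) auto
  moreover have "{0..1} \<times> cball 0 1 \<subseteq> ?T ` ?M"
  proof
    fix p :: "real \<times> (real^'n)" assume p: "p \<in> {0..1} \<times> cball 0 1"
    then have "Phi (fst p) (snd p) \<in> cball x0 (1 / c)"
      by (intro norm_Psi_le_1[of "fst p"]) auto
    with p show "p \<in> ?T ` ?M"
      by (intro image_eqI[of _ _ "(fst p, Phi (fst p) (snd p))"]) auto
  qed
  ultimately have "continuous_on ({0..1} \<times> cball 0 1) (\<lambda>p. (fst p, Phi (fst p) (snd p)))"
    by (rule continuous_on_subset)
  from continuous_on_snd[OF this] show ?thesis by simp
qed

lemma continuous_Phi:
  assumes "0 \<le> k" "k \<le> 1"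
  shows "continuous_on (cball 0 1) (Phi k)"
proof -
  have "continuous_on (cball 0 1) (\<lambda>y :: real^'n. (k, y))"
    by (intro continuous_intros)
  moreover have "(\<lambda>y :: real^'n. (k, y)) ` cball 0 1 \<subseteq> {0..1} \<times> cball 0 1"
    using assms by auto
  ultimately show ?thesis
    using continuous_on_compose2[OF continuous_Phi_joint, of "cball 0 1" "\<lambda>y. (k, y)"] by simp
qed

lemma Phi_cball: "0 \<le> k \<Longrightarrow> norm y \<le> 1 \<Longrightarrow> Phi k y \<in> cball x0 (1 / c)"
  by (rule norm_Psi_le_1[of k]) auto

text \<open>The Jacobian matrix of \<open>Psi k\<close>: derivative in direction \<open>i\<close> of
  component \<open>l\<close>.\<close>

definition P :: "real \<Rightarrow> 'n \<Rightarrow> 'n \<Rightarrow> real^'n \<Rightarrow> real" where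
  "P k i l x = (if i = l then c + k * E x else 0) + k * (partial i E x * (x $ l - x0 $ l))"

lemma smooth_Psi_nth: "smooth (\<lambda>x. Psi k x $ l)"
  unfolding Psi_def g_def by (simp, intro smooth_intros smooth_E)

lemma smooth_offset: "smooth (\<lambda>x. x $ l - x0 $ l)"
  by (intro smooth_intros)

lemma partial_offset: "partial i (\<lambda>x. x $ l - x0 $ l) = (\<lambda>x. if i = l then 1 else 0)"
  using partial_diff[OF smooth_nth smooth_const, of i l "x0 $ l"] by (simp add: partial_nth)

lemma partial_g: "partial i (\<lambda>x. c + k * E x) = (\<lambda>x. k * partial i E x)"
  using partial_add[OF smooth_const smooth_cmult[OF smooth_E], of i c k]
  by (simp add: partial_cmult[OF smooth_E])

lemma partial_Psi: "partial i (\<lambda>x. Psi k x $ l) = P k i l"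
proof -
  have eq: "(\<lambda>x. Psi k x $ l) = (\<lambda>x. (c + k * E x) * (x $ l - x0 $ l))"
    by (simp add: Psi_def g_def)
  have "smooth (\<lambda>x. c + k * E x)" by (intro smooth_intros smooth_E)
  from partial_mult[OF this smooth_offset, of i l] show ?thesis
    unfolding eq partial_g partial_offset by (auto simp: P_def fun_eq_iff)
qed

lemma P_eq: "P k i l = (\<lambda>x. of_bool (i = l) * (c + k * E x) + k * (partial i E x * (x $ l - x0 $ l)))"
  by (auto simp: P_def)

lemma smooth_P: "smooth (P k i l)"
  unfolding P_eq by (intro smooth_intros smooth_E)

lemma partial_P:
  "partial j (P k i l) x = of_bool (i = l) * (k * partial j E x)
    + k * (partial i E x * of_bool (j = l) + partial j (partial i E) x * (x $ l - x0 $ l))"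
proof -
  have s: "smooth (\<lambda>x. c + k * E x)" "smooth (\<lambda>x. partial i E x * (x $ l - x0 $ l))"
    by (intro smooth_intros smooth_E)+
  have "partial j (P k i l) = (\<lambda>x. of_bool (i = l) * partial j (\<lambda>x. c + k * E x) x
      + k * partial j (\<lambda>x. partial i E x * (x $ l - x0 $ l)) x)"
    unfolding P_eq partial_add[OF smooth_cmult[OF s(1)] smooth_cmult[OF s(2)]]
      partial_cmult[OF s(1)] partial_cmult[OF s(2)] ..
  then show ?thesis
    unfolding partial_g partial_mult[OF smooth_partial[OF smooth_E] smooth_offset] partial_offset
    by (simp add: of_bool_def)
qed

lemma smooth_wk: "smooth (wk k)"
  unfolding wk_def[abs_def]
  by (rule smooth_poly_compose[OF polys_polynomial[OF ball_fun_polys] smooth_Psi_nth])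

lemma wk_pos_iff: "0 < wk k x \<longleftrightarrow> norm (Psi k x) < 1"
  unfolding wk_def by (rule ball_fun_pos_iff)

lemma domain: "0 \<le> k \<Longrightarrow> smooth_domain (wk k) x0 (1 / c)"
  using c smooth_wk norm_Psi_le_1[of k] by unfold_locales (auto simp: wk_pos_iff simp del: mem_cball)

text \<open>\<open>wk k\<close> is 1 minus the square of the nonnegative convex function |Psi
  k|.\<close>

lemma wk_concave:
  assumes "0 \<le> k"
  shows "(\<Sum>i\<in>UNIV. \<Sum>j\<in>UNIV. partial i (partial j (wk k)) x * \<xi> i * \<xi> j) \<le> 0"
proof -
  have w: "wk k = (\<lambda>x. 1 - (norm (Psi k x))\<^sup>2)"
    by (simp add: wk_def[abs_def] ball_fun_def power2_norm_eq_inner)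
  let ?F = "\<lambda>x. 1 - wk k x"
  have F: "smooth ?F" by (intro smooth_intros smooth_wk)
  have "convex_on UNIV ?F"
    using convex_on_square[OF convex_norm_Psi[OF assms]] by (simp add: w)
  from smooth_convex_hessian_nonneg[OF F this, of x \<xi>]
  have "0 \<le> (\<Sum>i\<in>UNIV. \<Sum>j\<in>UNIV. - (partial i (partial j (wk k)) x * \<xi> i * \<xi> j))"
    by (simp add: partial_diff partial_minus smooth_const smooth_wk smooth_partial)
  then show ?thesis by (simp add: sum_negf)
qed

text \<open>Left difference quotients of a function that is nondecreasing along rays. This sign
  keeps the eigenvalue g + k (grad E . (x - x0)) of the Jacobian in radial direction at least
  \<open>c\<close>.\<close>

lemma radial_derivative_nonneg: "0 \<le> grad E x \<bullet> (x - x0)"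
proof -
  let ?v = "x - x0"
  have "((\<lambda>t. E (x + t *\<^sub>R ?v)) has_real_derivative (grad E x \<bullet> ?v)) (at 0)"
    using DERIV_along_line[OF smooth_E, of x ?v 0] by (simp add: grad_def inner_vec_def)
  then have "((\<lambda>h. (E (x + (0 + h) *\<^sub>R ?v) - E (x + 0 *\<^sub>R ?v)) / h) \<longlongrightarrow> grad E x \<bullet> ?v) (at_left 0)"
    unfolding DERIV_def by (rule filterlim_mono) (auto simp: at_le)
  then show ?thesis
  proof (rule tendsto_lowerbound)
    have "E (x + h *\<^sub>R ?v) \<le> E x" if "-1 < h" "h < 0" for h
    proof -
      have "x0 + (1 + h) *\<^sub>R ?v = x + h *\<^sub>R ?v" by (simp add: algebra_simps)
      then show ?thesis using E_ray[of "1 + h" ?v] that by simp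
    qed
    then show "\<forall>\<^sub>F h in at_left 0. 0 \<le> (E (x + (0 + h) *\<^sub>R ?v) - E (x + 0 *\<^sub>R ?v)) / h"
      unfolding eventually_at_left_field by (intro exI[of _ "-1"]) (auto intro!: divide_nonpos_neg)
  qed simp
qed

section \<open>Uniform bounds for the Jacobian and its inverse\<close>

definition D :: real where
  "D = (SUP x\<in>cball x0 (1 / c). norm (grad E x))"

lemma grad_E_le:
  assumes "x \<in> cball x0 (1 / c)"
  shows "norm (grad E x) \<le> D"
proof -
  have "compact ((\<lambda>x. norm (grad E x)) ` cball x0 (1 / c))"
    by (intro compact_continuous_image continuous_intros continuous_grad smooth_E) auto
  then show ?thesis
    unfolding D_def using assms by (intro cSUP_upper bounded_imp_bdd_above compact_imp_bounded) auto
qed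

lemma D_nonneg: "D \<ge> 0"
  using grad_E_le[of x0] c norm_ge_zero by (meson centre_in_cball divide_nonneg_pos order_trans zero_le_one)

text \<open>A bound for the inverse of the Jacobian and of its transpose: \<open>1 / c\<close> for
  the multiple of the identity, enlarged by the rank one correction.\<close>

definition C0 :: real where "C0 = (1 + D / c\<^sup>2) / c"

lemma C0_pos: "C0 > 0"
  using c D_nonneg by (simp add: C0_def add_pos_nonneg)

text \<open>Both the Jacobian of \<open>Psi k\<close> and its transpose are rank one perturbations of a multiple of
  the identity and can be inverted by the Sherman--Morrison formula.\<close>

lemma rank_one_bound:
  fixes v p q :: "real^'n"
  assumes a: "c \<le> a" "c \<le> a + q \<bullet> p" and pq: "norm p * norm q \<le> D / c"
  shows "norm v \<le> C0 * norm (a *\<^sub>R v + (v \<bullet> p) *\<^sub>R q)"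
proof -
  define u where "u = a *\<^sub>R v + (v \<bullet> p) *\<^sub>R q"
  \<comment> \<open>Pairing with \<open>p\<close> gives a scalar equation for
    \<open>v \<bullet> p\<close>; once this is bounded, \<open>v\<close> is read off from the
    definition of \<open>u\<close>.\<close>
  have "(a + q \<bullet> p) * (v \<bullet> p) = u \<bullet> p"
    by (simp add: u_def inner_add_left algebra_simps)
  then have "\<bar>a + q \<bullet> p\<bar> * \<bar>v \<bullet> p\<bar> = \<bar>u \<bullet> p\<bar>"
    by (simp only: abs_mult[symmetric])
  then have "(a + q \<bullet> p) * \<bar>v \<bullet> p\<bar> = \<bar>u \<bullet> p\<bar>"
    using a c by simp
  also have "\<dots> \<le> norm u * norm p" by (rule Cauchy_Schwarz_ineq2)
  finally have "(a + q \<bullet> p) * \<bar>v \<bullet> p\<bar> \<le> norm u * norm p" .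
  moreover have "c * \<bar>v \<bullet> p\<bar> \<le> (a + q \<bullet> p) * \<bar>v \<bullet> p\<bar>" using a by (intro mult_right_mono) auto
  ultimately have "c * \<bar>v \<bullet> p\<bar> \<le> norm u * norm p" by linarith
  then have "c * \<bar>v \<bullet> p\<bar> * norm q \<le> norm u * norm p * norm q"
    by (rule mult_right_mono) simp
  also have "\<dots> \<le> norm u * (D / c)"
    using mult_left_mono[OF pq, of "norm u"] by (simp add: mult.assoc)
  finally have vq: "\<bar>v \<bullet> p\<bar> * norm q \<le> norm u * D / c\<^sup>2"
    using c by (simp add: field_simps power2_eq_square)
  have "c * norm v \<le> norm (a *\<^sub>R v)"
    using a c by (simp add: mult_right_mono)
  also have "a *\<^sub>R v = u - (v \<bullet> p) *\<^sub>R q" by (simp add: u_def)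
  also have "norm (u - (v \<bullet> p) *\<^sub>R q) \<le> norm u + \<bar>v \<bullet> p\<bar> * norm q"
    using norm_triangle_ineq4[of u "(v \<bullet> p) *\<^sub>R q"] by simp
  finally have "c * norm v \<le> norm u * (1 + D / c\<^sup>2)" using vq by (simp add: algebra_simps)
  then have "norm v \<le> norm u * (1 + D / c\<^sup>2) / c"
    using c by (simp add: pos_le_divide_eq mult.commute)
  then show ?thesis by (simp add: C0_def u_def mult.commute)
qed

lemma rank_one_facts:
  assumes k: "0 \<le> k" "k \<le> 1" and x: "x \<in> cball x0 (1 / c)"
  shows "c \<le> g k x" "c \<le> g k x + (k *\<^sub>R grad E x) \<bullet> (x - x0)"
    "norm (k *\<^sub>R grad E x) * norm (x - x0) \<le> D / c"
proof -
  show "c \<le> g k x" using g_ge[OF k(1)] .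
  then show "c \<le> g k x + (k *\<^sub>R grad E x) \<bullet> (x - x0)"
    using mult_nonneg_nonneg[OF k(1) radial_derivative_nonneg[of x]] by simp
  have "norm (x - x0) \<le> 1 / c" using x by (simp add: dist_norm norm_minus_commute)
  moreover have "norm (k *\<^sub>R grad E x) \<le> D"
    using grad_E_le[OF x] k mult_left_le_one_le[of "norm (grad E x)" k] by simp
  ultimately have "norm (k *\<^sub>R grad E x) * norm (x - x0) \<le> D * (1 / c)"
    using D_nonneg by (intro mult_mono) auto
  then show "norm (k *\<^sub>R grad E x) * norm (x - x0) \<le> D / c" by simp
qed

text \<open>For \<open>v\<close> the gradient of a function at \<open>Psi k x\<close>, the inner
  sums on the right are the partial derivatives of the composed function, so this inverts the chain
  rule.\<close>

lemma jacobian_bound: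
  assumes k: "0 \<le> k" "k \<le> 1" and x: "x \<in> cball x0 (1 / c)"
  shows "(\<Sum>l\<in>UNIV. (v l)\<^sup>2) \<le> C0\<^sup>2 * (\<Sum>i\<in>UNIV. (\<Sum>l\<in>UNIV. v l * P k i l x)\<^sup>2)"
proof -
  define V :: "real^'n" where "V = (\<chi> l. v l)"
  have "(\<Sum>l\<in>UNIV. v l * P k i l x) = g k x * v i + (V \<bullet> (x - x0)) * (k * partial i E x)" for i
    by (simp add: P_def V_def inner_vec_def g_def distrib_left sum.distrib sum_distrib_right
        sum_distrib_left mult_ac mult_delta_left if_distrib[of "(*) _"] cong: if_cong)
  then have "(\<chi> i. \<Sum>l\<in>UNIV. v l * P k i l x) = g k x *\<^sub>R V + (V \<bullet> (x - x0)) *\<^sub>R (k *\<^sub>R grad E x)"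
    by (simp add: vec_eq_iff V_def grad_def)
  moreover have "norm V \<le> C0 * norm (g k x *\<^sub>R V + (V \<bullet> (x - x0)) *\<^sub>R (k *\<^sub>R grad E x))"
    using rank_one_facts[OF assms] by (intro rank_one_bound) (simp_all add: mult_ac)
  ultimately have "norm V \<le> C0 * norm (\<chi> i. \<Sum>l\<in>UNIV. v l * P k i l x)" by simp
  then have "(norm V)\<^sup>2 \<le> (C0 * norm (\<chi> i. \<Sum>l\<in>UNIV. v l * P k i l x))\<^sup>2"
    by (intro power_mono) auto
  then show ?thesis
    unfolding power_mult_distrib V_def norm_vec_square .
qed

end

text \<open>First and second derivatives only: the Laplacian of a composition has no term of order
  zero.\<close>

definition jet :: "(real^'n \<Rightarrow> real) \<Rightarrow> real^'n \<Rightarrow> (real^'n) \<times> (real^'n^'n)" where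
  "jet v y = (grad v y, hess v y)"

lemma continuous_jet: "smooth v \<Longrightarrow> continuous_on A (jet v)"
  unfolding jet_def[abs_def] by (intro continuous_on_Pair continuous_grad continuous_hess)

lemma norm_jet: "(norm (jet v y))\<^sup>2 = (\<Sum>i\<in>UNIV. (partial i v y)\<^sup>2)
    + (\<Sum>i\<in>UNIV. \<Sum>j\<in>UNIV. (partial i (partial j v) y)\<^sup>2)"
  by (simp add: jet_def norm_Pair norm_hess grad_def norm_vec_square sum_nonneg)

lemma jet_add: "smooth u \<Longrightarrow> smooth v \<Longrightarrow> jet (\<lambda>x. u x + v x) y = jet u y + jet v y"
  by (simp add: jet_def hess_add grad_def partial_add vec_eq_iff)

context star_map
begin

text \<open>Coefficients of the transported Laplacian: the Laplacians of the components of
  \<open>Psi k\<close>, and the Gram matrix of their gradients.\<close>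

definition coeff :: "real \<Rightarrow> real^'n \<Rightarrow> (real^'n) \<times> (real^'n^'n)" where
  "coeff k x = (\<chi> l. \<Sum>i\<in>UNIV. partial i (P k i l) x, \<chi> m l. \<Sum>i\<in>UNIV. P k i m x * P k i l x)"

text \<open>All domains are referred to the unit ball, so that the operators for different
  \<open>k\<close> act on one space and can be compared.\<close>

definition T :: "real \<Rightarrow> (real^'n \<Rightarrow> real) \<Rightarrow> real^'n \<Rightarrow> real" where
  "T k v y = coeff k (Phi k y) \<bullet> jet v y"

lemma smooth_comp: "real_polynomial_function v \<Longrightarrow> smooth (\<lambda>x. v (Psi k x))"
  by (rule smooth_poly_compose[OF _ smooth_Psi_nth])

lemma partial_comp:
  assumes "real_polynomial_function v"
  shows "partial i (\<lambda>x. v (Psi k x)) = (\<lambda>x. \<Sum>l\<in>UNIV. partial l v (Psi k x) * P k i l x)"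
  using partial_compose[OF smooth_polynomial[OF assms] smooth_Psi_nth, of i k]
  by (simp add: partial_Psi fun_eq_iff)

lemma partial_partial_comp:
  assumes v: "real_polynomial_function v"
  shows "partial j (partial i (\<lambda>x. v (Psi k x))) x
    = (\<Sum>l\<in>UNIV. (\<Sum>m\<in>UNIV. partial m (partial l v) (Psi k x) * P k j m x) * P k i l x)
      + (\<Sum>l\<in>UNIV. partial l v (Psi k x) * partial j (P k i l) x)"
proof -
  have s: "smooth (\<lambda>x. partial l v (Psi k x))" for l
    by (intro smooth_comp partial_polynomial v)
  have "partial j (partial i (\<lambda>x. v (Psi k x))) x
      = (\<Sum>l\<in>UNIV. partial j (\<lambda>x. partial l v (Psi k x) * P k i l x) x)"
    unfolding partial_comp[OF v] by (subst partial_sum) (auto intro: smooth_mult s smooth_P)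
  also have "\<dots> = (\<Sum>l\<in>UNIV. (\<Sum>m\<in>UNIV. partial m (partial l v) (Psi k x) * P k j m x) * P k i l x
      + partial l v (Psi k x) * partial j (P k i l) x)"
    by (intro sum.cong refl)
      (simp add: partial_mult[OF s smooth_P] partial_comp[OF partial_polynomial[OF v]])
  finally show ?thesis by (simp add: sum.distrib)
qed

lemma laplacian_comp:
  assumes v: "real_polynomial_function v"
  shows "laplacian (\<lambda>x. v (Psi k x)) x = coeff k x \<bullet> jet v (Psi k x)"
proof -
  have 1: "(\<Sum>i\<in>UNIV. \<Sum>l\<in>UNIV. (\<Sum>m\<in>UNIV. partial m (partial l v) (Psi k x) * P k i m x) * P k i l x)
      = (\<Sum>m\<in>UNIV. \<Sum>l\<in>UNIV. (\<Sum>i\<in>UNIV. P k i m x * P k i l x) * partial m (partial l v) (Psi k x))"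
  proof -
    have "(\<Sum>i\<in>UNIV. \<Sum>l\<in>UNIV. (\<Sum>m\<in>UNIV. partial m (partial l v) (Psi k x) * P k i m x) * P k i l x)
        = (\<Sum>i\<in>UNIV. \<Sum>m\<in>UNIV. \<Sum>l\<in>UNIV. P k i m x * P k i l x * partial m (partial l v) (Psi k x))"
      unfolding sum_distrib_right by (rule sum.cong[OF refl], subst sum.swap) (simp add: mult_ac)
    also have "\<dots> = (\<Sum>m\<in>UNIV. \<Sum>l\<in>UNIV. \<Sum>i\<in>UNIV. P k i m x * P k i l x * partial m (partial l v) (Psi k x))"
      by (subst sum.swap, rule sum.cong[OF refl], rule sum.swap)
    finally show ?thesis by (simp add: sum_distrib_right)
  qed
  have 2: "(\<Sum>i\<in>UNIV. \<Sum>l\<in>UNIV. partial l v (Psi k x) * partial i (P k i l) x)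
      = (\<Sum>l\<in>UNIV. (\<Sum>i\<in>UNIV. partial i (P k i l) x) * partial l v (Psi k x))"
    by (subst sum.swap) (simp add: sum_distrib_left mult.commute)
  show ?thesis
    by (simp add: laplacian_def partial_partial_comp[OF v] sum.distrib 1 2 coeff_def jet_def
        inner_matrix_Frobenius inner_vec_def[of "\<chi> l. _ l"] hess_def grad_def)
qed

lemma continuous_P: "continuous_on S (\<lambda>p. P (fst p) i l (snd p))"
  unfolding P_eq
  by (intro continuous_on_add continuous_on_mult continuous_on_const continuous_on_fst continuous_on_id
      continuous_snd_smooth smooth_E smooth_partial smooth_offset)

lemma continuous_partial_P: "continuous_on S (\<lambda>p. partial j (P (fst p) i l) (snd p))"
  unfolding partial_P
  by (intro continuous_on_add continuous_on_mult continuous_on_const continuous_on_fst continuous_on_id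
      continuous_snd_smooth smooth_E smooth_partial smooth_offset)

lemma continuous_coeff: "continuous_on S (\<lambda>p. coeff (fst p) (snd p))"
  unfolding coeff_def
  by (intro continuous_on_Pair continuous_on_vec_lambda continuous_on_sum continuous_on_mult
      continuous_P continuous_partial_P)

lemma continuous_coeff_Phi:
  "continuous_on ({0..1} \<times> cball 0 1) (\<lambda>p. coeff (fst p) (Phi (fst p) (snd p)))"
proof -
  have "continuous_on ({0..1} \<times> cball 0 1) (\<lambda>p. (fst p, Phi (fst p) (snd p)))"
    by (intro continuous_on_Pair continuous_on_fst continuous_on_id continuous_Phi_joint)
  from continuous_on_compose2[OF continuous_coeff[of UNIV] this] show ?thesis by simp
qed

lemma continuous_T:
  assumes "0 \<le> k" "k \<le> 1" "smooth v"
  shows "continuous_on (cball 0 1) (T k v)"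
proof -
  have "continuous_on (cball 0 1) (\<lambda>y :: real^'n. (k, Phi k y))"
    by (intro continuous_intros continuous_Phi assms)
  from continuous_on_compose2[OF continuous_coeff[of UNIV] this]
  have "continuous_on (cball 0 1) (\<lambda>y. coeff k (Phi k y))" by simp
  then show ?thesis
    unfolding T_def[abs_def] by (intro continuous_on_inner continuous_jet assms)
qed

text \<open>Inverse chain rule with constants uniform in \<open>k\<close>. Gradients follow from
  \<open>jacobian_bound\<close>. For Hessians the transformed matrix \<open>B\<close> is the Hessian
  of the composition minus a term with second derivatives of \<open>Psi k\<close> and the gradient
  of \<open>v\<close>; \<open>jacobian_bound\<close> is then used once for each index.\<close>

lemma jet_bound:
  obtains C1 where "C1 \<ge> 0"
    "\<And>k x v. 0 \<le> k \<Longrightarrow> k \<le> 1 \<Longrightarrow> x \<in> cball x0 (1 / c) \<Longrightarrow> real_polynomial_function v \<Longrightarrow>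
      (norm (jet v (Psi k x)))\<^sup>2 \<le> C1 * (norm (jet (\<lambda>x. v (Psi k x)) x))\<^sup>2"
proof -
  let ?q = "\<lambda>k x. \<Sum>j\<in>UNIV. \<Sum>i\<in>UNIV. \<Sum>l\<in>UNIV. (partial j (P k i l) x)\<^sup>2"
  have "continuous_on ({0..1} \<times> cball x0 (1 / c)) (\<lambda>p. ?q (fst p) (snd p))"
    by (intro continuous_on_sum continuous_on_power continuous_partial_P)
  then have "compact ((\<lambda>p. ?q (fst p) (snd p)) ` ({0..1} \<times> cball x0 (1 / c)))"
    by (intro compact_continuous_image compact_Times) auto
  then obtain Q where Q: "\<And>k x. k \<in> {0..1} \<Longrightarrow> x \<in> cball x0 (1 / c) \<Longrightarrow> ?q k x \<le> Q"
    using compact_imp_bounded[THEN bounded_imp_bdd_above] unfolding bdd_above_def by fastforce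
  have "0 \<le> ?q 0 x0" by (intro sum_nonneg) auto
  then have Q0: "Q \<ge> 0" using Q[of 0 x0] c by simp
  \<comment> \<open>The first summand belongs to the gradient, the second to the Hessian, where
    \<open>(p - q)^2 \<le> 2 p^2 + 2 q^2\<close> splits \<open>B\<close>.\<close>
  define C1 where "C1 = C0\<^sup>2 + C0\<^sup>2 * C0\<^sup>2 * (2 + 2 * Q * C0\<^sup>2)"
  have "C1 \<ge> 0" using Q0 by (simp add: C1_def)
  moreover have "(norm (jet v (Psi k x)))\<^sup>2 \<le> C1 * (norm (jet (\<lambda>x. v (Psi k x)) x))\<^sup>2"
    if k: "0 \<le> k" "k \<le> 1" and x: "x \<in> cball x0 (1 / c)" and v: "real_polynomial_function v" for k x v
  proof -
    define u where "u = (\<lambda>x. v (Psi k x))"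
    define d where "d l = partial l v (Psi k x)" for l
    define h where "h m l = partial m (partial l v) (Psi k x)" for m l
    define r where "r j i = (\<Sum>l\<in>UNIV. d l * partial j (P k i l) x)" for j i
    define B where "B j i = (\<Sum>l\<in>UNIV. (\<Sum>m\<in>UNIV. h m l * P k j m x) * P k i l x)" for j i
    let ?d = "\<Sum>l\<in>UNIV. (d l)\<^sup>2" and ?h = "\<Sum>m\<in>UNIV. \<Sum>l\<in>UNIV. (h m l)\<^sup>2"
    let ?G = "\<Sum>i\<in>UNIV. (partial i u x)\<^sup>2"
    let ?H = "\<Sum>j\<in>UNIV. \<Sum>i\<in>UNIV. (partial j (partial i u) x)\<^sup>2"
    have d: "?d \<le> C0\<^sup>2 * ?G"
      using jacobian_bound[OF k x, of d] by (simp add: u_def partial_comp[OF v] d_def)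
    have "?h = (\<Sum>l\<in>UNIV. \<Sum>m\<in>UNIV. (h m l)\<^sup>2)" by (rule sum.swap)
    also have "\<dots> \<le> (\<Sum>l\<in>UNIV. C0\<^sup>2 * (\<Sum>j\<in>UNIV. (\<Sum>m\<in>UNIV. h m l * P k j m x)\<^sup>2))"
      by (intro sum_mono jacobian_bound[OF k x])
    also have "\<dots> = C0\<^sup>2 * (\<Sum>j\<in>UNIV. \<Sum>l\<in>UNIV. (\<Sum>m\<in>UNIV. h m l * P k j m x)\<^sup>2)"
      unfolding sum_distrib_left[symmetric] by (subst sum.swap) (rule refl)
    also have "\<dots> \<le> C0\<^sup>2 * (\<Sum>j\<in>UNIV. C0\<^sup>2 * (\<Sum>i\<in>UNIV. (B j i)\<^sup>2))"
      unfolding B_def by (intro mult_left_mono sum_mono jacobian_bound[OF k x]) auto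
    also have "\<dots> = C0\<^sup>2 * C0\<^sup>2 * (\<Sum>j\<in>UNIV. \<Sum>i\<in>UNIV. (B j i)\<^sup>2)"
      by (simp add: sum_distrib_left mult.assoc)
    finally have h: "?h \<le> C0\<^sup>2 * C0\<^sup>2 * (\<Sum>j\<in>UNIV. \<Sum>i\<in>UNIV. (B j i)\<^sup>2)" .
    have Bji: "(B j i)\<^sup>2 \<le> 2 * (partial j (partial i u) x)\<^sup>2 + 2 * (?d * (\<Sum>l\<in>UNIV. (partial j (P k i l) x)\<^sup>2))"
      for j i
    proof -
      have "B j i = partial j (partial i u) x - r j i"
        by (simp add: u_def partial_partial_comp[OF v] B_def r_def h_def d_def)
      moreover have "(p - q)\<^sup>2 \<le> 2 * p\<^sup>2 + 2 * q\<^sup>2" for p q :: real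
        using zero_le_power2[of "p + q"] by (simp add: power2_eq_square algebra_simps)
      moreover have "(r j i)\<^sup>2 \<le> ?d * (\<Sum>l\<in>UNIV. (partial j (P k i l) x)\<^sup>2)"
        unfolding r_def by (rule Cauchy_Schwarz_ineq_sum)
      ultimately show ?thesis by (smt (verit))
    qed
    have "(\<Sum>j\<in>UNIV. \<Sum>i\<in>UNIV. (B j i)\<^sup>2)
        \<le> (\<Sum>j\<in>UNIV. \<Sum>i\<in>UNIV. 2 * (partial j (partial i u) x)\<^sup>2 + 2 * (?d * (\<Sum>l\<in>UNIV. (partial j (P k i l) x)\<^sup>2)))"
      by (intro sum_mono Bji)
    also have "\<dots> = 2 * ?H + 2 * ?d * ?q k x"
    proof -
      have "(\<Sum>j\<in>UNIV. \<Sum>i\<in>UNIV. 2 * a j i + 2 * (s * b j i))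
          = 2 * (\<Sum>j\<in>UNIV. \<Sum>i\<in>UNIV. a j i) + 2 * s * (\<Sum>j\<in>UNIV. \<Sum>i\<in>UNIV. b j i)"
        for s :: real and a b :: "'n \<Rightarrow> 'n \<Rightarrow> real"
        by (simp add: sum.distrib sum_distrib_left mult.assoc)
      then show ?thesis .
    qed
    also have "\<dots> \<le> 2 * ?H + 2 * ?d * Q"
      using Q[of k x] k x by (intro add_left_mono mult_left_mono) (auto intro: sum_nonneg)
    also have "2 * ?d * Q \<le> 2 * (C0\<^sup>2 * ?G) * Q"
      using d Q0 by (intro mult_right_mono mult_left_mono) auto
    finally have "(\<Sum>j\<in>UNIV. \<Sum>i\<in>UNIV. (B j i)\<^sup>2) \<le> 2 * ?H + 2 * Q * C0\<^sup>2 * ?G"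
      by (simp add: mult_ac)
    also have "\<dots> \<le> (2 + 2 * Q * C0\<^sup>2) * (?G + ?H)"
      using Q0 by (simp add: algebra_simps sum_nonneg)
    finally have "C0\<^sup>2 * C0\<^sup>2 * (\<Sum>j\<in>UNIV. \<Sum>i\<in>UNIV. (B j i)\<^sup>2) \<le> C0\<^sup>2 * C0\<^sup>2 * ((2 + 2 * Q * C0\<^sup>2) * (?G + ?H))"
      by (intro mult_left_mono) auto
    with h have h': "?h \<le> C0\<^sup>2 * C0\<^sup>2 * (2 + 2 * Q * C0\<^sup>2) * (?G + ?H)"
      by (simp add: mult.assoc)
    have "C0\<^sup>2 * ?G \<le> C0\<^sup>2 * (?G + ?H)"
      by (intro mult_left_mono) (simp_all add: sum_nonneg)
    with d h' have "?d + ?h \<le> C1 * (?G + ?H)"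
      unfolding C1_def by (simp add: algebra_simps)
    then show ?thesis
      unfolding norm_jet by (simp add: d_def h_def u_def)
  qed
  ultimately show ?thesis by (rule that)
qed

lemma Psi_has_derivative:
  "(Psi k has_derivative (\<lambda>\<xi>. g k x *\<^sub>R \<xi> + (\<xi> \<bullet> (k *\<^sub>R grad E x)) *\<^sub>R (x - x0))) (at x within S)"
proof -
  have "(E has_derivative (\<lambda>\<xi>. \<xi> \<bullet> grad E x)) (at x within S)"
    using has_derivative_at_withinI[OF smooth_has_derivative[OF smooth_E]]
    by (simp add: grad_def inner_vec_def mult.commute)
  then have "((\<lambda>x. (c + k * E x) *\<^sub>R (x - x0)) has_derivative
      (\<lambda>\<xi>. (c + k * E x) *\<^sub>R \<xi> + (k * (\<xi> \<bullet> grad E x)) *\<^sub>R (x - x0))) (at x within S)"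
    by (auto intro!: derivative_eq_intros)
  then show ?thesis
    unfolding Psi_def[abs_def] g_def by (simp add: mult.commute)
qed

lemma Psi_lipschitz:
  obtains L where "\<And>k x y. 0 \<le> k \<Longrightarrow> k \<le> 1 \<Longrightarrow> x \<in> cball x0 (1 / c) \<Longrightarrow> y \<in> cball x0 (1 / c) \<Longrightarrow>
    dist (Psi k x) (Psi k y) \<le> L * dist x y"
proof -
  have "compact (E ` cball x0 (1 / c))"
    by (intro compact_continuous_image smooth_continuous smooth_E) auto
  then obtain m where m: "\<And>x. x \<in> cball x0 (1 / c) \<Longrightarrow> E x \<le> m"
    using compact_imp_bounded[THEN bounded_imp_bdd_above] unfolding bdd_above_def by fastforce
  have "dist (Psi k x) (Psi k y) \<le> (c + m + D / c) * dist x y"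
    if k: "0 \<le> k" "k \<le> 1" and xy: "x \<in> cball x0 (1 / c)" "y \<in> cball x0 (1 / c)" for k x y
    unfolding dist_norm
  proof (rule differentiable_bound[OF convex_cball Psi_has_derivative _ xy])
    fix x assume x: "x \<in> cball x0 (1 / c)"
    show "onorm (\<lambda>\<xi>. g k x *\<^sub>R \<xi> + (\<xi> \<bullet> (k *\<^sub>R grad E x)) *\<^sub>R (x - x0)) \<le> c + m + D / c"
    proof (rule onorm_le)
      fix \<xi> :: "real^'n"
      have "k * E x \<le> m"
        using m[OF x] E_nonneg[of x] k mult_left_le_one_le[of "E x" k] by linarith
      then have "\<bar>g k x\<bar> * norm \<xi> \<le> (c + m) * norm \<xi>"
        using g_pos[OF k(1), of x] by (intro mult_right_mono) (auto simp: g_def)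
      moreover have "\<bar>\<xi> \<bullet> (k *\<^sub>R grad E x)\<bar> * norm (x - x0) \<le> norm \<xi> * norm (k *\<^sub>R grad E x) * norm (x - x0)"
        by (intro mult_right_mono Cauchy_Schwarz_ineq2) auto
      moreover have "norm \<xi> * (norm (k *\<^sub>R grad E x) * norm (x - x0)) \<le> norm \<xi> * (D / c)"
        by (intro mult_left_mono rank_one_facts k x) auto
      ultimately have "\<bar>g k x\<bar> * norm \<xi> + \<bar>\<xi> \<bullet> (k *\<^sub>R grad E x)\<bar> * norm (x - x0) \<le> (c + m + D / c) * norm \<xi>"
        by (simp add: algebra_simps)
      then show "norm (g k x *\<^sub>R \<xi> + (\<xi> \<bullet> (k *\<^sub>R grad E x)) *\<^sub>R (x - x0)) \<le> (c + m + D / c) * norm \<xi>"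
        using norm_triangle_ineq[of "g k x *\<^sub>R \<xi>" "(\<xi> \<bullet> (k *\<^sub>R grad E x)) *\<^sub>R (x - x0)"] by simp
    qed
  qed
  then show ?thesis by (rule that)
qed

text \<open>The derivative of the inverse map is the inverse Jacobian, bounded by \<open>C0\<close>;
  the unit ball is convex, so the mean value inequality applies.\<close>

lemma Phi_lipschitz:
  assumes k: "0 \<le> k" "k \<le> 1" and yz: "y \<in> ball 0 1" "z \<in> ball 0 1"
  shows "dist (Phi k y) (Phi k z) \<le> C0 * dist y z"
proof -
  define e where "e y = k *\<^sub>R grad E (Phi k y)" for y
  define X where "X y = Phi k y - x0" for y
  define f' where "f' y \<xi> = g k (Phi k y) *\<^sub>R \<xi> + (\<xi> \<bullet> e y) *\<^sub>R X y" for y \<xi>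
  \<comment> \<open>The Sherman--Morrison inverse of \<open>f' y\<close>.\<close>
  define g' where "g' y \<eta> = (1 / g k (Phi k y)) *\<^sub>R (\<eta> - ((\<eta> \<bullet> e y) / (g k (Phi k y) + e y \<bullet> X y)) *\<^sub>R X y)" for y \<eta>
  have facts: "c \<le> g k (Phi k y)" "c \<le> g k (Phi k y) + e y \<bullet> X y" "norm (e y) * norm (X y) \<le> D / c"
    if "y \<in> ball 0 1" for y
    using rank_one_facts[OF k Phi_cball[OF k(1), of y]] that by (auto simp: e_def X_def)
  have g'f': "g' y (f' y \<xi>) = \<xi>" and f'g': "f' y (g' y \<xi>) = \<xi>" if y: "y \<in> ball 0 1" for y \<xi>
  proof -
    have g0: "g k (Phi k y) \<noteq> 0" and h0: "g k (Phi k y) + e y \<bullet> X y \<noteq> 0" using facts[OF y] c by auto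
    have "f' y \<xi> \<bullet> e y = (g k (Phi k y) + e y \<bullet> X y) * (\<xi> \<bullet> e y)"
      by (simp add: f'_def inner_add_left inner_commute[of "X y"] algebra_simps)
    then have "(f' y \<xi> \<bullet> e y) / (g k (Phi k y) + e y \<bullet> X y) = \<xi> \<bullet> e y" using h0 by simp
    then show "g' y (f' y \<xi>) = \<xi>"
      using g0 by (simp add: g'_def f'_def)
    have "g' y \<xi> \<bullet> e y = (1 / g k (Phi k y)) * (\<xi> \<bullet> e y - (\<xi> \<bullet> e y) / (g k (Phi k y) + e y \<bullet> X y) * (e y \<bullet> X y))"
      by (simp add: g'_def inner_diff_left inner_commute[of "X y"])
    also have "\<dots> = (\<xi> \<bullet> e y) / (g k (Phi k y) + e y \<bullet> X y)"
      using g0 h0 by (simp add: field_simps)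
    finally show "f' y (g' y \<xi>) = \<xi>"
      using g0 by (simp add: f'_def, simp add: g'_def)
  qed
  have der: "(Phi k has_derivative g' y) (at y within ball 0 1)" if y: "y \<in> ball 0 1" for y
  proof (rule has_derivative_at_withinI, rule has_derivative_inverse_basic[where f="Psi k" and f'="f' y" and T="ball 0 1"])
    show "(Psi k has_derivative f' y) (at (Phi k y))"
      using Psi_has_derivative[of k "Phi k y" UNIV] by (simp add: f'_def[abs_def] e_def X_def)
    show "bounded_linear (g' y)"
      unfolding g'_def[abs_def] divide_inverse
      by (intro bounded_linear_intros bounded_linear_scaleR_const bounded_linear_mult_const
          bounded_linear_inner_left bounded_linear_ident)
    show "g' y \<circ> f' y = id" using g'f'[OF y] by auto
    show "continuous (at y) (Phi k)"
      using continuous_on_subset[OF continuous_Phi[OF k] ball_subset_cball] y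
      by (simp add: continuous_on_eq_continuous_at)
  qed (use y k in auto)
  show ?thesis
    unfolding dist_norm
  proof (rule differentiable_bound[OF convex_ball der _ yz])
    fix y :: "real^'n" assume y: "y \<in> ball 0 1"
    show "onorm (g' y) \<le> C0"
    proof (rule onorm_le)
      fix \<eta> :: "real^'n"
      show "norm (g' y \<eta>) \<le> C0 * norm \<eta>"
        using rank_one_bound[of "g k (Phi k y)" "X y" "e y" "g' y \<eta>"] facts[OF y] f'g'[OF y, of \<eta>]
        by (simp add: f'_def inner_commute)
    qed
  qed
qed

end

definition ball_polys :: "(real^'n \<Rightarrow> real) set" where
  "ball_polys = {\<lambda>y. ball_fun y * p y | p. real_polynomial_function p}"

lemma ball_polys_polynomial: "v \<in> ball_polys \<Longrightarrow> real_polynomial_function v"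
  using polys_polynomial[OF ball_fun_polys] by (auto simp: ball_polys_def)

lemma ball_polys_smooth: "v \<in> ball_polys \<Longrightarrow> smooth v"
  using ball_polys_polynomial smooth_polynomial by blast

lemma ball_polys_add: "u \<in> ball_polys \<Longrightarrow> v \<in> ball_polys \<Longrightarrow> (\<lambda>x. u x + v x) \<in> ball_polys"
  unfolding ball_polys_def
proof safe
  fix p q :: "real^'n \<Rightarrow> real" assume "real_polynomial_function p" "real_polynomial_function q"
  then show "\<exists>r. (\<lambda>x. ball_fun x * p x + ball_fun x * q x) = (\<lambda>y. ball_fun y * r y) \<and> real_polynomial_function r"
    by (intro exI[of _ "\<lambda>x. p x + q x"] conjI real_polynomial_function.intros(3))
      (auto simp: distrib_left)
qed

lemma sq_integrable_ball:
  fixes f :: "real^'n \<Rightarrow> 'b::euclidean_space"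
  assumes "continuous_on (cball 0 1) f"
  shows "sq_integrable (lebesgue_on (ball 0 1)) f"
  unfolding sq_integrable_def
  by (intro conjI borel_measurable_integrable
      integrable_continuous_bounded[OF open_ball compact_cball ball_subset_cball] continuous_intros assms)

lemma l2norm_le_sup:
  fixes f :: "real^'n \<Rightarrow> real"
  assumes f: "continuous_on (cball 0 1) f" and le: "\<And>x. x \<in> cball 0 1 \<Longrightarrow> \<bar>f x\<bar> \<le> a" and a: "a \<ge> 0"
  shows "l2norm (lebesgue_on (ball 0 1)) f \<le> a * l2norm (lebesgue_on (ball (0 :: real^'n) 1)) (\<lambda>x. 1 :: real)"
proof (rule l2norm_mono)
  show "sq_integrable (lebesgue_on (ball (0 :: real^'n) 1)) (\<lambda>x. 1 :: real)"
    by (intro sq_integrable_ball continuous_intros)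
  show "f \<in> borel_measurable (lebesgue_on (ball 0 1))"
    using sq_integrable_ball[OF f] by (simp add: sq_integrable_def)
  show "AE x in lebesgue_on (ball 0 1). norm (f x) \<le> a * norm (1 :: real)"
    using le by (intro AE_I2) (auto simp: space_restrict_space)
qed (rule a)

text \<open>The right-hand side is approximated uniformly by a polynomial, for which the equation is
  solved exactly.\<close>

lemma unit_ball_dense:
  fixes f :: "real^'n \<Rightarrow> real"
  assumes f: "continuous_on (cball 0 1) f" and e: "e > 0"
  shows "\<exists>v\<in>ball_polys. l2norm (lebesgue_on (ball 0 1)) (\<lambda>x. laplacian v x - f x) < e"
proof -
  let ?M = "lebesgue_on (ball (0 :: real^'n) 1)"
  define K where "K = l2norm ?M (\<lambda>x. 1 :: real) + 1"
  have K: "K > 0" by (simp add: K_def add_nonneg_pos)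
  obtain p where p: "real_polynomial_function p" "\<And>x. x \<in> cball 0 1 \<Longrightarrow> \<bar>f x - p x\<bar> < e / K"
    using Stone_Weierstrass_real_polynomial_function[OF compact_cball f, of "e / K"] e K by auto
  obtain q where q: "real_polynomial_function q" "laplacian (\<lambda>x. ball_fun x * q x) = p"
    using unit_ball_surjective[OF p(1)] by blast
  have "continuous_on (cball 0 1) (\<lambda>x. p x - f x)"
    by (intro continuous_intros f smooth_continuous smooth_polynomial p)
  then have "l2norm ?M (\<lambda>x. p x - f x) \<le> e / K * l2norm ?M (\<lambda>x. 1 :: real)"
    using p(2) e K by (intro l2norm_le_sup) (auto simp: abs_minus_commute less_imp_le)
  also have "\<dots> < e / K * K" using e K by (intro mult_strict_left_mono) (auto simp: K_def)
  also have "\<dots> = e" using K by simp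
  finally show ?thesis
    using q by (intro bexI[of _ "\<lambda>x. ball_fun x * q x"]) (auto simp: ball_polys_def)
qed

section \<open>Density of the range carried from the ball to the domain\<close>

context star_map
begin

definition Om :: "real \<Rightarrow> (real^'n) set" where
  "Om k = {x. norm (Psi k x) < 1}"

lemma open_Om: "open (Om k)"
  unfolding Om_def by (intro open_Collect_less continuous_intros continuous_Psi)

lemma U_eq_Om: "0 \<le> k \<Longrightarrow> smooth_domain.U (wk k) = Om k"
  using smooth_domain.U_def[OF domain] by (simp add: Om_def wk_pos_iff)

lemma Om_subset: "0 \<le> k \<Longrightarrow> Om k \<subseteq> cball x0 (1 / c)"
  unfolding Om_def using norm_Psi_le_1[of k] by (auto simp del: mem_cball)

text \<open>\<open>Psi k\<close> and \<open>Phi k\<close> are Lipschitz with one constant for all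
  \<open>k\<close> in [0,1], so passing between the domain and the ball is bounded in both
  directions uniformly in \<open>k\<close>.\<close>

lemma pullback_bounds:
  obtains K where "K > 0"
    "\<And>k f. 0 \<le> k \<Longrightarrow> k \<le> 1 \<Longrightarrow> continuous_on UNIV f \<Longrightarrow>
      l2norm (lebesgue_on (ball 0 1)) (\<lambda>y. f (Phi k y) :: real) \<le> K * l2norm (lebesgue_on (Om k)) f"
    "\<And>k f. 0 \<le> k \<Longrightarrow> k \<le> 1 \<Longrightarrow> continuous_on (cball 0 1) f \<Longrightarrow>
      l2norm (lebesgue_on (Om k)) (\<lambda>x. f (Psi k x) :: real) \<le> K * l2norm (lebesgue_on (ball 0 1)) f"
proof -
  obtain L0 where L0: "\<And>k x y. 0 \<le> k \<Longrightarrow> k \<le> 1 \<Longrightarrow> x \<in> cball x0 (1 / c) \<Longrightarrow> y \<in> cball x0 (1 / c) \<Longrightarrow>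
    dist (Psi k x) (Psi k y) \<le> L0 * dist x y"
    using Psi_lipschitz by blast
  define L where "L = max L0 C0"
  have L: "L > 0" "L0 \<le> L" "C0 \<le> L" using C0_pos by (auto simp: L_def)
  show ?thesis
  proof (rule that[of "sqrt (L ^ CARD('n))"])
    show "sqrt (L ^ CARD('n)) > 0" using L by simp
    fix k :: real assume k: "0 \<le> k" "k \<le> 1"
    have lipPsi: "dist (Psi k x) (Psi k y) \<le> L * dist x y" if "x \<in> Om k" "y \<in> Om k" for x y
    proof -
      have "dist (Psi k x) (Psi k y) \<le> L0 * dist x y"
        using that Om_subset[OF k(1)] by (intro L0 k) auto
      also have "\<dots> \<le> L * dist x y" using L by (intro mult_right_mono) auto
      finally show ?thesis .
    qed
    have lipPhi: "dist (Phi k x) (Phi k y) \<le> L * dist x y" if "x \<in> ball 0 1" "y \<in> ball 0 1" for x y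
    proof -
      have "dist (Phi k x) (Phi k y) \<le> C0 * dist x y" by (rule Phi_lipschitz[OF k that])
      also have "\<dots> \<le> L * dist x y" using L by (intro mult_right_mono) auto
      finally show ?thesis .
    qed
    have maps: "Psi k x \<in> ball 0 1 \<and> Phi k (Psi k x) = x" if "x \<in> Om k" for x
      using that k by (simp add: Om_def)
    have maps': "Phi k y \<in> Om k \<and> Psi k (Phi k y) = y" if "y \<in> ball 0 1" for y
      using that k by (simp add: Om_def)
    show "l2norm (lebesgue_on (ball 0 1)) (\<lambda>y. f (Phi k y) :: real) \<le> sqrt (L ^ CARD('n)) * l2norm (lebesgue_on (Om k)) f"
      if f: "continuous_on UNIV f" for f
    proof (rule l2norm_lipschitz_le[OF open_Om open_ball L(1) maps maps' lipPsi])
      show "continuous_on (ball 0 1) (Phi k)"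
        using continuous_on_subset[OF continuous_Phi[OF k] ball_subset_cball] .
      show "continuous_on (Om k) f" using continuous_on_subset[OF f] by simp
      show "sq_integrable (lebesgue_on (Om k)) f"
        using smooth_domain.sq_integrable_U[OF domain[OF k(1)] f] by (simp add: U_eq_Om k)
    qed
    show "l2norm (lebesgue_on (Om k)) (\<lambda>x. f (Psi k x) :: real) \<le> sqrt (L ^ CARD('n)) * l2norm (lebesgue_on (ball 0 1)) f"
      if f: "continuous_on (cball 0 1) f" for f
      by (rule l2norm_lipschitz_le[OF open_ball open_Om L(1) maps' maps lipPhi continuous_Psi])
        (use f continuous_on_subset[OF f ball_subset_cball] sq_integrable_ball in auto)
  qed
qed

lemma comp_form:
  assumes "v \<in> ball_polys"
  shows "\<exists>h. smooth h \<and> (\<lambda>x. v (Psi k x)) = (\<lambda>x. wk k x * h x)"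
proof -
  obtain p where p: "real_polynomial_function p" "v = (\<lambda>y. ball_fun y * p y)"
    using assms by (auto simp: ball_polys_def)
  then show ?thesis
    by (intro exI[of _ "\<lambda>x. p (Psi k x)"]) (auto simp: wk_def smooth_comp)
qed

lemma T_Psi: "0 \<le> k \<Longrightarrow> v \<in> ball_polys \<Longrightarrow> T k v (Psi k x) = laplacian (\<lambda>x. v (Psi k x)) x"
  by (simp add: T_def laplacian_comp ball_polys_polynomial)

text \<open>On each domain the gradient bound and Miranda--Talenti apply to \<open>v\<close>
  composed with \<open>Psi k\<close>; \<open>jet_bound\<close> and two changes of variables carry
  them to the ball. Uniformity in \<open>k\<close> is the point: it fixes the step of the
  continuation.\<close>

lemma T_estimate:
  obtains C2 where "C2 > 0"
    "\<And>k v. 0 \<le> k \<Longrightarrow> k \<le> 1 \<Longrightarrow> v \<in> ball_polys \<Longrightarrow>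
      l2norm (lebesgue_on (ball 0 1)) (jet v) \<le> C2 * l2norm (lebesgue_on (ball 0 1)) (T k v)"
proof -
  obtain K where K: "K > 0"
    "\<And>k f. 0 \<le> k \<Longrightarrow> k \<le> 1 \<Longrightarrow> continuous_on UNIV f \<Longrightarrow>
      l2norm (lebesgue_on (ball 0 1)) (\<lambda>y. f (Phi k y) :: real) \<le> K * l2norm (lebesgue_on (Om k)) f"
    "\<And>k f. 0 \<le> k \<Longrightarrow> k \<le> 1 \<Longrightarrow> continuous_on (cball 0 1) f \<Longrightarrow>
      l2norm (lebesgue_on (Om k)) (\<lambda>x. f (Psi k x) :: real) \<le> K * l2norm (lebesgue_on (ball 0 1)) f"
    using pullback_bounds by blast
  obtain C1 where C1: "C1 \<ge> 0"
    "\<And>k x v. 0 \<le> k \<Longrightarrow> k \<le> 1 \<Longrightarrow> x \<in> cball x0 (1 / c) \<Longrightarrow> real_polynomial_function v \<Longrightarrow>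
      (norm (jet v (Psi k x)))\<^sup>2 \<le> C1 * (norm (jet (\<lambda>x. v (Psi k x)) x))\<^sup>2"
    using jet_bound by blast
  define C3 where "C3 = sqrt (C1 * (1 + 4 * (1 / c)\<^sup>2)) + 1"
  have C3: "C3 > 0" using C1(1) by (simp add: C3_def add_nonneg_pos)
  show ?thesis
  proof (rule that[of "K * C3 * K"])
    show "K * C3 * K > 0" using K(1) C3 by simp
    fix k :: real and v :: "real^'n \<Rightarrow> real" assume k: "0 \<le> k" "k \<le> 1" and v: "v \<in> ball_polys"
    interpret smooth_domain "wk k" x0 "1 / c" by (rule domain[OF k(1)])
    note [simp] = U_eq_Om[OF k(1)]
    have pv: "real_polynomial_function v" by (rule ball_polys_polynomial[OF v])
    have sv: "smooth v" by (rule ball_polys_smooth[OF v])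
    define u where "u = (\<lambda>x. v (Psi k x))"
    have su: "smooth u" unfolding u_def by (rule smooth_comp[OF pv])
    obtain h where h: "smooth h" "u = (\<lambda>x. wk k x * h x)" using comp_form[OF v, of k] by (auto simp: u_def)
    let ?M = "lebesgue_on (Om k)"
    have cj: "continuous_on UNIV (\<lambda>x. norm (jet v (Psi k x)))"
      by (intro continuous_on_norm continuous_on_compose2[OF continuous_jet[OF sv, of UNIV]] continuous_Psi) auto
    have "(l2norm ?M (\<lambda>x. norm (jet v (Psi k x))))\<^sup>2 = (\<integral>x. (norm (jet v (Psi k x)))\<^sup>2 \<partial>?M)"
      by (simp add: l2norm_square)
    also have "\<dots> \<le> (\<integral>x. C1 * (norm (jet u x))\<^sup>2 \<partial>?M)"
    proof -
      have "(\<integral>x. (norm (jet v (Psi k x)))\<^sup>2 \<partial>lebesgue_on U) \<le> (\<integral>x. C1 * (norm (jet u x))\<^sup>2 \<partial>lebesgue_on U)"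
      proof (rule integral_mono_U)
        show "continuous_on UNIV (\<lambda>x. (norm (jet v (Psi k x)))\<^sup>2)" using cj by (rule continuous_on_power)
        show "continuous_on UNIV (\<lambda>x. C1 * (norm (jet u x))\<^sup>2)"
          by (intro continuous_on_mult_left continuous_on_power continuous_on_norm continuous_jet su)
        fix x assume "0 < wk k x"
        then have "x \<in> Om k" by (simp add: Om_def wk_pos_iff)
        then have "x \<in> cball x0 (1 / c)" using Om_subset[OF k(1)] by blast
        then show "(norm (jet v (Psi k x)))\<^sup>2 \<le> C1 * (norm (jet u x))\<^sup>2"
          unfolding u_def by (rule C1(2)[OF k _ pv])
      qed
      then show ?thesis by simp
    qed
    also have "\<dots> = C1 * ((\<integral>x. (\<Sum>i\<in>UNIV. (partial i u x)\<^sup>2) \<partial>?M)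
        + (\<integral>x. (\<Sum>i\<in>UNIV. \<Sum>j\<in>UNIV. (partial i (partial j u) x)\<^sup>2) \<partial>?M))"
    proof -
      have "integrable (lebesgue_on U) (\<lambda>x. \<Sum>i\<in>UNIV. (partial i u x)\<^sup>2)"
        "integrable (lebesgue_on U) (\<lambda>x. \<Sum>i\<in>UNIV. \<Sum>j\<in>UNIV. (partial i (partial j u) x)\<^sup>2)"
        by (intro integrable_smooth smooth_intros su)+
      then show ?thesis unfolding norm_jet by (simp del: Bochner_Integration.integral_sum)
    qed
    also have "\<dots> \<le> C1 * (4 * (1 / c)\<^sup>2 * (\<integral>x. (laplacian u x)\<^sup>2 \<partial>?M) + (\<integral>x. (laplacian u x)\<^sup>2 \<partial>?M))"
      using gradient_bound[OF h] miranda_talenti[OF h wk_concave[OF k(1)]] C1(1)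
      by (intro mult_left_mono add_mono) auto
    also have "\<dots> = (sqrt (C1 * (1 + 4 * (1 / c)\<^sup>2)) * l2norm ?M (laplacian u))\<^sup>2"
      using C1(1) by (simp add: power_mult_distrib l2norm_square algebra_simps)
    also have "\<dots> \<le> (C3 * l2norm ?M (laplacian u))\<^sup>2"
      using C1(1) by (intro power_mono mult_right_mono) (auto simp: C3_def)
    finally have 1: "l2norm ?M (\<lambda>x. norm (jet v (Psi k x))) \<le> C3 * l2norm ?M (laplacian u)"
      by (rule power2_le_imp_le) (use C3 in simp)
    have "l2norm (lebesgue_on (ball 0 1)) (jet v)
        = l2norm (lebesgue_on (ball 0 1)) (\<lambda>y. norm (jet v (Psi k (Phi k y))))"
      using k by (simp add: l2norm_def)
    also have "\<dots> \<le> K * l2norm ?M (\<lambda>x. norm (jet v (Psi k x)))"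
      by (rule K(2)[OF k cj])
    also have "\<dots> \<le> K * (C3 * l2norm ?M (laplacian u))"
      using 1 K(1) by (intro mult_left_mono) auto
    also have "laplacian u = (\<lambda>x. T k v (Psi k x))"
      using T_Psi[OF k(1) v] by (simp add: u_def fun_eq_iff)
    also have "K * (C3 * l2norm ?M (\<lambda>x. T k v (Psi k x)))
        \<le> K * (C3 * (K * l2norm (lebesgue_on (ball 0 1)) (T k v)))"
      using K(1) C3 by (intro mult_left_mono K(3) continuous_T k sv) auto
    finally show "l2norm (lebesgue_on (ball 0 1)) (jet v) \<le> K * C3 * K * l2norm (lebesgue_on (ball 0 1)) (T k v)"
      by (simp add: mult_ac)
  qed
qed

text \<open>\<open>Psi 0\<close> is a similarity with factor \<open>c\<close>, so \<open>T 0\<close>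
  is \<open>c^2\<close> times the Laplacian.\<close>

lemma T_0_dense:
  assumes f: "continuous_on (cball 0 1) f" and e: "e > 0"
  shows "\<exists>v\<in>ball_polys. l2norm (lebesgue_on (ball 0 1)) (\<lambda>x. T 0 v x - f x) < e"
proof -
  have P0: "P 0 i l = (\<lambda>x. of_bool (i = l) * c)" for i l by (auto simp: P_def)
  have "coeff 0 x = (0, c\<^sup>2 *\<^sub>R mat 1)" for x
    by (simp add: coeff_def P0 vec_eq_iff mat_def of_bool_def mult_delta_left power2_eq_square)
  then have T0: "T 0 v y = c\<^sup>2 * laplacian v y" for v y
    by (simp add: T_def jet_def mat_inner_hess)
  obtain v where v: "v \<in> ball_polys"
    "l2norm (lebesgue_on (ball 0 1)) (\<lambda>x. laplacian v x - (1 / c\<^sup>2) * f x) < e / c\<^sup>2"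
    using unit_ball_dense[OF continuous_on_mult_left[OF f], of "e / c\<^sup>2" "1 / c\<^sup>2"] e c by auto
  have "T 0 v x - f x = c\<^sup>2 * (laplacian v x - (1 / c\<^sup>2) * f x)" for x
    using c by (simp add: T0 right_diff_distrib)
  then have "l2norm (lebesgue_on (ball 0 1)) (\<lambda>x. T 0 v x - f x)
      = c\<^sup>2 * l2norm (lebesgue_on (ball 0 1)) (\<lambda>x. laplacian v x - (1 / c\<^sup>2) * f x)"
    by (simp add: l2norm_cmult)
  also have "\<dots> < e" using v(2) c by (simp add: pos_less_divide_eq mult.commute)
  finally show ?thesis using v(1) by blast
qed

text \<open>Continuation in \<open>k\<close>: by uniform continuity the coefficients change by less
  than \<open>1 / (2 C2)\<close> over a step \<open>1 / n\<close>, which by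
  \<open>T_estimate\<close> is a perturbation of relative size 1/2.\<close>

lemma T_1_dense:
  assumes f: "continuous_on (cball 0 1) f" and e: "e > 0"
  shows "\<exists>v\<in>ball_polys. l2norm (lebesgue_on (ball 0 1)) (\<lambda>x. T 1 v x - f x) < e"
proof -
  let ?M = "lebesgue_on (ball (0 :: real^'n) 1)"
  obtain C2 where C2: "C2 > 0" "\<And>k v. 0 \<le> k \<Longrightarrow> k \<le> 1 \<Longrightarrow> v \<in> ball_polys \<Longrightarrow>
      l2norm ?M (jet v) \<le> C2 * l2norm ?M (T k v)"
    using T_estimate by blast
  have "uniformly_continuous_on ({0..1} \<times> cball 0 1) (\<lambda>p. coeff (fst p) (Phi (fst p) (snd p)))"
    by (intro compact_uniformly_continuous continuous_coeff_Phi compact_Times) auto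
  then obtain d where d: "d > 0" "\<And>p q. p \<in> {0..1} \<times> cball 0 1 \<Longrightarrow> q \<in> {0..1} \<times> cball 0 1 \<Longrightarrow> dist q p < d \<Longrightarrow>
      dist (coeff (fst q) (Phi (fst q) (snd q))) (coeff (fst p) (Phi (fst p) (snd p))) < 1 / (2 * C2)"
    unfolding uniformly_continuous_on_def using C2(1) by (metis divide_pos_pos mult_pos_pos zero_less_numeral zero_less_one)
  obtain n :: nat where n: "n > 0" "1 / real n < d"
    using d(1) by (metis nat_approx_posE of_nat_0_less_iff zero_less_Suc)
  have step: "\<forall>f e. continuous_on (cball 0 1) f \<longrightarrow> e > 0 \<longrightarrow>
      (\<exists>v\<in>ball_polys. l2norm ?M (\<lambda>x. T (real i / real n) v x - f x) < e)" if "i \<le> n" for i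
    using that
  proof (induction i)
    case 0
    then show ?case using T_0_dense by simp
  next
    case (Suc i)
    define k k' where "k = real i / real n" and "k' = real (Suc i) / real n"
    have k: "0 \<le> k" "k \<le> 1" "0 \<le> k'" "k' \<le> 1" using Suc.prems n by (auto simp: k_def k'_def)
    have kk: "\<bar>k' - k\<bar> < d"
      using n by (simp add: k_def k'_def diff_divide_distrib[symmetric])
    have dense: "\<exists>v\<in>ball_polys. l2norm ?M (\<lambda>x. T k v x - f x) < e"
      if "continuous_on (cball 0 1) f" "e > 0" for f e
      using Suc.IH Suc.prems that by (auto simp: k_def)
    show ?case
      unfolding k'_def[symmetric]
    proof (intro allI impI)
      fix f :: "real^'n \<Rightarrow> real" and e :: real assume f: "continuous_on (cball 0 1) f" and e: "e > 0"
      show "\<exists>v\<in>ball_polys. l2norm ?M (\<lambda>x. T k' v x - f x) < e"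
      proof (rule dense_range_perturbation[where Y="{f. continuous_on (cball 0 1) f}" and S="T k" and \<theta>="1/2"])
        fix v :: "real^'n \<Rightarrow> real" assume v: "v \<in> ball_polys"
        note cT = continuous_T[OF k(1,2) ball_polys_smooth[OF v]] continuous_T[OF k(3,4) ball_polys_smooth[OF v]]
        have "l2norm ?M (\<lambda>x. T k' v x - T k v x) \<le> 1 / (2 * C2) * l2norm ?M (jet v)"
        proof (rule l2norm_mono)
          show "sq_integrable ?M (jet v)"
            by (intro sq_integrable_ball continuous_jet ball_polys_smooth v)
          show "(\<lambda>x. T k' v x - T k v x) \<in> borel_measurable ?M"
            using sq_integrable_ball[OF continuous_on_diff[OF cT(2,1)]] by (simp add: sq_integrable_def)
          show "AE y in ?M. norm (T k' v y - T k v y) \<le> 1 / (2 * C2) * norm (jet v y)"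
          proof (rule AE_I2)
            fix y assume "y \<in> space ?M"
            then have y: "y \<in> cball 0 1" by (simp add: space_restrict_space)
            have "dist (coeff k' (Phi k' y)) (coeff k (Phi k y)) < 1 / (2 * C2)"
              using d(2)[of "(k, y)" "(k', y)"] y k kk by (simp add: dist_Pair_Pair dist_real_def)
            then have "norm (coeff k' (Phi k' y) - coeff k (Phi k y)) * norm (jet v y) \<le> 1 / (2 * C2) * norm (jet v y)"
              by (intro mult_right_mono) (auto simp: dist_norm)
            then show "norm (T k' v y - T k v y) \<le> 1 / (2 * C2) * norm (jet v y)"
              using Cauchy_Schwarz_ineq2[of "coeff k' (Phi k' y) - coeff k (Phi k y)" "jet v y"]
              by (simp add: T_def inner_diff_left)
          qed
        qed (use C2 in simp)
        also have "\<dots> \<le> 1 / (2 * C2) * (C2 * l2norm ?M (T k v))"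
          using C2 by (intro mult_left_mono C2(2) k v) auto
        finally show "l2norm ?M (\<lambda>x. T k' v x - T k v x) \<le> 1/2 * l2norm ?M (T k v)"
          using C2(1) by simp
        show "sq_integrable ?M (T k v)" "T k' v \<in> {f. continuous_on (cball 0 1) f}"
          using sq_integrable_ball cT by auto
      next
        fix u v :: "real^'n \<Rightarrow> real" and x assume "u \<in> ball_polys" "v \<in> ball_polys"
        then show "T k' (\<lambda>x. u x + v x) x = T k' u x + T k' v x"
          by (simp add: T_def jet_add ball_polys_smooth inner_add_right)
      qed (use f e dense ball_polys_add sq_integrable_ball in \<open>auto intro: continuous_on_diff\<close>)
    qed
  qed
  show ?thesis
    using step[of n] n f e by simp
qed

text \<open>A right-hand side on the domain is moved to the ball by \<open>Phi 1\<close>, solved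
  there approximately for \<open>T 1\<close>, and the solution is moved back by
  \<open>Psi 1\<close>.\<close>

theorem dense_domain:
  "dense_domain (wk 1) x0 (1 / c) {\<lambda>x. v (Psi 1 x) | v. v \<in> ball_polys}"
proof -
  interpret smooth_domain "wk 1" x0 "1 / c" by (rule domain) simp
  obtain K where K: "K > 0"
    "\<And>k f. 0 \<le> k \<Longrightarrow> k \<le> 1 \<Longrightarrow> continuous_on UNIV f \<Longrightarrow>
      l2norm (lebesgue_on (ball 0 1)) (\<lambda>y. f (Phi k y) :: real) \<le> K * l2norm (lebesgue_on (Om k)) f"
    "\<And>k f. 0 \<le> k \<Longrightarrow> k \<le> 1 \<Longrightarrow> continuous_on (cball 0 1) f \<Longrightarrow>
      l2norm (lebesgue_on (Om k)) (\<lambda>x. f (Psi k x) :: real) \<le> K * l2norm (lebesgue_on (ball 0 1)) f"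
    using pullback_bounds by blast
  show ?thesis
  proof unfold_locales
    show "(\<Sum>i\<in>UNIV. \<Sum>j\<in>UNIV. partial i (partial j (wk 1)) x * \<xi> i * \<xi> j) \<le> 0" for x \<xi>
      by (rule wk_concave) simp
    show "\<exists>h. smooth h \<and> u = (\<lambda>x. wk 1 x * h x)" if "u \<in> {\<lambda>x. v (Psi 1 x) | v. v \<in> ball_polys}" for u
      using that comp_form by blast
    show "(\<lambda>x. u x + v x) \<in> {\<lambda>x. v (Psi 1 x) | v. v \<in> ball_polys}"
      if "u \<in> {\<lambda>x. v (Psi 1 x) | v. v \<in> ball_polys}" "v \<in> {\<lambda>x. v (Psi 1 x) | v. v \<in> ball_polys}" for u v
      using that ball_polys_add by fastforce
    fix f :: "real^'n \<Rightarrow> real" and e :: real assume f: "continuous_on UNIV f" and e: "e > 0"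
    have cf: "continuous_on (cball 0 1) (\<lambda>y. f (Phi 1 y))"
      by (intro continuous_on_compose2[OF f] continuous_Phi) auto
    obtain v where v: "v \<in> ball_polys" "l2norm (lebesgue_on (ball 0 1)) (\<lambda>y. T 1 v y - f (Phi 1 y)) < e / K"
      using T_1_dense[OF cf, of "e / K"] e K(1) by auto
    have "l2norm (lebesgue_on (Om 1)) (\<lambda>x. T 1 v (Psi 1 x) - f (Phi 1 (Psi 1 x)))
        \<le> K * l2norm (lebesgue_on (ball 0 1)) (\<lambda>y. T 1 v y - f (Phi 1 y))"
      by (rule K(3)) (auto intro!: continuous_on_diff continuous_T cf ball_polys_smooth v(1))
    also have "\<dots> < e" using v(2) K(1) by (simp add: pos_less_divide_eq mult.commute)
    finally have "l2norm (lebesgue_on U) (\<lambda>x. laplacian (\<lambda>x. v (Psi 1 x)) x - f x) < e"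
      by (simp add: T_Psi v(1) U_eq_Om)
    then show "\<exists>u\<in>{\<lambda>x. v (Psi 1 x) | v. v \<in> ball_polys}. l2norm (lebesgue_on U) (\<lambda>x. laplacian u x - f x) < e"
      using v(1) by blast
  qed
qed

end

section \<open>Completeness and weak compactness in \<open>L\<^sup>2\<close>\<close>

lemma nn_integral_norm_square:
  assumes "sq_integrable M f"
  shows "(\<integral>\<^sup>+x. ennreal ((norm (f x))\<^sup>2) \<partial>M) = ennreal ((l2norm M f)\<^sup>2)"
  unfolding l2norm_square using assms
  by (intro nn_integral_eq_integral) (auto simp: sq_integrable_def)

lemma l2_integral_norm_le:
  fixes f :: "'a \<Rightarrow> 'b::euclidean_space"
  assumes "finite_measure M" "sq_integrable M f"
  shows "integrable M f" "(\<integral>x. norm (f x) \<partial>M) \<le> sqrt (measure M (space M)) * l2norm M f"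
proof -
  interpret finite_measure M by fact
  have 1: "sq_integrable M (\<lambda>x. 1 :: real)" "sq_integrable M (\<lambda>x. norm (f x))"
    using assms(2) by (auto simp: sq_integrable_def)
  from sq_integrable_inner(2)[OF 1] show "integrable M f"
    using assms(2) by (auto simp: sq_integrable_def intro: integrable_norm_cancel)
  show "(\<integral>x. norm (f x) \<partial>M) \<le> sqrt (measure M (space M)) * l2norm M f"
    using integral_norm_mult_le[OF 1] by (simp add: l2norm_def)
qed

text \<open>On a finite measure space the increments are summable in L^1, so almost everywhere their
  sum converges absolutely.\<close>

lemma AE_convergent_of_fast:
  fixes Z :: "nat \<Rightarrow> 'a \<Rightarrow> 'b::euclidean_space"
  assumes M: "finite_measure M" and Z: "\<And>n. sq_integrable M (Z n)"
    and fast: "\<And>n. l2norm M (\<lambda>x. Z (Suc n) x - Z n x) \<le> (1/2) ^ n"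
  shows "AE x in M. convergent (\<lambda>n. Z n x)"
proof -
  define d where "d n = (\<lambda>x. Z (Suc n) x - Z n x)" for n
  have sd: "sq_integrable M (d n)" for n unfolding d_def by (intro sq_integrable_diff Z)
  then have [measurable]: "d n \<in> borel_measurable M" for n by (simp add: sq_integrable_def)
  define c where "c = sqrt (measure M (space M))"
  have c: "c \<ge> 0" by (simp add: c_def)
  have "(\<integral>\<^sup>+x. (\<Sum>n. ennreal (norm (d n x))) \<partial>M) = (\<Sum>n. \<integral>\<^sup>+x. ennreal (norm (d n x)) \<partial>M)"
    by (rule nn_integral_suminf) measurable
  also have "\<dots> \<le> (\<Sum>n. ennreal (c * (1/2) ^ n))"
  proof (rule suminf_le)
    fix n
    have "(\<integral>\<^sup>+x. ennreal (norm (d n x)) \<partial>M) = ennreal (\<integral>x. norm (d n x) \<partial>M)"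
      using l2_integral_norm_le(1)[OF M sd[of n]] by (intro nn_integral_eq_integral) auto
    also have "\<dots> \<le> ennreal (c * (1/2) ^ n)"
    proof (rule ennreal_leI)
      have "(\<integral>x. norm (d n x) \<partial>M) \<le> c * l2norm M (d n)"
        unfolding c_def by (rule l2_integral_norm_le(2)[OF M sd])
      also have "\<dots> \<le> c * (1/2) ^ n" using fast[of n] c unfolding d_def by (rule mult_left_mono)
      finally show "(\<integral>x. norm (d n x) \<partial>M) \<le> c * (1/2) ^ n" .
    qed
    finally show "(\<integral>\<^sup>+x. ennreal (norm (d n x)) \<partial>M) \<le> ennreal (c * (1/2) ^ n)" .
  qed auto
  also have "\<dots> = ennreal (\<Sum>n. c * (1/2) ^ n)"
    using c by (intro suminf_ennreal2 summable_mult summable_geometric) auto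
  also have "\<dots> < \<infinity>" by simp
  finally have "AE x in M. (\<Sum>n. ennreal (norm (d n x))) \<noteq> \<infinity>"
    by (intro nn_integral_PInf_AE) auto
  then show ?thesis
  proof eventually_elim
    fix x assume "(\<Sum>n. ennreal (norm (d n x))) \<noteq> \<infinity>"
    then have "summable (\<lambda>n. norm (d n x))"
      by (intro summable_suminf_not_top) auto
    then have "summable (\<lambda>n. d n x)" by (rule summable_norm_cancel)
    then have "convergent (\<lambda>n. \<Sum>k<n. d k x)"
      by (simp add: summable_iff_convergent)
    moreover have "(\<Sum>k<n. d k x) = Z n x - Z 0 x" for n
      unfolding d_def by (rule sum_lessThan_telescope)
    ultimately have "convergent (\<lambda>n. (Z n x - Z 0 x) + Z 0 x)"
      by (intro convergent_add convergent_const) auto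
    then show "convergent (\<lambda>n. Z n x)" by simp
  qed
qed

text \<open>Riesz--Fischer: a rapidly Cauchy subsequence converges almost everywhere, and Fatou's
  lemma transfers the Cauchy estimates to the limit.\<close>

theorem l2_complete:
  fixes Z :: "nat \<Rightarrow> 'a \<Rightarrow> 'b::euclidean_space"
  assumes M: "finite_measure M" and Z: "\<And>n. sq_integrable M (Z n)"
    and cauchy: "\<And>e. e > 0 \<Longrightarrow> \<exists>N. \<forall>m\<ge>N. \<forall>n\<ge>N. l2norm M (\<lambda>x. Z m x - Z n x) < e"
  obtains f where "sq_integrable M f" "(\<lambda>n. l2norm M (\<lambda>x. Z n x - f x)) \<longlonglongrightarrow> 0"
proof -
  have "\<exists>r. \<forall>k::nat. (\<forall>m\<ge>r k. \<forall>n\<ge>r k. l2norm M (\<lambda>x. Z m x - Z n x) < (1/2) ^ k) \<and> r (Suc k) > r k"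
  proof (rule dependent_nat_choice)
    show "\<exists>N. \<forall>m\<ge>N. \<forall>n\<ge>N. l2norm M (\<lambda>x. Z m x - Z n x) < (1/2) ^ 0"
      using cauchy[of 1] by simp
    fix N k
    obtain N' where "\<forall>m\<ge>N'. \<forall>n\<ge>N'. l2norm M (\<lambda>x. Z m x - Z n x) < (1/2) ^ Suc k"
      using cauchy[of "(1/2) ^ Suc k"] by auto
    then show "\<exists>y. (\<forall>m\<ge>y. \<forall>n\<ge>y. l2norm M (\<lambda>x. Z m x - Z n x) < (1/2) ^ Suc k) \<and> N < y"
      by (intro exI[of _ "max N' (Suc N)"]) auto
  qed
  then obtain r where r: "\<And>k m n. m \<ge> r k \<Longrightarrow> n \<ge> r k \<Longrightarrow> l2norm M (\<lambda>x. Z m x - Z n x) < (1/2) ^ k"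
    and mono: "\<And>k. r k < r (Suc k)" by blast
  have [measurable]: "Z n \<in> borel_measurable M" for n using Z[of n] by (simp add: sq_integrable_def)
  have conv: "AE x in M. convergent (\<lambda>k. Z (r k) x)"
    by (rule AE_convergent_of_fast[OF M Z less_imp_le[OF r]]) (use mono in \<open>auto intro: less_imp_le\<close>)
  define f where "f x = lim (\<lambda>k. Z (r k) x)" for x
  have fm [measurable]: "f \<in> borel_measurable M"
    unfolding f_def by (rule borel_measurable_lim_metric) measurable
  have lim: "AE x in M. (\<lambda>k. Z (r k) x) \<longlonglongrightarrow> f x"
    using conv by eventually_elim (simp add: f_def convergent_LIMSEQ_iff)
  have fatou: "(\<integral>\<^sup>+x. ennreal ((norm (Z n x - f x))\<^sup>2) \<partial>M) \<le> ennreal (((1/2) ^ k)\<^sup>2)" if n: "n \<ge> r k" for n k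
  proof -
    have "(\<integral>\<^sup>+x. ennreal ((norm (Z n x - f x))\<^sup>2) \<partial>M)
        = (\<integral>\<^sup>+x. liminf (\<lambda>j. ennreal ((norm (Z n x - Z (r j) x))\<^sup>2)) \<partial>M)"
    proof (rule nn_integral_cong_AE, use lim in eventually_elim)
      fix x assume "(\<lambda>k. Z (r k) x) \<longlonglongrightarrow> f x"
      then have "(\<lambda>j. ennreal ((norm (Z n x - Z (r j) x))\<^sup>2)) \<longlonglongrightarrow> ennreal ((norm (Z n x - f x))\<^sup>2)"
        by (intro tendsto_intros)
      then show "ennreal ((norm (Z n x - f x))\<^sup>2) = liminf (\<lambda>j. ennreal ((norm (Z n x - Z (r j) x))\<^sup>2))"
        by (rule lim_imp_Liminf[OF sequentially_bot, symmetric])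
    qed
    also have "\<dots> \<le> liminf (\<lambda>j. \<integral>\<^sup>+x. ennreal ((norm (Z n x - Z (r j) x))\<^sup>2) \<partial>M)"
      by (rule nn_integral_liminf) measurable
    also have "\<dots> \<le> ennreal (((1/2) ^ k)\<^sup>2)"
    proof (rule Liminf_le)
      show "\<forall>\<^sub>F j in sequentially. (\<integral>\<^sup>+x. ennreal ((norm (Z n x - Z (r j) x))\<^sup>2) \<partial>M) \<le> ennreal (((1/2) ^ k)\<^sup>2)"
        using eventually_ge_at_top[of k]
      proof eventually_elim
        fix j assume "k \<le> j"
        then have "r k \<le> r j" using mono by (simp add: lift_Suc_mono_le less_imp_le)
        then have "l2norm M (\<lambda>x. Z n x - Z (r j) x) \<le> (1/2) ^ k" using r[of k n "r j"] n by simp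
        then have "(l2norm M (\<lambda>x. Z n x - Z (r j) x))\<^sup>2 \<le> ((1/2) ^ k)\<^sup>2" by (intro power_mono) auto
        then show "(\<integral>\<^sup>+x. ennreal ((norm (Z n x - Z (r j) x))\<^sup>2) \<partial>M) \<le> ennreal (((1/2) ^ k)\<^sup>2)"
          by (subst nn_integral_norm_square) (auto intro: Z ennreal_leI)
      qed
    qed simp
    finally show ?thesis .
  qed
  have sqd: "sq_integrable M (\<lambda>x. Z n x - f x)" if "n \<ge> r k" for n k
  proof -
    have "(\<integral>\<^sup>+x. ennreal (norm ((norm (Z n x - f x))\<^sup>2)) \<partial>M) < \<infinity>"
      using le_less_trans[OF fatou[OF that]] by simp
    then have "integrable M (\<lambda>x. (norm (Z n x - f x))\<^sup>2)"
      by (intro integrableI_bounded) auto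
    then show ?thesis by (simp add: sq_integrable_def)
  qed
  have "sq_integrable M (\<lambda>x. Z (r 0) x - (Z (r 0) x - f x))"
    by (intro sq_integrable_diff Z sqd[of 0]) auto
  then have sqf: "sq_integrable M f" by simp
  have "(\<lambda>n. l2norm M (\<lambda>x. Z n x - f x)) \<longlonglongrightarrow> 0"
  proof (rule LIMSEQ_I)
    fix e :: real assume e: "e > 0"
    then obtain k where k: "(1/2 :: real) ^ k < e" using real_arch_pow_inv[of e "1/2"] by auto
    have "l2norm M (\<lambda>x. Z n x - f x) < e" if n: "n \<ge> r k" for n
    proof -
      have "(l2norm M (\<lambda>x. Z n x - f x))\<^sup>2 \<le> ((1/2) ^ k)\<^sup>2"
        using fatou[OF n] nn_integral_norm_square[OF sqd[OF n]] by simp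
      then have "l2norm M (\<lambda>x. Z n x - f x) \<le> (1/2) ^ k" by (rule power2_le_imp_le) simp
      with k show ?thesis by simp
    qed
    then show "\<exists>N. \<forall>n\<ge>N. norm (l2norm M (\<lambda>x. Z n x - f x) - 0) < e" by auto
  qed
  with sqf show ?thesis by (rule that)
qed

text \<open>The support starts at \<open>n\<close>, so a combination of index \<open>n\<close>
  inherits whatever convex property holds for the sequence from \<open>n\<close> on.\<close>

definition conv_weights :: "nat \<Rightarrow> nat \<Rightarrow> (nat \<Rightarrow> real) \<Rightarrow> bool" where
  "conv_weights n N a \<longleftrightarrow> (\<forall>k. 0 \<le> a k) \<and> (\<forall>k. k < n \<or> N \<le> k \<longrightarrow> a k = 0) \<and> (\<Sum>k<N. a k) = 1"

lemma conv_weights_extend: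
  assumes "conv_weights n N a" "N \<le> N'" "n' \<le> n"
  shows "conv_weights n' N' a" "(\<Sum>k<N'. a k *\<^sub>R (z k :: 'b::real_vector)) = (\<Sum>k<N. a k *\<^sub>R z k)"
proof -
  have zero: "a k = 0" if "k \<ge> N" for k using assms that by (auto simp: conv_weights_def)
  have "(\<Sum>k<N'. a k) = (\<Sum>k<N. a k)"
    using assms(2) zero by (intro sum.mono_neutral_right) auto
  then show "conv_weights n' N' a"
    using assms zero by (auto simp: conv_weights_def)
  show "(\<Sum>k<N'. a k *\<^sub>R z k) = (\<Sum>k<N. a k *\<^sub>R z k)"
    using assms(2) zero by (intro sum.mono_neutral_right) auto
qed

lemma parallelogram_l2:
  assumes "sq_integrable M f" "sq_integrable M g"
  shows "(l2norm M (\<lambda>x. f x - g x))\<^sup>2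
    = 2 * (l2norm M f)\<^sup>2 + 2 * (l2norm M g)\<^sup>2 - 4 * (l2norm M (\<lambda>x. (1/2) *\<^sub>R f x + (1/2) *\<^sub>R g x))\<^sup>2"
proof -
  have "(l2norm M (\<lambda>x. f x - g x))\<^sup>2 = (\<integral>x. (2 * (norm (f x))\<^sup>2 + 2 * (norm (g x))\<^sup>2)
      - 4 * (norm ((1/2) *\<^sub>R f x + (1/2) *\<^sub>R g x))\<^sup>2 \<partial>M)"
    unfolding l2norm_square
    by (intro Bochner_Integration.integral_cong refl)
      (simp add: power2_norm_eq_inner inner_add_left inner_add_right inner_diff_left inner_diff_right
        inner_commute algebra_simps)
  also have "\<dots> = (\<integral>x. 2 * (norm (f x))\<^sup>2 + 2 * (norm (g x))\<^sup>2 \<partial>M)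
      - (\<integral>x. 4 * (norm ((1/2) *\<^sub>R f x + (1/2) *\<^sub>R g x))\<^sup>2 \<partial>M)"
    using assms sq_integrable_add[OF sq_integrable_scaleR[OF assms(1), of "1/2"] sq_integrable_scaleR[OF assms(2), of "1/2"]]
    by (intro Bochner_Integration.integral_diff) (auto simp: sq_integrable_def)
  also have "(\<integral>x. 2 * (norm (f x))\<^sup>2 + 2 * (norm (g x))\<^sup>2 \<partial>M)
      = (\<integral>x. 2 * (norm (f x))\<^sup>2 \<partial>M) + (\<integral>x. 2 * (norm (g x))\<^sup>2 \<partial>M)"
    using assms by (intro Bochner_Integration.integral_add) (auto simp: sq_integrable_def)
  finally show ?thesis by (simp add: l2norm_square)
qed

text \<open>Almost minimal convex combinations of the tails form a Cauchy sequence by the parallelogram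
  law.\<close>

theorem convex_combinations_converge:
  fixes Z :: "nat \<Rightarrow> 'a \<Rightarrow> 'b::euclidean_space"
  assumes M: "finite_measure M" and Z: "\<And>n. sq_integrable M (Z n)" and B: "\<And>n. l2norm M (Z n) \<le> B"
  obtains N a f where "\<And>n. conv_weights n (N n) (a n)" "sq_integrable M f"
    "(\<lambda>n. l2norm M (\<lambda>x. (\<Sum>k<N n. a n k *\<^sub>R Z k x) - f x)) \<longlonglongrightarrow> 0"
proof -
  define Y where "Y N a = (\<lambda>x. \<Sum>k<N. a k *\<^sub>R Z k x)" for N :: nat and a
  have sY: "sq_integrable M (Y N a)" for N a
    unfolding Y_def by (intro sq_integrable_sum sq_integrable_scaleR Z)
  \<comment> \<open>Squared norms of convex combinations of the tail from \<open>n\<close>. Their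
    infima \<open>d n\<close> increase as the tails shrink and are bounded by \<open>B^2\<close>,
    hence converge.\<close>
  define D where "D n = {(l2norm M (Y N a))\<^sup>2 | N a. conv_weights n N a}" for n
  define d where "d n = Inf (D n)" for n
  have single: "conv_weights n (Suc n) (\<lambda>k. of_bool (k = n))" for n
    by (auto simp: conv_weights_def of_bool_def)
  have Ysingle: "Y (Suc n) (\<lambda>k. of_bool (k = n)) = Z n" for n
    by (simp add: Y_def of_bool_def if_distribR[of _ "\<lambda>z. z *\<^sub>R _"] fun_eq_iff)
  have bdd: "bdd_below (D n)" for n by (rule bdd_belowI[of _ 0]) (auto simp: D_def)
  have ZD: "(l2norm M (Z n))\<^sup>2 \<in> D m" if "m \<le> n" for m n
    using conv_weights_extend(1)[OF single order_refl that] Ysingle[of n] unfolding D_def mem_Collect_eq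
    by (intro exI[of _ "Suc n"] exI[of _ "\<lambda>k. of_bool (k = n)"]) simp
  have ne: "D n \<noteq> {}" for n using ZD[of n n] by auto
  have d_le: "d n \<le> (l2norm M (Y N a))\<^sup>2" if "conv_weights n N a" for n N a
    unfolding d_def using that bdd by (intro cInf_lower) (auto simp: D_def)
  have dB: "d n \<le> B\<^sup>2" for n
  proof -
    have "d n \<le> (l2norm M (Z n))\<^sup>2" unfolding d_def using ZD bdd by (intro cInf_lower) auto
    also have "\<dots> \<le> B\<^sup>2" using B by (intro power_mono) auto
    finally show ?thesis .
  qed
  have "D n \<subseteq> D m" if "m \<le> n" for m n
    using conv_weights_extend(1)[OF _ order_refl that] unfolding D_def by blast
  then have d_mono: "d m \<le> d n" if "m \<le> n" for m n
    unfolding d_def using that bdd ne by (intro cInf_superset_mono) auto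
  have "\<forall>n. \<exists>Na. conv_weights n (fst Na) (snd Na) \<and> (l2norm M (Y (fst Na) (snd Na)))\<^sup>2 < d n + inverse (real (Suc n))"
  proof
    fix n
    have "d n < d n + inverse (real (Suc n))" by simp
    then obtain y where "y \<in> D n" "y < d n + inverse (real (Suc n))"
      using cInf_lessD[OF ne[of n]] unfolding d_def by blast
    then show "\<exists>Na. conv_weights n (fst Na) (snd Na) \<and> (l2norm M (Y (fst Na) (snd Na)))\<^sup>2 < d n + inverse (real (Suc n))"
      by (auto simp: D_def)
  qed
  from choice[OF this] obtain Na where Na: "\<And>n. conv_weights n (fst (Na n)) (snd (Na n))"
    "\<And>n. (l2norm M (Y (fst (Na n)) (snd (Na n))))\<^sup>2 < d n + inverse (real (Suc n))"
    by blast
  define y where "y n = Y (fst (Na n)) (snd (Na n))" for n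
  have close: "(l2norm M (\<lambda>x. y m x - y n x))\<^sup>2 \<le> 2 * (d m - d n) + 4 * inverse (real (Suc n))"
    if "n \<le> m" for m n
  proof -
    define K where "K = max (fst (Na m)) (fst (Na n))"
    have am: "conv_weights n K (snd (Na m))" and an: "conv_weights n K (snd (Na n))"
      using conv_weights_extend(1)[OF Na(1)[of m], of K n] conv_weights_extend(1)[OF Na(1)[of n], of K n] that
      by (simp_all add: K_def)
    \<comment> \<open>The midpoint of two almost minimisers competes for \<open>d n\<close>, so its
      norm cannot be much smaller; the parallelogram law then makes the difference small.\<close>
    have "conv_weights n K (\<lambda>k. (1/2) * snd (Na m) k + (1/2) * snd (Na n) k)"
      using am an by (auto simp: conv_weights_def sum.distrib sum_divide_distrib[symmetric])
    from d_le[OF this] have "d n \<le> (l2norm M (Y K (\<lambda>k. (1/2) * snd (Na m) k + (1/2) * snd (Na n) k)))\<^sup>2" .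
    also have "Y K (\<lambda>k. (1/2) * snd (Na m) k + (1/2) * snd (Na n) k) = (\<lambda>x. (1/2) *\<^sub>R y m x + (1/2) *\<^sub>R y n x)"
    proof
      fix x
      have "y m x = (\<Sum>k<K. snd (Na m) k *\<^sub>R Z k x)" "y n x = (\<Sum>k<K. snd (Na n) k *\<^sub>R Z k x)"
        unfolding y_def Y_def
        using conv_weights_extend(2)[OF Na(1)[of m], of K 0 "\<lambda>k. Z k x"]
          conv_weights_extend(2)[OF Na(1)[of n], of K 0 "\<lambda>k. Z k x"]
        by (simp_all add: K_def)
      then show "Y K (\<lambda>k. (1/2) * snd (Na m) k + (1/2) * snd (Na n) k) x = (1/2) *\<^sub>R y m x + (1/2) *\<^sub>R y n x"
        by (simp add: Y_def scaleR_add_left sum.distrib scaleR_sum_right)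
    qed
    finally have "d n \<le> (l2norm M (\<lambda>x. (1/2) *\<^sub>R y m x + (1/2) *\<^sub>R y n x))\<^sup>2" .
    moreover have "inverse (real (Suc m)) \<le> inverse (real (Suc n))" using that by simp
    moreover have "(l2norm M (y k))\<^sup>2 < d k + inverse (real (Suc k))" for k
      using Na(2)[of k] by (simp add: y_def)
    moreover have "sq_integrable M (y k)" for k
      unfolding y_def by (rule sY)
    ultimately show ?thesis
      using parallelogram_l2[of M "y m" "y n"] by (smt (verit))
  qed
  have "incseq d" using d_mono by (auto simp: incseq_def)
  then have "convergent d"
    using incseq_convergent[of d "B\<^sup>2"] dB by (metis convergentI)
  then have dC: "Cauchy d" by (rule convergent_Cauchy)
  have cauchy: "\<exists>N. \<forall>m\<ge>N. \<forall>n\<ge>N. l2norm M (\<lambda>x. y m x - y n x) < e" if e: "e > 0" for e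
  proof -
    have e2: "e\<^sup>2 / 8 > 0" using e by simp
    obtain N1 where N1: "\<And>m n. m \<ge> N1 \<Longrightarrow> n \<ge> N1 \<Longrightarrow> \<bar>d m - d n\<bar> < e\<^sup>2 / 8"
      using CauchyD[OF dC e2] by auto
    obtain N2 where N2: "inverse (real (Suc N2)) < e\<^sup>2 / 8"
      using reals_Archimedean[OF e2] by auto
    have *: "l2norm M (\<lambda>x. y m x - y n x) < e" if "n \<ge> max N1 N2" "m \<ge> n" for m n
    proof -
      have "inverse (real (Suc n)) \<le> inverse (real (Suc N2))" using that by simp
      moreover have "d m - d n < e\<^sup>2 / 8" using N1[of m n] that abs_ge_self[of "d m - d n"] by linarith
      ultimately have "(l2norm M (\<lambda>x. y m x - y n x))\<^sup>2 < e\<^sup>2"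
        using close[OF that(2)] N2 e2 unfolding right_diff_distrib by linarith
      then show ?thesis by (rule power2_less_imp_less) (use e in simp)
    qed
    have "l2norm M (\<lambda>x. y m x - y n x) < e" if "n \<ge> max N1 N2" "m \<ge> max N1 N2" for m n
    proof (cases "n \<le> m")
      case True
      then show ?thesis using *[OF that(1)] by simp
    next
      case False
      then have "m \<le> n" by simp
      from *[OF that(2) this] show ?thesis
        by (subst l2norm_minus_commute)
    qed
    then show ?thesis by (intro exI[of _ "max N1 N2"] allI impI)
  qed
  have sy: "sq_integrable M (y n)" for n unfolding y_def by (rule sY)
  obtain f where "sq_integrable M f" "(\<lambda>n. l2norm M (\<lambda>x. y n x - f x)) \<longlonglongrightarrow> 0"
    using l2_complete[OF M sy cauchy] by metis
  then show ?thesis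
    using that[of "\<lambda>n. fst (Na n)" "\<lambda>n. snd (Na n)" f] Na(1) by (simp add: y_def Y_def)
qed

section \<open>Approximation of measurable functions\<close>

lemma finite_measure_lebesgue_on:
  assumes "bounded S" "S \<in> sets lebesgue"
  shows "finite_measure (lebesgue_on S)"
proof
  have "emeasure lebesgue S \<noteq> \<infinity>"
    using fmeasurableD2[OF bounded_set_imp_lmeasurable[OF assms]] by simp
  then show "emeasure (lebesgue_on S) (space (lebesgue_on S)) \<noteq> \<infinity>"
    using assms(2) by (subst emeasure_restrict_space) (auto simp: space_restrict_space)
qed

text \<open>Nearest point projection onto the closed convex set \<open>S\<close> is continuous and
  fixes \<open>S\<close>, so it enforces the constraint without disturbing the limit.\<close>

lemma measurable_imp_limit_continuous:
  fixes f :: "'a::euclidean_space \<Rightarrow> 'b::euclidean_space"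
  assumes \<Omega>: "\<Omega> \<in> sets lebesgue" and f: "f \<in> borel_measurable (lebesgue_on \<Omega>)"
    and S: "closed S" "convex S" "S \<noteq> {}" and fS: "AE x in lebesgue_on \<Omega>. f x \<in> S"
  obtains g where "\<And>n. continuous_on UNIV (g n)" "\<And>n x. g n x \<in> S"
    "AE x in lebesgue_on \<Omega>. (\<lambda>n. g n x) \<longlonglongrightarrow> f x"
proof -
  have "f measurable_on \<Omega>"
    using f measurable_on_iff_borel_measurable[OF \<Omega>] by blast
  then obtain N h where N: "negligible N" and h: "\<And>n. continuous_on UNIV (h n)"
    and lim: "\<And>x. x \<notin> N \<Longrightarrow> (\<lambda>n. h n x) \<longlonglongrightarrow> (if x \<in> \<Omega> then f x else 0)"
    unfolding measurable_on_def by blast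
  define g where "g n = (\<lambda>x. closest_point S (h n x))" for n
  have cont: "continuous_on A (closest_point S)" for A
    by (rule continuous_on_closest_point[OF S(2) S(1) S(3)])
  show ?thesis
  proof
    show "continuous_on UNIV (g n)" for n
      unfolding g_def by (rule continuous_on_compose2[OF cont[of UNIV] h]) auto
    show "g n x \<in> S" for n x unfolding g_def by (rule closest_point_in_set[OF S(1,3)])
    have "AE x in lebesgue. x \<notin> N"
      using N by (intro AE_not_in) (simp add: negligible_iff_null_sets)
    then have "AE x in lebesgue_on \<Omega>. x \<in> \<Omega> \<and> x \<notin> N"
      using \<Omega> by (subst AE_restrict_space_iff) auto
    with fS show "AE x in lebesgue_on \<Omega>. (\<lambda>n. g n x) \<longlonglongrightarrow> f x"
    proof eventually_elim
      case (elim x)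
      have "(\<lambda>n. h n x) \<longlonglongrightarrow> f x" using lim[of x] elim by simp
      then have "(\<lambda>n. closest_point S (h n x)) \<longlonglongrightarrow> closest_point S (f x)"
        by (rule continuous_on_tendsto_compose[OF cont[of UNIV]]) auto
      then show ?case using closest_point_self[OF elim(1)] by (simp add: g_def)
    qed
  qed
qed

lemma l2norm_dominated_tendsto:
  fixes g :: "nat \<Rightarrow> 'a \<Rightarrow> 'b::euclidean_space"
  assumes M: "finite_measure M" and meas: "\<And>n. g n \<in> borel_measurable M" "f \<in> borel_measurable M"
    and bd: "\<And>n. AE x in M. norm (g n x - f x) \<le> C"
    and lim: "AE x in M. (\<lambda>n. g n x) \<longlonglongrightarrow> f x"
  shows "(\<lambda>n. l2norm M (\<lambda>x. g n x - f x)) \<longlonglongrightarrow> 0"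
proof -
  interpret finite_measure M by fact
  note [measurable] = meas
  have "(\<lambda>n. \<integral>x. (norm (g n x - f x))\<^sup>2 \<partial>M) \<longlonglongrightarrow> (\<integral>x. 0 \<partial>M)"
  proof (rule integral_dominated_convergence[where w="\<lambda>x. C\<^sup>2"])
    show "AE x in M. (\<lambda>n. (norm (g n x - f x))\<^sup>2) \<longlonglongrightarrow> 0"
      using lim
    proof eventually_elim
      case (elim x)
      then have "(\<lambda>n. (norm (g n x - f x))\<^sup>2) \<longlonglongrightarrow> (norm (f x - f x))\<^sup>2"
        by (intro tendsto_intros)
      then show ?case by simp
    qed
    show "AE x in M. norm ((norm (g n x - f x))\<^sup>2) \<le> C\<^sup>2" for n
      using bd[of n] by eventually_elim (simp add: power_mono)
  qed auto
  then show ?thesis unfolding l2norm_def using tendsto_real_sqrt by fastforce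
qed

lemma continuous_l2_approximation:
  fixes f :: "'a::euclidean_space \<Rightarrow> 'b::euclidean_space"
  assumes \<Omega>: "\<Omega> \<in> sets lebesgue" "bounded \<Omega>" and f: "f \<in> borel_measurable (lebesgue_on \<Omega>)"
    and S: "compact S" "convex S" "S \<noteq> {}" and fS: "AE x in lebesgue_on \<Omega>. f x \<in> S"
  obtains g where "\<And>n. continuous_on UNIV (g n)" "\<And>n x. g n x \<in> S"
    "(\<lambda>n. l2norm (lebesgue_on \<Omega>) (\<lambda>x. g n x - f x)) \<longlonglongrightarrow> 0"
proof -
  obtain g where g: "\<And>n. continuous_on UNIV (g n)" "\<And>n x. g n x \<in> S"
    "AE x in lebesgue_on \<Omega>. (\<lambda>n. g n x) \<longlonglongrightarrow> f x"
    using measurable_imp_limit_continuous[OF \<Omega>(1) f compact_imp_closed[OF S(1)] S(2,3) fS] by metis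
  have "(\<lambda>n. l2norm (lebesgue_on \<Omega>) (\<lambda>x. g n x - f x)) \<longlonglongrightarrow> 0"
  proof (rule l2norm_dominated_tendsto[OF finite_measure_lebesgue_on[OF \<Omega>(2,1)] _ f _ g(3)])
    show "g n \<in> borel_measurable (lebesgue_on \<Omega>)" for n
      using continuous_on_subset[OF g(1)] \<Omega>(1)
      by (intro continuous_imp_measurable_on_sets_lebesgue) auto
    show "AE x in lebesgue_on \<Omega>. norm (g n x - f x) \<le> diameter S" for n
      using fS
    proof eventually_elim
      case (elim x)
      then show ?case
        using diameter_bounded_bound[OF compact_imp_bounded[OF S(1)] g(2)[of n x] elim]
        by (simp add: dist_norm)
    qed
  qed
  with g show ?thesis using that by blast
qed

text \<open>Continuous approximations with values in the ball of radius \<rho> come first; replacing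
  them by polynomials costs a uniform error, for which the gap between \<rho> and \<rho>' leaves
  room.\<close>

lemma smooth_matrix_approximation:
  fixes b :: "real^'n \<Rightarrow> real^'n^'n"
  assumes \<Omega>: "open \<Omega>" "bounded \<Omega>" and b: "b \<in> borel_measurable (lebesgue_on \<Omega>)"
    and \<rho>: "0 \<le> \<rho>" "\<rho> < \<rho>'" and bd: "AE x in lebesgue_on \<Omega>. norm (b x - B) \<le> \<rho>"
  obtains c where "\<And>n. smooth_matrix (c n)" "\<And>n x. x \<in> \<Omega> \<Longrightarrow> norm (c n x - B) \<le> \<rho>'"
    "(\<lambda>n. l2norm (lebesgue_on \<Omega>) (\<lambda>x. c n x - b x)) \<longlonglongrightarrow> 0"
proof -
  let ?M = "lebesgue_on \<Omega>"
  have \<Omega>': "\<Omega> \<in> sets lebesgue" using \<Omega> by simp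
  interpret finite_measure ?M by (rule finite_measure_lebesgue_on[OF \<Omega>(2) \<Omega>'])
  have "AE x in ?M. b x \<in> cball B \<rho>"
    using bd by eventually_elim (simp add: dist_norm norm_minus_commute)
  then obtain g where g: "\<And>n. continuous_on UNIV (g n)" "\<And>n x. g n x \<in> cball B \<rho>"
    "(\<lambda>n. l2norm ?M (\<lambda>x. g n x - b x)) \<longlonglongrightarrow> 0"
    using continuous_l2_approximation[OF \<Omega>' \<Omega>(2) b, of "cball B \<rho>"] \<rho> by auto
  define d where "d n = (\<rho>' - \<rho>) * inverse (real (Suc n))" for n
  have d: "d n > 0" "d n \<le> \<rho>' - \<rho>" for n
  proof -
    show "d n > 0" using \<rho> by (simp add: d_def)
    have "inverse (real (Suc n)) \<le> 1" by (simp add: inverse_le_1_iff)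
    then have "(\<rho>' - \<rho>) * inverse (real (Suc n)) \<le> (\<rho>' - \<rho>) * 1" using \<rho> by (intro mult_left_mono) auto
    then show "d n \<le> \<rho>' - \<rho>" by (simp add: d_def)
  qed
  have d0: "d \<longlonglongrightarrow> 0"
    using tendsto_mult_left[OF LIMSEQ_inverse_real_of_nat, of "\<rho>' - \<rho>"] by (simp add: d_def[abs_def])
  have "compact (closure \<Omega>)" using \<Omega>(2) by (simp add: compact_closure)
  then have "\<forall>n. \<exists>c. polynomial_function c \<and> (\<forall>x\<in>closure \<Omega>. norm (g n x - c x) < d n)"
    using Stone_Weierstrass_polynomial_function[OF _ continuous_on_subset[OF g(1)] d(1)] by simp
  then obtain c where c: "\<And>n. polynomial_function (c n)" "\<And>n x. x \<in> closure \<Omega> \<Longrightarrow> norm (g n x - c n x) < d n"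
    using choice[of "\<lambda>n c. polynomial_function c \<and> (\<forall>x\<in>closure \<Omega>. norm (g n x - c x) < d n)"] by blast
  have sm: "smooth_matrix (c n)" for n
    unfolding smooth_matrix_def
  proof (intro allI smooth_polynomial)
    fix i j
    have "bounded_linear (\<lambda>A :: real^'n^'n. A $ i $ j)"
      using bounded_linear_compose[OF bounded_linear_vec_nth bounded_linear_vec_nth] by blast
    then show "real_polynomial_function (\<lambda>x. c n x $ i $ j)"
      using c(1)[of n] by (auto simp: polynomial_function_def o_def)
  qed
  have cm: "c n \<in> borel_measurable ?M" "g n \<in> borel_measurable ?M" for n
    using continuous_on_subset[OF g(1)] continuous_smooth_matrix[OF sm] \<Omega>'
    by (auto intro!: continuous_imp_measurable_on_sets_lebesgue)
  have gb: "AE x in ?M. norm (g n x - b x) \<le> 2 * \<rho>" for n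
    using bd
  proof eventually_elim
    case (elim x)
    then show ?case using g(2)[of n x] norm_triangle_ineq4[of "g n x - B" "b x - B"]
      by (simp add: dist_norm norm_minus_commute)
  qed
  have lim: "(\<lambda>n. l2norm ?M (\<lambda>x. c n x - b x)) \<longlonglongrightarrow> 0"
  proof (rule tendsto_sandwich[OF _ _ tendsto_const])
    show "\<forall>\<^sub>F n in sequentially. l2norm ?M (\<lambda>x. c n x - b x) \<le> d n * sqrt (measure ?M (space ?M)) + l2norm ?M (\<lambda>x. g n x - b x)"
    proof (intro always_eventually allI)
      fix n
      have 1: "sq_integrable ?M (\<lambda>x. 1 :: real)" by (simp add: sq_integrable_def)
      have AEd: "AE x in ?M. norm (c n x - g n x) \<le> d n * norm (1::real)"
        using c(2)[of _ n] closure_subset[of \<Omega>]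
        by (intro AE_I2) (auto simp: space_restrict_space norm_minus_commute intro!: less_imp_le)
      have sc: "sq_integrable ?M (\<lambda>x. c n x - g n x)"
        using sq_integrable_bound[OF 1 _ AEd] cm by simp
      have "AE x in ?M. norm (g n x - b x) \<le> (2 * \<rho>) * norm (1::real)" using gb[of n] by simp
      then have sg: "sq_integrable ?M (\<lambda>x. g n x - b x)"
        by (rule sq_integrable_bound[OF 1, rotated]) (use cm b in simp)
      have "l2norm ?M (\<lambda>x. c n x - g n x) \<le> d n * l2norm ?M (\<lambda>x. 1 :: real)"
        using d(1)[of n] cm by (intro l2norm_mono[OF 1 _ AEd]) auto
      moreover have "l2norm ?M (\<lambda>x. 1 :: real) = sqrt (measure ?M (space ?M))" by (simp add: l2norm_def)
      ultimately show "l2norm ?M (\<lambda>x. c n x - b x) \<le> d n * sqrt (measure ?M (space ?M)) + l2norm ?M (\<lambda>x. g n x - b x)"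
        using l2norm_triangle[OF sc sg] by simp
    qed
    show "(\<lambda>n. d n * sqrt (measure ?M (space ?M)) + l2norm ?M (\<lambda>x. g n x - b x)) \<longlonglongrightarrow> 0"
      using tendsto_add[OF tendsto_mult_right[OF d0] g(3)] by simp
  qed simp
  have "norm (c n x - B) \<le> \<rho>'" if "x \<in> \<Omega>" for n x
  proof -
    have "norm (g n x - c n x) < d n" using c(2) that closure_subset by blast
    moreover have "norm (g n x - B) \<le> \<rho>" using g(2)[of n x] by (simp add: dist_norm norm_minus_commute)
    ultimately show ?thesis
      using d(2)[of n] norm_triangle_ineq[of "c n x - g n x" "g n x - B"] by (simp add: norm_minus_commute)
  qed
  with sm lim show ?thesis using that by blast
qed

section \<open>Uniqueness of weak derivatives\<close>

lemma test_functionI: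
  assumes "smooth \<phi>" "compact K" "K \<subseteq> \<Omega>" "\<And>x. x \<notin> K \<Longrightarrow> \<phi> x = 0"
  shows "\<phi> \<in> test_functions \<Omega>"
proof -
  have sub: "closure {x. \<phi> x \<noteq> 0} \<subseteq> K"
    using assms(2,4) by (intro closure_minimal compact_imp_closed) auto
  moreover have "compact (closure {x. \<phi> x \<noteq> 0})"
    using compact_Int_closed[OF assms(2), of "closure {x. \<phi> x \<noteq> 0}"] sub
    by (simp add: Int_absorb1)
  ultimately show ?thesis using assms(1,3) by (auto simp: test_functions_def)
qed

lemma test_functionE:
  assumes "\<phi> \<in> test_functions \<Omega>"
  obtains K where "smooth \<phi>" "compact K" "K \<subseteq> \<Omega>" "\<And>x. x \<notin> K \<Longrightarrow> \<phi> x = 0"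
proof
  show "smooth \<phi>" "compact (closure {x. \<phi> x \<noteq> 0})" "closure {x. \<phi> x \<noteq> 0} \<subseteq> \<Omega>"
    using assms by (auto simp: test_functions_def)
  show "\<phi> x = 0" if "x \<notin> closure {x. \<phi> x \<noteq> 0}" for x
    using that closure_subset[of "{x. \<phi> x \<noteq> 0}"] by auto
qed

text \<open>Smooth test functions approach a bump \<phi> times the sign of \<open>g\<close>: the
  sign is replaced by polynomials that converge to it almost everywhere on the ball and stay bounded
  there. In the limit \<phi> |g| has integral zero.\<close>

lemma integral_test_eq_0_imp_ball:
  fixes g :: "real^'n \<Rightarrow> real"
  assumes \<Omega>: "open \<Omega>" "bounded \<Omega>" and g: "sq_integrable (lebesgue_on \<Omega>) g"
    and zero: "\<And>\<phi>. \<phi> \<in> test_functions \<Omega> \<Longrightarrow> (\<integral>x. g x * \<phi> x \<partial>lebesgue_on \<Omega>) = 0"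
    and y: "r > 0" "cball y r \<subseteq> \<Omega>"
  shows "AE x in lebesgue_on \<Omega>. x \<in> ball y r \<longrightarrow> g x = 0"
proof -
  let ?M = "lebesgue_on \<Omega>"
  have \<Omega>': "\<Omega> \<in> sets lebesgue" using \<Omega> by simp
  have fm: "finite_measure ?M" by (rule finite_measure_lebesgue_on[OF \<Omega>(2) \<Omega>'])
  have gm [measurable]: "g \<in> borel_measurable ?M" using g by (simp add: sq_integrable_def)
  have gi: "integrable ?M g" by (rule l2_integral_norm_le(1)[OF fm g])
  define \<phi> where "\<phi> x = psi 0 (r\<^sup>2 - (\<Sum>i\<in>UNIV. (x $ i - y $ i)\<^sup>2))" for x :: "real^'n"
  have \<phi>: "smooth \<phi>" unfolding \<phi>_def by (intro smooth_intros)
  have sumsq: "(\<Sum>i\<in>UNIV. (x $ i - y $ i)\<^sup>2) = (dist y x)\<^sup>2" for x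
    by (simp add: dist_norm norm_vec_def L2_set_def sum_nonneg power2_commute)
  have \<phi>0: "\<phi> x = 0" if "x \<notin> ball y r" for x
  proof -
    have "r\<^sup>2 \<le> (dist y x)\<^sup>2" using that y(1) by (intro power_mono) auto
    then show ?thesis unfolding \<phi>_def sumsq by simp
  qed
  have \<phi>pos: "\<phi> x > 0" if "x \<in> ball y r" for x
  proof -
    have "(dist y x)\<^sup>2 < r\<^sup>2" using that y(1) by (intro power_strict_mono) auto
    then show ?thesis unfolding \<phi>_def sumsq by (intro psi_pos) simp
  qed
  have \<phi>b: "0 \<le> \<phi> x" "\<phi> x \<le> 1" for x
    by (simp_all add: \<phi>_def psi_nonneg psi_0_le_1)
  have sm: "(\<lambda>x. sgn (g x)) \<in> borel_measurable ?M" by measurable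
  have "AE x in ?M. sgn (g x) \<in> {-1..1}" by (intro AE_I2) (auto simp: sgn_if)
  then obtain h where h: "\<And>n. continuous_on UNIV (h n)" "\<And>n x. h n x \<in> {-1..1 :: real}"
    "AE x in ?M. (\<lambda>n. h n x) \<longlonglongrightarrow> sgn (g x)"
    using measurable_imp_limit_continuous[OF \<Omega>' sm, of "{-1..1}"] by auto
  define d where "d n = inverse (real (Suc n))" for n
  have d: "d n > 0" "d n \<le> 1" for n by (auto simp: d_def divide_simps)
  have d0: "d \<longlonglongrightarrow> 0" unfolding d_def[abs_def] by (rule LIMSEQ_inverse_real_of_nat)
  have "\<forall>n. \<exists>p. real_polynomial_function p \<and> (\<forall>x\<in>cball y r. \<bar>h n x - p x\<bar> < d n)"
    using Stone_Weierstrass_real_polynomial_function[OF compact_cball continuous_on_subset[OF h(1) subset_UNIV] d(1)]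
    by metis
  from choice[OF this] obtain p where p: "\<And>n. real_polynomial_function (p n)"
    "\<And>n x. x \<in> cball y r \<Longrightarrow> \<bar>h n x - p n x\<bar> < d n" by blast
  have pm [measurable]: "(\<lambda>x. \<phi> x * p n x) \<in> borel_measurable ?M" for n
    using smooth_continuous[OF \<phi>] smooth_continuous[OF smooth_polynomial[OF p(1)]] \<Omega>'
    by (intro continuous_imp_measurable_on_sets_lebesgue continuous_intros) auto
  have \<phi>m [measurable]: "\<phi> \<in> borel_measurable ?M"
    using smooth_continuous[OF \<phi>] \<Omega>' by (intro continuous_imp_measurable_on_sets_lebesgue)
  have "(\<lambda>n. \<integral>x. g x * (\<phi> x * p n x) \<partial>?M) \<longlonglongrightarrow> (\<integral>x. g x * (\<phi> x * sgn (g x)) \<partial>?M)"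
  proof (rule integral_dominated_convergence[where w="\<lambda>x. 2 * \<bar>g x\<bar>"])
    show "AE x in ?M. (\<lambda>n. g x * (\<phi> x * p n x)) \<longlonglongrightarrow> g x * (\<phi> x * sgn (g x))"
      using h(3)
    proof eventually_elim
      case (elim x)
      show ?case
      proof (cases "x \<in> cball y r")
        case True
        have "(\<lambda>n. h n x - p n x) \<longlonglongrightarrow> 0"
          by (rule Lim_null_comparison[OF always_eventually d0]) (use p(2)[OF True] in \<open>auto intro: less_imp_le\<close>)
        from tendsto_diff[OF elim this] have "(\<lambda>n. p n x) \<longlonglongrightarrow> sgn (g x)" by simp
        then show ?thesis by (intro tendsto_intros)
      next
        case False
        then have "\<phi> x = 0" using \<phi>0[of x] ball_subset_cball[of y r] by blast
        then show ?thesis by simp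
      qed
    qed
    show "AE x in ?M. norm (g x * (\<phi> x * p n x)) \<le> 2 * \<bar>g x\<bar>" for n
    proof (rule AE_I2)
      fix x
      have "\<bar>\<phi> x * p n x\<bar> \<le> 2"
      proof (cases "x \<in> cball y r")
        case True
        have "\<bar>p n x\<bar> \<le> 2" using p(2)[OF True, of n] h(2)[of n x] d(2)[of n] by (simp add: abs_if split: if_splits)
        then have "\<bar>\<phi> x\<bar> * \<bar>p n x\<bar> \<le> 1 * 2" using \<phi>b[of x] by (intro mult_mono) auto
        then show ?thesis by (simp add: abs_mult)
      next
        case False
        then have "\<phi> x = 0" using \<phi>0[of x] ball_subset_cball[of y r] by blast
        then show ?thesis by simp
      qed
      then have "\<bar>\<phi> x * p n x\<bar> * \<bar>g x\<bar> \<le> 2 * \<bar>g x\<bar>" by (intro mult_right_mono) auto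
      then show "norm (g x * (\<phi> x * p n x)) \<le> 2 * \<bar>g x\<bar>" by (simp add: abs_mult ac_simps)
    qed
    show "integrable ?M (\<lambda>x. 2 * \<bar>g x\<bar>)" using gi by auto
  qed measurable
  moreover have "(\<integral>x. g x * (\<phi> x * p n x) \<partial>?M) = 0" for n
  proof (rule zero, rule test_functionI)
    show "smooth (\<lambda>x. \<phi> x * p n x)" by (intro smooth_mult \<phi> smooth_polynomial p(1))
    show "\<phi> x * p n x = 0" if "x \<notin> cball y r" for x
      using \<phi>0[of x] that ball_subset_cball[of y r] by auto
  qed (use y in auto)
  ultimately have "(\<integral>x. g x * (\<phi> x * sgn (g x)) \<partial>?M) = 0"
    by (simp add: LIMSEQ_const_iff)
  moreover have "g x * (\<phi> x * sgn (g x)) = \<phi> x * \<bar>g x\<bar>" for x by (simp add: sgn_if abs_if)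
  ultimately have I: "(\<integral>x. \<phi> x * \<bar>g x\<bar> \<partial>?M) = 0" by simp
  have "integrable ?M (\<lambda>x. \<phi> x * \<bar>g x\<bar>)"
  proof (rule Bochner_Integration.integrable_bound[OF gi])
    show "AE x in ?M. norm (\<phi> x * \<bar>g x\<bar>) \<le> norm (g x)"
      using \<phi>b by (intro AE_I2) (simp add: abs_mult mult_left_le_one_le)
  qed measurable
  then have "AE x in ?M. \<phi> x * \<bar>g x\<bar> = 0"
    using I \<phi>b by (subst (asm) integral_nonneg_eq_0_iff_AE) auto
  then show ?thesis
  proof eventually_elim
    case (elim x)
    show ?case
    proof
      assume "x \<in> ball y r"
      from \<phi>pos[OF this] elim show "g x = 0" by simp
    qed
  qed
qed

text \<open>By Lindelof countably many balls cover the open set, so the exceptional null sets can be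
  united.\<close>

lemma integral_test_eq_0_imp_AE:
  fixes g :: "real^'n \<Rightarrow> real"
  assumes \<Omega>: "open \<Omega>" "bounded \<Omega>" and g: "sq_integrable (lebesgue_on \<Omega>) g"
    and zero: "\<And>\<phi>. \<phi> \<in> test_functions \<Omega> \<Longrightarrow> (\<integral>x. g x * \<phi> x \<partial>lebesgue_on \<Omega>) = 0"
  shows "AE x in lebesgue_on \<Omega>. g x = 0"
proof -
  define F where "F = {ball y r | y r. r > 0 \<and> cball y r \<subseteq> \<Omega>}"
  have "open S" if "S \<in> F" for S using that by (auto simp: F_def)
  then obtain F' where F': "F' \<subseteq> F" "countable F'" "\<Union>F' = \<Union>F"
    using Lindelof[of F] by metis
  have cov: "\<Omega> \<subseteq> \<Union>F"
  proof
    fix x assume "x \<in> \<Omega>"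
    then obtain r where "r > 0" "cball x r \<subseteq> \<Omega>" using \<Omega>(1) open_contains_cball by blast
    then have "ball x r \<in> F" "x \<in> ball x r" by (auto simp: F_def)
    then show "x \<in> \<Union>F" by blast
  qed
  have "AE x in lebesgue_on \<Omega>. \<forall>S\<in>F'. x \<in> S \<longrightarrow> g x = 0"
  proof (subst AE_ball_countable[OF F'(2)], intro ballI)
    fix S assume "S \<in> F'"
    then obtain y r where S: "S = ball y r" "r > 0" "cball y r \<subseteq> \<Omega>" using F'(1) by (auto simp: F_def)
    show "AE x in lebesgue_on \<Omega>. x \<in> S \<longrightarrow> g x = 0"
      unfolding S(1) by (rule integral_test_eq_0_imp_ball[OF \<Omega> g zero S(2,3)])
  qed
  moreover have "AE x in lebesgue_on \<Omega>. x \<in> \<Omega>"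
    by (rule AE_I2) (simp add: space_restrict_space)
  ultimately show ?thesis
  proof eventually_elim
    case (elim x)
    then obtain S where "S \<in> F'" "x \<in> S" using cov F'(3) by blast
    with elim show ?case by blast
  qed
qed

section \<open>Weak derivatives and membership in \<open>V\<close>\<close>

lemma L2_iff: "u \<in> L2 \<Omega> \<longleftrightarrow> sq_integrable (lebesgue_on \<Omega>) u"
  by (simp add: L2_def sq_integrable_def)

lemma L2_inner_self: "L2_inner \<Omega> u u = (l2norm (lebesgue_on \<Omega>) u)\<^sup>2"
  unfolding L2_inner_def l2norm_square by (simp add: power2_eq_square)

lemma test_function_sq_integrable:
  assumes \<Omega>: "open \<Omega>" "bounded \<Omega>" and \<phi>: "smooth \<phi>"
  shows "sq_integrable (lebesgue_on \<Omega>) \<phi>"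
proof -
  have "integrable (lebesgue_on \<Omega>) (\<lambda>x. (norm (\<phi> x))\<^sup>2)"
    by (rule integrable_continuous_bounded[OF \<Omega>(1), of "closure \<Omega>"])
      (use \<Omega> closure_subset smooth_continuous[OF \<phi>] in \<open>auto simp: compact_closure intro!: continuous_intros\<close>)
  moreover have "\<phi> \<in> borel_measurable (lebesgue_on \<Omega>)"
    using smooth_continuous[OF \<phi>] \<Omega> by (intro continuous_imp_measurable_on_sets_lebesgue) auto
  ultimately show ?thesis by (simp add: sq_integrable_def)
qed

lemma test_function_weak_partial:
  assumes \<Omega>: "open \<Omega>" "bounded \<Omega>" and \<phi>: "\<phi> \<in> test_functions \<Omega>"
  shows "has_weak_partial \<Omega> i \<phi> (partial i \<phi>)"
  unfolding has_weak_partial_def L2_iff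
proof (intro conjI ballI)
  obtain K where K: "smooth \<phi>" "compact K" "K \<subseteq> \<Omega>" "\<And>x. x \<notin> K \<Longrightarrow> \<phi> x = 0"
    using test_functionE[OF \<phi>] by metis
  show s: "sq_integrable (lebesgue_on \<Omega>) \<phi>" "sq_integrable (lebesgue_on \<Omega>) (partial i \<phi>)"
    using K(1) by (auto intro!: test_function_sq_integrable[OF \<Omega>] smooth_partial)
  fix \<theta> assume "\<theta> \<in> test_functions \<Omega>"
  then have \<theta>: "smooth \<theta>" by (auto simp: test_functions_def)
  have t: "sq_integrable (lebesgue_on \<Omega>) \<theta>" "sq_integrable (lebesgue_on \<Omega>) (partial i \<theta>)"
    using \<theta> by (auto intro!: test_function_sq_integrable[OF \<Omega>] smooth_partial)
  have "0 = (\<integral>x. partial i (\<lambda>x. \<phi> x * \<theta> x) x \<partial>lebesgue_on \<Omega>)"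
    by (rule integral_partial_supported[symmetric, OF smooth_mult[OF K(1) \<theta>] K(2,3) _ \<Omega>(1)]) (simp add: K(4))
  also have "\<dots> = (\<integral>x. partial i \<phi> x * \<theta> x + \<phi> x * partial i \<theta> x \<partial>lebesgue_on \<Omega>)"
    by (simp add: partial_mult K(1) \<theta> add.commute)
  also have "\<dots> = (\<integral>x. partial i \<phi> x * \<theta> x \<partial>lebesgue_on \<Omega>) + (\<integral>x. \<phi> x * partial i \<theta> x \<partial>lebesgue_on \<Omega>)"
    using sq_integrable_inner(1)[OF s(2) t(1)] sq_integrable_inner(1)[OF s(1) t(2)]
    by (intro Bochner_Integration.integral_add) simp_all
  finally show "L2_inner \<Omega> \<phi> (partial i \<theta>) = - L2_inner \<Omega> (partial i \<phi>) \<theta>"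
    by (simp add: L2_inner_def)
qed

lemma has_weak_partial_diff:
  assumes \<Omega>: "open \<Omega>" "bounded \<Omega>"
    and u: "has_weak_partial \<Omega> i u g" and v: "has_weak_partial \<Omega> i v h"
  shows "has_weak_partial \<Omega> i (\<lambda>x. u x - v x) (\<lambda>x. g x - h x)"
  unfolding has_weak_partial_def L2_iff
proof (intro conjI ballI)
  have s: "sq_integrable (lebesgue_on \<Omega>) u" "sq_integrable (lebesgue_on \<Omega>) v"
    "sq_integrable (lebesgue_on \<Omega>) g" "sq_integrable (lebesgue_on \<Omega>) h"
    using u v by (simp_all add: has_weak_partial_def L2_iff)
  then show "sq_integrable (lebesgue_on \<Omega>) (\<lambda>x. u x - v x)" "sq_integrable (lebesgue_on \<Omega>) (\<lambda>x. g x - h x)"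
    by auto
  fix \<phi> assume \<phi>: "\<phi> \<in> test_functions \<Omega>"
  then have "smooth \<phi>" by (auto simp: test_functions_def)
  then have t: "sq_integrable (lebesgue_on \<Omega>) \<phi>" "sq_integrable (lebesgue_on \<Omega>) (partial i \<phi>)"
    by (auto intro!: test_function_sq_integrable[OF \<Omega>] smooth_partial)
  have "L2_inner \<Omega> (\<lambda>x. f x - f' x) \<theta> = L2_inner \<Omega> f \<theta> - L2_inner \<Omega> f' \<theta>"
    if "sq_integrable (lebesgue_on \<Omega>) f" "sq_integrable (lebesgue_on \<Omega>) f'" "sq_integrable (lebesgue_on \<Omega>) \<theta>" for f f' \<theta>
    using sq_integrable_inner(1)[OF that(1,3)] sq_integrable_inner(1)[OF that(2,3)]
    by (simp add: L2_inner_def left_diff_distrib)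
  from this[OF s(1,2) t(2)] this[OF s(3,4) t(1)]
  show "L2_inner \<Omega> (\<lambda>x. u x - v x) (partial i \<phi>) = - L2_inner \<Omega> (\<lambda>x. g x - h x) \<phi>"
    using u v \<phi> by (simp add: has_weak_partial_def)
qed

lemma L2_inner_cong_AE:
  assumes "AE x in lebesgue_on \<Omega>. u x = u' x"
    "u \<in> borel_measurable (lebesgue_on \<Omega>)" "u' \<in> borel_measurable (lebesgue_on \<Omega>)"
    "\<phi> \<in> borel_measurable (lebesgue_on \<Omega>)"
  shows "L2_inner \<Omega> u \<phi> = L2_inner \<Omega> u' \<phi>"
  unfolding L2_inner_def using assms(2-)
  by (intro integral_cong_AE borel_measurable_times) (use assms(1) in auto)

text \<open>The functions \<open>u\<close> and \<open>v\<close> may differ on a null set, because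
  weak derivatives are chosen representatives and second derivatives are taken of such
  choices.\<close>

lemma has_weak_partial_unique:
  assumes \<Omega>: "open \<Omega>" "bounded \<Omega>"
    and u: "has_weak_partial \<Omega> i u g" and v: "has_weak_partial \<Omega> i v h"
    and eq: "AE x in lebesgue_on \<Omega>. u x = v x"
  shows "AE x in lebesgue_on \<Omega>. g x = h x"
proof -
  have "AE x in lebesgue_on \<Omega>. g x - h x = 0"
  proof (rule integral_test_eq_0_imp_AE[OF \<Omega>])
    have d: "has_weak_partial \<Omega> i (\<lambda>x. u x - v x) (\<lambda>x. g x - h x)"
      by (rule has_weak_partial_diff[OF \<Omega> u v])
    then show "sq_integrable (lebesgue_on \<Omega>) (\<lambda>x. g x - h x)"
      by (simp add: has_weak_partial_def L2_iff)
    fix \<phi> assume \<phi>: "\<phi> \<in> test_functions \<Omega>"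
    then have "partial i \<phi> \<in> borel_measurable (lebesgue_on \<Omega>)"
      using test_function_sq_integrable[OF \<Omega> smooth_partial] by (auto simp: test_functions_def sq_integrable_def)
    moreover have "(\<lambda>x. u x - v x) \<in> borel_measurable (lebesgue_on \<Omega>)"
      using d by (simp add: has_weak_partial_def L2_def)
    ultimately have "L2_inner \<Omega> (\<lambda>x. u x - v x) (partial i \<phi>) = L2_inner \<Omega> (\<lambda>x. 0) (partial i \<phi>)"
      using eq by (intro L2_inner_cong_AE) auto
    then show "(\<integral>x. (g x - h x) * \<phi> x \<partial>lebesgue_on \<Omega>) = 0"
      using d \<phi> by (simp add: has_weak_partial_def L2_inner_def)
  qed
  then show ?thesis by eventually_elim simp
qed

lemma weak_partial_AE:
  assumes \<Omega>: "open \<Omega>" "bounded \<Omega>" and u: "has_weak_partial \<Omega> i u g"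
  shows "has_weak_partial \<Omega> i u (weak_partial \<Omega> i u)" "AE x in lebesgue_on \<Omega>. weak_partial \<Omega> i u x = g x"
proof -
  show 1: "has_weak_partial \<Omega> i u (weak_partial \<Omega> i u)"
    unfolding weak_partial_def using u by (rule someI[where P = "has_weak_partial \<Omega> i u"])
  show "AE x in lebesgue_on \<Omega>. weak_partial \<Omega> i u x = g x"
    by (rule has_weak_partial_unique[OF \<Omega> 1 u]) simp
qed

lemma has_weak_partial_cong_AE:
  assumes \<Omega>: "open \<Omega>" "bounded \<Omega>" and u: "has_weak_partial \<Omega> i u g"
    and v: "v \<in> L2 \<Omega>" "AE x in lebesgue_on \<Omega>. v x = u x"
  shows "has_weak_partial \<Omega> i v g"
  unfolding has_weak_partial_def
proof (intro conjI ballI v(1))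
  show "g \<in> L2 \<Omega>" using u by (simp add: has_weak_partial_def)
  fix \<phi> assume \<phi>: "\<phi> \<in> test_functions \<Omega>"
  have "partial i \<phi> \<in> borel_measurable (lebesgue_on \<Omega>)"
    using \<phi> test_function_sq_integrable[OF \<Omega> smooth_partial] by (auto simp: test_functions_def sq_integrable_def)
  then have "L2_inner \<Omega> v (partial i \<phi>) = L2_inner \<Omega> u (partial i \<phi>)"
    using u v by (intro L2_inner_cong_AE) (auto simp: has_weak_partial_def L2_def)
  then show "L2_inner \<Omega> v (partial i \<phi>) = - L2_inner \<Omega> g \<phi>"
    using u \<phi> by (simp add: has_weak_partial_def)
qed

text \<open>The representatives chosen by \<open>weak_partial\<close> agree almost everywhere with
  the explicit derivatives \<open>dv\<close> and \<open>hv\<close>; convergence of the test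
  functions in H^1 then gives the closure condition in \<open>H10\<close>.\<close>

lemma V_spaceI:
  assumes \<Omega>: "open \<Omega>" "bounded \<Omega>"
    and v: "\<And>i. has_weak_partial \<Omega> i v (dv i)" and dv: "\<And>i j. has_weak_partial \<Omega> i (dv j) (hv i j)"
    and \<phi>: "\<And>n :: nat. \<phi> n \<in> test_functions \<Omega>"
      "(\<lambda>n. l2norm (lebesgue_on \<Omega>) (\<lambda>x. v x - \<phi> n x)) \<longlonglongrightarrow> 0"
      "\<And>i. (\<lambda>n. l2norm (lebesgue_on \<Omega>) (\<lambda>x. dv i x - partial i (\<phi> n) x)) \<longlonglongrightarrow> 0"
  shows "v \<in> V_space \<Omega>" "AE x in lebesgue_on \<Omega>. weak_hessian \<Omega> v x = (\<chi> i j. hv i j x)"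
proof -
  let ?M = "lebesgue_on \<Omega>"
  have wp: "has_weak_partial \<Omega> i v (weak_partial \<Omega> i v)" "AE x in ?M. weak_partial \<Omega> i v x = dv i x" for i
    by (rule weak_partial_AE[OF \<Omega> v])+
  have wpL2: "weak_partial \<Omega> i v \<in> L2 \<Omega>" for i using wp(1)[of i] by (simp add: has_weak_partial_def)
  have wp2: "has_weak_partial \<Omega> i (weak_partial \<Omega> j v) (hv i j)" for i j
    by (rule has_weak_partial_cong_AE[OF \<Omega> dv wpL2 wp(2)])
  have vH1: "v \<in> H1 \<Omega>" using v by (auto simp: H1_def has_weak_partial_def)
  have "v \<in> H2 \<Omega>"
    using vH1 wp2 wpL2 unfolding H2_def H1_def by blast
  moreover have "v \<in> H10 \<Omega>"
    unfolding H10_def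
  proof (intro CollectI conjI allI impI vH1)
    fix e :: real assume e: "e > 0"
    have H1n: "H1_norm \<Omega> (\<lambda>x. v x - \<phi> n x) = sqrt ((l2norm ?M (\<lambda>x. v x - \<phi> n x))\<^sup>2 +
        (\<Sum>i\<in>UNIV. (l2norm ?M (\<lambda>x. dv i x - partial i (\<phi> n) x))\<^sup>2))" for n
    proof -
      have "L2_inner \<Omega> (weak_partial \<Omega> i (\<lambda>x. v x - \<phi> n x)) (weak_partial \<Omega> i (\<lambda>x. v x - \<phi> n x))
          = (l2norm ?M (\<lambda>x. dv i x - partial i (\<phi> n) x))\<^sup>2" for i
      proof -
        have d: "has_weak_partial \<Omega> i (\<lambda>x. v x - \<phi> n x) (\<lambda>x. dv i x - partial i (\<phi> n) x)"
          by (rule has_weak_partial_diff[OF \<Omega> v test_function_weak_partial[OF \<Omega> \<phi>(1)]])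
        note w = weak_partial_AE[OF \<Omega> d]
        show ?thesis
          unfolding L2_inner_self l2norm_square
        proof (rule integral_cong_AE)
          show "AE x in ?M. (norm (weak_partial \<Omega> i (\<lambda>x. v x - \<phi> n x) x))\<^sup>2 =
              (norm (dv i x - partial i (\<phi> n) x))\<^sup>2"
            using w(2) by eventually_elim simp
        qed (use w(1) d in \<open>auto simp: has_weak_partial_def L2_def\<close>)
      qed
      then show ?thesis by (simp add: H1_norm_def L2_inner_self)
    qed
    have "(\<lambda>n. H1_norm \<Omega> (\<lambda>x. v x - \<phi> n x)) \<longlonglongrightarrow> sqrt (0\<^sup>2 + (\<Sum>i\<in>(UNIV::'a set). 0\<^sup>2))"
      unfolding H1n by (intro tendsto_intros \<phi>(2,3))
    then have "(\<lambda>n. H1_norm \<Omega> (\<lambda>x. v x - \<phi> n x)) \<longlonglongrightarrow> 0" by simp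
    then have "\<forall>\<^sub>F n in sequentially. H1_norm \<Omega> (\<lambda>x. v x - \<phi> n x) < e"
      using e by (rule order_tendstoD(2))
    then obtain n where "H1_norm \<Omega> (\<lambda>x. v x - \<phi> n x) < e"
      unfolding eventually_sequentially by blast
    then show "\<exists>\<phi>\<in>test_functions \<Omega>. H1_norm \<Omega> (\<lambda>x. v x - \<phi> x) < e"
      using \<phi>(1) by blast
  qed
  ultimately show "v \<in> V_space \<Omega>" by (simp add: V_space_def)
  have "AE x in ?M. \<forall>i j. weak_partial \<Omega> i (weak_partial \<Omega> j v) x = hv i j x"
    using weak_partial_AE(2)[OF \<Omega> wp2] by (simp add: AE_all_countable)
  then show "AE x in ?M. weak_hessian \<Omega> v x = (\<chi> i j. hv i j x)"
    by eventually_elim (simp add: weak_hessian_def)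
qed

section \<open>Exhaustion of a convex domain\<close>

text \<open>\<open>t * psi (m + 1) t = psi m t\<close> makes the second derivative equal to
  \<open>psi 3\<close>. The function is a smooth convex substitute for the positive part, zero
  exactly for \<open>t \<le> 0\<close>.\<close>

lemma convex_on_psi: "convex_on UNIV (\<lambda>t. t * psi 0 t)"
proof (rule f''_ge0_imp_convex)
  have shift: "t * psi (Suc m) t = psi m t" for t m by (simp add: psi_def)
  show "((\<lambda>t. t * psi 0 t) has_real_derivative psi 0 t + psi 1 t) (at t)" for t
    using DERIV_mult[OF DERIV_ident DERIV_psi[of 0 t]] shift[of t 1]
    by (simp add: numeral_2_eq_2 algebra_simps)
  show "((\<lambda>t. psi 0 t + psi 1 t) has_real_derivative psi 3 t) (at t)" for t
    using DERIV_add[OF DERIV_psi[of 0 t] DERIV_psi[of 1 t]] by (simp add: numeral_2_eq_2 numeral_3_eq_3)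
qed (auto simp: psi_nonneg)

lemma convex_on_compose_affine:
  fixes a :: "'a::real_inner"
  assumes "convex_on UNIV \<beta>"
  shows "convex_on UNIV (\<lambda>x. \<beta> (b - a \<bullet> x))"
  unfolding convex_on_def
proof (intro conjI ballI allI impI)
  fix x y and u v :: real assume uv: "0 \<le> u" "0 \<le> v" "u + v = 1"
  have "b - a \<bullet> (u *\<^sub>R x + v *\<^sub>R y) = (u + v) * b - a \<bullet> (u *\<^sub>R x + v *\<^sub>R y)" using uv by simp
  also have "\<dots> = u *\<^sub>R (b - a \<bullet> x) + v *\<^sub>R (b - a \<bullet> y)"
    by (simp add: inner_right_distrib algebra_simps)
  finally show "\<beta> (b - a \<bullet> (u *\<^sub>R x + v *\<^sub>R y)) \<le> u * \<beta> (b - a \<bullet> x) + v * \<beta> (b - a \<bullet> y)"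
    using assms uv unfolding convex_on_def by (metis UNIV_I)
qed simp

lemma convex_on_sum_fun:
  assumes "finite D" "\<And>z. z \<in> D \<Longrightarrow> convex_on UNIV (f z)"
  shows "convex_on UNIV (\<lambda>x. \<Sum>z\<in>D. f z x :: real)"
  using assms by (induction D rule: finite_induct) (auto intro: convex_on_add simp: convex_on_const)

text \<open>Each boundary point is separated from \<open>K\<close> by a hyperplane, finitely many of
  these half-spaces cover the frontier, and the smooth positive parts of the affine functions are
  added. Compactness of the frontier gives a positive minimum, hence the normalisation.\<close>

lemma exists_convex_barrier:
  fixes \<Omega> :: "(real^'n) set"
  assumes \<Omega>: "open \<Omega>" "bounded \<Omega>" and K: "compact K" "convex K" "K \<subseteq> \<Omega>"
  obtains S where "smooth S" "convex_on UNIV S" "\<And>x. 0 \<le> S x" "\<And>x. x \<in> K \<Longrightarrow> S x = 0"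
    "\<And>x. x \<in> frontier \<Omega> \<Longrightarrow> 1 \<le> S x"
proof -
  have "\<forall>z. \<exists>ab. z \<in> frontier \<Omega> \<longrightarrow> fst ab \<bullet> z < snd ab \<and> (\<forall>x\<in>K. fst ab \<bullet> x > snd ab)"
  proof
    fix z
    show "\<exists>ab. z \<in> frontier \<Omega> \<longrightarrow> fst ab \<bullet> z < snd ab \<and> (\<forall>x\<in>K. fst ab \<bullet> x > snd ab)"
    proof (cases "z \<in> frontier \<Omega>")
      case True
      then have "z \<notin> K" using K(3) \<Omega>(1) by (auto simp: frontier_def interior_open)
      from separating_hyperplane_closed_point[OF K(2) compact_imp_closed[OF K(1)] this]
      show ?thesis by auto
    qed simp
  qed
  from choice[OF this] obtain ab where
    ab: "\<And>z. z \<in> frontier \<Omega> \<Longrightarrow> fst (ab z) \<bullet> z < snd (ab z)"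
      "\<And>z x. z \<in> frontier \<Omega> \<Longrightarrow> x \<in> K \<Longrightarrow> fst (ab z) \<bullet> x > snd (ab z)" by blast
  define L where "L z x = snd (ab z) - fst (ab z) \<bullet> x" for z x :: "real^'n"
  have "compact (frontier \<Omega>)" using \<Omega>(2) by (rule compact_frontier_bounded)
  moreover have "open {x. 0 < L z x}" for z
    unfolding L_def by (intro open_Collect_less continuous_intros)
  moreover have "frontier \<Omega> \<subseteq> (\<Union>z\<in>frontier \<Omega>. {x. 0 < L z x})"
    using ab(1) by (auto simp: L_def)
  ultimately obtain D where D: "D \<subseteq> frontier \<Omega>" "finite D" "frontier \<Omega> \<subseteq> (\<Union>z\<in>D. {x. 0 < L z x})"
    by (rule compactE_image) auto
  define \<sigma> where "\<sigma> x = (\<Sum>z\<in>D. L z x * psi 0 (L z x))" for x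
  have smL: "smooth (L z)" for z
    unfolding L_def[abs_def]
    by (intro smooth_diff smooth_const smooth_linear bounded_linear_inner_right)
  have sm: "smooth \<sigma>" unfolding \<sigma>_def[abs_def] by (intro smooth_sum smooth_mult smooth_psi smL)
  have cx: "convex_on UNIV \<sigma>"
    unfolding \<sigma>_def[abs_def] L_def
    by (intro convex_on_sum_fun D(2) convex_on_compose_affine[OF convex_on_psi])
  have term_nonneg: "0 \<le> L z x * psi 0 (L z x)" for z x
    by (cases "L z x > 0") (auto simp: psi_nonneg)
  have nonneg: "0 \<le> \<sigma> x" for x unfolding \<sigma>_def by (intro sum_nonneg term_nonneg)
  have zero: "\<sigma> x = 0" if "x \<in> K" for x
    unfolding \<sigma>_def
  proof (intro sum.neutral ballI)
    fix z assume "z \<in> D"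
    then have "L z x < 0" using ab(2)[of z x] D(1) that by (auto simp: L_def)
    then show "L z x * psi 0 (L z x) = 0" by simp
  qed
  have pos: "0 < \<sigma> x" if x: "x \<in> frontier \<Omega>" for x
  proof -
    obtain z where z: "z \<in> D" "0 < L z x" using D(3) x by blast
    then have "0 < L z x * psi 0 (L z x)" by (simp add: psi_pos)
    then show ?thesis unfolding \<sigma>_def by (intro sum_pos2[OF D(2) z(1)] term_nonneg)
  qed
  obtain A where A: "A > 0" "\<And>x. x \<in> frontier \<Omega> \<Longrightarrow> 1 \<le> A * \<sigma> x"
  proof (cases "frontier \<Omega> = {}")
    case True
    then show ?thesis using that[of 1] by simp
  next
    case False
    obtain y where y: "y \<in> frontier \<Omega>" "\<And>x. x \<in> frontier \<Omega> \<Longrightarrow> \<sigma> y \<le> \<sigma> x"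
      using continuous_attains_inf[OF compact_frontier_bounded[OF \<Omega>(2)] False smooth_continuous[OF sm]] by blast
    show ?thesis
      using that[of "1 / \<sigma> y"] pos[OF y(1)] y(2) by (simp add: le_divide_eq)
  qed
  show ?thesis
  proof
    show "smooth (\<lambda>x. A * \<sigma> x)" by (rule smooth_cmult[OF sm])
    show "convex_on UNIV (\<lambda>x. A * \<sigma> x)" using A(1) by (intro convex_on_cmul cx) simp
  qed (use A nonneg zero in auto)
qed

text \<open>For a barrier \<open>S\<close> and E = S / |x - x0|, the norm of \<open>Psi 1\<close> is
  c |x - x0| + S: below 1 on \<open>K\<close>, where \<open>S\<close> vanishes, and at least 1 on
  the frontier.\<close>

lemma exhausting_star_map:
  fixes \<Omega> :: "(real^'n) set"
  assumes \<Omega>: "open \<Omega>" "bounded \<Omega>" "convex \<Omega>" and x0: "x0 \<in> \<Omega>"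
    and c: "c > 0" "\<And>x. x \<in> \<Omega> \<Longrightarrow> c * norm (x - x0) < 1" and K: "compact K" "K \<subseteq> \<Omega>"
  obtains E where "star_map x0 c E" "K \<subseteq> star_map.Om x0 c E 1" "star_map.Om x0 c E 1 \<subseteq> \<Omega>"
proof -
  obtain r where r: "r > 0" "cball x0 r \<subseteq> \<Omega>" using \<Omega>(1) x0 open_contains_cball by blast
  \<comment> \<open>A ball around \<open>x0\<close> is included so that \<open>S\<close> vanishes
    near \<open>x0\<close> and the division by the distance stays smooth.\<close>
  define K' where "K' = convex hull (K \<union> cball x0 r)"
  have K': "compact K'" "convex K'" "K' \<subseteq> \<Omega>" "K \<subseteq> K'" "cball x0 r \<subseteq> K'"
  proof -
    show "compact K'" unfolding K'_def by (intro compact_convex_hull compact_Un K(1) compact_cball)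
    show "K' \<subseteq> \<Omega>" unfolding K'_def using K(2) r(2) \<Omega>(3) by (intro hull_minimal) auto
    have "K \<union> cball x0 r \<subseteq> K'" unfolding K'_def by (rule hull_subset)
    then show "K \<subseteq> K'" "cball x0 r \<subseteq> K'" by auto
  qed (simp add: K'_def)
  obtain S where S: "smooth S" "convex_on UNIV S" "\<And>x. 0 \<le> S x" "\<And>x. x \<in> K' \<Longrightarrow> S x = 0"
    "\<And>x. x \<in> frontier \<Omega> \<Longrightarrow> 1 \<le> S x"
    using exists_convex_barrier[OF \<Omega>(1,2) K'(1,2,3)] by metis
  define q where "q x = (\<Sum>i\<in>UNIV. (x $ i - x0 $ i)\<^sup>2)" for x :: "real^'n"
  have q: "q x = (norm (x - x0))\<^sup>2" for x
    by (simp add: q_def norm_vec_def L2_set_def sum_nonneg)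
  \<comment> \<open>Outside radius \<open>r\<close> the \<open>psi\<close> term vanishes and the
    denominator is the distance to \<open>x0\<close>; inside it keeps the denominator positive where
    \<open>S\<close> is zero.\<close>
  define E where "E x = S x / sqrt (q x + psi 0 (r\<^sup>2 - q x))" for x
  have den: "q x + psi 0 (r\<^sup>2 - q x) > 0" for x
  proof (cases "x = x0")
    case True
    then show ?thesis using r(1) by (simp add: q psi_pos)
  next
    case False
    then have "q x > 0" by (simp add: q)
    then show ?thesis using psi_nonneg[of 0 "r\<^sup>2 - q x"] by linarith
  qed
  have smE: "smooth E"
  proof -
    have sq: "smooth q" unfolding q_def[abs_def]
      by (intro smooth_sum smooth_power smooth_diff smooth_nth smooth_const)
    show ?thesis unfolding E_def[abs_def]
      by (intro smooth_divide smooth_sqrt smooth_add smooth_psi smooth_diff smooth_const sq S(1))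
        (use den in auto)
  qed
  have SE: "norm (x - x0) * E x = S x" for x
  proof (cases "x \<in> cball x0 r")
    case True
    then have "S x = 0" using S(4) K'(5) by blast
    then show ?thesis by (simp add: E_def)
  next
    case False
    then have nr: "norm (x - x0) > r" by (simp add: dist_norm norm_minus_commute)
    then have "r\<^sup>2 \<le> q x" using r(1) unfolding q by (intro power_mono) auto
    then have "E x = S x / norm (x - x0)" by (simp add: E_def q)
    moreover have "norm (x - x0) \<noteq> 0" using nr r(1) by linarith
    ultimately show ?thesis by simp
  qed
  have sm: "star_map x0 c E"
  proof
    show "0 \<le> E x" for x using S(3)[of x] den[of x] by (simp add: E_def)
    show "convex_on UNIV (\<lambda>x. norm (x - x0) * E x)" by (simp add: SE S(2))
  qed (use c smE in auto)
  note c_less = c(2)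
  interpret star_map x0 c E by (rule sm)
  have nP: "norm (Psi 1 x) = c * norm (x - x0) + S x" for x
    by (simp add: norm_Psi SE)
  have "K \<subseteq> Om 1"
  proof
    fix x assume "x \<in> K"
    then have "S x = 0" "c * norm (x - x0) < 1" using S(4) K'(4) K(2) c_less by auto
    then show "x \<in> Om 1" by (simp add: Om_def nP)
  qed
  \<comment> \<open>\<open>Om 1\<close> is convex, hence connected, and meets \<Omega>; if it left
    \<Omega> it would contain a frontier point, where \<open>S\<close> is at least 1.\<close>
  moreover have "Om 1 \<subseteq> \<Omega>"
  proof (rule ccontr)
    assume "\<not> Om 1 \<subseteq> \<Omega>"
    then have "Om 1 - \<Omega> \<noteq> {}" by auto
    moreover have "x0 \<in> Om 1" by (simp add: Om_def Psi_def)
    then have "Om 1 \<inter> \<Omega> \<noteq> {}" using x0 by auto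
    moreover have "convex (Om 1)"
      unfolding convex_def
    proof (intro ballI allI impI)
      fix x y and u v :: real assume *: "x \<in> Om 1" "y \<in> Om 1" "0 \<le> u" "0 \<le> v" "u + v = 1"
      have "norm (Psi 1 (u *\<^sub>R x + v *\<^sub>R y)) \<le> u * norm (Psi 1 x) + v * norm (Psi 1 y)"
        using convex_norm_Psi[of 1] * unfolding convex_on_def by simp
      also have "\<dots> < 1" using * by (intro convex_bound_lt) (auto simp: Om_def)
      finally show "u *\<^sub>R x + v *\<^sub>R y \<in> Om 1" by (simp add: Om_def)
    qed
    then have "connected (Om 1)" by (rule convex_connected)
    ultimately obtain y where "y \<in> Om 1" "y \<in> frontier \<Omega>"
      using connected_Int_frontier by blast
    then have "norm (Psi 1 y) < 1" "1 \<le> S y" using S(5) by (auto simp: Om_def)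
    moreover have "0 \<le> c * norm (y - x0)" using c by simp
    ultimately show False using nP[of y] by linarith
  qed
  ultimately show ?thesis using that sm by blast
qed

text \<open>One \<open>c\<close> serves the whole sequence, so all domains lie in the same ball of
  radius \<open>1 / c\<close> and share the constants of the a priori estimates.\<close>

lemma exhausting_sequence:
  fixes \<Omega> :: "(real^'n) set"
  assumes \<Omega>: "open \<Omega>" "bounded \<Omega>" "convex \<Omega>" "x0 \<in> \<Omega>"
  obtains c and E :: "nat \<Rightarrow> real^'n \<Rightarrow> real" where "\<And>n. star_map x0 c (E n)" "\<And>n. star_map.Om x0 c (E n) 1 \<subseteq> \<Omega>"
    "\<And>K. compact K \<Longrightarrow> K \<subseteq> \<Omega> \<Longrightarrow> \<exists>N. \<forall>n\<ge>N. K \<subseteq> star_map.Om x0 c (E n) 1"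
proof -
  obtain C where C: "\<And>n. compact (C n)" "\<And>n. C n \<subseteq> \<Omega>" "\<And>n. C n \<subseteq> interior (C (Suc n))"
    "\<Union>(range C) = \<Omega>" "\<And>K. compact K \<Longrightarrow> K \<subseteq> \<Omega> \<Longrightarrow> \<exists>N. \<forall>n\<ge>N. K \<subseteq> C n"
    using open_Union_compact_subsets[OF \<Omega>(1)] by metis
  obtain B where B: "B > 0" "\<And>x. x \<in> \<Omega> \<Longrightarrow> norm (x - x0) \<le> B"
    using bounded_pos bounded_translation[OF \<Omega>(2), of "- x0"] by (auto simp: bounded_pos)
  \<comment> \<open>The factor 2 makes the inequality with 1 strict.\<close>
  define c where "c = 1 / (2 * B)"
  have c: "c > 0" "\<And>x. x \<in> \<Omega> \<Longrightarrow> c * norm (x - x0) < 1"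
  proof -
    show "c > 0" using B(1) by (simp add: c_def)
    fix x assume "x \<in> \<Omega>"
    from B(2)[OF this] B(1) show "c * norm (x - x0) < 1" by (simp add: c_def divide_simps)
  qed
  have "\<forall>n. \<exists>E. star_map x0 c E \<and> C n \<subseteq> star_map.Om x0 c E 1 \<and> star_map.Om x0 c E 1 \<subseteq> \<Omega>"
  proof
    fix n
    show "\<exists>E. star_map x0 c E \<and> C n \<subseteq> star_map.Om x0 c E 1 \<and> star_map.Om x0 c E 1 \<subseteq> \<Omega>"
      using exhausting_star_map[OF \<Omega> c C(1)[of n] C(2)[of n]] by metis
  qed
  from choice[OF this] obtain E where E: "\<And>n. star_map x0 c (E n)"
    "\<And>n. C n \<subseteq> star_map.Om x0 c (E n) 1" "\<And>n. star_map.Om x0 c (E n) 1 \<subseteq> \<Omega>" by blast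
  have "\<exists>N. \<forall>n\<ge>N. K \<subseteq> star_map.Om x0 c (E n) 1" if K: "compact K" "K \<subseteq> \<Omega>" for K
  proof -
    obtain N where "\<forall>n\<ge>N. K \<subseteq> C n" using C(5)[OF K] by blast
    then show ?thesis using E(2) by (intro exI[of _ N]) blast
  qed
  then show ?thesis by (rule that[of c E, OF E(1,3)])
qed

section \<open>Passage to the limit\<close>

lemma integral_extend:
  fixes f :: "real^'n \<Rightarrow> 'b::euclidean_space"
  assumes "S \<subseteq> \<Omega>" "S \<in> sets lebesgue" "\<Omega> \<in> sets lebesgue"
  shows "(\<integral>x. indicator S x *\<^sub>R f x \<partial>lebesgue_on \<Omega>) = (\<integral>x. f x \<partial>lebesgue_on S)"
proof -
  have *: "indicat_real \<Omega> x * indicat_real S x = indicat_real S x" for x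
    using assms(1) by (auto simp: indicator_def)
  show ?thesis using assms(2,3) by (simp add: integral_restrict_space *)
qed

lemma
  fixes f :: "real^'n \<Rightarrow> 'b::euclidean_space"
  assumes S: "S \<subseteq> \<Omega>" "S \<in> sets lebesgue" "\<Omega> \<in> sets lebesgue"
  shows sq_integrable_extend: "sq_integrable (lebesgue_on S) f \<Longrightarrow>
      sq_integrable (lebesgue_on \<Omega>) (\<lambda>x. indicator S x *\<^sub>R f x)"
    and l2norm_extend: "l2norm (lebesgue_on \<Omega>) (\<lambda>x. indicator S x *\<^sub>R f x) = l2norm (lebesgue_on S) f"
proof -
  have sq: "(norm (indicator S x *\<^sub>R f x))\<^sup>2 = indicator S x *\<^sub>R (norm (f x))\<^sup>2" for x
    by (simp add: indicator_def)
  show "l2norm (lebesgue_on \<Omega>) (\<lambda>x. indicator S x *\<^sub>R f x) = l2norm (lebesgue_on S) f"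
    unfolding l2norm_def sq integral_extend[OF S] ..
  have ind: "indicator \<Omega> x *\<^sub>R (indicator S x *\<^sub>R z) = indicator S x *\<^sub>R z" for x and z :: 'b
    using S(1) by (auto simp: indicator_def)
  have ind': "indicator \<Omega> x *\<^sub>R (indicator S x *\<^sub>R z) = indicator S x *\<^sub>R z" for x and z :: real
    using S(1) by (auto simp: indicator_def)
  assume f: "sq_integrable (lebesgue_on S) f"
  have "f \<in> borel_measurable (lebesgue_on S)" using f by (simp add: sq_integrable_def)
  then have "(\<lambda>x. indicator S x *\<^sub>R f x) \<in> borel_measurable lebesgue"
    using S(2) by (subst (asm) borel_measurable_restrict_space_iff) simp_all
  then have "(\<lambda>x. indicator \<Omega> x *\<^sub>R (indicator S x *\<^sub>R f x)) \<in> borel_measurable lebesgue"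
    unfolding ind .
  then have m: "(\<lambda>x. indicator S x *\<^sub>R f x) \<in> borel_measurable (lebesgue_on \<Omega>)"
    using S(3) by (subst borel_measurable_restrict_space_iff) simp_all
  have "integrable (lebesgue_on S) (\<lambda>x. (norm (f x))\<^sup>2)" using f by (simp add: sq_integrable_def)
  then have "integrable lebesgue (\<lambda>x. indicator S x *\<^sub>R (norm (f x))\<^sup>2)"
    using S(2) by (subst (asm) integrable_restrict_space) simp_all
  then have "integrable lebesgue (\<lambda>x. indicator \<Omega> x *\<^sub>R (indicator S x *\<^sub>R (norm (f x))\<^sup>2))"
    unfolding ind' .
  then have "integrable (lebesgue_on \<Omega>) (\<lambda>x. indicator S x *\<^sub>R (norm (f x))\<^sup>2)"
    using S(3) by (subst integrable_restrict_space) simp_all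
  with m show "sq_integrable (lebesgue_on \<Omega>) (\<lambda>x. indicator S x *\<^sub>R f x)"
    unfolding sq_integrable_def sq by (rule conjI)
qed

lemma l2norm_sum_le:
  assumes "finite A" "\<And>k. k \<in> A \<Longrightarrow> sq_integrable M (f k)"
  shows "l2norm M (\<lambda>x. \<Sum>k\<in>A. f k x) \<le> (\<Sum>k\<in>A. l2norm M (f k))"
  using assms
proof (induction A rule: finite_induct)
  case empty
  then show ?case by (simp add: l2norm_def)
next
  case (insert k A)
  have "l2norm M (\<lambda>x. f k x + (\<Sum>k\<in>A. f k x)) \<le> l2norm M (f k) + l2norm M (\<lambda>x. \<Sum>k\<in>A. f k x)"
    by (intro l2norm_triangle sq_integrable_sum insert.prems) auto
  with insert show ?case by simp
qed

lemma conv_weights_sum_le: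
  assumes a: "conv_weights n N a" and r: "\<And>k. k \<ge> n \<Longrightarrow> r k \<le> e"
  shows "(\<Sum>k<N. a k * r k) \<le> e"
proof -
  have "(\<Sum>k<N. a k * r k) \<le> (\<Sum>k<N. a k * e)"
  proof (rule sum_mono)
    show "a k * r k \<le> a k * e" for k
      using a r[of k] by (cases "k < n") (auto simp: conv_weights_def intro: mult_left_mono)
  qed
  also have "\<dots> = e" using a by (simp add: conv_weights_def sum_distrib_right[symmetric])
  finally show ?thesis .
qed

lemma l2norm_conv_le:
  assumes a: "conv_weights n N a" and f: "\<And>k. sq_integrable M (f k)" "\<And>k. k \<ge> n \<Longrightarrow> l2norm M (f k) \<le> e"
  shows "l2norm M (\<lambda>x. \<Sum>k<N. a k *\<^sub>R f k x) \<le> e"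
proof -
  have "l2norm M (\<lambda>x. \<Sum>k<N. a k *\<^sub>R f k x) \<le> (\<Sum>k<N. l2norm M (\<lambda>x. a k *\<^sub>R f k x))"
    by (intro l2norm_sum_le sq_integrable_scaleR f) auto
  also have "\<dots> = (\<Sum>k<N. a k * l2norm M (f k))"
    using a by (simp add: l2norm_scaleR conv_weights_def)
  also have "\<dots> \<le> e" by (rule conv_weights_sum_le[OF a f(2)])
  finally show ?thesis .
qed

lemma tendsto_integral_inner:
  assumes Y: "\<And>n. sq_integrable M (Y n)" "sq_integrable M y" and g: "sq_integrable M g"
    and lim: "(\<lambda>n. l2norm M (\<lambda>x. Y n x - y x)) \<longlonglongrightarrow> 0"
  shows "(\<lambda>n. \<integral>x. Y n x \<bullet> g x \<partial>M) \<longlonglongrightarrow> (\<integral>x. y x \<bullet> g x \<partial>M)"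
proof (rule LIM_zero_cancel, rule Lim_null_comparison[OF always_eventually])
  show "\<forall>n. norm ((\<integral>x. Y n x \<bullet> g x \<partial>M) - (\<integral>x. y x \<bullet> g x \<partial>M)) \<le> l2norm M (\<lambda>x. Y n x - y x) * l2norm M g"
  proof
    fix n
    have "(\<integral>x. Y n x \<bullet> g x \<partial>M) - (\<integral>x. y x \<bullet> g x \<partial>M) = (\<integral>x. (Y n x - y x) \<bullet> g x \<partial>M)"
      using sq_integrable_inner(1)[OF Y(1) g] sq_integrable_inner(1)[OF Y(2) g]
      by (simp add: inner_diff_left)
    then show "norm ((\<integral>x. Y n x \<bullet> g x \<partial>M) - (\<integral>x. y x \<bullet> g x \<partial>M)) \<le> l2norm M (\<lambda>x. Y n x - y x) * l2norm M g"
      using abs_integral_inner_le[OF sq_integrable_diff[OF Y] g, of n] by simp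
  qed
  show "(\<lambda>n. l2norm M (\<lambda>x. Y n x - y x) * l2norm M g) \<longlonglongrightarrow> 0"
    using tendsto_mult_right[OF lim, of "l2norm M g"] by simp
qed

text \<open>Integration by parts is asked of the approximants only from an index depending on the
  test function; the weights of the \<open>n\<close>-th combination vanish below \<open>n\<close>,
  so eventually it holds for all its terms.\<close>

lemma has_weak_partial_limit:
  assumes \<Omega>: "open \<Omega>" "bounded \<Omega>" and a: "\<And>n. conv_weights n (N n) (a n)"
    and s: "\<And>k. sq_integrable (lebesgue_on \<Omega>) (P k)" "\<And>k. sq_integrable (lebesgue_on \<Omega>) (Q k)"
      "sq_integrable (lebesgue_on \<Omega>) p" "sq_integrable (lebesgue_on \<Omega>) q"
    and lim: "(\<lambda>n. l2norm (lebesgue_on \<Omega>) (\<lambda>x. (\<Sum>k<N n. a n k * P k x) - p x)) \<longlonglongrightarrow> 0"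
      "(\<lambda>n. l2norm (lebesgue_on \<Omega>) (\<lambda>x. (\<Sum>k<N n. a n k * Q k x) - q x)) \<longlonglongrightarrow> 0"
    and parts: "\<And>\<phi>. \<phi> \<in> test_functions \<Omega> \<Longrightarrow> \<exists>n0. \<forall>k\<ge>n0.
      (\<integral>x. P k x * partial i \<phi> x \<partial>lebesgue_on \<Omega>) = - (\<integral>x. Q k x * \<phi> x \<partial>lebesgue_on \<Omega>)"
  shows "has_weak_partial \<Omega> i p q"
  unfolding has_weak_partial_def L2_iff
proof (intro conjI s ballI)
  let ?M = "lebesgue_on \<Omega>"
  fix \<phi> assume \<phi>: "\<phi> \<in> test_functions \<Omega>"
  then have "smooth \<phi>" by (auto simp: test_functions_def)
  then have t: "sq_integrable ?M \<phi>" "sq_integrable ?M (partial i \<phi>)"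
    by (auto intro!: test_function_sq_integrable[OF \<Omega>] smooth_partial)
  obtain n0 where n0: "\<And>k. k \<ge> n0 \<Longrightarrow> (\<integral>x. P k x * partial i \<phi> x \<partial>?M) = - (\<integral>x. Q k x * \<phi> x \<partial>?M)"
    using parts[OF \<phi>] by blast
  have lin: "(\<integral>x. (\<Sum>k<N n. a n k * F k x) * g x \<partial>?M) = (\<Sum>k<N n. a n k * (\<integral>x. F k x * g x \<partial>?M))"
    if "\<And>k. sq_integrable ?M (F k)" "sq_integrable ?M g" for F g n
  proof -
    have int: "integrable ?M (\<lambda>x. F k x * g x)" for k
      using sq_integrable_inner(1)[OF that(1)[of k] that(2)] by simp
    have "(\<integral>x. (\<Sum>k<N n. a n k * F k x) * g x \<partial>?M) = (\<integral>x. (\<Sum>k<N n. a n k * (F k x * g x)) \<partial>?M)"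
      by (simp add: sum_distrib_right mult.assoc)
    also have "\<dots> = (\<Sum>k<N n. \<integral>x. a n k * (F k x * g x) \<partial>?M)"
      by (intro Bochner_Integration.integral_sum integrable_mult_right int)
    finally show ?thesis by simp
  qed
  have eq: "(\<integral>x. (\<Sum>k<N n. a n k * P k x) * partial i \<phi> x \<partial>?M) = - (\<integral>x. (\<Sum>k<N n. a n k * Q k x) * \<phi> x \<partial>?M)"
    if "n \<ge> n0" for n
  proof -
    have "a n k * (\<integral>x. P k x * partial i \<phi> x \<partial>?M) = - (a n k * (\<integral>x. Q k x * \<phi> x \<partial>?M))" for k
    proof (cases "k < n")
      case True
      then show ?thesis using a[of n] by (simp add: conv_weights_def)
    next
      case False
      then show ?thesis using n0[of k] that by simp
    qed
    then show ?thesis by (simp add: lin s t sum_negf)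
  qed
  have sY: "sq_integrable ?M (\<lambda>x. \<Sum>k<N n. a n k * F k x)" if "\<And>k. sq_integrable ?M (F k)" for F :: "nat \<Rightarrow> real^'a \<Rightarrow> real" and n
    by (intro sq_integrable_sum sq_integrable_cmult that)
  have "(\<lambda>n. \<integral>x. (\<Sum>k<N n. a n k * P k x) * partial i \<phi> x \<partial>?M) \<longlonglongrightarrow> (\<integral>x. p x * partial i \<phi> x \<partial>?M)"
    using tendsto_integral_inner[OF sY[OF s(1)] s(3) t(2) lim(1)] by simp
  moreover have "(\<lambda>n. - (\<integral>x. (\<Sum>k<N n. a n k * Q k x) * \<phi> x \<partial>?M)) \<longlonglongrightarrow> - (\<integral>x. q x * \<phi> x \<partial>?M)"
    using tendsto_minus[OF tendsto_integral_inner[OF sY[OF s(2)] s(4) t(1) lim(2)]] by simp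
  then have "(\<lambda>n. \<integral>x. (\<Sum>k<N n. a n k * P k x) * partial i \<phi> x \<partial>?M) \<longlonglongrightarrow> - (\<integral>x. q x * \<phi> x \<partial>?M)"
    by (rule Lim_transform_eventually) (use eq in \<open>auto simp: eventually_sequentially intro!: exI[of _ n0]\<close>)
  ultimately have "(\<integral>x. p x * partial i \<phi> x \<partial>?M) = - (\<integral>x. q x * \<phi> x \<partial>?M)"
    by (rule LIMSEQ_unique)
  then show "L2_inner \<Omega> p (partial i \<phi>) = - L2_inner \<Omega> q \<phi>" by (simp add: L2_inner_def)
qed

lemma test_function_sum:
  assumes "finite A" "\<And>k. k \<in> A \<Longrightarrow> \<theta> k \<in> test_functions \<Omega>"
  shows "(\<lambda>x. \<Sum>k\<in>A. a k * \<theta> k x) \<in> test_functions \<Omega>"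
proof (rule test_functionI)
  define K where "K = (\<Union>k\<in>A. closure {x. \<theta> k x \<noteq> 0})"
  show "compact K" "K \<subseteq> \<Omega>" "smooth (\<lambda>x. \<Sum>k\<in>A. a k * \<theta> k x)"
    using assms unfolding K_def
    by (auto simp: test_functions_def intro!: compact_UN smooth_sum smooth_cmult)
  fix x assume x: "x \<notin> K"
  show "(\<Sum>k\<in>A. a k * \<theta> k x) = 0"
  proof (intro sum.neutral ballI)
    fix k assume "k \<in> A"
    then have "x \<notin> closure {x. \<theta> k x \<noteq> 0}" using x by (auto simp: K_def)
    then have "\<theta> k x = 0" using closure_subset[of "{x. \<theta> k x \<noteq> 0}"] by auto
    then show "a k * \<theta> k x = 0" by simp
  qed
qed

text \<open>The truncations \<open>cut \<delta> (w x) * (w x * h x)\<close> converge in H^1, again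
  because \<open>cut'\<close> comes with a factor \<open>w\<close>. Their derivatives vanish outside
  \<open>U\<close> too, so the estimate survives extension by zero.\<close>

lemma (in smooth_domain) cut_approximation:
  assumes h: "smooth h" and e: "e > 0" and sub: "U \<subseteq> \<Omega>"
  obtains \<theta> where "\<theta> \<in> test_functions \<Omega>" "\<And>x. x \<notin> U \<Longrightarrow> \<theta> x = 0" "\<And>x i. x \<notin> U \<Longrightarrow> partial i \<theta> x = 0"
    "l2norm (lebesgue_on U) (\<lambda>x. w x * h x - \<theta> x) < e"
    "\<And>i. l2norm (lebesgue_on U) (\<lambda>x. partial i (\<lambda>x. w x * h x) x - partial i \<theta> x) < e"
proof -
  let ?M = "lebesgue_on U"
  let ?u = "\<lambda>x. w x * h x"
  have u: "smooth ?u" by (rule smooth_mult[OF smooth_w h])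
  define \<delta> where "\<delta> n = inverse (real (Suc n))" for n
  have \<delta>: "\<delta> n > 0" for n by (simp add: \<delta>_def)
  define \<theta> where "\<theta> n x = cut (\<delta> n) (w x) * ?u x" for n x
  have sm: "smooth (\<theta> n)" for n unfolding \<theta>_def[abs_def] by (intro smooth_mult smooth_cut smooth_w h)
  have p\<theta>: "partial i (\<theta> n) =
      (\<lambda>x. cut (\<delta> n) (w x) * partial i ?u x + (cut' (\<delta> n) (w x) * w x) * (partial i w x * h x))" for n i
    unfolding \<theta>_def[abs_def]
    using partial_mult[OF smooth_cut[OF smooth_w, of "\<delta> n"] u, of i]
    by (simp add: partial_chain[OF smooth_w DERIV_cut] mult_ac)
  define K where "K n = {x. \<delta> n \<le> w x}" for n
  have K: "compact (K n)" "K n \<subseteq> U" for n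
  proof -
    have "closed (K n)" unfolding K_def
      using smooth_continuous[OF smooth_w] by (intro closed_Collect_le) auto
    moreover have "K n \<subseteq> cball z R"
      using subset_cball \<delta>[of n] by (force simp: K_def)
    then have "bounded (K n)" by (rule bounded_subset[OF bounded_cball])
    ultimately show "compact (K n)" by (simp add: compact_eq_bounded_closed)
    show "K n \<subseteq> U" using \<delta>[of n] by (auto simp: K_def U_def)
  qed
  have zero: "\<theta> n x = 0" if "x \<notin> K n" for n x
    using that by (simp add: K_def \<theta>_def cut_eq_0[OF \<delta>])
  have tf: "\<theta> n \<in> test_functions \<Omega>" for n
    using K[of n] sub by (intro test_functionI[OF sm K(1)] zero) auto
  have out: "\<theta> n x = 0" "partial i (\<theta> n) x = 0" if "x \<notin> U" for n x i
  proof -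
    have "x \<notin> K n" using that K(2) by blast
    then show "\<theta> n x = 0" "partial i (\<theta> n) x = 0"
      using zero partial_eq_0_outside[OF compact_imp_closed[OF K(1)] zero] by auto
  qed
  have bd: "\<exists>C. \<forall>x. w x > 0 \<longrightarrow> \<bar>f x\<bar> \<le> C" if f: "smooth f" for f
  proof -
    obtain C where "\<And>x. x \<in> cball z R \<Longrightarrow> norm (f x) \<le> C"
      using compact_imp_bounded[OF compact_continuous_image[OF smooth_continuous[OF f] compact_cball]]
      by (metis bounded_iff imageI)
    then show ?thesis using subset_cball by (intro exI[of _ C]) force
  qed
  have finU: "finite_measure ?M"
    using bounded_subset[OF bounded_cball subset_cball] open_U
    by (intro finite_measure_lebesgue_on) (auto simp: U_def)
  have meas: "f \<in> borel_measurable ?M" if "smooth f" for f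
    using integrable_smooth[OF that] by simp
  have lim: "(\<lambda>n. l2norm ?M (\<lambda>x. \<theta> n x - ?u x)) \<longlonglongrightarrow> 0"
  proof -
    obtain C where C: "\<And>x. w x > 0 \<Longrightarrow> \<bar>?u x\<bar> \<le> C" using bd[OF u] by blast
    show ?thesis
    proof (rule l2norm_dominated_tendsto[OF finU, where C=C])
      show "AE x in ?M. norm (\<theta> n x - ?u x) \<le> C" for n
      proof (rule AE_U)
        fix x assume x: "0 < w x"
        have "\<bar>1 - cut (\<delta> n) (w x)\<bar> * \<bar>?u x\<bar> \<le> 1 * \<bar>?u x\<bar>"
          using cut_bounds(1,2)[OF \<delta>[of n], of "w x"] by (intro mult_right_mono) auto
        moreover have "\<bar>\<theta> n x - ?u x\<bar> = \<bar>1 - cut (\<delta> n) (w x)\<bar> * \<bar>?u x\<bar>"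
          unfolding abs_mult[symmetric] by (simp add: \<theta>_def left_diff_distrib abs_minus_commute)
        ultimately show "norm (\<theta> n x - ?u x) \<le> C" using C[OF x] by simp
      qed
      show "AE x in ?M. (\<lambda>n. \<theta> n x) \<longlonglongrightarrow> ?u x"
      proof (rule AE_U)
        fix x assume x: "0 < w x"
        have "(\<lambda>n. \<theta> n x) \<longlonglongrightarrow> 1 * ?u x"
          unfolding \<theta>_def \<delta>_def by (intro tendsto_intros tendsto_cut[OF x])
        then show "(\<lambda>n. \<theta> n x) \<longlonglongrightarrow> ?u x" by simp
      qed
    qed (intro meas sm u)+
  qed
  have limp: "(\<lambda>n. l2norm ?M (\<lambda>x. partial i (\<theta> n) x - partial i ?u x)) \<longlonglongrightarrow> 0" for i
  proof -
    obtain C where C: "\<And>x. w x > 0 \<Longrightarrow> \<bar>partial i ?u x\<bar> \<le> C" using bd[OF smooth_partial[OF u]] by blast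
    obtain C' where C': "\<And>x. w x > 0 \<Longrightarrow> \<bar>partial i w x * h x\<bar> \<le> C'"
      using bd[OF smooth_mult[OF smooth_partial[OF smooth_w] h]] by blast
    show ?thesis
    proof (rule l2norm_dominated_tendsto[OF finU, where C="C + 3 * C'"])
      show "AE x in ?M. norm (partial i (\<theta> n) x - partial i ?u x) \<le> C + 3 * C'" for n
      proof (rule AE_U)
        fix x assume x: "0 < w x"
        let ?c = "cut (\<delta> n) (w x)" and ?d = "cut' (\<delta> n) (w x) * w x"
        have "\<bar>1 - ?c\<bar> * \<bar>partial i ?u x\<bar> \<le> 1 * \<bar>partial i ?u x\<bar>"
          using cut_bounds(1,2)[OF \<delta>[of n], of "w x"] by (intro mult_right_mono) auto
        moreover have "\<bar>?d\<bar> * \<bar>partial i w x * h x\<bar> \<le> 3 * \<bar>partial i w x * h x\<bar>"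
          using cut_bounds(4)[OF \<delta>[of n], of "w x"] by (intro mult_right_mono) auto
        moreover have "\<bar>partial i (\<theta> n) x - partial i ?u x\<bar>
            \<le> \<bar>1 - ?c\<bar> * \<bar>partial i ?u x\<bar> + \<bar>?d\<bar> * \<bar>partial i w x * h x\<bar>"
        proof -
          have "partial i (\<theta> n) x - partial i ?u x = - ((1 - ?c) * partial i ?u x) + ?d * (partial i w x * h x)"
            by (simp add: p\<theta> left_diff_distrib)
          then show ?thesis
            using abs_triangle_ineq[of "- ((1 - ?c) * partial i ?u x)" "?d * (partial i w x * h x)"]
            by (simp only: abs_mult abs_minus_cancel)
        qed
        ultimately show "norm (partial i (\<theta> n) x - partial i ?u x) \<le> C + 3 * C'"
          using C[OF x] C'[OF x] unfolding real_norm_def by linarith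
      qed
      show "AE x in ?M. (\<lambda>n. partial i (\<theta> n) x) \<longlonglongrightarrow> partial i ?u x"
      proof (rule AE_U)
        fix x assume x: "0 < w x"
        have "(\<lambda>n. partial i (\<theta> n) x) \<longlonglongrightarrow> 1 * partial i ?u x + (0 * w x) * (partial i w x * h x)"
          unfolding p\<theta> \<delta>_def by (intro tendsto_intros tendsto_cut[OF x])
        then show "(\<lambda>n. partial i (\<theta> n) x) \<longlonglongrightarrow> partial i ?u x" by simp
      qed
    qed (intro meas smooth_partial sm u)+
  qed
  have "\<forall>\<^sub>F n in sequentially. l2norm ?M (\<lambda>x. \<theta> n x - ?u x) < e \<and>
      (\<forall>i\<in>UNIV. l2norm ?M (\<lambda>x. partial i (\<theta> n) x - partial i ?u x) < e)"
    using order_tendstoD(2)[OF lim e] order_tendstoD(2)[OF limp e]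
    by (intro eventually_conj eventually_ball_finite) auto
  then obtain n where n: "l2norm ?M (\<lambda>x. \<theta> n x - ?u x) < e"
      "\<And>i. l2norm ?M (\<lambda>x. partial i (\<theta> n) x - partial i ?u x) < e"
    unfolding eventually_sequentially by blast
  show ?thesis
    using that[of "\<theta> n"] tf out n by (simp add: l2norm_minus_commute)
qed

text \<open>Extracts components from the limit of vector-valued combinations, so that function,
  gradient and Hessian converge with the same weights.\<close>

lemma l2norm_linear_limit:
  fixes P :: "'b::euclidean_space \<Rightarrow> 'c::euclidean_space"
  assumes P: "bounded_linear P" "\<And>z. norm (P z) \<le> norm z"
    and Z: "\<And>k. sq_integrable M (Z k)" "sq_integrable M f"
    and lim: "(\<lambda>n. l2norm M (\<lambda>x. (\<Sum>k<N n. a n k *\<^sub>R Z k x) - f x)) \<longlonglongrightarrow> 0"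
  shows "sq_integrable M (\<lambda>x. P (Z k x))" "sq_integrable M (\<lambda>x. P (f x))"
    "(\<lambda>n. l2norm M (\<lambda>x. (\<Sum>k<N n. a n k *\<^sub>R P (Z k x)) - P (f x))) \<longlonglongrightarrow> 0"
proof -
  have cont: "continuous_on UNIV P" using P(1) by (rule linear_continuous_on)
  have meas: "(\<lambda>x. P (g x)) \<in> borel_measurable M" if "sq_integrable M g" for g
    using that by (intro borel_measurable_continuous_on[OF cont]) (simp add: sq_integrable_def)
  have sq: "sq_integrable M (\<lambda>x. P (g x))" if "sq_integrable M g" for g
    by (rule sq_integrable_bound[OF that meas[OF that], of 1]) (simp add: P(2))
  show "sq_integrable M (\<lambda>x. P (Z k x))" "sq_integrable M (\<lambda>x. P (f x))" by (intro sq Z)+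
  show "(\<lambda>n. l2norm M (\<lambda>x. (\<Sum>k<N n. a n k *\<^sub>R P (Z k x)) - P (f x))) \<longlonglongrightarrow> 0"
  proof (rule tendsto_sandwich[OF _ _ tendsto_const lim])
    show "\<forall>\<^sub>F n in sequentially. l2norm M (\<lambda>x. (\<Sum>k<N n. a n k *\<^sub>R P (Z k x)) - P (f x))
        \<le> l2norm M (\<lambda>x. (\<Sum>k<N n. a n k *\<^sub>R Z k x) - f x)"
    proof (intro always_eventually allI)
      fix n
      interpret bounded_linear P by (rule P(1))
      have eq: "(\<lambda>x. (\<Sum>k<N n. a n k *\<^sub>R P (Z k x)) - P (f x)) = (\<lambda>x. P ((\<Sum>k<N n. a n k *\<^sub>R Z k x) - f x))"
        by (simp add: diff sum scaleR)
      have s: "sq_integrable M (\<lambda>x. (\<Sum>k<N n. a n k *\<^sub>R Z k x) - f x)"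
        by (intro sq_integrable_diff sq_integrable_sum sq_integrable_scaleR Z)
      show "l2norm M (\<lambda>x. (\<Sum>k<N n. a n k *\<^sub>R P (Z k x)) - P (f x))
          \<le> l2norm M (\<lambda>x. (\<Sum>k<N n. a n k *\<^sub>R Z k x) - f x)"
        unfolding eq using l2norm_mono[OF s meas[OF s], of 1] P(2) by simp
    qed
  qed simp
qed

lemma l2norm_cong_AE:
  assumes "f \<in> borel_measurable M" "g \<in> borel_measurable M" "AE x in M. f x = g x"
  shows "l2norm M f = l2norm M g"
proof -
  have "(\<integral>x. (norm (f x))\<^sup>2 \<partial>M) = (\<integral>x. (norm (g x))\<^sup>2 \<partial>M)"
    using assms(1,2) by (intro integral_cong_AE) (use assms(3) in auto)
  then show ?thesis by (simp add: l2norm_def)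
qed

lemma borel_measurable_matrix:
  fixes A :: "'a \<Rightarrow> real^'m^'n"
  assumes "\<And>i j. (\<lambda>x. A x $ i $ j) \<in> borel_measurable M"
  shows "A \<in> borel_measurable M"
proof (subst borel_measurable_euclidean_space, intro ballI)
  fix b :: "real^'m^'n" assume "b \<in> Basis"
  then obtain i j where "b = axis i (axis j 1)" by (auto simp: Basis_vec_def)
  then show "(\<lambda>x. A x \<bullet> b) \<in> borel_measurable M" using assms by (simp add: inner_axis)
qed

text \<open>The triples of function, gradient and Hessian are extended by zero and combined at once.
  The extended \<open>u k\<close> has a weak gradient because \<open>u k\<close> vanishes on the
  boundary, but this gradient may jump there; second weak derivatives therefore arise only in the
  limit, since every test function is eventually supported in \<open>U k\<close>.\<close>

lemma sobolev_limit:
  fixes \<Omega> :: "(real^'n) set" and w h :: "nat \<Rightarrow> real^'n \<Rightarrow> real"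
  defines "u \<equiv> \<lambda>k x. w k x * h k x" and "U \<equiv> \<lambda>k. {x. 0 < w k x}"
  assumes \<Omega>: "open \<Omega>" "bounded \<Omega>"
    and D: "\<And>k. smooth_domain (w k) x0 R" "\<And>k. U k \<subseteq> \<Omega>"
      "\<And>K. compact K \<Longrightarrow> K \<subseteq> \<Omega> \<Longrightarrow> \<exists>n. \<forall>k\<ge>n. K \<subseteq> U k"
    and h: "\<And>k. smooth (h k)"
    and B: "\<And>k. l2norm (lebesgue_on (U k)) (\<lambda>x. (u k x, grad (u k) x, hess (u k) x)) \<le> B"
  obtains N a v where "\<And>n. conv_weights n (N n) (a n)" "v \<in> V_space \<Omega>"
    "sq_integrable (lebesgue_on \<Omega>) v" "sq_integrable (lebesgue_on \<Omega>) (weak_hessian \<Omega> v)"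
    "(\<lambda>n. l2norm (lebesgue_on \<Omega>) (\<lambda>x. (\<Sum>k<N n. a n k * (indicator (U k) x * u k x)) - v x)) \<longlonglongrightarrow> 0"
    "(\<lambda>n. l2norm (lebesgue_on \<Omega>) (\<lambda>x. (\<Sum>k<N n. a n k *\<^sub>R (indicator (U k) x *\<^sub>R hess (u k) x))
       - weak_hessian \<Omega> v x)) \<longlonglongrightarrow> 0"
proof -
  let ?M = "lebesgue_on \<Omega>"
  have U: "smooth_domain.U (w k) = U k" for k
    by (simp add: U_def smooth_domain.U_def[OF D(1)])
  have Uset: "U k \<in> sets lebesgue" "open (U k)" for k
    using smooth_domain.open_U[OF D(1)[of k]] unfolding U by auto
  have \<Omega>': "\<Omega> \<in> sets lebesgue" using \<Omega> by simp
  note ext = D(2) Uset(1) \<Omega>'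
  have fin: "finite_measure ?M" by (rule finite_measure_lebesgue_on[OF \<Omega>(2) \<Omega>'])
  have smw: "smooth (w k)" for k using D(1)[of k] by (simp add: smooth_domain_def)
  have smu: "smooth (u k)" for k unfolding u_def by (rule smooth_mult[OF smw h])
  define Z where "Z k x = indicator (U k) x *\<^sub>R (u k x, grad (u k) x, hess (u k) x)" for k x
  have sZ: "sq_integrable ?M (Z k)" for k
    unfolding Z_def[abs_def]
  proof (rule sq_integrable_extend[OF ext])
    show "sq_integrable (lebesgue_on (U k)) (\<lambda>x. (u k x, grad (u k) x, hess (u k) x))"
      by (intro smooth_domain.sq_integrable_U[OF D(1)[of k], unfolded U] continuous_on_Pair
          continuous_grad continuous_hess smooth_continuous smu)
  qed
  have BZ: "l2norm ?M (Z k) \<le> B" for k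
    unfolding Z_def[abs_def] l2norm_extend[OF ext] by (rule B)
  obtain N a F where a: "\<And>n. conv_weights n (N n) (a n)" and F: "sq_integrable ?M F"
    and lim: "(\<lambda>n. l2norm ?M (\<lambda>x. (\<Sum>k<N n. a n k *\<^sub>R Z k x) - F x)) \<longlonglongrightarrow> 0"
    by (rule convex_combinations_converge[where Z = Z, OF fin sZ BZ]) blast
  note proj = l2norm_linear_limit[where Z = Z and a = a and N = N, OF _ _ sZ F lim]
  define v where "v x = fst (F x)" for x
  define dv where "dv i x = fst (snd (F x)) $ i" for i x
  define hv where "hv i j x = snd (snd (F x)) $ i $ j" for i j x
  have P1: "bounded_linear (fst :: real \<times> (real^'n) \<times> (real^'n^'n) \<Rightarrow> real)" "norm (fst z) \<le> norm z"
    for z :: "real \<times> (real^'n) \<times> (real^'n^'n)"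
    using norm_fst_le[of "fst z" "snd z"] by (simp_all add: bounded_linear_fst)
  have P2: "bounded_linear (\<lambda>z :: real \<times> (real^'n) \<times> (real^'n^'n). fst (snd z) $ i)" "norm (fst (snd z) $ i) \<le> norm z"
    for z :: "real \<times> (real^'n) \<times> (real^'n^'n)" and i
  proof -
    show "bounded_linear (\<lambda>z :: real \<times> (real^'n) \<times> (real^'n^'n). fst (snd z) $ i)"
      by (intro bounded_linear_compose[OF bounded_linear_vec_nth] bounded_linear_compose[OF bounded_linear_fst bounded_linear_snd])
    show "norm (fst (snd z) $ i) \<le> norm z"
      using Finite_Cartesian_Product.norm_nth_le[of "fst (snd z)" i] norm_fst_le[of "fst (snd z)" "snd (snd z)"] norm_snd_le[of "snd z" "fst z"]
      by simp
  qed
  have P3: "bounded_linear (\<lambda>z :: real \<times> (real^'n) \<times> (real^'n^'n). snd (snd z))" "norm (snd (snd z)) \<le> norm z"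
    for z :: "real \<times> (real^'n) \<times> (real^'n^'n)"
  proof -
    show "bounded_linear (\<lambda>z :: real \<times> (real^'n) \<times> (real^'n^'n). snd (snd z))"
      by (intro bounded_linear_compose[OF bounded_linear_snd bounded_linear_snd])
    show "norm (snd (snd z)) \<le> norm z"
      using norm_snd_le[of "snd (snd z)" "fst (snd z)"] norm_snd_le[of "snd z" "fst z"] by simp
  qed
  have P4: "bounded_linear (\<lambda>z :: real \<times> (real^'n) \<times> (real^'n^'n). snd (snd z) $ i $ j)" "norm (snd (snd z) $ i $ j) \<le> norm z"
    for z :: "real \<times> (real^'n) \<times> (real^'n^'n)" and i j
  proof -
    show "bounded_linear (\<lambda>z :: real \<times> (real^'n) \<times> (real^'n^'n). snd (snd z) $ i $ j)"
      by (intro bounded_linear_compose[OF bounded_linear_vec_nth] P3)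
    show "norm (snd (snd z) $ i $ j) \<le> norm z"
      using Finite_Cartesian_Product.norm_nth_le[of "snd (snd z) $ i" j]
        Finite_Cartesian_Product.norm_nth_le[of "snd (snd z)" i] P3(2)[of z] by linarith
  qed
  have Z1: "fst (Z k x) = indicator (U k) x * u k x"
    and Z2: "fst (snd (Z k x)) $ i = indicator (U k) x * partial i (u k) x"
    and Z3: "snd (snd (Z k x)) = indicator (U k) x *\<^sub>R hess (u k) x"
    and Z4: "snd (snd (Z k x)) $ i $ j = indicator (U k) x * partial i (partial j (u k)) x" for k x i j
    by (simp_all add: Z_def grad_def hess_def)
  note lim1 = proj[OF P1, unfolded Z1, folded v_def, simplified real_scaleR_def]
  note lim2 = proj[OF P2, unfolded Z2, folded dv_def, simplified real_scaleR_def]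
  note lim3 = proj[OF P3, unfolded Z3]
  note lim4 = proj[OF P4, unfolded Z4, folded hv_def, simplified real_scaleR_def]
  have move: "(\<integral>x. (indicator (U k) x * f x) * g x \<partial>?M) = (\<integral>x. f x * g x \<partial>lebesgue_on (U k))" for k and f g :: "real^'n \<Rightarrow> real"
    using integral_extend[OF ext, of k "\<lambda>x. f x * g x"] by (simp add: mult.assoc)
  have wv: "has_weak_partial \<Omega> i v (dv i)" for i
  proof (rule has_weak_partial_limit[OF \<Omega> a lim1(1) lim2(1) lim1(2) lim2(2) lim1(3) lim2(3)])
    fix \<phi> assume "\<phi> \<in> test_functions \<Omega>"
    then have \<phi>: "smooth \<phi>" by (simp add: test_functions_def)
    have "(\<integral>x. u k x * partial i \<phi> x \<partial>lebesgue_on (U k)) = - (\<integral>x. partial i (u k) x * \<phi> x \<partial>lebesgue_on (U k))" for k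
      using smooth_domain.integral_by_parts[OF D(1)[of k] h[of k] \<phi>, of i] unfolding U u_def by simp
    then show "\<exists>n0. \<forall>k\<ge>n0. (\<integral>x. (indicator (U k) x * u k x) * partial i \<phi> x \<partial>?M)
        = - (\<integral>x. (indicator (U k) x * partial i (u k) x) * \<phi> x \<partial>?M)"
      by (simp only: move) simp
  qed
  have wdv: "has_weak_partial \<Omega> i (dv j) (hv i j)" for i j
  proof (rule has_weak_partial_limit[OF \<Omega> a lim2(1) lim4(1) lim2(2) lim4(2) lim2(3) lim4(3)])
    fix \<phi> assume \<phi>: "\<phi> \<in> test_functions \<Omega>"
    obtain K where K: "smooth \<phi>" "compact K" "K \<subseteq> \<Omega>" "\<And>x. x \<notin> K \<Longrightarrow> \<phi> x = 0"
      using test_functionE[OF \<phi>] by metis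
    obtain n0 where n0: "\<And>k. k \<ge> n0 \<Longrightarrow> K \<subseteq> U k" using D(3)[OF K(2,3)] by blast
    have "(\<integral>x. partial j (u k) x * partial i \<phi> x \<partial>lebesgue_on (U k))
        = - (\<integral>x. partial i (partial j (u k)) x * \<phi> x \<partial>lebesgue_on (U k))" if "k \<ge> n0" for k
    proof -
      have s: "smooth (partial j (u k))" by (rule smooth_partial[OF smu])
      have int: "integrable (lebesgue_on (U k)) f" if "smooth f" for f
        using smooth_domain.integrable_smooth[OF D(1)[of k] that] unfolding U .
      have "0 = (\<integral>x. partial i (\<lambda>x. partial j (u k) x * \<phi> x) x \<partial>lebesgue_on (U k))"
        by (rule integral_partial_supported[symmetric, OF smooth_mult[OF s K(1)] K(2) n0[OF that] _ Uset(2)])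
          (simp add: K(4))
      also have "\<dots> = (\<integral>x. partial i (partial j (u k)) x * \<phi> x + partial j (u k) x * partial i \<phi> x \<partial>lebesgue_on (U k))"
        by (simp add: partial_mult s K(1) add.commute)
      also have "\<dots> = (\<integral>x. partial i (partial j (u k)) x * \<phi> x \<partial>lebesgue_on (U k))
          + (\<integral>x. partial j (u k) x * partial i \<phi> x \<partial>lebesgue_on (U k))"
        by (intro Bochner_Integration.integral_add int smooth_mult smooth_partial smu K(1))
      finally show ?thesis by simp
    qed
    then show "\<exists>n0. \<forall>k\<ge>n0. (\<integral>x. (indicator (U k) x * partial j (u k) x) * partial i \<phi> x \<partial>?M)
        = - (\<integral>x. (indicator (U k) x * partial i (partial j (u k)) x) * \<phi> x \<partial>?M)"
      unfolding move by blast
  qed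
  \<comment> \<open>Test functions close to the extended \<open>u k\<close> in H^1, combined with
    the same weights, show that the limit lies in the closure \<open>H10\<close>.\<close>
  define e where "e k = inverse (real (Suc k))" for k
  have "\<forall>k. \<exists>\<theta>. \<theta> \<in> test_functions \<Omega> \<and> l2norm ?M (\<lambda>x. indicator (U k) x * u k x - \<theta> x) \<le> e k \<and>
      (\<forall>i. l2norm ?M (\<lambda>x. indicator (U k) x * partial i (u k) x - partial i \<theta> x) \<le> e k)"
  proof
    fix k
    have "e k > 0" by (simp add: e_def)
    then show "\<exists>\<theta>. \<theta> \<in> test_functions \<Omega> \<and> l2norm ?M (\<lambda>x. indicator (U k) x * u k x - \<theta> x) \<le> e k \<and>
      (\<forall>i. l2norm ?M (\<lambda>x. indicator (U k) x * partial i (u k) x - partial i \<theta> x) \<le> e k)" (is ?goal)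
    proof (rule smooth_domain.cut_approximation[OF D(1)[of k] h[of k], unfolded U, OF _ D(2)[of k]])
      fix \<theta> assume \<theta>: "\<theta> \<in> test_functions \<Omega>" "\<And>x. x \<notin> U k \<Longrightarrow> \<theta> x = 0" "\<And>x i. x \<notin> U k \<Longrightarrow> partial i \<theta> x = 0"
        "l2norm (lebesgue_on (U k)) (\<lambda>x. w k x * h k x - \<theta> x) < e k"
        "\<And>i. l2norm (lebesgue_on (U k)) (\<lambda>x. partial i (\<lambda>x. w k x * h k x) x - partial i \<theta> x) < e k"
      have 1: "(\<lambda>x. indicator (U k) x * u k x - \<theta> x) = (\<lambda>x. indicator (U k) x *\<^sub>R (u k x - \<theta> x))"
        using \<theta>(2) by (auto simp: indicator_def)
      have 2: "(\<lambda>x. indicator (U k) x * partial i (u k) x - partial i \<theta> x)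
          = (\<lambda>x. indicator (U k) x *\<^sub>R (partial i (u k) x - partial i \<theta> x))" for i
        using \<theta>(3) by (auto simp: indicator_def)
      have "l2norm ?M (\<lambda>x. indicator (U k) x * u k x - \<theta> x) \<le> e k"
        unfolding 1 l2norm_extend[OF ext] using \<theta>(4) unfolding u_def by (rule less_imp_le)
      moreover have "l2norm ?M (\<lambda>x. indicator (U k) x * partial i (u k) x - partial i \<theta> x) \<le> e k" for i
        unfolding 2 l2norm_extend[OF ext] using \<theta>(5)[of i] unfolding u_def by (rule less_imp_le)
      ultimately show ?goal using \<theta>(1) by blast
    qed
  qed
  from choice[OF this] obtain \<theta> where \<theta>: "\<And>k. \<theta> k \<in> test_functions \<Omega>"
    "\<And>k. l2norm ?M (\<lambda>x. indicator (U k) x * u k x - \<theta> k x) \<le> e k"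
    "\<And>k i. l2norm ?M (\<lambda>x. indicator (U k) x * partial i (u k) x - partial i (\<theta> k) x) \<le> e k"
    by blast
  have sm\<theta>: "smooth (\<theta> k)" for k using \<theta>(1)[of k] by (simp add: test_functions_def)
  define \<phi> where "\<phi> n x = (\<Sum>k<N n. a n k * \<theta> k x)" for n x
  have \<phi>: "\<phi> n \<in> test_functions \<Omega>" for n
    unfolding \<phi>_def[abs_def] by (rule test_function_sum) (auto intro: \<theta>(1))
  have p\<phi>: "partial i (\<phi> n) = (\<lambda>x. \<Sum>k<N n. a n k * partial i (\<theta> k) x)" for i n
    unfolding \<phi>_def[abs_def] by (simp add: partial_sum partial_cmult smooth_cmult sm\<theta>)
  have e_mono: "e k \<le> e n" if "n \<le> k" for n k using that by (simp add: e_def)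
  have e0: "e \<longlonglongrightarrow> 0" unfolding e_def[abs_def] by (rule LIMSEQ_inverse_real_of_nat)
  have approx: "(\<lambda>n. l2norm ?M (\<lambda>x. f x - (\<Sum>k<N n. a n k * t k x))) \<longlonglongrightarrow> 0"
    if g: "\<And>k. sq_integrable ?M (g k)" "sq_integrable ?M f" and t: "\<And>k. sq_integrable ?M (t k)"
      and close: "\<And>k. l2norm ?M (\<lambda>x. g k x - t k x) \<le> e k"
      and lim: "(\<lambda>n. l2norm ?M (\<lambda>x. (\<Sum>k<N n. a n k * g k x) - f x)) \<longlonglongrightarrow> 0"
    for f :: "real^'n \<Rightarrow> real" and g t :: "nat \<Rightarrow> real^'n \<Rightarrow> real"
  proof (rule tendsto_sandwich[OF _ _ tendsto_const])
    show "\<forall>\<^sub>F n in sequentially. l2norm ?M (\<lambda>x. f x - (\<Sum>k<N n. a n k * t k x))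
        \<le> l2norm ?M (\<lambda>x. (\<Sum>k<N n. a n k * g k x) - f x) + e n"
    proof (intro always_eventually allI)
      fix n
      have s: "sq_integrable ?M (\<lambda>x. \<Sum>k<N n. a n k * q k x)" if "\<And>k. sq_integrable ?M (q k)" for q :: "nat \<Rightarrow> real^'n \<Rightarrow> real"
        by (intro sq_integrable_sum sq_integrable_cmult that)
      have "l2norm ?M (\<lambda>x. \<Sum>k<N n. a n k *\<^sub>R (g k x - t k x)) \<le> e n"
        using order_trans[OF close e_mono] by (intro l2norm_conv_le[OF a] sq_integrable_diff g t)
      then have "l2norm ?M (\<lambda>x. (\<Sum>k<N n. a n k * g k x) - (\<Sum>k<N n. a n k * t k x)) \<le> e n"
        by (simp add: right_diff_distrib sum_subtractf)
      then show "l2norm ?M (\<lambda>x. f x - (\<Sum>k<N n. a n k * t k x))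
          \<le> l2norm ?M (\<lambda>x. (\<Sum>k<N n. a n k * g k x) - f x) + e n"
        using l2norm_triangle_diff[OF g(2) s[of g, OF g(1)] s[of t, OF t]]
        by (simp add: l2norm_minus_commute[of ?M f])
    qed
    show "(\<lambda>n. l2norm ?M (\<lambda>x. (\<Sum>k<N n. a n k * g k x) - f x) + e n) \<longlonglongrightarrow> 0"
      using tendsto_add[OF lim e0] by simp
  qed simp
  have 1: "(\<lambda>n. l2norm ?M (\<lambda>x. v x - \<phi> n x)) \<longlonglongrightarrow> 0"
    unfolding \<phi>_def
    by (rule approx[OF lim1(1,2) test_function_sq_integrable[OF \<Omega> sm\<theta>] \<theta>(2) lim1(3)])
  have 2: "(\<lambda>n. l2norm ?M (\<lambda>x. dv i x - partial i (\<phi> n) x)) \<longlonglongrightarrow> 0" for i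
    unfolding p\<phi>
    by (rule approx[OF lim2(1,2) test_function_sq_integrable[OF \<Omega> smooth_partial[OF sm\<theta>]] \<theta>(3) lim2(3)])
  note V = V_spaceI[OF \<Omega> wv wdv \<phi> 1 2]
  have hvm: "(\<chi> i j. hv i j x) = snd (snd (F x))" for x by (simp add: hv_def vec_eq_iff)
  note hess = V(2)[unfolded hvm]
  have whm: "weak_hessian \<Omega> v \<in> borel_measurable ?M"
  proof -
    have "has_weak_partial \<Omega> j v (weak_partial \<Omega> j v)" for j by (rule weak_partial_AE[OF \<Omega> wv])
    moreover have "AE x in ?M. weak_partial \<Omega> j v x = dv j x" for j by (rule weak_partial_AE[OF \<Omega> wv])
    ultimately have "has_weak_partial \<Omega> i (weak_partial \<Omega> j v) (hv i j)" for i j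
      by (intro has_weak_partial_cong_AE[OF \<Omega> wdv]) (auto simp: has_weak_partial_def)
    from weak_partial_AE(1)[OF \<Omega> this]
    have "weak_partial \<Omega> i (weak_partial \<Omega> j v) \<in> borel_measurable ?M" for i j
      by (simp add: has_weak_partial_def L2_def)
    then show ?thesis by (intro borel_measurable_matrix) (simp add: weak_hessian_def)
  qed
  show ?thesis
  proof (rule that[OF a V(1) lim1(2) _ lim1(3)])
    have "AE x in ?M. norm (weak_hessian \<Omega> v x) \<le> 1 * norm (snd (snd (F x)))"
      using hess by eventually_elim simp
    then show "sq_integrable ?M (weak_hessian \<Omega> v)" by (rule sq_integrable_bound[OF lim3(2) whm])
    have "l2norm ?M (\<lambda>x. (\<Sum>k<N n. a n k *\<^sub>R (indicator (U k) x *\<^sub>R hess (u k) x)) - snd (snd (F x)))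
        = l2norm ?M (\<lambda>x. (\<Sum>k<N n. a n k *\<^sub>R (indicator (U k) x *\<^sub>R hess (u k) x)) - weak_hessian \<Omega> v x)" for n
    proof (rule l2norm_cong_AE)
      have "(\<lambda>x. \<Sum>k<N n. a n k *\<^sub>R (indicator (U k) x *\<^sub>R hess (u k) x)) \<in> borel_measurable ?M"
      proof (rule borel_measurable_sum)
        show "(\<lambda>x. a n k *\<^sub>R (indicator (U k) x *\<^sub>R hess (u k) x)) \<in> borel_measurable ?M" for k
          using sq_integrable_scaleR[OF lim3(1)[of k]] unfolding sq_integrable_def by blast
      qed
      then show "(\<lambda>x. (\<Sum>k<N n. a n k *\<^sub>R (indicator (U k) x *\<^sub>R hess (u k) x)) - snd (snd (F x))) \<in> borel_measurable ?M"
        "(\<lambda>x. (\<Sum>k<N n. a n k *\<^sub>R (indicator (U k) x *\<^sub>R hess (u k) x)) - weak_hessian \<Omega> v x) \<in> borel_measurable ?M"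
        using lim3(2) whm by (auto simp: sq_integrable_def intro: borel_measurable_diff)
    qed (use hess in eventually_elim, simp)
    with lim3(3) show "(\<lambda>n. l2norm ?M (\<lambda>x. (\<Sum>k<N n. a n k *\<^sub>R (indicator (U k) x *\<^sub>R hess (u k) x))
       - weak_hessian \<Omega> v x)) \<longlonglongrightarrow> 0" by simp
  qed
qed

lemma l2norm_Pair_le:
  assumes "sq_integrable M f" "sq_integrable M g"
  shows "l2norm M (\<lambda>x. (f x, g x)) \<le> l2norm M f + l2norm M g"
proof -
  have "sq_integrable M (\<lambda>x. (f x, 0 :: 'c))" "sq_integrable M (\<lambda>x. (0 :: 'b, g x))"
    using assms by (simp_all add: sq_integrable_def norm_Pair borel_measurable_Pair)
  from l2norm_triangle[OF this] show ?thesis by (simp add: l2norm_def norm_Pair)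
qed

lemma l2norm_eq_0_imp_AE:
  assumes f: "sq_integrable M f" "l2norm M f \<le> 0"
  shows "AE x in M. f x = 0"
proof -
  have "(\<integral>x. (norm (f x))\<^sup>2 \<partial>M) = 0"
    using f(2) l2norm_nonneg[of M f] by (simp add: l2norm_square[symmetric])
  then have "AE x in M. (norm (f x))\<^sup>2 = 0"
    using f(1) by (subst (asm) integral_nonneg_eq_0_iff_AE) (auto simp: sq_integrable_def)
  then show ?thesis by eventually_elim simp
qed

lemma conv_weights_tendsto_0:
  assumes a: "\<And>n. conv_weights n (N n) (a n)" and r: "r \<longlonglongrightarrow> 0" "\<And>k. 0 \<le> r k"
  shows "(\<lambda>n. \<Sum>k<N n. a n k * r k) \<longlonglongrightarrow> 0"
proof (rule LIMSEQ_I)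
  fix e :: real assume e: "e > 0"
  then have "e / 2 > 0" by simp
  from order_tendstoD(2)[OF r(1) this] obtain n0 where n0: "\<And>k. k \<ge> n0 \<Longrightarrow> r k < e / 2"
    unfolding eventually_sequentially by blast
  have "norm ((\<Sum>k<N n. a n k * r k) - 0) < e" if "n \<ge> n0" for n
  proof -
    have "(\<Sum>k<N n. a n k * r k) \<le> e / 2"
      by (rule conv_weights_sum_le[OF a]) (use n0 that in \<open>auto intro: less_imp_le\<close>)
    moreover have "0 \<le> (\<Sum>k<N n. a n k * r k)"
      using a[of n] r(2) by (intro sum_nonneg mult_nonneg_nonneg) (auto simp: conv_weights_def)
    ultimately show ?thesis using e by simp
  qed
  then show "\<exists>no. \<forall>n\<ge>no. norm ((\<Sum>k<N n. a n k * r k) - 0) < e" by blast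
qed

context dense_domain
begin

text \<open>The three summands of the constant belong to function, gradient and Hessian; the last is
  1 by Miranda--Talenti.\<close>

lemma X_sobolev_le:
  assumes u: "u \<in> X"
  shows "l2norm M (\<lambda>x. (u x, grad u x, hess u x)) \<le> (4 * R\<^sup>2 + 2 * R + 1) * l2norm M (laplacian u)"
proof -
  have su: "smooth u" by (rule X_smooth[OF u])
  have s: "sq_integrable M u" "sq_integrable M (grad u)" "sq_integrable M (hess u)"
    by (intro sq_integrable_U continuous_grad continuous_hess smooth_continuous su)+
  have "(l2norm M (grad u))\<^sup>2 \<le> (2 * R * l2norm M (laplacian u))\<^sup>2"
  proof -
    have "(norm (grad u x))\<^sup>2 = (\<Sum>i\<in>UNIV. (partial i u x)\<^sup>2)" for x
      unfolding grad_def by (rule norm_vec_square)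
    moreover have "4 * R\<^sup>2 * (l2norm M (laplacian u))\<^sup>2 = (2 * R * l2norm M (laplacian u))\<^sup>2"
      by (simp only: power_mult_distrib) simp
    ultimately show ?thesis using X_gradient_le[OF u] by (simp only: l2norm_square[of M "grad u"])
  qed
  then have g: "l2norm M (grad u) \<le> 2 * R * l2norm M (laplacian u)"
    by (rule power2_le_imp_le) (use R_pos in simp)
  have s2: "sq_integrable M (\<lambda>x. (grad u x, hess u x))"
    by (intro sq_integrable_U continuous_on_Pair continuous_grad continuous_hess su)
  have "l2norm M (\<lambda>x. (u x, grad u x, hess u x)) \<le> l2norm M u + (l2norm M (grad u) + l2norm M (hess u))"
    using l2norm_Pair_le[OF s(1) s2] l2norm_Pair_le[OF s(2,3)] by linarith
  then show ?thesis
    using g X_l2_le[OF u] X_hess_le[OF u] by (simp add: algebra_simps)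
qed

text \<open>The Sobolev bound is expressed through \<open>R\<close>, \<rho> and \<open>C\<close>
  only, so that it stays fixed while domain, coefficients and accuracy vary.\<close>

lemma approximate_solution_bounded:
  assumes b: "smooth_matrix b" "\<And>x. w x > 0 \<Longrightarrow> norm (b x - mat 1) \<le> \<rho>" "0 \<le> \<rho>" "\<rho> < 1"
    and f: "continuous_on UNIV f" "\<And>x. 0 \<le> f x" "l2norm M f \<le> C" and e: "0 < e" "e \<le> 1"
  shows "\<exists>h. smooth h \<and> l2norm M (\<lambda>x. b x \<bullet> hess (\<lambda>x. w x * h x) x + f x) < e \<and>
    l2norm M (neg (\<lambda>x. w x * h x)) < e \<and>
    l2norm M (\<lambda>x. (w x * h x, grad (\<lambda>x. w x * h x) x, hess (\<lambda>x. w x * h x) x))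
      \<le> (4 * R\<^sup>2 + 2 * R + 1) * ((C + 1) / (1 - \<rho>))"
proof (rule approximate_nonneg_solution[OF b f(1,2) e(1)])
  fix u assume u: "u \<in> X" "l2norm M (\<lambda>x. b x \<bullet> hess u x + f x) < e" "l2norm M (neg u) < e"
    "(1 - \<rho>) * l2norm M (laplacian u) \<le> l2norm M (\<lambda>x. b x \<bullet> hess u x)"
  have su: "smooth u" by (rule X_smooth[OF u(1)])
  obtain h where h: "smooth h" "u = (\<lambda>x. w x * h x)" using X_form[OF u(1)] by blast
  have c: "continuous_on UNIV (\<lambda>x. b x \<bullet> hess u x)"
    by (intro continuous_on_inner continuous_smooth_matrix b(1) continuous_hess su)
  have "l2norm M (\<lambda>x. b x \<bullet> hess u x) = l2norm M (\<lambda>x. (b x \<bullet> hess u x + f x) - f x)" by simp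
  also have "\<dots> \<le> l2norm M (\<lambda>x. b x \<bullet> hess u x + f x) + l2norm M f"
    using l2norm_triangle[OF sq_integrable_U[OF continuous_on_add[OF c f(1)]] sq_integrable_minus[OF sq_integrable_U[OF f(1)]]]
    by simp
  also have "\<dots> \<le> C + 1" using u(2) f(3) e by linarith
  finally have "(1 - \<rho>) * l2norm M (laplacian u) \<le> C + 1" using u(4) by linarith
  then have "l2norm M (laplacian u) \<le> (C + 1) / (1 - \<rho>)" using b(4) by (simp add: pos_le_divide_eq mult.commute)
  then have "(4 * R\<^sup>2 + 2 * R + 1) * l2norm M (laplacian u) \<le> (4 * R\<^sup>2 + 2 * R + 1) * ((C + 1) / (1 - \<rho>))"
    using R_pos by (intro mult_left_mono) auto
  with X_sobolev_le[OF u(1)]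
  have "l2norm M (\<lambda>x. (u x, grad u x, hess u x)) \<le> (4 * R\<^sup>2 + 2 * R + 1) * ((C + 1) / (1 - \<rho>))"
    by linarith
  with h u show ?thesis by (intro exI[of _ h] conjI) simp_all
qed

end

text \<open>Coefficients and right-hand side are only bounded and measurable, so both are
  regularised. Coefficients converging in L^2 against Hessians bounded in L^2 control the residual
  in L^1, which is enough to show that it vanishes.\<close>

lemma nonneg_solution:
  fixes b :: "real^'n \<Rightarrow> real^'n^'n" and f :: "real^'n \<Rightarrow> real"
  assumes \<Omega>: "open \<Omega>" "bounded \<Omega>" "convex \<Omega>" "\<Omega> \<noteq> {}"
    and b: "b \<in> borel_measurable (lebesgue_on \<Omega>)" "0 \<le> \<rho>" "\<rho> < 1"
      "AE x in lebesgue_on \<Omega>. norm (b x - mat 1) \<le> \<rho>"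
    and f: "f \<in> borel_measurable (lebesgue_on \<Omega>)" "\<And>x. f x \<in> {0..1}"
  obtains v where "v \<in> V_space \<Omega>" "sq_integrable (lebesgue_on \<Omega>) (weak_hessian \<Omega> v)"
    "AE x in lebesgue_on \<Omega>. 0 \<le> v x" "AE x in lebesgue_on \<Omega>. b x \<bullet> weak_hessian \<Omega> v x = - f x"
proof -
  let ?M = "lebesgue_on \<Omega>"
  have \<Omega>': "\<Omega> \<in> sets lebesgue" using \<Omega>(1) by simp
  have fin: "finite_measure ?M" by (rule finite_measure_lebesgue_on[OF \<Omega>(2) \<Omega>'])
  interpret finite_measure ?M by (rule fin)
  define m0 where "m0 = sqrt (measure ?M (space ?M))"
  have m0: "m0 \<ge> 0" by (simp add: m0_def)
  have one: "sq_integrable ?M (\<lambda>x. 1 :: real)" "l2norm ?M (\<lambda>x. 1 :: real) = m0"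
    by (simp_all add: sq_integrable_def l2norm_def m0_def)

  \<comment> \<open>Approximating domains, coefficients and right-hand sides\<close>
  obtain x0 where x0: "x0 \<in> \<Omega>" using \<Omega>(4) by blast
  obtain c and E :: "nat \<Rightarrow> real^'n \<Rightarrow> real" where E: "\<And>n. star_map x0 c (E n)"
    "\<And>n. star_map.Om x0 c (E n) 1 \<subseteq> \<Omega>"
    "\<And>K. compact K \<Longrightarrow> K \<subseteq> \<Omega> \<Longrightarrow> \<exists>N. \<forall>n\<ge>N. K \<subseteq> star_map.Om x0 c (E n) 1"
    by (rule exhausting_sequence[OF \<Omega>(1-3) x0]) blast
  define w where "w n = star_map.wk x0 c (E n) 1" for n
  define X where "X n = {\<lambda>x. v (star_map.Psi x0 c (E n) 1 x) | v. v \<in> ball_polys}" for n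
  define R where "R = 1 / c"
  have D: "dense_domain (w n) x0 R (X n)" for n
    unfolding w_def R_def X_def by (rule star_map.dense_domain[OF E(1)])
  have SD: "smooth_domain (w n) x0 R" for n by (rule dense_domain.axioms(1)[OF D])
  define U where "U n = {x. 0 < w n x}" for n
  have U: "smooth_domain.U (w n) = U n" for n by (simp add: U_def smooth_domain.U_def[OF SD])
  have UOm: "U n = star_map.Om x0 c (E n) 1" for n
    using star_map.U_eq_Om[OF E(1)[of n], of 1] U[of n] by (simp add: w_def)
  have Usub: "U n \<subseteq> \<Omega>" and Uexh: "\<And>K. compact K \<Longrightarrow> K \<subseteq> \<Omega> \<Longrightarrow> \<exists>N. \<forall>n\<ge>N. K \<subseteq> U n" for n
    unfolding UOm by (rule E)+
  have Uset: "U n \<in> sets lebesgue" for n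
    using smooth_domain.open_U[OF SD[of n]] unfolding U by auto
  note ext = Usub Uset \<Omega>'
  \<comment> \<open>The midpoint leaves room for smoothing the coefficients while staying below
    1.\<close>
  define \<rho>' where "\<rho>' = (1 + \<rho>) / 2"
  have \<rho>': "0 \<le> \<rho>'" "\<rho>' < 1" "\<rho> < \<rho>'" using b(2,3) by (auto simp: \<rho>'_def)
  obtain bb where bb: "\<And>n. smooth_matrix (bb n)" "\<And>n x. x \<in> \<Omega> \<Longrightarrow> norm (bb n x - mat 1) \<le> \<rho>'"
    "(\<lambda>n. l2norm ?M (\<lambda>x. bb n x - b x)) \<longlonglongrightarrow> 0"
    by (rule smooth_matrix_approximation[OF \<Omega>(1,2) b(1,2) \<rho>'(3) b(4)]) blast
  have f01: "AE x in ?M. f x \<in> {0..1}" using f(2) by simp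
  obtain ff :: "nat \<Rightarrow> real^'n \<Rightarrow> real" where ff: "\<And>n. continuous_on UNIV (ff n)" "\<And>n x. ff n x \<in> {0..1}"
    "(\<lambda>n. l2norm ?M (\<lambda>x. ff n x - f x)) \<longlonglongrightarrow> 0"
    by (rule continuous_l2_approximation[OF \<Omega>' \<Omega>(2) f(1) compact_Icc convex_closed_interval _ f01]) auto
  have sU: "sq_integrable (lebesgue_on (U n)) g" if "continuous_on UNIV g" for g :: "real^'n \<Rightarrow> 'x::euclidean_space" and n
    using smooth_domain.sq_integrable_U[OF SD[of n] that] unfolding U .
  have ffm0: "l2norm (lebesgue_on (U n)) (ff n) \<le> m0" for n
  proof -
    have s: "sq_integrable ?M (\<lambda>x. indicator (U n) x *\<^sub>R ff n x)"
      by (rule sq_integrable_extend[OF ext sU[OF ff(1)]])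
    have "l2norm ?M (\<lambda>x. indicator (U n) x *\<^sub>R ff n x) \<le> 1 * l2norm ?M (\<lambda>x. 1 :: real)"
      using s ff(2)[of n] by (intro l2norm_mono[OF one(1)]) (auto simp: sq_integrable_def indicator_def)
    then show ?thesis unfolding l2norm_extend[OF ext] one by simp
  qed
  define e where "e k = inverse (real (Suc k))" for k
  have e: "0 < e k" "e k \<le> 1" for k by (auto simp: e_def divide_simps)
  have e0: "e \<longlonglongrightarrow> 0" unfolding e_def[abs_def] by (rule LIMSEQ_inverse_real_of_nat)
  define B where "B = (4 * R\<^sup>2 + 2 * R + 1) * ((m0 + 1) / (1 - \<rho>'))"
  have "\<forall>k. \<exists>h. smooth h \<and> l2norm (lebesgue_on (U k)) (\<lambda>x. bb k x \<bullet> hess (\<lambda>x. w k x * h x) x + ff k x) < e k \<and>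
      l2norm (lebesgue_on (U k)) (neg (\<lambda>x. w k x * h x)) < e k \<and>
      l2norm (lebesgue_on (U k)) (\<lambda>x. (w k x * h x, grad (\<lambda>x. w k x * h x) x, hess (\<lambda>x. w k x * h x) x)) \<le> B"
  proof
    fix k
    have "norm (bb k x - mat 1) \<le> \<rho>'" if "0 < w k x" for x
      using bb(2)[of x k] Usub[of k] that by (auto simp: U_def)
    from dense_domain.approximate_solution_bounded[OF D[of k] bb(1)[of k] this \<rho>'(1,2) ff(1)[of k] _ _ e, unfolded U, of m0 k]
    show "\<exists>h. smooth h \<and> l2norm (lebesgue_on (U k)) (\<lambda>x. bb k x \<bullet> hess (\<lambda>x. w k x * h x) x + ff k x) < e k \<and>
      l2norm (lebesgue_on (U k)) (neg (\<lambda>x. w k x * h x)) < e k \<and>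
      l2norm (lebesgue_on (U k)) (\<lambda>x. (w k x * h x, grad (\<lambda>x. w k x * h x) x, hess (\<lambda>x. w k x * h x) x)) \<le> B"
      using ffm0[of k] ff(2)[of k] unfolding B_def by simp
  qed
  from choice[OF this] obtain h where h: "\<And>k. smooth (h k)"
    "\<And>k. l2norm (lebesgue_on (U k)) (\<lambda>x. bb k x \<bullet> hess (\<lambda>x. w k x * h k x) x + ff k x) < e k"
    "\<And>k. l2norm (lebesgue_on (U k)) (neg (\<lambda>x. w k x * h k x)) < e k"
    "\<And>k. l2norm (lebesgue_on (U k)) (\<lambda>x. (w k x * h k x, grad (\<lambda>x. w k x * h k x) x, hess (\<lambda>x. w k x * h k x) x)) \<le> B"
    by blast
  define u where "u k = (\<lambda>x. w k x * h k x)" for k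
  have su: "smooth (u k)" for k
    using smooth_mult[OF _ h(1)] SD[of k] by (simp add: u_def smooth_domain_def)
  obtain N a v where a: "\<And>n. conv_weights n (N n) (a n)" and v: "v \<in> V_space \<Omega>"
    "sq_integrable ?M v" "sq_integrable ?M (weak_hessian \<Omega> v)"
    and lim: "(\<lambda>n. l2norm ?M (\<lambda>x. (\<Sum>k<N n. a n k * (indicator (U k) x * u k x)) - v x)) \<longlonglongrightarrow> 0"
    "(\<lambda>n. l2norm ?M (\<lambda>x. (\<Sum>k<N n. a n k *\<^sub>R (indicator (U k) x *\<^sub>R hess (u k) x)) - weak_hessian \<Omega> v x)) \<longlonglongrightarrow> 0"
    unfolding u_def U_def
  proof (rule sobolev_limit[OF \<Omega>(1,2) SD Usub[unfolded U_def] _ h(1) h(4)[unfolded U_def]])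
    show "\<exists>n. \<forall>k\<ge>n. K \<subseteq> {x. 0 < w k x}" if "compact K" "K \<subseteq> \<Omega>" for K
      by (rule Uexh[unfolded U_def, OF that])
  qed (rule that[unfolded u_def U_def])
  define p where "p k x = indicator (U k) x * u k x" for k x
  define H where "H k x = indicator (U k) x *\<^sub>R hess (u k) x" for k x
  define hv where "hv = weak_hessian \<Omega> v"
  have sp: "sq_integrable ?M (p k)" for k
    using sq_integrable_extend[OF ext sU[OF smooth_continuous[OF su]], of k k] by (simp add: p_def[abs_def])
  have sH: "sq_integrable ?M (H k)" for k
    unfolding H_def[abs_def] by (rule sq_integrable_extend[OF ext sU[OF continuous_hess[OF su]]])

  \<comment> \<open>Nonnegativity of the limit\<close>
  have nonneg: "AE x in ?M. 0 \<le> v x"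
  proof -
    have cn: "continuous_on UNIV (\<lambda>t::real. max 0 (- t))" by (intro continuous_intros)
    have sneg: "sq_integrable ?M (neg g)" if "sq_integrable ?M g" for g
    proof (rule sq_integrable_bound[OF that, of _ 1])
      show "neg g \<in> borel_measurable ?M"
        unfolding neg_def[abs_def] using that
        by (intro borel_measurable_continuous_on[OF cn]) (simp add: sq_integrable_def)
    qed (simp add: neg_def)
    have npk: "l2norm ?M (neg (p k)) \<le> e k" for k
    proof -
      have "neg (p k) = (\<lambda>x. indicator (U k) x *\<^sub>R neg (u k) x)"
        by (auto simp: neg_def p_def indicator_def)
      then show ?thesis using h(3)[of k] by (simp only: l2norm_extend[OF ext] u_def less_imp_le)
    qed
    \<comment> \<open>By convexity the negative part of a combination is at most the combination of
      the negative parts, whose norm is at most \<open>e n\<close> because only indices from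
      \<open>n\<close> on occur.\<close>
    have le: "l2norm ?M (neg v) \<le> e n + l2norm ?M (\<lambda>x. (\<Sum>k<N n. a n k * p k x) - v x)" for n
    proof -
      let ?Y = "\<lambda>x. (\<Sum>k<N n. a n k * p k x) - v x" and ?S = "\<lambda>x. \<Sum>k<N n. a n k * neg (p k) x"
      have sS: "sq_integrable ?M ?S" by (intro sq_integrable_sum sq_integrable_cmult sneg sp)
      have sY: "sq_integrable ?M ?Y" by (intro sq_integrable_diff sq_integrable_sum sq_integrable_cmult sp v(2))
      have sYa: "sq_integrable ?M (\<lambda>x. \<bar>?Y x\<bar>)" using sY by (auto simp: sq_integrable_def intro: borel_measurable_abs)
      have "l2norm ?M (neg v) \<le> 1 * l2norm ?M (\<lambda>x. ?S x + \<bar>?Y x\<bar>)"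
      proof (rule l2norm_mono[OF sq_integrable_add[OF sS sYa]])
        show "neg v \<in> borel_measurable ?M" using sneg[OF v(2)] by (simp add: sq_integrable_def)
        show "AE x in ?M. norm (neg v x) \<le> 1 * norm (?S x + \<bar>?Y x\<bar>)"
        proof (rule AE_I2)
          fix x
          have S0: "0 \<le> ?S x" using a[of n]
            by (intro sum_nonneg mult_nonneg_nonneg) (auto simp: conv_weights_def neg_def)
          have "- ?S x \<le> (\<Sum>k<N n. a n k * p k x)"
            unfolding sum_negf[symmetric]
          proof (rule sum_mono)
            fix k
            have "a n k * (- neg (p k) x) \<le> a n k * p k x"
              using a[of n] by (intro mult_left_mono) (auto simp: conv_weights_def neg_def)
            then show "- (a n k * neg (p k) x) \<le> a n k * p k x" by simp
          qed
          then have "- v x \<le> ?S x + \<bar>?Y x\<bar>" using abs_ge_self[of "?Y x"] by linarith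
          then show "norm (neg v x) \<le> 1 * norm (?S x + \<bar>?Y x\<bar>)" using S0 by (simp add: neg_def)
        qed
      qed simp
      also have "\<dots> \<le> l2norm ?M ?S + l2norm ?M (\<lambda>x. \<bar>?Y x\<bar>)" using l2norm_triangle[OF sS sYa] by simp
      also have "l2norm ?M (\<lambda>x. \<bar>?Y x\<bar>) = l2norm ?M ?Y" by (simp add: l2norm_def)
      also have "l2norm ?M ?S \<le> e n"
      proof -
        have "l2norm ?M (neg (p k)) \<le> e n" if "k \<ge> n" for k
          using npk[of k] that by (auto simp: e_def elim!: order_trans)
        from l2norm_conv_le[OF a[of n] sneg[OF sp] this] show ?thesis by simp
      qed
      finally show ?thesis by simp
    qed
    have "(\<lambda>n. e n + l2norm ?M (\<lambda>x. (\<Sum>k<N n. a n k * p k x) - v x)) \<longlonglongrightarrow> 0 + 0"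
      using lim(1) by (intro tendsto_add e0) (simp add: p_def)
    then have "l2norm ?M (neg v) \<le> 0" using le by (intro LIMSEQ_le_const[where x=0]) auto
    from l2norm_eq_0_imp_AE[OF sneg[OF v(2)] this] show ?thesis
      by eventually_elim (simp add: neg_def max_def split: if_splits)
  qed

  \<comment> \<open>The equation for the limit\<close>
  have fsq: "sq_integrable ?M f"
    by (rule sq_integrable_bound[OF one(1) f(1), of 1]) (use f(2) in auto)
  have ffsq: "sq_integrable ?M (\<lambda>x. ff k x - f x)" for k
  proof (rule sq_integrable_diff[OF _ fsq], rule sq_integrable_bound[OF one(1), of _ 1])
    show "ff k \<in> borel_measurable ?M"
      using continuous_on_subset[OF ff(1)] \<Omega>' by (intro continuous_imp_measurable_on_sets_lebesgue) auto
  qed (use ff(2) in auto)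
  have bbsq: "sq_integrable ?M (\<lambda>x. bb k x - b x)" for k
  proof (rule sq_integrable_bound[OF one(1), of _ "\<rho>' + \<rho>"])
    have "bb k \<in> borel_measurable ?M"
      using continuous_smooth_matrix[OF bb(1)] \<Omega>' by (intro continuous_imp_measurable_on_sets_lebesgue) auto
    then show "(\<lambda>x. bb k x - b x) \<in> borel_measurable ?M" using b(1) by (intro borel_measurable_diff)
    have "AE x in ?M. x \<in> \<Omega>" by (rule AE_I2) (simp add: space_restrict_space)
    with b(4) show "AE x in ?M. norm (bb k x - b x) \<le> (\<rho>' + \<rho>) * norm (1 :: real)"
    proof eventually_elim
      case (elim x)
      then show ?case
        using bb(2)[of x k] norm_triangle_ineq4[of "bb k x - mat 1" "b x - mat 1"] by simp
    qed
  qed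
  define Cb where "Cb = norm (mat 1 :: real^'n^'n) + 1"
  have Cb: "Cb \<ge> 0" "AE x in ?M. norm (b x) \<le> Cb"
  proof -
    show "Cb \<ge> 0" by (simp add: Cb_def)
    show "AE x in ?M. norm (b x) \<le> Cb"
      using b(4)
    proof eventually_elim
      case (elim x)
      then show ?case using norm_triangle_ineq2[of "b x" "mat 1"] b(3) by (simp add: Cb_def)
    qed
  qed
  have bsq: "sq_integrable ?M (\<lambda>x. b x \<bullet> g x)" if g: "sq_integrable ?M g" for g
  proof (rule sq_integrable_bound[OF g, of _ Cb])
    show "(\<lambda>x. b x \<bullet> g x) \<in> borel_measurable ?M"
      using b(1) g by (intro borel_measurable_inner) (simp_all add: sq_integrable_def)
    show "AE x in ?M. norm (b x \<bullet> g x) \<le> Cb * norm (g x)"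
      using Cb(2)
    proof eventually_elim
      case (elim x)
      then have "norm (b x) * norm (g x) \<le> Cb * norm (g x)" by (rule mult_right_mono) simp
      then show ?case using Cauchy_Schwarz_ineq2[of "b x" "g x"] by simp
    qed
  qed
  have abs_int: "integrable ?M (\<lambda>x. \<bar>g x\<bar>)" "(\<integral>x. \<bar>g x\<bar> \<partial>?M) \<le> m0 * l2norm ?M g"
    if "sq_integrable ?M g" for g :: "real^'n \<Rightarrow> real"
    using l2_integral_norm_le[OF fin that] by (simp_all add: m0_def integrable_abs)
  \<comment> \<open>The L^1 residual of the \<open>k\<close>-th extended approximant, measured with
    the original \<open>b\<close> and \<open>f\<close>.\<close>
  define r where "r k = (\<integral>x. \<bar>b x \<bullet> H k x + f x\<bar> \<partial>?M)" for k
  define q where "q k x = indicator (U k) x *\<^sub>R (bb k x \<bullet> hess (u k) x + ff k x)" for k x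
  define s where "s k = (\<integral>x. 1 - indicat_real (U k) x \<partial>?M)" for k
  have qsq: "sq_integrable ?M (q k)" and qe: "l2norm ?M (q k) \<le> e k" for k
  proof -
    show "sq_integrable ?M (q k)"
      unfolding q_def[abs_def]
      by (intro sq_integrable_extend[OF ext] sU continuous_on_add continuous_on_inner
          continuous_smooth_matrix bb(1) continuous_hess su ff(1))
    show "l2norm ?M (q k) \<le> e k"
      unfolding q_def[abs_def] l2norm_extend[OF ext] using h(2)[of k] by (simp add: u_def)
  qed
  have HB: "l2norm ?M (H k) \<le> B" for k
  proof -
    have c: "continuous_on UNIV (\<lambda>x. (u k x, grad (u k) x, hess (u k) x))"
      by (intro continuous_on_Pair continuous_grad continuous_hess smooth_continuous su)
    have "l2norm ?M (H k) = l2norm (lebesgue_on (U k)) (hess (u k))"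
      unfolding H_def[abs_def] by (rule l2norm_extend[OF ext])
    also have "\<dots> \<le> 1 * l2norm (lebesgue_on (U k)) (\<lambda>x. (u k x, grad (u k) x, hess (u k) x))"
    proof (rule l2norm_mono[OF sU[OF c]])
      show "hess (u k) \<in> borel_measurable (lebesgue_on (U k))"
        using sU[OF continuous_hess[OF su]] by (simp add: sq_integrable_def)
      show "AE x in lebesgue_on (U k). norm (hess (u k) x) \<le> 1 * norm (u k x, grad (u k) x, hess (u k) x)"
        using norm_snd_le[of "hess (u k) x" "grad (u k) x" for x]
          norm_snd_le[of "(grad (u k) x, hess (u k) x)" "u k x" for x]
        by (intro AE_I2) (auto intro: order_trans)
    qed simp
    also have "\<dots> \<le> B" using h(4)[of k] by (simp add: u_def)
    finally show ?thesis .
  qed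
  have indm: "indicat_real (U k) \<in> borel_measurable ?M" for k
    using sq_integrable_extend[OF ext, of k "\<lambda>x. 1 :: real"] sU[OF continuous_on_const, of k "1 :: real"]
    by (simp add: sq_integrable_def)
  have s0: "s \<longlonglongrightarrow> 0"
  proof -
    have "(\<lambda>k. \<integral>x. 1 - indicat_real (U k) x \<partial>?M) \<longlonglongrightarrow> (\<integral>x. 0 \<partial>?M)"
    proof (rule integral_dominated_convergence[where w="\<lambda>x. 1"])
      show "AE x in ?M. (\<lambda>k. 1 - indicat_real (U k) x) \<longlonglongrightarrow> 0"
      proof (rule AE_I2)
        fix x assume "x \<in> space ?M"
        then have "{x} \<subseteq> \<Omega>" by (simp add: space_restrict_space)
        then obtain n0 where "\<And>k. k \<ge> n0 \<Longrightarrow> x \<in> U k" using Uexh[of "{x}"] by auto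
        then have "\<forall>\<^sub>F k in sequentially. 1 - indicat_real (U k) x = 0"
          by (auto simp: eventually_sequentially intro!: exI[of _ n0])
        then show "(\<lambda>k. 1 - indicat_real (U k) x) \<longlonglongrightarrow> 0" by (rule tendsto_eventually)
      qed
      show "(\<lambda>x. 1 - indicat_real (U k) x) \<in> borel_measurable ?M" for k
        by (intro borel_measurable_diff borel_measurable_const indm)
    qed (auto simp: indicator_def)
    then show ?thesis by (simp add: s_def[abs_def])
  qed
  \<comment> \<open>Four errors: smoothing of the coefficients, the defect of the approximate
    solution, the part of \<Omega> outside \<open>U k\<close>, where the residual is
    \<open>f\<close> and at most 1, and smoothing of \<open>f\<close>.\<close>
  have r_le: "r k \<le> l2norm ?M (\<lambda>x. bb k x - b x) * B + m0 * e k + s k + m0 * l2norm ?M (\<lambda>x. ff k x - f x)" for k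
  proof -
    have i1: "integrable ?M (\<lambda>x. norm (bb k x - b x) * norm (H k x))"
      by (rule sq_integrable_inner(2)[OF bbsq sH])
    have i3: "integrable ?M (\<lambda>x. 1 - indicat_real (U k) x)"
    proof (rule integrable_const_bound[of _ 1])
      show "(\<lambda>x. 1 - indicat_real (U k) x) \<in> borel_measurable ?M"
        by (intro borel_measurable_diff borel_measurable_const indm)
    qed (auto simp: indicator_def)
    have "r k \<le> (\<integral>x. norm (bb k x - b x) * norm (H k x) + \<bar>q k x\<bar> + (1 - indicat_real (U k) x) + \<bar>ff k x - f x\<bar> \<partial>?M)"
      unfolding r_def
    proof (rule integral_mono)
      show "integrable ?M (\<lambda>x. \<bar>b x \<bullet> H k x + f x\<bar>)"
        by (intro abs_int(1) sq_integrable_add bsq sH fsq)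
      show "integrable ?M (\<lambda>x. norm (bb k x - b x) * norm (H k x) + \<bar>q k x\<bar> + (1 - indicat_real (U k) x) + \<bar>ff k x - f x\<bar>)"
        by (intro Bochner_Integration.integrable_add i1 i3 abs_int(1) qsq ffsq)
      fix x
      show "\<bar>b x \<bullet> H k x + f x\<bar> \<le> norm (bb k x - b x) * norm (H k x) + \<bar>q k x\<bar> + (1 - indicat_real (U k) x) + \<bar>ff k x - f x\<bar>"
      proof (cases "x \<in> U k")
        case True
        have "b x \<bullet> H k x + f x = - ((bb k x - b x) \<bullet> H k x) + q k x - (ff k x - f x)"
          using True by (simp add: H_def q_def inner_diff_left)
        moreover have "\<bar>(bb k x - b x) \<bullet> H k x\<bar> \<le> norm (bb k x - b x) * norm (H k x)"
          by (rule Cauchy_Schwarz_ineq2)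
        moreover have "1 - indicat_real (U k) x = 0" using True by simp
        ultimately show ?thesis by linarith
      next
        case False
        then have "H k x = 0" "q k x = 0" "1 - indicat_real (U k) x = 1" by (simp_all add: H_def q_def)
        moreover have "0 \<le> f x" "f x \<le> 1" using f(2)[of x] by auto
        ultimately show ?thesis by (simp add: add_increasing2)
      qed
    qed
    also have "\<dots> = (\<integral>x. norm (bb k x - b x) * norm (H k x) \<partial>?M) + (\<integral>x. \<bar>q k x\<bar> \<partial>?M) + s k + (\<integral>x. \<bar>ff k x - f x\<bar> \<partial>?M)"
      using i1 i3 abs_int(1)[OF qsq[of k]] abs_int(1)[OF ffsq[of k]] by (simp add: s_def)
    also have "(\<integral>x. norm (bb k x - b x) * norm (H k x) \<partial>?M) \<le> l2norm ?M (\<lambda>x. bb k x - b x) * B"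
      using integral_norm_mult_le[OF bbsq[of k] sH[of k]] mult_left_mono[OF HB[of k] l2norm_nonneg]
      by (rule order_trans)
    also have "(\<integral>x. \<bar>q k x\<bar> \<partial>?M) \<le> m0 * e k"
      using abs_int(2)[OF qsq[of k]] mult_left_mono[OF qe[of k] m0] by (rule order_trans)
    also have "(\<integral>x. \<bar>ff k x - f x\<bar> \<partial>?M) \<le> m0 * l2norm ?M (\<lambda>x. ff k x - f x)"
      by (rule abs_int(2)[OF ffsq])
    finally show ?thesis by simp
  qed
  have r_pos: "0 \<le> r k" for k by (simp add: r_def)
  have r0: "r \<longlonglongrightarrow> 0"
  proof (rule tendsto_sandwich[OF _ _ tendsto_const])
    show "(\<lambda>k. l2norm ?M (\<lambda>x. bb k x - b x) * B + m0 * e k + s k + m0 * l2norm ?M (\<lambda>x. ff k x - f x)) \<longlonglongrightarrow> 0"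
      using tendsto_add[OF tendsto_add[OF tendsto_add[OF tendsto_mult_right[OF bb(3), of B] tendsto_mult_left[OF e0, of m0]] s0]
          tendsto_mult_left[OF ff(3), of m0]] by simp
  qed (use r_pos r_le in auto)
  define G where "G x = b x \<bullet> hv x + f x" for x
  have hvsq: "sq_integrable ?M hv" unfolding hv_def by (rule v(3))
  have Gsq: "sq_integrable ?M G" unfolding G_def[abs_def] by (intro sq_integrable_add bsq hvsq fsq)
  \<comment> \<open>Since the weights sum to 1, the combination of the residuals is the residual of
    the combination; what remains is the distance of the combined Hessians to the limit, multiplied
    by the bound \<open>Cb\<close> for \<open>b\<close>.\<close>
  have G_le: "(\<integral>x. \<bar>G x\<bar> \<partial>?M) \<le> Cb * (m0 * l2norm ?M (\<lambda>x. (\<Sum>k<N n. a n k *\<^sub>R H k x) - hv x)) + (\<Sum>k<N n. a n k * r k)" for n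
  proof -
    let ?Y = "\<lambda>x. (\<Sum>k<N n. a n k *\<^sub>R H k x) - hv x"
    have Y: "sq_integrable ?M ?Y" by (intro sq_integrable_diff sq_integrable_sum sq_integrable_scaleR sH hvsq)
    have iY: "integrable ?M (\<lambda>x. norm (?Y x))"
      by (rule integrable_norm[OF l2_integral_norm_le(1)[OF fin Y]])
    have iR: "integrable ?M (\<lambda>x. \<bar>b x \<bullet> H k x + f x\<bar>)" for k
      by (intro abs_int(1) sq_integrable_add bsq sH fsq)
    have iS: "integrable ?M (\<lambda>x. \<Sum>k<N n. a n k * \<bar>b x \<bullet> H k x + f x\<bar>)"
      by (intro Bochner_Integration.integrable_sum integrable_mult_right iR)
    have "(\<integral>x. \<bar>G x\<bar> \<partial>?M) \<le> (\<integral>x. Cb * norm (?Y x) + (\<Sum>k<N n. a n k * \<bar>b x \<bullet> H k x + f x\<bar>) \<partial>?M)"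
    proof (rule integral_mono_AE)
      show "integrable ?M (\<lambda>x. \<bar>G x\<bar>)" by (rule abs_int(1)[OF Gsq])
      show "integrable ?M (\<lambda>x. Cb * norm (?Y x) + (\<Sum>k<N n. a n k * \<bar>b x \<bullet> H k x + f x\<bar>))"
        by (intro Bochner_Integration.integrable_add integrable_mult_right iY iS)
      show "AE x in ?M. \<bar>G x\<bar> \<le> Cb * norm (?Y x) + (\<Sum>k<N n. a n k * \<bar>b x \<bullet> H k x + f x\<bar>)"
        using Cb(2)
      proof eventually_elim
        case (elim x)
        have an: "(\<Sum>k<N n. a n k) = 1" "0 \<le> a n k" for k using a[of n] by (auto simp: conv_weights_def)
        have "(\<Sum>k<N n. a n k * (b x \<bullet> H k x + f x)) = b x \<bullet> (\<Sum>k<N n. a n k *\<^sub>R H k x) + f x"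
          by (simp add: distrib_left sum.distrib inner_sum_right sum_distrib_right[symmetric] an(1))
        then have "G x = (\<Sum>k<N n. a n k * (b x \<bullet> H k x + f x)) - b x \<bullet> ?Y x"
          by (simp add: G_def inner_diff_right)
        moreover have "\<bar>b x \<bullet> ?Y x\<bar> \<le> Cb * norm (?Y x)"
          using order_trans[OF Cauchy_Schwarz_ineq2 mult_right_mono[OF elim norm_ge_zero]] .
        moreover have "\<bar>\<Sum>k<N n. a n k * (b x \<bullet> H k x + f x)\<bar> \<le> (\<Sum>k<N n. a n k * \<bar>b x \<bullet> H k x + f x\<bar>)"
          using sum_abs[of "\<lambda>k. a n k * (b x \<bullet> H k x + f x)" "{..<N n}"] an(2) by (simp add: abs_mult)
        ultimately show ?case by linarith
      qed
    qed
    also have "\<dots> = Cb * (\<integral>x. norm (?Y x) \<partial>?M) + (\<Sum>k<N n. a n k * r k)"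
    proof -
      have "(\<integral>x. (\<Sum>k<N n. a n k * \<bar>b x \<bullet> H k x + f x\<bar>) \<partial>?M) = (\<Sum>k<N n. a n k * r k)"
        unfolding r_def by (subst Bochner_Integration.integral_sum) (use iR in auto)
      then show ?thesis
        using Bochner_Integration.integral_add[OF integrable_mult_right[OF iY, of Cb] iS] by simp
    qed
    also have "Cb * (\<integral>x. norm (?Y x) \<partial>?M) \<le> Cb * (m0 * l2norm ?M ?Y)"
      using l2_integral_norm_le(2)[OF fin Y] Cb(1) by (intro mult_left_mono) (simp_all add: m0_def)
    finally show ?thesis by simp
  qed
  have "(\<lambda>n. Cb * (m0 * l2norm ?M (\<lambda>x. (\<Sum>k<N n. a n k *\<^sub>R H k x) - hv x)) + (\<Sum>k<N n. a n k * r k)) \<longlonglongrightarrow> Cb * (m0 * 0) + 0"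
    using lim(2) unfolding H_def hv_def
    by (intro tendsto_add tendsto_mult_left conv_weights_tendsto_0 a r0 r_pos)
  then have "(\<integral>x. \<bar>G x\<bar> \<partial>?M) \<le> 0"
    using G_le by (intro LIMSEQ_le_const[where x="Cb * (m0 * 0) + 0", simplified]) auto
  then have "(\<integral>x. \<bar>G x\<bar> \<partial>?M) = 0" by (intro antisym) simp_all
  then have "AE x in ?M. \<bar>G x\<bar> = 0"
    using abs_int(1)[OF Gsq] by (subst (asm) integral_nonneg_eq_0_iff_AE) auto
  then have "AE x in ?M. b x \<bullet> weak_hessian \<Omega> v x = - f x"
    by eventually_elim (simp add: G_def hv_def)
  with nonneg v(1,3) show ?thesis using that by blast
qed

section \<open>Rescaling by the Cordes factor, and conclusion\<close>

lemma mat_1_inner: "mat 1 \<bullet> A = trace (A :: real^'n^'n)"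
proof -
  have *: "(if i = j then 1 else 0) * t = (if i = j then t else 0)" for i j :: 'n and t :: real by simp
  show ?thesis by (simp add: inner_vec_def mat_def trace_def *)
qed

text \<open>Completing the square, the factor \<open>trace A / (norm A)^2\<close> minimises the
  distance of the multiples of \<open>A\<close> to the identity. The squared minimum is
  \<open>d - (trace A)^2 / (norm A)^2\<close>, and the Cordes bound makes this at most
  \<open>d - (d - 1 + \<epsilon>) = 1 - \<epsilon>\<close>.\<close>

lemma cordes_rescaled:
  fixes A :: "real^'n^'n"
  assumes A: "A \<in> cordes \<nu>lo \<nu>hi \<epsilon>" and \<nu>: "0 < \<nu>lo" and \<epsilon>: "0 < \<epsilon>" "\<epsilon> \<le> 1"
  shows "0 < trace A / (norm A)\<^sup>2" "norm ((trace A / (norm A)\<^sup>2) *\<^sub>R A - mat 1) \<le> sqrt (1 - \<epsilon>)"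
proof -
  define d where "d = real CARD('n)"
  have d: "d \<ge> 1" by (simp add: d_def Suc_le_eq)
  \<comment> \<open>Testing ellipticity with coordinate vectors makes the diagonal, and hence the
    trace, positive.\<close>
  have diag: "0 < A $ i $ i" for i
  proof -
    have "\<nu>lo * (norm (axis i 1 :: real^'n))\<^sup>2 \<le> axis i 1 \<bullet> (A *v axis i 1)"
      using A unfolding cordes_def by blast
    moreover have "axis i 1 \<bullet> (A *v axis i 1) = A $ i $ i"
      by (simp add: inner_axis' matrix_vector_mul_component inner_axis)
    ultimately show ?thesis using \<nu> by simp
  qed
  have tr: "0 < trace A" unfolding trace_def by (intro sum_pos diag) auto
  then have "A \<noteq> 0" by (auto simp: trace_def)
  then have nA: "0 < norm A" by simp
  show pos: "0 < trace A / (norm A)\<^sup>2" using tr nA by simp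
  define t where "t = d - 1 + \<epsilon>"
  have t: "t > 0" using d \<epsilon> by (simp add: t_def)
  have "norm A / trace A \<le> 1 / sqrt t"
    using A unfolding cordes_def t_def d_def by blast
  moreover have "0 < sqrt t" using t by simp
  ultimately have "norm A * sqrt t \<le> 1 * trace A"
    using tr by (simp only: pos_divide_le_eq pos_le_divide_eq times_divide_eq_left mult.commute[of "1 / sqrt t"])
  then have "(norm A * sqrt t)\<^sup>2 \<le> (trace A)\<^sup>2" using t by (intro power_mono) auto
  then have tA: "t * (norm A)\<^sup>2 \<le> (trace A)\<^sup>2" using t by (simp add: power_mult_distrib mult.commute)
  define \<gamma> where "\<gamma> = trace A / (norm A)\<^sup>2"
  have \<gamma>: "\<gamma> * (norm A)\<^sup>2 = trace A" using nA by (simp add: \<gamma>_def)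
  have mm: "trace (mat 1 :: real^'n^'n) = d"
    by (simp add: trace_def mat_def d_def)
  have "(norm (\<gamma> *\<^sub>R A - mat 1))\<^sup>2 = \<gamma> * (\<gamma> * (norm A)\<^sup>2) - 2 * \<gamma> * trace A + d"
  proof -
    have sq: "(norm (x - y))\<^sup>2 = (norm x)\<^sup>2 - 2 * (y \<bullet> x) + y \<bullet> y" for x y :: "real^'n^'n"
      unfolding power2_norm_eq_inner inner_diff_left inner_diff_right by (simp add: inner_commute)
    have "(norm (\<gamma> *\<^sub>R A))\<^sup>2 = \<gamma> * (\<gamma> * (norm A)\<^sup>2)"
      by (simp add: power_mult_distrib power2_eq_square)
    then show ?thesis unfolding sq inner_scaleR_right mat_1_inner mm by simp
  qed
  also have "\<dots> = d - \<gamma> * trace A" unfolding \<gamma> by simp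
  also have "\<gamma> * trace A \<ge> t"
    using tA nA by (simp add: \<gamma>_def power2_eq_square pos_le_divide_eq)
  then have "d - \<gamma> * trace A \<le> 1 - \<epsilon>" by (simp add: t_def)
  finally show "norm (\<gamma> *\<^sub>R A - mat 1) \<le> sqrt (1 - \<epsilon>)"
    by (rule real_le_rsqrt)
qed

theorem corollary5p4:
  fixes \<Omega> :: "(real^'n) set"
    and \<nu>lo \<nu>hi \<epsilon> :: real
    and a :: "real^'n \<Rightarrow> real^'n^'n"
    and G :: "(real^'n \<Rightarrow> real) \<Rightarrow> real"
    and m :: "real^'n \<Rightarrow> real"
  assumes "bounded \<Omega>" "convex \<Omega>" "open \<Omega>"
    and "0 < \<nu>lo" "\<nu>lo \<le> \<nu>hi" "0 < \<epsilon>" "\<epsilon> \<le> 1"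
    and "a \<in> Linf_sym_psd \<Omega>"
    and "AE x in lebesgue_on \<Omega>. a x \<in> cordes \<nu>lo \<nu>hi \<epsilon>"
    and "G \<in> V_dual \<Omega>"
    and "m \<in> L2 \<Omega>"
    and "\<forall>v\<in>V_space \<Omega>. L2_inner \<Omega> m (\<lambda>x. - (a x \<bullet> weak_hessian \<Omega> v x)) = G v"
    and "nonneg_functional \<Omega> G"
  shows "AE x in lebesgue_on \<Omega>. 0 \<le> m x"
proof (cases "\<Omega> = {}")
  case True
  \<comment> \<open>The hypotheses allow the empty set, which offers no centre for a star
    map.\<close>
  then show ?thesis by (intro AE_I2) (simp add: space_restrict_space)
next
  case False
  let ?M = "lebesgue_on \<Omega>"
  have am [measurable]: "a \<in> borel_measurable ?M" using assms(8) by (simp add: Linf_sym_psd_def)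
  have msq: "sq_integrable ?M m" using assms(11) by (simp add: L2_iff)
  then have mm [measurable]: "m \<in> borel_measurable ?M" by (simp add: sq_integrable_def)
  define \<gamma> where "\<gamma> x = trace (a x) / (norm (a x))\<^sup>2" for x
  define b where "b x = \<gamma> x *\<^sub>R a x" for x
  \<comment> \<open>With this right-hand side the integrand \<open>g\<close> below is
    \<open>m\<close> divided by \<gamma> where \<open>m\<close> is negative, and zero
    elsewhere.\<close>
  define f where "f x = (if m x < 0 then 1 else 0 :: real)" for x
  have fm: "f \<in> borel_measurable ?M" unfolding f_def[abs_def] by measurable
  have \<gamma>m: "\<gamma> \<in> borel_measurable ?M"
    unfolding \<gamma>_def[abs_def] mat_1_inner[symmetric] by measurable
  then have bm: "b \<in> borel_measurable ?M"
    unfolding b_def[abs_def] using am by (rule borel_measurable_scaleR)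
  define \<rho> where "\<rho> = sqrt (1 - \<epsilon>)"
  have \<rho>: "0 \<le> \<rho>" "\<rho> < 1" using assms(6,7) by (auto simp: \<rho>_def real_sqrt_lt_1_iff)
  have "AE x in ?M. norm (b x - mat 1) \<le> \<rho>"
    using assms(9) by eventually_elim (simp add: b_def \<gamma>_def \<rho>_def cordes_rescaled(2)[OF _ assms(4,6,7)])
  moreover have "f x \<in> {0..1}" for x by (simp add: f_def)
  ultimately obtain v where v: "v \<in> V_space \<Omega>" "sq_integrable ?M (weak_hessian \<Omega> v)"
    "AE x in ?M. 0 \<le> v x" "AE x in ?M. b x \<bullet> weak_hessian \<Omega> v x = - f x"
    by (rule nonneg_solution[OF assms(3,1,2) False bm \<rho> _ fm]) blast
  obtain C where C: "AE x in ?M. norm (a x) \<le> C" using assms(8) by (auto simp: Linf_sym_psd_def)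
  define g where "g x = m x * - (a x \<bullet> weak_hessian \<Omega> v x)" for x
  have "sq_integrable ?M (\<lambda>x. a x \<bullet> weak_hessian \<Omega> v x)"
  proof (rule sq_integrable_bound[OF v(2), of _ C])
    show "(\<lambda>x. a x \<bullet> weak_hessian \<Omega> v x) \<in> borel_measurable ?M"
      using am v(2) by (intro borel_measurable_inner) (simp_all add: sq_integrable_def)
    show "AE x in ?M. norm (a x \<bullet> weak_hessian \<Omega> v x) \<le> C * norm (weak_hessian \<Omega> v x)"
      using C
    proof eventually_elim
      case (elim x)
      then show ?case
        using order_trans[OF Cauchy_Schwarz_ineq2 mult_right_mono[OF elim norm_ge_zero]] by simp
    qed
  qed
  from sq_integrable_inner(1)[OF msq sq_integrable_minus[OF this]]
  have gi: "integrable ?M g" by (simp add: g_def[abs_def])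
  have "AE x in ?M. 0 < \<gamma> x"
    using assms(9) by eventually_elim (simp only: \<gamma>_def cordes_rescaled(1)[OF _ assms(4,6,7)])
  then have g_eq: "AE x in ?M. 0 < \<gamma> x \<and> g x = m x * (f x / \<gamma> x)"
    using v(4)
  proof eventually_elim
    case (elim x)
    then have "\<gamma> x * (a x \<bullet> weak_hessian \<Omega> v x) = - f x" by (simp add: b_def)
    then have "- (a x \<bullet> weak_hessian \<Omega> v x) = f x / \<gamma> x" using elim(1) by (simp add: field_simps)
    then show ?case using elim(1) by (simp add: g_def)
  qed
  have "(\<integral>x. g x \<partial>?M) = G v"
    using assms(12) v(1) by (simp add: L2_inner_def g_def)
  also have "G v \<ge> 0" using assms(13) v(1,3) by (simp add: nonneg_functional_def)
  finally have "0 \<le> (\<integral>x. g x \<partial>?M)" .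
  \<comment> \<open>\<open>g\<close> is nonpositive with a nonnegative integral, so it vanishes
    almost everywhere, which excludes \<open>m x < 0\<close>.\<close>
  moreover have neg: "AE x in ?M. 0 \<le> - g x"
    using g_eq by eventually_elim (auto simp: f_def divide_nonpos_pos)
  ultimately have "(\<integral>x. - g x \<partial>?M) = 0"
    using integral_nonneg_AE[OF neg] by simp
  then have "AE x in ?M. - g x = 0"
    using gi neg by (subst (asm) integral_nonneg_eq_0_iff_AE) auto
  with g_eq show ?thesis
  proof eventually_elim
    case (elim x)
    then show ?case by (auto simp: f_def split: if_splits)
  qed
qed

end
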